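(* Let $\mathcal{C}$ be any flexible class of separable unital $C^*$-algebras. Let $A\supset P$ be a finite index inclusion of unital $C^*$-algebras with the Rohlin property. If $A$ is a unital local $\mathcal{C}$-algebra, then $P$ is also a unital local $\mathcal{C}$-algebra.
   Context: Inclusions of unital $C^*$-algebras have a common unit. For a conditional expectation $E:A\to P$, a quasi-basis is a finite set $\{(u_i,v_i)\}_{i=1}^n\subset A\times A$ with $a=\sum_i u_iE(v_ia)=\sum_i E(au_i)v_i$ for all $a\in A$. If one exists, $E$ has a finite index and $\mathrm{Index}\,E=\sum_i u_iv_i$ (independent of the choice; a positive central invertible element of $A$). Put $A^\infty=\ell^\infty(\mathbb{N},A)/c_0(A)$, $A$ being identified with the classes of constant sequences, and $A_\infty=A^\infty\cap A'$; $P^\infty$ is regarded as a subalgebra of $A^\infty$, and $E^\infty:A^\infty\to P^\infty$ is the termwise induced conditional expectation. A conditional expectation $E:A\to P$ with a finite index has the Rohlin property if there is a projection $e\in A_\infty$ with $E^\infty(e)=(\mathrm{Index}\,E)^{-1}\cdot1$ and such that the map $A\ni x\mapsto xe$ is injective. An inclusion $A\supset P$ has the Rohlin property if there is a conditional expectation $E:A\to P$ with a finite index having the Rohlin property. A class $\mathcal{C}$ of separable unital $C^*$-algebras is finitely saturated if: (1) $A\in\mathcal{C}$ and $B\cong A$ imply $B\in\mathcal{C}$; (2) $A_1,\dots,A_n\in\mathcal{C}$ implies $\bigoplus_{k=1}^nA_k\in\mathcal{C}$; (3) $A\in\mathcal{C}$, $n\in\mathbb{N}$ imply $M_n(A)\in\mathcal{C}$;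 (4) $A\in\mathcal{C}$ and $p\in A$ a nonzero projection imply $pAp\in\mathcal{C}$. The finite saturation of $\mathcal{C}$ is the smallest finitely saturated class containing $\mathcal{C}$. A class $\mathcal{C}$ of separable unital $C^*$-algebras is flexible if: (1) for every $A\in\mathcal{C}$, every $n\in\mathbb{N}$ and every nonzero projection $p\in M_n(A)$, the corner $pM_n(A)p$ is semiprojective and finitely generated; (2) for every $A\in\mathcal{C}$ and every ideal $I\subset A$ there is an increasing sequence $I_0\subset I_1\subset\cdots$ of ideals of $A$ with $\overline{\bigcup_nI_n}=I$ such that for every $n$ the $C^*$-algebra $A/I_n$ is in the finite saturation of $\mathcal{C}$. Here a $C^*$-algebra $D$ is semiprojective if for every $C^*$-algebra $B$, every increasing sequence $J_1\subset J_2\subset\cdots$ of ideals of $B$ with $J=\overline{\bigcup_nJ_n}$, and every $*$-homomorphism $\varphi:D\to B/J$, there are $n$ and a $*$-homomorphism $\bar\varphi:D\to B/J_n$ whose composition with the quotient map $B/J_n\to B/J$ is $\varphi$. A unital local $\mathcal{C}$-algebra is a separable unital $C^*$-algebra $A$ such that for every finite set $S\subset A$ and every $\varepsilon>0$ there are a $C^*$-algebra $B$ in the finite saturation of $\mathcal{C}$ and a unital homomorphism $\varphi:B\to A$ with $\mathrm{dist}(a,\varphi(B))<\varepsilon$ for all $a\in S$. *)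

theory Defs
  imports "HOL-Analysis.Analysis" "HOL-Algebra.QuotRing" "HOL-Algebra.Module"
begin

section \<open>C*-algebras with explicit carrier\<close>

text \<open>The field \<open>one\<close> inherited from the monoid record carries no information unless the algebra
  is asserted to be unital.\<close>

record 'a cstar_alg = "(complex, 'a) module" +
  cadj :: "'a \<Rightarrow> 'a"
  cnorm :: "'a \<Rightarrow> real"

text \<open>The value 0 outside the carrier is there because \<open>Metric_space\<close> demands non-negativity and
  symmetry of the distance for all elements of the type.\<close>

definition cdist :: "'a cstar_alg \<Rightarrow> 'a \<Rightarrow> 'a \<Rightarrow> real" where
  "cdist A x y = (if x \<in> carrier A \<and> y \<in> carrier A then cnorm A (x \<ominus>\<^bsub>A\<^esub> y) else 0)"

definition ctopology :: "'a cstar_alg \<Rightarrow> 'a topology" where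
  "ctopology A = Metric_space.mtopology (carrier A) (cdist A)"

locale cstar_algebra = abelian_group A for A :: "'a cstar_alg" (structure) +
  assumes mult_closed: "\<lbrakk>x \<in> carrier A; y \<in> carrier A\<rbrakk> \<Longrightarrow> x \<otimes> y \<in> carrier A"
    and mult_assoc: "\<lbrakk>x \<in> carrier A; y \<in> carrier A; z \<in> carrier A\<rbrakk>
          \<Longrightarrow> (x \<otimes> y) \<otimes> z = x \<otimes> (y \<otimes> z)"
    and mult_distl: "\<lbrakk>x \<in> carrier A; y \<in> carrier A; z \<in> carrier A\<rbrakk>
          \<Longrightarrow> (x \<oplus> y) \<otimes> z = x \<otimes> z \<oplus> y \<otimes> z"
    and mult_distr: "\<lbrakk>x \<in> carrier A; y \<in> carrier A; z \<in> carrier A\<rbrakk>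
          \<Longrightarrow> z \<otimes> (x \<oplus> y) = z \<otimes> x \<oplus> z \<otimes> y"
    and smult_closed: "x \<in> carrier A \<Longrightarrow> c \<odot> x \<in> carrier A"
    and smult_add_left: "x \<in> carrier A \<Longrightarrow> (c + d) \<odot> x = c \<odot> x \<oplus> d \<odot> x"
    and smult_add_right: "\<lbrakk>x \<in> carrier A; y \<in> carrier A\<rbrakk> \<Longrightarrow> c \<odot> (x \<oplus> y) = c \<odot> x \<oplus> c \<odot> y"
    and smult_smult: "x \<in> carrier A \<Longrightarrow> (c * d) \<odot> x = c \<odot> (d \<odot> x)"
    and smult_one: "x \<in> carrier A \<Longrightarrow> 1 \<odot> x = x"
    and smult_mult_left: "\<lbrakk>x \<in> carrier A; y \<in> carrier A\<rbrakk> \<Longrightarrow> (c \<odot> x) \<otimes> y = c \<odot> (x \<otimes> y)"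
    and smult_mult_right: "\<lbrakk>x \<in> carrier A; y \<in> carrier A\<rbrakk> \<Longrightarrow> x \<otimes> (c \<odot> y) = c \<odot> (x \<otimes> y)"
    and cadj_closed: "x \<in> carrier A \<Longrightarrow> cadj A x \<in> carrier A"
    and cadj_cadj: "x \<in> carrier A \<Longrightarrow> cadj A (cadj A x) = x"
    and cadj_add: "\<lbrakk>x \<in> carrier A; y \<in> carrier A\<rbrakk> \<Longrightarrow> cadj A (x \<oplus> y) = cadj A x \<oplus> cadj A y"
    and cadj_smult: "x \<in> carrier A \<Longrightarrow> cadj A (c \<odot> x) = cnj c \<odot> cadj A x"
    and cadj_mult: "\<lbrakk>x \<in> carrier A; y \<in> carrier A\<rbrakk> \<Longrightarrow> cadj A (x \<otimes> y) = cadj A y \<otimes> cadj A x"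
    and cnorm_eq_0: "x \<in> carrier A \<Longrightarrow> cnorm A x = 0 \<longleftrightarrow> x = \<zero>"
    and cnorm_add: "\<lbrakk>x \<in> carrier A; y \<in> carrier A\<rbrakk> \<Longrightarrow> cnorm A (x \<oplus> y) \<le> cnorm A x + cnorm A y"
    and cnorm_smult: "x \<in> carrier A \<Longrightarrow> cnorm A (c \<odot> x) = cmod c * cnorm A x"
    and cnorm_mult: "\<lbrakk>x \<in> carrier A; y \<in> carrier A\<rbrakk> \<Longrightarrow> cnorm A (x \<otimes> y) \<le> cnorm A x * cnorm A y"
    and cnorm_cadj_mult: "x \<in> carrier A \<Longrightarrow> cnorm A (cadj A x \<otimes> x) = (cnorm A x)\<^sup>2"
    and complete: "Metric_space.mcomplete (carrier A) (cdist A)"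

locale unital_cstar_algebra = cstar_algebra A + monoid A for A :: "'a cstar_alg" (structure)

definition separable_unital_cstar :: "'a cstar_alg \<Rightarrow> bool" where
  "separable_unital_cstar A \<longleftrightarrow> unital_cstar_algebra A \<and> separable_space (ctopology A)"

definition star_hom :: "'a cstar_alg \<Rightarrow> 'b cstar_alg \<Rightarrow> ('a \<Rightarrow> 'b) \<Rightarrow> bool" where
  "star_hom A B \<phi> \<longleftrightarrow>
     \<phi> \<in> carrier A \<rightarrow> carrier B \<and>
     (\<forall>x\<in>carrier A. \<forall>y\<in>carrier A.
        \<phi> (x \<oplus>\<^bsub>A\<^esub> y) = \<phi> x \<oplus>\<^bsub>B\<^esub> \<phi> y \<and> \<phi> (x \<otimes>\<^bsub>A\<^esub> y) = \<phi> x \<otimes>\<^bsub>B\<^esub> \<phi> y) \<and>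
     (\<forall>c. \<forall>x\<in>carrier A. \<phi> (c \<odot>\<^bsub>A\<^esub> x) = c \<odot>\<^bsub>B\<^esub> \<phi> x) \<and>
     (\<forall>x\<in>carrier A. \<phi> (cadj A x) = cadj B (\<phi> x))"

definition unital_hom :: "'a cstar_alg \<Rightarrow> 'b cstar_alg \<Rightarrow> ('a \<Rightarrow> 'b) \<Rightarrow> bool" where
  "unital_hom A B \<phi> \<longleftrightarrow> star_hom A B \<phi> \<and> \<phi> \<one>\<^bsub>A\<^esub> = \<one>\<^bsub>B\<^esub>"

definition cstar_iso :: "'a cstar_alg \<Rightarrow> 'b cstar_alg \<Rightarrow> bool" (infix \<open>\<simeq>\<^sub>*\<close> 50) where
  "A \<simeq>\<^sub>* B \<longleftrightarrow> (\<exists>\<phi>. star_hom A B \<phi> \<and> bij_betw \<phi> (carrier A) (carrier B))"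

definition projection :: "'a cstar_alg \<Rightarrow> 'a \<Rightarrow> bool" where
  "projection A p \<longleftrightarrow> p \<in> carrier A \<and> p \<otimes>\<^bsub>A\<^esub> p = p \<and> cadj A p = p"

definition positive :: "'a cstar_alg \<Rightarrow> 'a \<Rightarrow> bool" where
  "positive A a \<longleftrightarrow> (\<exists>x\<in>carrier A. a = cadj A x \<otimes>\<^bsub>A\<^esub> x)"

definition linear_subspace :: "'a cstar_alg \<Rightarrow> 'a set \<Rightarrow> bool" where
  "linear_subspace A S \<longleftrightarrow> S \<subseteq> carrier A \<and> \<zero>\<^bsub>A\<^esub> \<in> S \<and>
     (\<forall>x\<in>S. \<forall>y\<in>S. x \<oplus>\<^bsub>A\<^esub> y \<in> S) \<and> (\<forall>c. \<forall>x\<in>S. c \<odot>\<^bsub>A\<^esub> x \<in> S)"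

definition cstar_subalgebra :: "'a cstar_alg \<Rightarrow> 'a set \<Rightarrow> bool" where
  "cstar_subalgebra A S \<longleftrightarrow> linear_subspace A S \<and>
     (\<forall>x\<in>S. \<forall>y\<in>S. x \<otimes>\<^bsub>A\<^esub> y \<in> S) \<and> (\<forall>x\<in>S. cadj A x \<in> S) \<and> closedin (ctopology A) S"

text \<open>As usual for C*-algebras, ideals are closed and two-sided.\<close>

definition cstar_ideal :: "'a cstar_alg \<Rightarrow> 'a set \<Rightarrow> bool" where
  "cstar_ideal A I \<longleftrightarrow> linear_subspace A I \<and>
     (\<forall>a\<in>carrier A. \<forall>x\<in>I. a \<otimes>\<^bsub>A\<^esub> x \<in> I \<and> x \<otimes>\<^bsub>A\<^esub> a \<in> I) \<and> closedin (ctopology A) I"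

definition finitely_generated :: "'a cstar_alg \<Rightarrow> bool" where
  "finitely_generated A \<longleftrightarrow>
     (\<exists>F. finite F \<and> F \<subseteq> carrier A \<and> \<Inter>{S. cstar_subalgebra A S \<and> F \<subseteq> S} = carrier A)"


section \<open>Constructions\<close>

definition subalg :: "'a cstar_alg \<Rightarrow> 'a set \<Rightarrow> 'a cstar_alg" where
  "subalg A S = A\<lparr>carrier := S\<rparr>"

definition corner :: "'a cstar_alg \<Rightarrow> 'a \<Rightarrow> 'a cstar_alg" where
  "corner A p = A\<lparr>carrier := {p \<otimes>\<^bsub>A\<^esub> x \<otimes>\<^bsub>A\<^esub> p | x. x \<in> carrier A}, one := p\<rparr>"

definition quot :: "'a cstar_alg \<Rightarrow> 'a set \<Rightarrow> 'a set cstar_alg" where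
  "quot A I =
     \<lparr>carrier = carrier (A Quot I),
      mult = mult (A Quot I),
      one = one (A Quot I),
      zero = zero (A Quot I),
      add = add (A Quot I),
      smult = (\<lambda>c X. \<Union>x\<in>X. I +>\<^bsub>A\<^esub> (c \<odot>\<^bsub>A\<^esub> x)),
      cadj = (\<lambda>X. \<Union>x\<in>X. I +>\<^bsub>A\<^esub> cadj A x),
      cnorm = (\<lambda>X. INF x\<in>X. cnorm A x)\<rparr>"

text \<open>For ideals \<open>I \<subseteq> J\<close> of \<open>A\<close>, the following is the quotient map from \<open>A/I\<close> to \<open>A/J\<close>.\<close>

definition quot_map :: "'a cstar_alg \<Rightarrow> 'a set \<Rightarrow> 'a set \<Rightarrow> 'a set" where
  "quot_map A J X = (\<Union>x\<in>X. J +>\<^bsub>A\<^esub> x)"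

definition direct_sum :: "nat \<Rightarrow> (nat \<Rightarrow> 'a cstar_alg) \<Rightarrow> (nat \<Rightarrow> 'a) cstar_alg" where
  "direct_sum n A =
     \<lparr>carrier = (\<Pi>\<^sub>E k\<in>{..<n}. carrier (A k)),
      mult = (\<lambda>f g. \<lambda>k\<in>{..<n}. f k \<otimes>\<^bsub>A k\<^esub> g k),
      one = (\<lambda>k\<in>{..<n}. \<one>\<^bsub>A k\<^esub>),
      zero = (\<lambda>k\<in>{..<n}. \<zero>\<^bsub>A k\<^esub>),
      add = (\<lambda>f g. \<lambda>k\<in>{..<n}. f k \<oplus>\<^bsub>A k\<^esub> g k),
      smult = (\<lambda>c f. \<lambda>k\<in>{..<n}. c \<odot>\<^bsub>A k\<^esub> f k),
      cadj = (\<lambda>f. \<lambda>k\<in>{..<n}. cadj (A k) (f k)),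
      cnorm = (\<lambda>f. Max ((\<lambda>k. cnorm (A k) (f k)) ` {..<n}))\<rparr>"

text \<open>The norm on \<open>M\<^sub>n(A)\<close> is its unique C*-norm, obtained as the operator norm on the right Hilbert
  module \<open>A\<^sup>n\<close>, in which the norm of a column \<open>x\<close> is the square root of the norm of the sum of
  the \<open>x\<^sub>i\<^sup>* x\<^sub>i\<close>.\<close>

definition column_norm :: "nat \<Rightarrow> 'a cstar_alg \<Rightarrow> (nat \<Rightarrow> 'a) \<Rightarrow> real" where
  "column_norm n A x = sqrt (cnorm A (\<Oplus>\<^bsub>A\<^esub>i\<in>{..<n}. cadj A (x i) \<otimes>\<^bsub>A\<^esub> x i))"

definition matrix_norm :: "nat \<Rightarrow> 'a cstar_alg \<Rightarrow> (nat \<times> nat \<Rightarrow> 'a) \<Rightarrow> real" where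
  "matrix_norm n A T =
     (SUP x\<in>{x \<in> {..<n} \<rightarrow> carrier A. column_norm n A x \<le> 1}.
        column_norm n A (\<lambda>i. \<Oplus>\<^bsub>A\<^esub>j\<in>{..<n}. T (i, j) \<otimes>\<^bsub>A\<^esub> x j))"

definition matrix_alg :: "nat \<Rightarrow> 'a cstar_alg \<Rightarrow> (nat \<times> nat \<Rightarrow> 'a) cstar_alg" where
  "matrix_alg n A =
     \<lparr>carrier = {..<n} \<times> {..<n} \<rightarrow>\<^sub>E carrier A,
      mult = (\<lambda>S T. \<lambda>(i, j)\<in>{..<n} \<times> {..<n}. \<Oplus>\<^bsub>A\<^esub>k\<in>{..<n}. S (i, k) \<otimes>\<^bsub>A\<^esub> T (k, j)),
      one = (\<lambda>(i, j)\<in>{..<n} \<times> {..<n}. if i = j then \<one>\<^bsub>A\<^esub> else \<zero>\<^bsub>A\<^esub>),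
      zero = (\<lambda>(i, j)\<in>{..<n} \<times> {..<n}. \<zero>\<^bsub>A\<^esub>),
      add = (\<lambda>S T. \<lambda>(i, j)\<in>{..<n} \<times> {..<n}. S (i, j) \<oplus>\<^bsub>A\<^esub> T (i, j)),
      smult = (\<lambda>c T. \<lambda>(i, j)\<in>{..<n} \<times> {..<n}. c \<odot>\<^bsub>A\<^esub> T (i, j)),
      cadj = (\<lambda>T. \<lambda>(i, j)\<in>{..<n} \<times> {..<n}. cadj A (T (j, i))),
      cnorm = matrix_norm n A\<rparr>"

definition ell_inf :: "'a cstar_alg \<Rightarrow> (nat \<Rightarrow> 'a) cstar_alg" where
  "ell_inf A =
     \<lparr>carrier = {f. range f \<subseteq> carrier A \<and> bdd_above (range (\<lambda>n. cnorm A (f n)))},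
      mult = (\<lambda>f g n. f n \<otimes>\<^bsub>A\<^esub> g n),
      one = (\<lambda>n. \<one>\<^bsub>A\<^esub>),
      zero = (\<lambda>n. \<zero>\<^bsub>A\<^esub>),
      add = (\<lambda>f g n. f n \<oplus>\<^bsub>A\<^esub> g n),
      smult = (\<lambda>c f n. c \<odot>\<^bsub>A\<^esub> f n),
      cadj = (\<lambda>f n. cadj A (f n)),
      cnorm = (\<lambda>f. SUP n. cnorm A (f n))\<rparr>"

definition c_zero :: "'a cstar_alg \<Rightarrow> (nat \<Rightarrow> 'a) set" where
  "c_zero A = {f \<in> carrier (ell_inf A). (\<lambda>n. cnorm A (f n)) \<longlonglongrightarrow> 0}"

definition seq_alg :: "'a cstar_alg \<Rightarrow> (nat \<Rightarrow> 'a) set cstar_alg" where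
  "seq_alg A = quot (ell_inf A) (c_zero A)"

definition seq_class :: "'a cstar_alg \<Rightarrow> (nat \<Rightarrow> 'a) \<Rightarrow> (nat \<Rightarrow> 'a) set" where
  "seq_class A f = c_zero A +>\<^bsub>ell_inf A\<^esub> f"

definition const_class :: "'a cstar_alg \<Rightarrow> 'a \<Rightarrow> (nat \<Rightarrow> 'a) set" where
  "const_class A a = seq_class A (\<lambda>n. a)"

definition central_seqs :: "'a cstar_alg \<Rightarrow> (nat \<Rightarrow> 'a) set set" where
  "central_seqs A = {X \<in> carrier (seq_alg A).
     \<forall>a\<in>carrier A. X \<otimes>\<^bsub>seq_alg A\<^esub> const_class A a = const_class A a \<otimes>\<^bsub>seq_alg A\<^esub> X}"


section \<open>Conditional expectations, finite index and the Rohlin property\<close>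

definition unital_inclusion :: "'a cstar_alg \<Rightarrow> 'a set \<Rightarrow> bool" where
  "unital_inclusion A P \<longleftrightarrow> unital_cstar_algebra A \<and> cstar_subalgebra A P \<and> \<one>\<^bsub>A\<^esub> \<in> P"

text \<open>Positive linear projections onto \<open>P\<close>; contractivity and the bimodule property then follow
  (Russo-Dye, Tomiyama), but all the customary properties are listed.\<close>

definition conditional_expectation :: "'a cstar_alg \<Rightarrow> 'a set \<Rightarrow> ('a \<Rightarrow> 'a) \<Rightarrow> bool" where
  "conditional_expectation A P E \<longleftrightarrow>
     E \<in> carrier A \<rightarrow> P \<and>
     (\<forall>x\<in>carrier A. \<forall>y\<in>carrier A. E (x \<oplus>\<^bsub>A\<^esub> y) = E x \<oplus>\<^bsub>A\<^esub> E y) \<and>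
     (\<forall>c. \<forall>x\<in>carrier A. E (c \<odot>\<^bsub>A\<^esub> x) = c \<odot>\<^bsub>A\<^esub> E x) \<and>
     (\<forall>p\<in>P. E p = p) \<and>
     (\<forall>x\<in>carrier A. \<forall>p\<in>P. \<forall>q\<in>P. E (p \<otimes>\<^bsub>A\<^esub> x \<otimes>\<^bsub>A\<^esub> q) = p \<otimes>\<^bsub>A\<^esub> E x \<otimes>\<^bsub>A\<^esub> q) \<and>
     (\<forall>x\<in>carrier A. positive A x \<longrightarrow> positive A (E x)) \<and>
     (\<forall>x\<in>carrier A. cnorm A (E x) \<le> cnorm A x)"

definition quasi_basis ::
    "'a cstar_alg \<Rightarrow> ('a \<Rightarrow> 'a) \<Rightarrow> nat \<Rightarrow> (nat \<Rightarrow> 'a) \<Rightarrow> (nat \<Rightarrow> 'a) \<Rightarrow> bool" where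
  "quasi_basis A E n u v \<longleftrightarrow>
     u \<in> {..<n} \<rightarrow> carrier A \<and> v \<in> {..<n} \<rightarrow> carrier A \<and>
     (\<forall>a\<in>carrier A.
        a = (\<Oplus>\<^bsub>A\<^esub>i\<in>{..<n}. u i \<otimes>\<^bsub>A\<^esub> E (v i \<otimes>\<^bsub>A\<^esub> a)) \<and>
        a = (\<Oplus>\<^bsub>A\<^esub>i\<in>{..<n}. E (a \<otimes>\<^bsub>A\<^esub> u i) \<otimes>\<^bsub>A\<^esub> v i))"

definition finite_index :: "'a cstar_alg \<Rightarrow> ('a \<Rightarrow> 'a) \<Rightarrow> bool" where
  "finite_index A E \<longleftrightarrow> (\<exists>n u v. quasi_basis A E n u v)"

definition Index :: "'a cstar_alg \<Rightarrow> ('a \<Rightarrow> 'a) \<Rightarrow> 'a" where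
  "Index A E = (THE w. \<exists>n u v. quasi_basis A E n u v \<and> w = (\<Oplus>\<^bsub>A\<^esub>i\<in>{..<n}. u i \<otimes>\<^bsub>A\<^esub> v i))"

definition finite_index_inclusion :: "'a cstar_alg \<Rightarrow> 'a set \<Rightarrow> bool" where
  "finite_index_inclusion A P \<longleftrightarrow>
     unital_inclusion A P \<and> (\<exists>E. conditional_expectation A P E \<and> finite_index A E)"

definition seq_expectation ::
    "'a cstar_alg \<Rightarrow> ('a \<Rightarrow> 'a) \<Rightarrow> (nat \<Rightarrow> 'a) set \<Rightarrow> (nat \<Rightarrow> 'a) set" where
  "seq_expectation A E X = (\<Union>f\<in>X. seq_class A (\<lambda>n. E (f n)))"

definition expectation_rohlin :: "'a cstar_alg \<Rightarrow> ('a \<Rightarrow> 'a) \<Rightarrow> bool" where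
  "expectation_rohlin A E \<longleftrightarrow>
     (\<exists>e\<in>central_seqs A. projection (seq_alg A) e \<and>
        seq_expectation A E e = const_class A (inv\<^bsub>A\<^esub> (Index A E)) \<and>
        inj_on (\<lambda>x. const_class A x \<otimes>\<^bsub>seq_alg A\<^esub> e) (carrier A))"

definition inclusion_rohlin :: "'a cstar_alg \<Rightarrow> 'a set \<Rightarrow> bool" where
  "inclusion_rohlin A P \<longleftrightarrow>
     (\<exists>E. conditional_expectation A P E \<and> finite_index A E \<and> expectation_rohlin A E)"


section \<open>Classes of C*-algebras\<close>

text \<open>A class of separable unital C*-algebras is a set of algebras whose carriers lie in a common,
  arbitrary type \<open>'u\<close>. Separable C*-algebras have at most continuum many elements, so as soon as
  \<open>'u\<close> has that many elements, every separable C*-algebra has an isomorphic copy with carrier in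
  \<open>'u\<close>. Direct sums, matrix algebras and quotients live in other types; that such an algebra belongs
  to a class is expressed through its isomorphic copies in \<open>'u\<close>.\<close>

definition finitely_saturated :: "'u cstar_alg set \<Rightarrow> bool" where
  "finitely_saturated \<C> \<longleftrightarrow>
     (\<forall>A\<in>\<C>. separable_unital_cstar A) \<and>
     (\<forall>A\<in>\<C>. \<forall>B. separable_unital_cstar B \<and> B \<simeq>\<^sub>* A \<longrightarrow> B \<in> \<C>) \<and>
     (\<forall>n\<ge>1. \<forall>A. (\<forall>k<n. A k \<in> \<C>) \<longrightarrow>
        (\<forall>B. separable_unital_cstar B \<and> B \<simeq>\<^sub>* direct_sum n A \<longrightarrow> B \<in> \<C>)) \<and>
     (\<forall>A\<in>\<C>. \<forall>n\<ge>1. \<forall>B. separable_unital_cstar B \<and> B \<simeq>\<^sub>* matrix_alg n A \<longrightarrow> B \<in> \<C>) \<and>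
     (\<forall>A\<in>\<C>. \<forall>p. projection A p \<and> p \<noteq> \<zero>\<^bsub>A\<^esub> \<longrightarrow>
        (\<forall>B. separable_unital_cstar B \<and> B \<simeq>\<^sub>* corner A p \<longrightarrow> B \<in> \<C>))"

definition finite_saturation :: "'u cstar_alg set \<Rightarrow> 'u cstar_alg set" where
  "finite_saturation \<C> = \<Inter>{\<D>. finitely_saturated \<D> \<and> \<C> \<subseteq> \<D>}"

lemma finitely_saturated_separable_unital:
  "finitely_saturated {A. separable_unital_cstar A}"
  by (auto simp: finitely_saturated_def)

lemma finitely_saturated_Inter:
  assumes "S \<noteq> {}" "\<And>\<D>. \<D> \<in> S \<Longrightarrow> finitely_saturated \<D>"
  shows "finitely_saturated (\<Inter>S)"
  unfolding finitely_saturated_def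
proof (intro conjI ballI allI impI)
  fix A assume "A \<in> \<Inter>S"
  then show "separable_unital_cstar A"
    using assms unfolding finitely_saturated_def by blast
next
  fix A B :: "'a cstar_alg" assume "A \<in> \<Inter>S" "separable_unital_cstar B \<and> B \<simeq>\<^sub>* A"
  then show "B \<in> \<Inter>S"
    using assms(2) unfolding finitely_saturated_def by blast
next
  fix n :: nat and A and B :: "'a cstar_alg"
  assume *: "1 \<le> n" "\<forall>k<n. A k \<in> \<Inter>S" "separable_unital_cstar B \<and> B \<simeq>\<^sub>* direct_sum n A"
  show "B \<in> \<Inter>S"
  proof
    fix \<D> assume "\<D> \<in> S"
    with *(2) have "\<forall>k<n. A k \<in> \<D>" by blast
    with *(1,3) assms(2)[OF \<open>\<D> \<in> S\<close>] show "B \<in> \<D>"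
      unfolding finitely_saturated_def by blast
  qed
next
  fix A and n :: nat and B :: "'a cstar_alg"
  assume "A \<in> \<Inter>S" "1 \<le> n" "separable_unital_cstar B \<and> B \<simeq>\<^sub>* matrix_alg n A"
  then show "B \<in> \<Inter>S"
    using assms(2) unfolding finitely_saturated_def by blast
next
  fix A p and B :: "'a cstar_alg"
  assume "A \<in> \<Inter>S" "projection A p \<and> p \<noteq> \<zero>\<^bsub>A\<^esub>" "separable_unital_cstar B \<and> B \<simeq>\<^sub>* corner A p"
  then show "B \<in> \<Inter>S"
    using assms(2) unfolding finitely_saturated_def by blast
qed

lemma finitely_saturated_finite_saturation:
  assumes "\<And>A. A \<in> \<C> \<Longrightarrow> separable_unital_cstar A"
  shows "finitely_saturated (finite_saturation \<C>)"
  unfolding finite_saturation_def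
  using assms finitely_saturated_separable_unital
  by (intro finitely_saturated_Inter) blast+

text \<open>HOL cannot quantify over types inside a formula, so the test algebras \<open>B\<close> have their carriers
  in a given type \<open>'u\<close>. For separable \<open>D\<close> nothing is lost once \<open>'u\<close> has at least continuum many
  elements, since lifting problems for \<open>D\<close> restrict to separable subalgebras of \<open>B\<close>.\<close>

definition semiprojective :: "'u itself \<Rightarrow> 'd cstar_alg \<Rightarrow> bool" where
  "semiprojective (_ :: 'u itself) D \<longleftrightarrow>
     (\<forall>(B :: 'u cstar_alg) J \<phi>.
        cstar_algebra B \<and> (\<forall>n. cstar_ideal B (J n)) \<and> incseq J \<and>
        star_hom D (quot B (ctopology B closure_of (\<Union>n. J n))) \<phi> \<longrightarrow>
        (\<exists>n \<psi>. star_hom D (quot B (J n)) \<psi> \<and>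
           (\<forall>d\<in>carrier D. quot_map B (ctopology B closure_of (\<Union>n. J n)) (\<psi> d) = \<phi> d)))"

text \<open>The ideals \<open>I\<close> in the second condition are proper: \<open>I = A\<close> would force some \<open>I\<^sub>n = A\<close>, and hence
  force the zero algebra into the finite saturation, which can happen only if the zero algebra is in
  \<open>\<C>\<close>. Omitting this case only enlarges the collection of flexible classes.\<close>

definition flexible :: "'u cstar_alg set \<Rightarrow> bool" where
  "flexible \<C> \<longleftrightarrow>
     (\<forall>A\<in>\<C>. separable_unital_cstar A) \<and>
     (\<forall>A\<in>\<C>. \<forall>n\<ge>1. \<forall>p. projection (matrix_alg n A) p \<and> p \<noteq> \<zero>\<^bsub>matrix_alg n A\<^esub> \<longrightarrow>
        semiprojective TYPE('u) (corner (matrix_alg n A) p) \<and>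
        finitely_generated (corner (matrix_alg n A) p)) \<and>
     (\<forall>A\<in>\<C>. \<forall>I. cstar_ideal A I \<and> I \<noteq> carrier A \<longrightarrow>
        (\<exists>J. (\<forall>n. cstar_ideal A (J n)) \<and> incseq J \<and>
           ctopology A closure_of (\<Union>n. J n) = I \<and>
           (\<forall>n. \<exists>B\<in>finite_saturation \<C>. B \<simeq>\<^sub>* quot A (J n))))"

definition unital_local_algebra :: "'u cstar_alg set \<Rightarrow> 'a cstar_alg \<Rightarrow> bool" where
  "unital_local_algebra \<C> A \<longleftrightarrow>
     separable_unital_cstar A \<and>
     (\<forall>S \<epsilon>. finite S \<and> S \<subseteq> carrier A \<and> \<epsilon> > 0 \<longrightarrow>
        (\<exists>B\<in>finite_saturation \<C>. \<exists>\<phi>. unital_hom B A \<phi> \<and>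
           (\<forall>a\<in>S. (INF b\<in>carrier B. cnorm A (a \<ominus>\<^bsub>A\<^esub> \<phi> b)) < \<epsilon>)))"

end

(* A projection e with E(e) = 1/Index E that commutes with A satisfies x e = e b(x) for the
   *-homomorphism b(x) = (Index E) E(x e) from A to the sequence algebra of P, and b fixes P.
   To see this, apply the dual of E to the projection 1 - (Index E) e e_P e on the range of e (e_P
   the Jones projection): the value is a sum of elements y y* and it vanishes, so each y does. This
   uses a quasi-basis of pairs of the form u, u* obtained from an arbitrary one in the C*-algebra of
   adjointable operators of the Hilbert module A over P.

   If f : B -> A approximates a finite set of P and B is in the finite saturation, then b o f lifts
   to a *-homomorphism from B to bounded sequences in P, and far entries of the lift approximate
   the same set; they are unital since a projection close to 1 is 1. The lifting property of all
   corners of matrix algebras holds in the class by semiprojectivity and passes to isomorphic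
   algebras, finite direct sums, matrix algebras and corners.

   No functional calculus is used: positivity is the condition ||t - h|| <= t. *)

theory Submission
  imports Defs "HOL-Library.Reflection" "HOL-Real_Asymp.Real_Asymp"
begin

text \<open>Two obstacles shape the development. Semiprojectivity speaks about quotients by an
  increasing union of ideals. It matches sequence algebras because the null sequences are the
  closure of the union over n of the sequences vanishing from index n on: a lift to such a quotient
  is a homomorphism that is exact from index n on. The bare lifting property is not visibly
  inherited by matrix algebras and corners, so the induction over the finite saturation carries all
  corners of all matrix algebras, which is what flexibility supplies. Direct sums then need an
  analytic step: lifts of the summands are orthogonal only asymptotically and have to be made
  exactly orthogonal.

  On the side of the expectation, passing from a vanishing sum of elements y y^* to each y rests on
  monotonicity of the norm on positive elements, and the Hilbert module needs Cauchy-Schwarz. Both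
  rest on positivity of a^* a, the one hard fact once positivity is a norm condition; sums and
  square roots are elementary for that condition.\<close>

locale star_ring = ring A for A :: "'a cstar_alg" (structure) +
  assumes smult_closed [simp, intro]: "x \<in> carrier A \<Longrightarrow> c \<odot> x \<in> carrier A"
    and smult_add_left: "x \<in> carrier A \<Longrightarrow> (c + d) \<odot> x = c \<odot> x \<oplus> d \<odot> x"
    and smult_add_right: "\<lbrakk>x \<in> carrier A; y \<in> carrier A\<rbrakk> \<Longrightarrow> c \<odot> (x \<oplus> y) = c \<odot> x \<oplus> c \<odot> y"
    and smult_smult: "x \<in> carrier A \<Longrightarrow> (c * d) \<odot> x = c \<odot> (d \<odot> x)"
    and smult_one [simp]: "x \<in> carrier A \<Longrightarrow> 1 \<odot> x = x"
    and smult_mult_left: "\<lbrakk>x \<in> carrier A; y \<in> carrier A\<rbrakk> \<Longrightarrow> (c \<odot> x) \<otimes> y = c \<odot> (x \<otimes> y)"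
    and smult_mult_right: "\<lbrakk>x \<in> carrier A; y \<in> carrier A\<rbrakk> \<Longrightarrow> x \<otimes> (c \<odot> y) = c \<odot> (x \<otimes> y)"
    and cadj_closed [simp, intro]: "x \<in> carrier A \<Longrightarrow> cadj A x \<in> carrier A"
    and cadj_cadj [simp]: "x \<in> carrier A \<Longrightarrow> cadj A (cadj A x) = x"
    and cadj_add: "\<lbrakk>x \<in> carrier A; y \<in> carrier A\<rbrakk> \<Longrightarrow> cadj A (x \<oplus> y) = cadj A x \<oplus> cadj A y"
    and cadj_smult: "x \<in> carrier A \<Longrightarrow> cadj A (c \<odot> x) = cnj c \<odot> cadj A x"
    and cadj_mult: "\<lbrakk>x \<in> carrier A; y \<in> carrier A\<rbrakk> \<Longrightarrow> cadj A (x \<otimes> y) = cadj A y \<otimes> cadj A x"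


context star_ring begin

lemma smult_zero_left [simp]: "x \<in> carrier A \<Longrightarrow> 0 \<odot> x = \<zero>"
  using smult_add_left[of x 0 0] by (metis add_0 add.l_cancel_one' smult_closed)

lemma smult_zero_right [simp]: "c \<odot> \<zero> = \<zero>"
  by (metis mult_zero_right smult_smult smult_zero_left zero_closed)

lemma smult_neg_one: "x \<in> carrier A \<Longrightarrow> (- 1) \<odot> x = \<ominus> x"
  using smult_add_left[of x "- 1" 1]
  by (metis add.inv_equality add.left_inverse smult_closed smult_one smult_zero_left)

lemma neg_smult: "x \<in> carrier A \<Longrightarrow> (- c) \<odot> x = \<ominus> (c \<odot> x)"
  using smult_smult[of x "-1" c] by (simp add: smult_neg_one)

lemma minus_eq_zero_iff: "\<lbrakk>x \<in> carrier A; y \<in> carrier A\<rbrakk> \<Longrightarrow> x \<ominus> y = \<zero> \<longleftrightarrow> x = y"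
  by (metis a_inv_closed a_minus_def add.inv_equality minus_minus r_neg)

lemma smult_left_commute: "x \<in> carrier A \<Longrightarrow> c \<odot> (d \<odot> x) = d \<odot> (c \<odot> x)"
  using smult_smult[of x c d] smult_smult[of x d c] by (simp add: mult.commute)

lemma cadj_zero [simp]: "cadj A \<zero> = \<zero>"
  using cadj_smult[of \<zero> 0] by simp

lemma cadj_one [simp]: "cadj A \<one> = \<one>"
  using cadj_mult[of "cadj A \<one>" \<one>] by simp

lemma cadj_neg: "x \<in> carrier A \<Longrightarrow> cadj A (\<ominus> x) = \<ominus> (cadj A x)"
  using cadj_smult[of x "-1"] by (simp add: smult_neg_one)

lemma cadj_minus: "\<lbrakk>x \<in> carrier A; y \<in> carrier A\<rbrakk> \<Longrightarrow> cadj A (x \<ominus> y) = cadj A x \<ominus> cadj A y"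
  by (simp add: a_minus_def cadj_add cadj_neg)

end

subsection \<open>Identities in *-algebras by normalisation in the free *-algebra\<close>

text \<open>Syntax for the terms of a unital *-algebra. Scalars stay complex numbers, so
  coefficients such as \<open>1 / t\<close> are constants of the syntax and not atoms.\<close>

datatype sexp = V nat | Zero | One | Add sexp sexp | Sub sexp sexp | Neg sexp | Mul sexp sexp
  | Smul complex sexp | Adj sexp

primrec sev :: "'a cstar_alg \<Rightarrow> sexp \<Rightarrow> 'a list \<Rightarrow> 'a" where
  "sev A (V i) vs = vs ! i"
| "sev A Zero vs = \<zero>\<^bsub>A\<^esub>"
| "sev A One vs = \<one>\<^bsub>A\<^esub>"
| "sev A (Add a b) vs = sev A a vs \<oplus>\<^bsub>A\<^esub> sev A b vs"
| "sev A (Sub a b) vs = sev A a vs \<ominus>\<^bsub>A\<^esub> sev A b vs"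
| "sev A (Neg a) vs = \<ominus>\<^bsub>A\<^esub> sev A a vs"
| "sev A (Mul a b) vs = sev A a vs \<otimes>\<^bsub>A\<^esub> sev A b vs"
| "sev A (Smul c a) vs = c \<odot>\<^bsub>A\<^esub> sev A a vs"
| "sev A (Adj a) vs = cadj A (sev A a vs)"

text \<open>Reification acts on a whole goal: making the equation itself an object puts both sides
  over one common list \<open>vs\<close> of atoms.\<close>

datatype seqn = Eqn sexp sexp

primrec seqn_holds :: "'a cstar_alg \<Rightarrow> seqn \<Rightarrow> 'a list \<Rightarrow> bool" where
  "seqn_holds A (Eqn a b) vs \<longleftrightarrow> sev A a vs = sev A b vs"

fun vars_ok :: "nat \<Rightarrow> sexp \<Rightarrow> bool" where
  "vars_ok n (V i) = (i < n)"
| "vars_ok n (Add a b) = (vars_ok n a \<and> vars_ok n b)"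
| "vars_ok n (Sub a b) = (vars_ok n a \<and> vars_ok n b)"
| "vars_ok n (Mul a b) = (vars_ok n a \<and> vars_ok n b)"
| "vars_ok n (Neg a) = vars_ok n a"
| "vars_ok n (Smul c a) = vars_ok n a"
| "vars_ok n (Adj a) = vars_ok n a"
| "vars_ok n _ = True"

text \<open>A normal form is a list of scalar multiples of words; the flag in a letter marks an adjoint.\<close>

type_synonym word_sum = "(complex \<times> (nat \<times> bool) list) list"

primrec nform :: "sexp \<Rightarrow> word_sum" where
  "nform (V i) = [(1, [(i, False)])]"
| "nform Zero = []"
| "nform One = [(1, [])]"
| "nform (Add a b) = nform a @ nform b"
| "nform (Sub a b) = nform a @ map (\<lambda>(c, w). (- c, w)) (nform b)"
| "nform (Neg a) = map (\<lambda>(c, w). (- c, w)) (nform a)"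
| "nform (Mul a b) = concat (map (\<lambda>(c, u). map (\<lambda>(d, w). (c * d, u @ w)) (nform b)) (nform a))"
| "nform (Smul k a) = map (\<lambda>(c, w). (k * c, w)) (nform a)"
| "nform (Adj a) = map (\<lambda>(c, w). (cnj c, rev (map (\<lambda>(i, b). (i, \<not> b)) w))) (nform a)"

text \<open>Distinct words are linearly independent in the free *-algebra, so an identity holds
  there exactly when all collected coefficients vanish. Grouping by the head word avoids an order on
  words, and the coefficients remain equations between complex numbers, which \<open>simp\<close>
  may settle with hypotheses such as \<open>t > 0\<close>.\<close>

fun vanishes :: "word_sum \<Rightarrow> bool" where
  "vanishes [] = True"
| "vanishes ((c, w) # l) = (c + sum_list (map fst (filter (\<lambda>p. snd p = w) l)) = 0 \<and>
     vanishes (filter (\<lambda>p. snd p \<noteq> w) l))"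

context star_ring begin

primrec word_val :: "'a list \<Rightarrow> (nat \<times> bool) list \<Rightarrow> 'a" where
  "word_val vs [] = \<one>"
| "word_val vs (l # w) = (if snd l then cadj A (vs ! fst l) else vs ! fst l) \<otimes> word_val vs w"

primrec sum_val :: "'a list \<Rightarrow> word_sum \<Rightarrow> 'a" where
  "sum_val vs [] = \<zero>"
| "sum_val vs (m # l) = fst m \<odot> word_val vs (snd m) \<oplus> sum_val vs l"

definition words_ok :: "nat \<Rightarrow> word_sum \<Rightarrow> bool" where
  "words_ok n l \<longleftrightarrow> (\<forall>m\<in>set l. \<forall>x\<in>set (snd m). fst x < n)"

lemma words_ok_simps [simp]:
  "words_ok n []" "words_ok n (m # l) \<longleftrightarrow> (\<forall>x\<in>set (snd m). fst x < n) \<and> words_ok n l"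
  "words_ok n (l @ l') \<longleftrightarrow> words_ok n l \<and> words_ok n l'"
  by (auto simp: words_ok_def)

lemma words_ok_filter: "words_ok n l \<Longrightarrow> words_ok n (filter P l)"
  by (auto simp: words_ok_def simp del: split_paired_All)

context
  fixes vs :: "'a list"
  assumes vs: "set vs \<subseteq> carrier A"
begin

lemma nth_vs: "i < length vs \<Longrightarrow> vs ! i \<in> carrier A"
  using vs by auto

lemma word_val_closed: "\<forall>x\<in>set w. fst x < length vs \<Longrightarrow> word_val vs w \<in> carrier A"
  by (induction w) (auto simp: nth_vs)

lemma word_val_append:
  "\<lbrakk>\<forall>x\<in>set u. fst x < length vs; \<forall>x\<in>set w. fst x < length vs\<rbrakk>
    \<Longrightarrow> word_val vs (u @ w) = word_val vs u \<otimes> word_val vs w"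
  by (induction u) (auto simp: nth_vs word_val_closed m_assoc)

lemma word_val_adj:
  "\<forall>x\<in>set w. fst x < length vs \<Longrightarrow>
    word_val vs (rev (map (\<lambda>(i, b). (i, \<not> b)) w)) = cadj A (word_val vs w)"
proof (induction w)
  case (Cons l w)
  have "\<forall>x\<in>set (rev (map (\<lambda>(i, b). (i, \<not> b)) w)). fst x < length vs"
    using Cons.prems by auto
  then show ?case
    using Cons by (cases l) (auto simp: word_val_append nth_vs word_val_closed cadj_mult)
qed simp

lemma sum_val_closed: "words_ok (length vs) l \<Longrightarrow> sum_val vs l \<in> carrier A"
  by (induction l) (auto simp: word_val_closed)

lemma sum_val_append:
  "\<lbrakk>words_ok (length vs) l; words_ok (length vs) l'\<rbrakk>
    \<Longrightarrow> sum_val vs (l @ l') = sum_val vs l \<oplus> sum_val vs l'"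
  by (induction l) (auto simp: word_val_closed sum_val_closed a_assoc)

lemma sum_val_neg:
  "words_ok (length vs) l \<Longrightarrow> sum_val vs (map (\<lambda>(c, w). (- c, w)) l) = \<ominus> sum_val vs l"
  by (induction l) (auto simp: word_val_closed sum_val_closed neg_smult minus_add)

lemma sum_val_smult:
  "words_ok (length vs) l \<Longrightarrow> sum_val vs (map (\<lambda>(c, w). (k * c, w)) l) = k \<odot> sum_val vs l"
  by (induction l) (auto simp: word_val_closed sum_val_closed smult_smult smult_add_right)

lemma sum_val_adj:
  "words_ok (length vs) l \<Longrightarrow>
    sum_val vs (map (\<lambda>(c, w). (cnj c, rev (map (\<lambda>(i, b). (i, \<not> b)) w))) l) = cadj A (sum_val vs l)"
  by (induction l) (auto simp: word_val_closed sum_val_closed cadj_add cadj_smult word_val_adj)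

lemma sum_val_mult_word:
  "\<lbrakk>\<forall>x\<in>set u. fst x < length vs; words_ok (length vs) l\<rbrakk> \<Longrightarrow>
    sum_val vs (map (\<lambda>(d, w). (c * d, u @ w)) l) = (c \<odot> word_val vs u) \<otimes> sum_val vs l"
  by (induction l)
    (auto simp: word_val_closed sum_val_closed word_val_append smult_smult smult_mult_left
      smult_mult_right r_distr smult_add_right smult_left_commute[of "_ \<otimes> _"])

lemma sum_val_mult:
  "\<lbrakk>words_ok (length vs) l; words_ok (length vs) l'\<rbrakk> \<Longrightarrow>
    sum_val vs (concat (map (\<lambda>(c, u). map (\<lambda>(d, w). (c * d, u @ w)) l') l)) =
    sum_val vs l \<otimes> sum_val vs l'"
proof (induction l)
  case (Cons m l)
  obtain c u where m: "m = (c, u)" by (cases m)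
  have ok: "words_ok (length vs) (map (\<lambda>(d, w). (c * d, u @ w)) l')"
    using Cons.prems m by (auto simp: words_ok_def split_def)
  have ok': "words_ok (length vs) (concat (map (\<lambda>(c, u). map (\<lambda>(d, w). (c * d, u @ w)) l') l))"
    using Cons.prems m by (fastforce simp: words_ok_def split_def)
  show ?case
    using Cons m ok ok'
    by (simp add: sum_val_append sum_val_mult_word word_val_closed sum_val_closed l_distr)
qed (simp add: sum_val_closed)

lemma words_ok_nform: "vars_ok (length vs) e \<Longrightarrow> words_ok (length vs) (nform e)"
  by (induction e) (fastforce simp: words_ok_def split_def)+

lemma sev_closed: "vars_ok (length vs) e \<Longrightarrow> sev A e vs \<in> carrier A"
  by (induction e) (auto simp: nth_vs)

lemma sev_nform: "vars_ok (length vs) e \<Longrightarrow> sev A e vs = sum_val vs (nform e)"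
proof (induction e)
  case (Sub e1 e2)
  then have "words_ok (length vs) (map (\<lambda>(c, w). (- c, w)) (nform e2))"
    using words_ok_nform[of e2] by (fastforce simp: words_ok_def split_def)
  with Sub show ?case
    by (simp add: sum_val_append words_ok_nform sum_val_neg a_minus_def)
next
  case (V i)
  then show ?case using nth_vs[of i] by simp
qed (simp_all add: sum_val_append sum_val_neg sum_val_mult sum_val_smult sum_val_adj words_ok_nform)

lemma sum_val_filter:
  "\<lbrakk>words_ok (length vs) l; \<forall>x\<in>set w. fst x < length vs\<rbrakk> \<Longrightarrow> sum_val vs l =
    sum_list (map fst (filter (\<lambda>p. snd p = w) l)) \<odot> word_val vs w \<oplus>
    sum_val vs (filter (\<lambda>p. snd p \<noteq> w) l)"
proof (induction l)
  case (Cons m l)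
  have "words_ok (length vs) (filter (\<lambda>p. snd p \<noteq> w) l)"
    using Cons.prems by (simp add: words_ok_filter)
  then have *: "sum_val vs (filter (\<lambda>p. snd p \<noteq> w) l) \<in> carrier A"
    by (rule sum_val_closed)
  from Cons * show ?case
    by (auto simp: word_val_closed smult_add_left a_assoc a_lcomm)
qed (simp add: word_val_closed)

lemma sum_val_vanishes: "\<lbrakk>vanishes l; words_ok (length vs) l\<rbrakk> \<Longrightarrow> sum_val vs l = \<zero>"
proof (induction l rule: vanishes.induct)
  case (2 c w l)
  have ok: "words_ok (length vs) (filter (\<lambda>p. snd p \<noteq> w) l)"
    using 2 by (simp add: words_ok_filter)
  define s where "s = sum_list (map fst (filter (\<lambda>p. snd p = w) l))"
  have w: "word_val vs w \<in> carrier A" "\<forall>x\<in>set w. fst x < length vs"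
    using 2 by (auto simp: word_val_closed)
  have "c + s = 0" using 2 by (simp add: s_def)
  then have "c \<odot> word_val vs w \<oplus> s \<odot> word_val vs w = \<zero>"
    using w smult_add_left[of "word_val vs w" c s] by simp
  moreover have "sum_val vs l = s \<odot> word_val vs w"
    using 2 ok w sum_val_filter[of l w] by (simp add: s_def)
  ultimately show ?case by simp
qed simp

text \<open>The premise is checked by evaluating the normal form of the difference of the two sides.
  After \<open>reify star_eqs\<close> the subgoals are membership of the atoms in the carrier and
  this evaluation; both fall to \<open>simp\<close>.\<close>

lemma seqn_holdsI:
  assumes "vars_ok (length vs) e1 \<and> vars_ok (length vs) e2 \<and> vanishes (nform (Sub e1 e2))"
  shows "seqn_holds A (Eqn e1 e2) vs"
proof -
  have ok: "vars_ok (length vs) (Sub e1 e2)" using assms by simp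
  have "sev A (Sub e1 e2) vs = \<zero>"
    using assms sum_val_vanishes[OF _ words_ok_nform[OF ok]] sev_nform[OF ok] by (simp only:)
  then show ?thesis
    using assms sev_closed[of e1] sev_closed[of e2] by (simp add: minus_eq_zero_iff)
qed

end

lemmas star_eqs = sev.simps[of A] seqn_holds.simps[of A]

end

subsection \<open>Norm convergence\<close>

text \<open>All axioms but completeness. The operator algebra, the bounded sequences, a subalgebra
  and a transported copy are recognised at this stage first, which provides limits and the metric
  before completeness is proved for them.\<close>

locale pre_cstar_algebra = star_ring A for A :: "'a cstar_alg" (structure) +
  assumes cnorm_eq_0: "x \<in> carrier A \<Longrightarrow> cnorm A x = 0 \<longleftrightarrow> x = \<zero>"
    and cnorm_add: "\<lbrakk>x \<in> carrier A; y \<in> carrier A\<rbrakk> \<Longrightarrow> cnorm A (x \<oplus> y) \<le> cnorm A x + cnorm A y"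
    and cnorm_smult: "x \<in> carrier A \<Longrightarrow> cnorm A (c \<odot> x) = cmod c * cnorm A x"
    and cnorm_mult: "\<lbrakk>x \<in> carrier A; y \<in> carrier A\<rbrakk> \<Longrightarrow> cnorm A (x \<otimes> y) \<le> cnorm A x * cnorm A y"
    and cnorm_cadj_mult: "x \<in> carrier A \<Longrightarrow> cnorm A (cadj A x \<otimes> x) = (cnorm A x)\<^sup>2"
begin

lemma cnorm_zero [simp]: "cnorm A \<zero> = 0"
  by (simp add: cnorm_eq_0)

lemma cnorm_neg [simp]: "x \<in> carrier A \<Longrightarrow> cnorm A (\<ominus> x) = cnorm A x"
  using cnorm_smult[of x "-1"] by (simp add: smult_neg_one)

lemma cnorm_nonneg [simp]: "x \<in> carrier A \<Longrightarrow> 0 \<le> cnorm A x"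
  using cnorm_add[of x "\<ominus> x"] by (simp add: r_neg)

lemma cnorm_minus_commute: "\<lbrakk>x \<in> carrier A; y \<in> carrier A\<rbrakk> \<Longrightarrow> cnorm A (x \<ominus> y) = cnorm A (y \<ominus> x)"
  using cnorm_neg[of "x \<ominus> y"] by (simp add: minus_add a_minus_def a_comm)

lemma cnorm_minus: "\<lbrakk>x \<in> carrier A; y \<in> carrier A\<rbrakk> \<Longrightarrow> cnorm A (x \<ominus> y) \<le> cnorm A x + cnorm A y"
  using cnorm_add[of x "\<ominus> y"] by (simp add: a_minus_def)

lemma cnorm_triangle:
  assumes "x \<in> carrier A" "y \<in> carrier A" "z \<in> carrier A"
  shows "cnorm A (x \<ominus> z) \<le> cnorm A (x \<ominus> y) + cnorm A (y \<ominus> z)"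
proof -
  have "x \<ominus> z = (x \<ominus> y) \<oplus> (y \<ominus> z)"
    using assms by (reify star_eqs, intro seqn_holdsI; simp)
  then show ?thesis using cnorm_add assms by simp
qed

lemma cnorm_le_diff:
  assumes "x \<in> carrier A" "y \<in> carrier A"
  shows "cnorm A x \<le> cnorm A y + cnorm A (x \<ominus> y)"
proof -
  have "x = y \<oplus> (x \<ominus> y)"
    using assms by (reify star_eqs, intro seqn_holdsI; simp)
  then show ?thesis using cnorm_add[of y "x \<ominus> y"] assms by simp
qed

lemma cnorm_cadj [simp]: assumes "x \<in> carrier A" shows "cnorm A (cadj A x) = cnorm A x"
proof -
  have *: "cnorm A y \<le> cnorm A (cadj A y)" if y: "y \<in> carrier A" for y
  proof (cases "cnorm A y = 0")
    case False
    have "cnorm A y * cnorm A y \<le> cnorm A (cadj A y) * cnorm A y"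
      using cnorm_mult[of "cadj A y" y] cnorm_cadj_mult[OF y] y by (simp add: power2_eq_square)
    then show ?thesis using False cnorm_nonneg[OF y] by simp
  qed (use y in simp)
  show ?thesis using *[of x] *[of "cadj A x"] assms by simp
qed

lemma cnorm_mult_cadj: "x \<in> carrier A \<Longrightarrow> cnorm A (x \<otimes> cadj A x) = (cnorm A x)\<^sup>2"
  using cnorm_cadj_mult[of "cadj A x"] by simp

lemma cnorm_one_le [simp]: "cnorm A \<one> \<le> 1"
  using cnorm_cadj_mult[of \<one>] by (auto simp: power2_eq_square)

lemma cadj_mult_eq_zero: "\<lbrakk>x \<in> carrier A; cadj A x \<otimes> x = \<zero>\<rbrakk> \<Longrightarrow> x = \<zero>"
  using cnorm_cadj_mult[of x] by (simp add: cnorm_eq_0)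

lemma cnorm_smult_one_le: "cnorm A (c \<odot> \<one>) \<le> cmod c"
  using mult_left_mono[OF cnorm_one_le, of "cmod c"] by (simp add: cnorm_smult)

sublocale cmetric: Metric_space "carrier A" "cdist A"
proof
  show "0 \<le> cdist A x y" for x y by (simp add: cdist_def)
  show "cdist A x y = cdist A y x" for x y by (simp add: cdist_def cnorm_minus_commute)
  show "cdist A x y = 0 \<longleftrightarrow> x = y" if "x \<in> carrier A" "y \<in> carrier A" for x y
    using that by (simp add: cdist_def cnorm_eq_0 minus_eq_zero_iff)
  show "cdist A x z \<le> cdist A x y + cdist A y z"
    if "x \<in> carrier A" "y \<in> carrier A" "z \<in> carrier A" for x y z
    using that by (simp add: cdist_def cnorm_triangle)
qed

definition clim :: "(nat \<Rightarrow> 'a) \<Rightarrow> 'a \<Rightarrow> bool" where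
  "clim f l \<longleftrightarrow> range f \<subseteq> carrier A \<and> l \<in> carrier A \<and> (\<lambda>n. cnorm A (f n \<ominus> l)) \<longlonglongrightarrow> 0"

lemma clim_limitin: "clim f l \<longleftrightarrow> range f \<subseteq> carrier A \<and> limitin (ctopology A) f l sequentially"
  unfolding clim_def ctopology_def cmetric.limitin_metric_dist_null
  by (auto simp: cdist_def range_subsetD)

lemma clim_carrier: "clim f l \<Longrightarrow> f n \<in> carrier A" "clim f l \<Longrightarrow> l \<in> carrier A"
  by (auto simp: clim_def)

lemma clim_unique: assumes "clim f l" "clim f k" shows "l = k"
proof -
  have c: "f n \<in> carrier A" "l \<in> carrier A" "k \<in> carrier A" for n
    using clim_carrier assms by blast+
  have "(\<lambda>n. cnorm A (f n \<ominus> l) + cnorm A (f n \<ominus> k)) \<longlonglongrightarrow> 0 + 0"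
    using assms by (intro tendsto_add) (auto simp: clim_def)
  moreover have "cnorm A (l \<ominus> k) \<le> cnorm A (f n \<ominus> l) + cnorm A (f n \<ominus> k)" for n
    using cnorm_triangle[of l "f n" k] cnorm_minus_commute[of l "f n"] c by simp
  ultimately have "cnorm A (l \<ominus> k) \<le> 0"
    using LIMSEQ_le_const by fastforce
  then have "cnorm A (l \<ominus> k) = 0" using c by (simp add: order_antisym)
  then show ?thesis using c by (simp add: cnorm_eq_0 minus_eq_zero_iff)
qed

lemma clim_le:
  assumes "range f \<subseteq> carrier A" "l \<in> carrier A" "g \<longlonglongrightarrow> 0" "\<And>n. cnorm A (f n \<ominus> l) \<le> g n"
  shows "clim f l"
  unfolding clim_def
proof (intro conjI)
  have "f n \<in> carrier A" for n using assms(1) by auto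
  with assms(2,4) show "(\<lambda>n. cnorm A (f n \<ominus> l)) \<longlonglongrightarrow> 0"
    by (intro Lim_null_comparison[OF _ assms(3)]) (simp add: eventually_sequentially)
qed (use assms(1,2) in auto)

lemma clim_const: "l \<in> carrier A \<Longrightarrow> clim (\<lambda>n. l) l"
  by (auto simp: clim_def a_minus_def r_neg)

lemma clim_Suc: "clim f l \<Longrightarrow> clim (\<lambda>n. f (Suc n)) l"
  by (auto simp: clim_def intro: filterlim_compose[OF _ filterlim_Suc])

lemma clim_cnorm: assumes "clim f l" shows "(\<lambda>n. cnorm A (f n)) \<longlonglongrightarrow> cnorm A l"
proof -
  have c: "f n \<in> carrier A" "l \<in> carrier A" for n using clim_carrier assms by blast+
  have "\<bar>cnorm A (f n) - cnorm A l\<bar> \<le> cnorm A (f n \<ominus> l)" for n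
    using cnorm_le_diff[of "f n" l] cnorm_le_diff[of l "f n"] cnorm_minus_commute[of l "f n"] c
    by (simp add: abs_le_iff)
  then have "(\<lambda>n. cnorm A (f n) - cnorm A l) \<longlonglongrightarrow> 0"
    using assms by (intro Lim_null_comparison[of "\<lambda>n. cnorm A (f n) - cnorm A l" "\<lambda>n. cnorm A (f n \<ominus> l)" sequentially] always_eventually) (simp_all add: clim_def)
  then show ?thesis by (simp add: LIM_zero_iff)
qed

lemma clim_add: assumes "clim f l" "clim g k" shows "clim (\<lambda>n. f n \<oplus> g n) (l \<oplus> k)"
proof (rule clim_le)
  have c: "f n \<in> carrier A" "l \<in> carrier A" "g n \<in> carrier A" "k \<in> carrier A" for n
    using clim_carrier assms by blast+
  then show "range (\<lambda>n. f n \<oplus> g n) \<subseteq> carrier A" "l \<oplus> k \<in> carrier A" by auto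
  show "(\<lambda>n. cnorm A (f n \<ominus> l) + cnorm A (g n \<ominus> k)) \<longlonglongrightarrow> 0"
    using tendsto_add[of "\<lambda>n. cnorm A (f n \<ominus> l)" 0 _ "\<lambda>n. cnorm A (g n \<ominus> k)" 0] assms
    by (auto simp: clim_def)
  have "(f n \<oplus> g n) \<ominus> (l \<oplus> k) = (f n \<ominus> l) \<oplus> (g n \<ominus> k)" for n
    using c by (reify star_eqs, intro seqn_holdsI; simp)
  then show "cnorm A ((f n \<oplus> g n) \<ominus> (l \<oplus> k)) \<le> cnorm A (f n \<ominus> l) + cnorm A (g n \<ominus> k)" for n
    using cnorm_add c by simp
qed

lemma clim_smult: assumes "clim f l" shows "clim (\<lambda>n. c \<odot> f n) (c \<odot> l)"
proof (rule clim_le)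
  have c: "f n \<in> carrier A" "l \<in> carrier A" for n
    using clim_carrier assms by blast+
  then show "range (\<lambda>n. c \<odot> f n) \<subseteq> carrier A" "c \<odot> l \<in> carrier A" by auto
  show "(\<lambda>n. cmod c * cnorm A (f n \<ominus> l)) \<longlonglongrightarrow> 0"
    using tendsto_mult_right_zero assms by (auto simp: clim_def)
  have "c \<odot> f n \<ominus> c \<odot> l = c \<odot> (f n \<ominus> l)" for n
    using c by (reify star_eqs, intro seqn_holdsI; simp)
  then show "cnorm A (c \<odot> f n \<ominus> c \<odot> l) \<le> cmod c * cnorm A (f n \<ominus> l)" for n
    using c by (simp add: cnorm_smult)
qed

lemma clim_cadj: assumes "clim f l" shows "clim (\<lambda>n. cadj A (f n)) (cadj A l)"
proof (rule clim_le)
  have c: "f n \<in> carrier A" "l \<in> carrier A" for n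
    using clim_carrier assms by blast+
  then show "range (\<lambda>n. cadj A (f n)) \<subseteq> carrier A" "cadj A l \<in> carrier A" by auto
  show "(\<lambda>n. cnorm A (f n \<ominus> l)) \<longlonglongrightarrow> 0"
    using assms by (auto simp: clim_def)
  show "cnorm A (cadj A (f n) \<ominus> cadj A l) \<le> cnorm A (f n \<ominus> l)" for n
    using c cnorm_cadj[of "f n \<ominus> l"] by (simp add: cadj_minus)
qed

lemma clim_mult: assumes "clim f l" "clim g k" shows "clim (\<lambda>n. f n \<otimes> g n) (l \<otimes> k)"
proof (rule clim_le)
  have c: "f n \<in> carrier A" "l \<in> carrier A" "g n \<in> carrier A" "k \<in> carrier A" for n
    using clim_carrier assms by blast+
  then show "range (\<lambda>n. f n \<otimes> g n) \<subseteq> carrier A" "l \<otimes> k \<in> carrier A" by auto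
  have "(\<lambda>n. cnorm A (f n) * cnorm A (g n \<ominus> k) + cnorm A (f n \<ominus> l) * cnorm A k) \<longlonglongrightarrow> cnorm A l * 0 + 0 * cnorm A k"
    using assms clim_cnorm[OF assms(1)] by (intro tendsto_intros) (auto simp: clim_def)
  then show "(\<lambda>n. cnorm A (f n) * cnorm A (g n \<ominus> k) + cnorm A (f n \<ominus> l) * cnorm A k) \<longlonglongrightarrow> 0"
    by simp
  fix n
  have "f n \<otimes> g n \<ominus> l \<otimes> k = f n \<otimes> (g n \<ominus> k) \<oplus> (f n \<ominus> l) \<otimes> k"
    using c by (reify star_eqs, intro seqn_holdsI; simp)
  then show "cnorm A (f n \<otimes> g n \<ominus> l \<otimes> k) \<le> cnorm A (f n) * cnorm A (g n \<ominus> k) + cnorm A (f n \<ominus> l) * cnorm A k"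
    using cnorm_add[of "f n \<otimes> (g n \<ominus> k)" "(f n \<ominus> l) \<otimes> k"] cnorm_mult[of "f n" "g n \<ominus> k"]
      cnorm_mult[of "f n \<ominus> l" k] c by (simp add: add_mono order_trans)
qed

lemma closedin_clim: "\<lbrakk>closedin (ctopology A) S; clim f l; \<And>n. f n \<in> S\<rbrakk> \<Longrightarrow> l \<in> S"
  unfolding clim_limitin by (rule limitin_closedin[of _ f l sequentially S]) auto

lemma closure_of_iff:
  assumes "S \<subseteq> carrier A"
  shows "x \<in> ctopology A closure_of S \<longleftrightarrow> x \<in> carrier A \<and> (\<forall>e>0. \<exists>y\<in>S. cnorm A (x \<ominus> y) < e)"
  unfolding ctopology_def cmetric.metric_closure_of using assms
  by (auto simp: cdist_def subset_iff cmetric.in_mball) 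

lemma closedinI:
  assumes "S \<subseteq> carrier A" and lim: "\<And>f l. \<lbrakk>clim f l; \<And>n. f n \<in> S\<rbrakk> \<Longrightarrow> l \<in> S"
  shows "closedin (ctopology A) S"
proof -
  have "x \<in> S" if "x \<in> ctopology A closure_of S" for x
  proof -
    have x: "x \<in> carrier A" and "\<forall>n. \<exists>y\<in>S. cnorm A (x \<ominus> y) < inverse (real (Suc n))"
      using that unfolding closure_of_iff[OF assms(1)] by auto
    then obtain f where f: "\<And>n. f n \<in> S" "\<And>n. cnorm A (x \<ominus> f n) < inverse (real (Suc n))"
      by metis
    then have "f n \<in> carrier A" for n using assms(1) by blast
    with f x have "clim f x"
      by (intro clim_le[OF _ _ LIMSEQ_inverse_real_of_nat])
        (auto simp: cnorm_minus_commute[of _ x] intro: less_imp_le)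
    then show ?thesis using lim f by blast
  qed
  moreover have "topspace (ctopology A) = carrier A" by (simp add: ctopology_def)
  ultimately show ?thesis
    using assms(1) closure_of_subset[of S "ctopology A"] closure_of_eq[of "ctopology A" S] by auto
qed

text \<open>Replaces metric completeness by convergence of norm Cauchy sequences, so that later
  constructions never meet \<open>cdist\<close> and its special value outside the carrier.\<close>

lemma unital_cstar_algebraI:
  assumes "\<And>f. \<lbrakk>range f \<subseteq> carrier A; \<And>e. e > 0 \<Longrightarrow> \<exists>N. \<forall>m\<ge>N. \<forall>n\<ge>N. cnorm A (f m \<ominus> f n) < e\<rbrakk>
    \<Longrightarrow> \<exists>l. clim f l"
  shows "unital_cstar_algebra A"
proof -
  have "cmetric.mcomplete"
    unfolding cmetric.mcomplete_def
  proof (intro allI impI)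
    fix f assume f: "cmetric.MCauchy f"
    then have "range f \<subseteq> carrier A" unfolding cmetric.MCauchy_def by blast
    moreover have "\<exists>N. \<forall>m\<ge>N. \<forall>n\<ge>N. cnorm A (f m \<ominus> f n) < e" if "e > 0" for e
    proof -
      have "\<exists>N. \<forall>n n'. N \<le> n \<longrightarrow> N \<le> n' \<longrightarrow> cdist A (f n) (f n') < e"
        using f that unfolding cmetric.MCauchy_def by blast
      then show ?thesis using \<open>range f \<subseteq> carrier A\<close> by (simp add: cdist_def range_subsetD)
    qed
    ultimately obtain l where "clim f l" using assms by blast
    then show "\<exists>l. limitin cmetric.mtopology f l sequentially"
      unfolding clim_limitin ctopology_def by blast
  qed
  then show ?thesis
    by unfold_locales
      (simp_all add: l_distr r_distr smult_add_left smult_add_right smult_smult smult_mult_left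
        smult_mult_right cadj_add cadj_smult cadj_mult m_assoc cnorm_eq_0 cnorm_add cnorm_smult
        cnorm_mult cnorm_cadj_mult)
qed

end

sublocale unital_cstar_algebra \<subseteq> pre_cstar_algebra A
  by unfold_locales
    (simp_all add: mult_distl mult_distr smult_closed smult_add_left smult_add_right smult_smult
      smult_one smult_mult_left smult_mult_right cadj_closed cadj_cadj cadj_add cadj_smult cadj_mult
      cnorm_eq_0 cnorm_add cnorm_smult cnorm_mult cnorm_cadj_mult)

context unital_cstar_algebra begin

lemma Cauchy_clim:
  assumes "range f \<subseteq> carrier A"
    and "\<And>e. e > 0 \<Longrightarrow> \<exists>N. \<forall>m\<ge>N. \<forall>n\<ge>N. cnorm A (f m \<ominus> f n) < e"
  shows "\<exists>l. clim f l"
proof -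
  have "cmetric.MCauchy f"
    unfolding cmetric.MCauchy_def using assms by (auto simp: cdist_def range_subsetD)
  then show ?thesis
    using complete assms(1) unfolding cmetric.mcomplete_def clim_limitin ctopology_def by blast
qed

text \<open>Steps bounded by increments of \<open>g\<close> telescope, so \<open>f\<close> is Cauchy
  because \<open>g\<close> is. Only convergence of a scalar majorant has to be known, which serves
  both the square root iteration and the geometric series.\<close>

lemma clim_dominated:
  assumes f: "range f \<subseteq> carrier A" and "convergent g"
    and le: "\<And>n. cnorm A (f (Suc n) \<ominus> f n) \<le> g (Suc n) - (g n :: real)"
  shows "\<exists>l. clim f l"
proof (rule Cauchy_clim[OF f])
  fix e :: real assume "e > 0"
  have f': "f n \<in> carrier A" for n using f by auto
  have *: "cnorm A (f n \<ominus> f m) \<le> g n - g m" if "m \<le> n" for m n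
    using that
  proof (induction n rule: dec_induct)
    case base
    then show ?case using f' by (simp add: a_minus_def r_neg)
  next
    case (step n)
    then show ?case using cnorm_triangle[OF f' f' f', of "Suc n" m n] le[of n] by simp
  qed
  have "Cauchy g" using assms(2) by (simp add: Cauchy_convergent_iff)
  then obtain N where N: "\<And>m n. m \<ge> N \<Longrightarrow> n \<ge> N \<Longrightarrow> \<bar>g m - g n\<bar> < e"
    using \<open>e > 0\<close> unfolding Cauchy_def dist_real_def by metis
  have "cnorm A (f m \<ominus> f n) < e" if "m \<ge> N" "n \<ge> N" for m n
  proof (cases "m \<le> n")
    case True
    then show ?thesis
      using *[OF True] N[OF that] cnorm_minus_commute[OF f' f', of m n] by linarith
  next
    case False
    then show ?thesis using *[of n m] N[OF that] by linarith
  qed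
  then show "\<exists>N. \<forall>m\<ge>N. \<forall>n\<ge>N. cnorm A (f m \<ominus> f n) < e" by blast
qed

end

context unital_cstar_algebra begin

lemma add_minus_cancel_left: "\<lbrakk>x \<in> carrier A; y \<in> carrier A\<rbrakk> \<Longrightarrow> (x \<oplus> y) \<ominus> x = y"
  by (reify star_eqs, intro seqn_holdsI; simp)

subsection \<open>Square roots and positive elements\<close>

text \<open>Stands in for the statement that \<open>z\<close> is a function of \<open>x\<close>. It
  is all that is kept of the functional calculus, and it makes square roots of commuting elements
  commute.\<close>

definition in_bicommutant :: "'a \<Rightarrow> 'a \<Rightarrow> bool" where
  "in_bicommutant x z \<longleftrightarrow> (\<forall>c\<in>carrier A. c \<otimes> x = x \<otimes> c \<longrightarrow> c \<otimes> z = z \<otimes> c)"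

lemma in_bicommutantI:
  "(\<And>c. \<lbrakk>c \<in> carrier A; c \<otimes> x = x \<otimes> c\<rbrakk> \<Longrightarrow> c \<otimes> z = z \<otimes> c) \<Longrightarrow> in_bicommutant x z"
  unfolding in_bicommutant_def by blast

lemma in_bicommutantD:
  "\<lbrakk>in_bicommutant x z; c \<in> carrier A; c \<otimes> x = x \<otimes> c\<rbrakk> \<Longrightarrow> c \<otimes> z = z \<otimes> c"
  unfolding in_bicommutant_def by blast

text \<open>A fixed point satisfies \<open>2 z = x + z^2\<close>, that is,
  \<open>(1 - z)^2 = 1 - x\<close>.\<close>

primrec sqrt_iter :: "'a \<Rightarrow> nat \<Rightarrow> 'a" where
  "sqrt_iter x 0 = \<zero>"
| "sqrt_iter x (Suc n) = (1/2) \<odot> (x \<oplus> sqrt_iter x n \<otimes> sqrt_iter x n)"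

text \<open>The iteration for the scalar \<open>x = 1\<close>. The iterates are polynomials in
  \<open>x\<close> with nonnegative coefficients, so this sequence and its increments majorise the
  norms whenever \<open>||x|| \<le> 1\<close>. At norm exactly 1 the majorant takes the place of a
  contraction estimate.\<close>

primrec scalar_sqrt_iter :: "nat \<Rightarrow> real" where
  "scalar_sqrt_iter 0 = 0"
| "scalar_sqrt_iter (Suc n) = (1 + (scalar_sqrt_iter n)\<^sup>2) / 2"

lemma scalar_sqrt_iter_bounds: "0 \<le> scalar_sqrt_iter n \<and> scalar_sqrt_iter n \<le> 1"
  by (induction n) (auto simp: power_le_one)

lemma convergent_scalar_sqrt_iter: "convergent scalar_sqrt_iter"
proof (rule Bseq_mono_convergent)
  show "Bseq scalar_sqrt_iter"
    using scalar_sqrt_iter_bounds by (intro BseqI'[of _ 1]) auto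
  have "scalar_sqrt_iter n \<le> scalar_sqrt_iter (Suc n)" for n
    using zero_le_power2[of "scalar_sqrt_iter n - 1"] by (simp add: power2_eq_square algebra_simps)
  then show "\<forall>m n. m \<le> n \<longrightarrow> scalar_sqrt_iter m \<le> scalar_sqrt_iter n"
    using lift_Suc_mono_le by blast
qed

text \<open>The square root of \<open>1 - x\<close> is \<open>1 - z\<close> for the limit \<open>z\<close> of the iteration; the scalar
  iteration started at \<open>1\<close> dominates it.\<close>

lemma sqrt_one_minus:
  assumes x: "x \<in> carrier A" "cadj A x = x" and le: "cnorm A x \<le> 1"
  obtains z where "z \<in> carrier A" "cadj A z = z" "cnorm A z \<le> cnorm A x"
    "(\<one> \<ominus> z) \<otimes> (\<one> \<ominus> z) = \<one> \<ominus> x"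
    "in_bicommutant x z"
proof -
  let ?z = "sqrt_iter x" and ?s = scalar_sqrt_iter
  have zc: "?z n \<in> carrier A" for n
    by (induction n) (use x in auto)
  \<comment> \<open>Besides the scalar majorant, a bound by the norm of \<open>x\<close> itself is
    recorded: for \<open>||x|| < 1\<close> it allows \<open>1 - z\<close> to be inverted by a
    geometric series.\<close>
  have zx: "cnorm A (?z n) \<le> cnorm A x" for n
  proof (induction n)
    case (Suc n)
    have "cnorm A (?z n) * cnorm A (?z n) \<le> cnorm A x * 1"
      using Suc le x zc by (intro mult_mono) auto
    then have "cnorm A (?z n \<otimes> ?z n) \<le> cnorm A x"
      using cnorm_mult[OF zc zc, of n n] by linarith
    then have "cnorm A (x \<oplus> ?z n \<otimes> ?z n) \<le> 2 * cnorm A x"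
      using cnorm_add[of x "?z n \<otimes> ?z n"] x zc by simp
    then show ?case using x zc by (simp add: cnorm_smult norm_divide)
  qed (use x in simp)
  have zs: "cnorm A (?z n) \<le> ?s n" for n
  proof (induction n)
    case (Suc n)
    have "cnorm A (?z n \<otimes> ?z n) \<le> (?s n)\<^sup>2"
      using cnorm_mult[OF zc zc, of n n] mult_mono[OF Suc Suc] scalar_sqrt_iter_bounds[of n]
        cnorm_nonneg[OF zc[of n]] by (simp add: power2_eq_square)
    then show ?case
      using cnorm_add[of x "?z n \<otimes> ?z n"] x zc le by (simp add: cnorm_smult norm_divide)
  qed simp
  have step: "cnorm A (?z (Suc n) \<ominus> ?z n) \<le> ?s (Suc n) - ?s n" for n
  proof (induction n)
    case 0
    then show ?case using x le by (simp add: a_minus_def cnorm_smult norm_divide)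
  next
    case (Suc n)
    let ?a = "?z (Suc n)" and ?b = "?z n"
    have c: "?a \<in> carrier A" "?b \<in> carrier A" using zc by blast+
    \<comment> \<open>Noncommutative form of \<open>a^2 - b^2 = (a + b) (a - b)\<close>. The scalar
      increments obey the same factorisation, which closes the induction.\<close>
    have "?z (Suc (Suc n)) \<ominus> ?a = (1/2) \<odot> (x \<oplus> ?a \<otimes> ?a) \<ominus> (1/2) \<odot> (x \<oplus> ?b \<otimes> ?b)"
      by simp
    also have "\<dots> = (1/2) \<odot> (?a \<otimes> (?a \<ominus> ?b) \<oplus> (?a \<ominus> ?b) \<otimes> ?b)"
    proof -
      have "(1/2) \<odot> (x \<oplus> a \<otimes> a) \<ominus> (1/2) \<odot> (x \<oplus> b \<otimes> b) = (1/2) \<odot> (a \<otimes> (a \<ominus> b) \<oplus> (a \<ominus> b) \<otimes> b)"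
        if "a \<in> carrier A" "b \<in> carrier A" for a b
        using that x(1) by (reify star_eqs, intro seqn_holdsI; simp)
      then show ?thesis using c by blast
    qed
    finally have eq: "?z (Suc (Suc n)) \<ominus> ?a = (1/2) \<odot> (?a \<otimes> (?a \<ominus> ?b) \<oplus> (?a \<ominus> ?b) \<otimes> ?b)" .
    let ?d = "cnorm A (?a \<ominus> ?b)"
    have "cnorm A (?a \<otimes> (?a \<ominus> ?b) \<oplus> (?a \<ominus> ?b) \<otimes> ?b) \<le> cnorm A ?a * ?d + ?d * cnorm A ?b"
      using cnorm_add[of "?a \<otimes> (?a \<ominus> ?b)" "(?a \<ominus> ?b) \<otimes> ?b"] cnorm_mult[of ?a "?a \<ominus> ?b"]
        cnorm_mult[of "?a \<ominus> ?b" ?b] c by (simp del: sqrt_iter.simps)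
    also have "\<dots> = (cnorm A ?a + cnorm A ?b) * ?d" by (simp add: algebra_simps)
    also have "\<dots> \<le> (?s (Suc n) + ?s n) * (?s (Suc n) - ?s n)"
      using zs[of "Suc n"] zs[of n] Suc c scalar_sqrt_iter_bounds[of "Suc n"] scalar_sqrt_iter_bounds[of n]
      by (intro mult_mono add_mono) (simp_all del: sqrt_iter.simps scalar_sqrt_iter.simps)
    also have "\<dots> = 2 * (?s (Suc (Suc n)) - ?s (Suc n))"
      by (simp add: power2_eq_square field_simps)
    finally have "cnorm A ((1/2) \<odot> (?a \<otimes> (?a \<ominus> ?b) \<oplus> (?a \<ominus> ?b) \<otimes> ?b)) \<le> ?s (Suc (Suc n)) - ?s (Suc n)"
      using c by (simp add: cnorm_smult norm_divide del: sqrt_iter.simps scalar_sqrt_iter.simps)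
    then show ?case unfolding eq .
  qed
  obtain z where z: "clim ?z z"
    using clim_dominated[OF _ convergent_scalar_sqrt_iter step] zc by blast
  have zA: "z \<in> carrier A" using z clim_carrier by blast
  have adj: "cadj A (?z n) = ?z n" for n
    by (induction n) (use x zc in \<open>auto simp: cadj_smult cadj_add cadj_mult\<close>)
  have adjz: "cadj A z = z"
    using clim_unique[OF clim_cadj[OF z]] adj z by simp
  have "clim (\<lambda>n. (1/2) \<odot> (x \<oplus> ?z n \<otimes> ?z n)) ((1/2) \<odot> (x \<oplus> z \<otimes> z))"
    by (intro clim_smult clim_add clim_mult clim_const z x)
  then have "clim (\<lambda>n. ?z (Suc n)) ((1/2) \<odot> (x \<oplus> z \<otimes> z))" by simp
  then have fix_pt: "z = (1/2) \<odot> (x \<oplus> z \<otimes> z)" using clim_unique[OF clim_Suc[OF z]] by blast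
  have "(\<one> \<ominus> z) \<otimes> (\<one> \<ominus> z) = \<one> \<ominus> 2 \<odot> z \<oplus> z \<otimes> z"
    using zA by (reify star_eqs, intro seqn_holdsI; simp)
  also have "\<dots> = \<one> \<ominus> 2 \<odot> ((1/2) \<odot> (x \<oplus> z \<otimes> z)) \<oplus> z \<otimes> z"
    using fix_pt by simp
  also have "\<dots> = \<one> \<ominus> x"
    using zA x(1) by (reify star_eqs, intro seqn_holdsI; simp)
  finally have sq: "(\<one> \<ominus> z) \<otimes> (\<one> \<ominus> z) = \<one> \<ominus> x" .
  have comm: "c \<otimes> z = z \<otimes> c" if c: "c \<in> carrier A" "c \<otimes> x = x \<otimes> c" for c
  proof -
    have "c \<otimes> ?z n = ?z n \<otimes> c" for n
    proof (induction n)
      case (Suc n)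
      have "c \<otimes> (?z n \<otimes> ?z n) = (c \<otimes> ?z n) \<otimes> ?z n"
        using c zc by (simp add: m_assoc)
      also have "\<dots> = (?z n \<otimes> ?z n) \<otimes> c"
        using c zc by (simp add: Suc m_assoc)
      finally show ?case
        using c x zc by (simp add: smult_mult_left smult_mult_right l_distr r_distr)
    qed (use c in simp)
    then show ?thesis
      using clim_unique[OF clim_mult[OF clim_const z, of c] ] clim_mult[OF z clim_const, of c] c
      by simp
  qed
  have "cnorm A z \<le> cnorm A x"
    using LIMSEQ_le_const2[OF clim_cnorm[OF z]] zx by blast
  then show thesis using that[OF zA adjz _ sq in_bicommutantI[OF comm]] by blast
qed

text \<open>For selfadjoint \<open>h\<close> the norm condition says that the spectrum lies in
  \<open>[0, 2 t]\<close>, so this is the usual positivity. Sums and nonnegative multiples follow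
  from the triangle inequality and scaling alone.\<close>

definition psd :: "'a \<Rightarrow> bool" where
  "psd h \<longleftrightarrow> h \<in> carrier A \<and> cadj A h = h \<and> (\<exists>t\<ge>0. cnorm A (of_real t \<odot> \<one> \<ominus> h) \<le> t)"

lemma psdD: "psd h \<Longrightarrow> h \<in> carrier A" "psd h \<Longrightarrow> cadj A h = h"
  by (auto simp: psd_def)

lemma psd_bound_mono:
  assumes "h \<in> carrier A" "cnorm A (of_real t \<odot> \<one> \<ominus> h) \<le> t" "t \<le> s"
  shows "cnorm A (of_real s \<odot> \<one> \<ominus> h) \<le> s"
proof -
  have "of_real s \<odot> \<one> \<ominus> h = (of_real t \<odot> \<one> \<ominus> h) \<oplus> of_real (s - t) \<odot> \<one>"
    using assms(1) by (reify star_eqs, intro seqn_holdsI; simp)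
  then show ?thesis
    using cnorm_add[of "of_real t \<odot> \<one> \<ominus> h" "of_real (s - t) \<odot> \<one>"] cnorm_smult_one_le[of "of_real (s - t)"]
      assms by (simp del: of_real_diff)
qed

lemma psd_obtain_pos:
  assumes "psd h" obtains t where "t > 0" "cnorm A (of_real t \<odot> \<one> \<ominus> h) \<le> t"
proof -
  obtain t where t: "t \<ge> 0" "cnorm A (of_real t \<odot> \<one> \<ominus> h) \<le> t"
    using assms by (auto simp: psd_def)
  then show thesis
    using psd_bound_mono[of h t "t + 1"] psdD[OF assms] that[of "t + 1"] by auto
qed

lemma psd_add: assumes "psd h" "psd k" shows "psd (h \<oplus> k)"
proof -
  note c = psdD[OF assms(1)] psdD[OF assms(2)]
  obtain s t where st: "s \<ge> 0" "cnorm A (of_real s \<odot> \<one> \<ominus> h) \<le> s" "t \<ge> 0" "cnorm A (of_real t \<odot> \<one> \<ominus> k) \<le> t"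
    using assms by (auto simp: psd_def)
  have "of_real (s + t) \<odot> \<one> \<ominus> (h \<oplus> k) = (of_real s \<odot> \<one> \<ominus> h) \<oplus> (of_real t \<odot> \<one> \<ominus> k)"
    using c by (reify star_eqs, intro seqn_holdsI; simp)
  then have "cnorm A (of_real (s + t) \<odot> \<one> \<ominus> (h \<oplus> k)) \<le> s + t"
    using cnorm_add[of "of_real s \<odot> \<one> \<ominus> h" "of_real t \<odot> \<one> \<ominus> k"] st c by simp
  then show ?thesis
    unfolding psd_def using c st by (intro conjI exI[of _ "s + t"]) (simp_all add: cadj_add)
qed

lemma psd_smult: assumes "psd h" "0 \<le> r" shows "psd (of_real r \<odot> h)"
proof -
  note c = psdD[OF assms(1)]
  obtain t where t: "t \<ge> 0" "cnorm A (of_real t \<odot> \<one> \<ominus> h) \<le> t"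
    using assms by (auto simp: psd_def)
  have "of_real (r * t) \<odot> \<one> \<ominus> of_real r \<odot> h = of_real r \<odot> (of_real t \<odot> \<one> \<ominus> h)"
    using c by (reify star_eqs, intro seqn_holdsI; simp)
  then have "cnorm A (of_real (r * t) \<odot> \<one> \<ominus> of_real r \<odot> h) \<le> r * t"
    using t assms(2) c by (simp add: cnorm_smult mult_left_mono)
  then show ?thesis
    unfolding psd_def using c t assms(2) by (intro conjI exI[of _ "r * t"]) (simp_all add: cadj_smult)
qed

lemma psd_zero: "psd \<zero>"
  unfolding psd_def by (auto simp: a_minus_def intro!: exI[of _ 0])

lemma psd_shift:
  assumes "k \<in> carrier A" "cadj A k = k" "cnorm A k \<le> t" shows "psd (of_real t \<odot> \<one> \<ominus> k)"
proof -
  have "of_real t \<odot> \<one> \<ominus> (of_real t \<odot> \<one> \<ominus> k) = k"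
    using assms(1) by (reify star_eqs, intro seqn_holdsI; simp)
  moreover have "t \<ge> 0" using assms cnorm_nonneg[of k] by linarith
  ultimately show ?thesis
    unfolding psd_def using assms by (auto simp: cadj_minus cadj_smult intro!: exI[of _ t])
qed

text \<open>\<open>h = t (1 - x)\<close> with \<open>||x|| \<le> 1\<close>, so the root is
  \<open>sqrt t\<close> times the root \<open>1 - z\<close> of \<open>1 - x\<close>. It is positive
  because \<open>z\<close> has norm at most 1.\<close>

lemma psd_sqrt:
  assumes "psd h"
  obtains y where "psd y" "y \<otimes> y = h"
    "in_bicommutant h y"
proof -
  note c = psdD[OF assms]
  obtain t where t: "t > 0" "cnorm A (of_real t \<odot> \<one> \<ominus> h) \<le> t"
    using psd_obtain_pos[OF assms] .
  define x where "x = of_real (1 / t) \<odot> (of_real t \<odot> \<one> \<ominus> h)"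
  have x: "x \<in> carrier A" "cadj A x = x" "cnorm A x \<le> 1"
    using c t by (simp_all add: x_def cadj_smult cadj_minus cnorm_smult norm_divide)
  obtain z where z: "z \<in> carrier A" "cadj A z = z" "cnorm A z \<le> cnorm A x"
    "(\<one> \<ominus> z) \<otimes> (\<one> \<ominus> z) = \<one> \<ominus> x"
    "in_bicommutant x z"
    using sqrt_one_minus[OF x] by blast
  define y where "y = of_real (sqrt t) \<odot> (\<one> \<ominus> z)"
  have "psd (of_real 1 \<odot> \<one> \<ominus> z)"
    using z x by (intro psd_shift) auto
  then have "psd y"
    unfolding y_def using t by (intro psd_smult) auto
  have r: "of_real (sqrt t) * of_real (sqrt t) = (of_real t :: complex)"
    using t by (simp flip: of_real_mult)
  have "y \<otimes> y = (of_real (sqrt t) * of_real (sqrt t)) \<odot> ((\<one> \<ominus> z) \<otimes> (\<one> \<ominus> z))"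
    unfolding y_def using z(1) by (simp add: smult_mult_left smult_mult_right smult_smult)
  also have "\<dots> = of_real t \<odot> (\<one> \<ominus> x)"
    unfolding r z(4) ..
  also have "\<dots> = h"
    unfolding x_def using c t by (reify star_eqs, intro seqn_holdsI; simp)
  finally have sq: "y \<otimes> y = h" .
  have "d \<otimes> y = y \<otimes> d" if d: "d \<in> carrier A" "d \<otimes> h = h \<otimes> d" for d
  proof -
    have "d \<otimes> x = of_real (1 / t) \<odot> (of_real t \<odot> d \<ominus> d \<otimes> h)"
      unfolding x_def using c(1) d(1) by (reify star_eqs, intro seqn_holdsI; simp)
    also have "\<dots> = x \<otimes> d"
      unfolding x_def d(2) using c(1) d(1) by (reify star_eqs, intro seqn_holdsI; simp)
    finally have "d \<otimes> z = z \<otimes> d" using in_bicommutantD[OF z(5)] d by blast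
    then show ?thesis
      unfolding y_def using z(1) d(1)
      by (simp add: smult_mult_left smult_mult_right a_minus_def l_distr r_distr l_minus r_minus)
  qed
  then show thesis using that[OF \<open>psd y\<close> sq in_bicommutantI] by blast
qed

text \<open>\<open>u = y + i w\<close> satisfies \<open>u^* u = 1\<close>, and \<open>y\<close>,
  \<open>w\<close> are its real and imaginary parts.\<close>

lemma cnorm_le_one_of_squares:
  assumes "y \<in> carrier A" "cadj A y = y" "w \<in> carrier A" "cadj A w = w" "y \<otimes> w = w \<otimes> y"
    and sum: "y \<otimes> y \<oplus> w \<otimes> w = \<one>"
  shows "cnorm A y \<le> 1" "cnorm A w \<le> 1"
proof -
  define u where "u = y \<oplus> \<i> \<odot> w"
  have u: "u \<in> carrier A" "cadj A u = y \<ominus> \<i> \<odot> w"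
    using assms by (simp_all add: u_def cadj_add cadj_smult neg_smult a_minus_def)
  have "cadj A u \<otimes> u = (y \<otimes> y \<oplus> w \<otimes> w) \<oplus> \<i> \<odot> (y \<otimes> w \<ominus> w \<otimes> y)"
    unfolding u(2) unfolding u_def using assms(1,3) by (reify star_eqs, intro seqn_holdsI; simp)
  also have "\<dots> = \<one>" using assms by (simp add: a_minus_def r_neg)
  finally have "cnorm A u \<le> 1"
    using cnorm_cadj_mult[OF u(1)] cnorm_one_le power2_le_imp_le[of "cnorm A u" 1] by simp
  then have v: "cnorm A (cadj A u) \<le> 1" using u(1) by simp
  have "y = (1/2) \<odot> (u \<oplus> cadj A u)"
    unfolding u(2) unfolding u_def using assms(1,3) by (reify star_eqs, intro seqn_holdsI; simp)
  then have "cnorm A y \<le> (cnorm A u + cnorm A (cadj A u)) / 2"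
    using cnorm_add[of u "cadj A u"] u(1) by (simp add: cnorm_smult norm_divide)
  also have "\<dots> \<le> (1 + 1) / 2" using \<open>cnorm A u \<le> 1\<close> v by (intro divide_right_mono add_mono) auto
  finally show "cnorm A y \<le> 1" by simp
  have "w = (1/(2*\<i>)) \<odot> (u \<ominus> cadj A u)"
    unfolding u(2) unfolding u_def using assms(1,3)
    by (reify star_eqs, intro seqn_holdsI; simp add: field_simps)
  then have "cnorm A w \<le> (cnorm A u + cnorm A (cadj A u)) / 2"
    using cnorm_minus[of u "cadj A u"] u(1) by (simp add: cnorm_smult norm_divide norm_mult)
  also have "\<dots> \<le> (1 + 1) / 2" using \<open>cnorm A u \<le> 1\<close> v by (intro divide_right_mono add_mono) auto
  finally show "cnorm A w \<le> 1" by simp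
qed

text \<open>For a multiple \<open>v\<close> of \<open>y\<close> of norm at most 1 let
  \<open>1 - z\<close> be a root of \<open>1 - v^2\<close>. The squares of \<open>v\<close> and
  \<open>1 - z\<close> add up to 1 and the two commute, so \<open>1 - v^2\<close> has norm at most
  1, which is positivity of \<open>v^2\<close> with \<open>t = 1\<close>.\<close>

lemma psd_square: assumes y: "y \<in> carrier A" "cadj A y = y" shows "psd (y \<otimes> y)"
proof -
  \<comment> \<open>The summand 1 keeps the scale positive when \<open>y = 0\<close>.\<close>
  define r where "r = cnorm A y + 1"
  have r: "r > 0" using cnorm_nonneg[OF y(1)] by (simp add: r_def)
  define v where "v = of_real (1 / r) \<odot> y"
  have v: "v \<in> carrier A" "cadj A v = v" using y by (simp_all add: v_def cadj_smult)
  have "cnorm A v \<le> 1" using y r by (simp add: v_def cnorm_smult norm_divide) (simp add: r_def)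
  then have vv: "cnorm A (v \<otimes> v) \<le> 1"
    using cnorm_mult[OF v(1) v(1)] v mult_le_one[of "cnorm A v" "cnorm A v"] by simp
  have v2: "v \<otimes> v \<in> carrier A" "cadj A (v \<otimes> v) = v \<otimes> v"
    using v by (simp_all add: cadj_mult)
  obtain z where z: "z \<in> carrier A" "cadj A z = z"
    "(\<one> \<ominus> z) \<otimes> (\<one> \<ominus> z) = \<one> \<ominus> v \<otimes> v"
    "in_bicommutant (v \<otimes> v) z"
    using sqrt_one_minus[OF v2 vv] by blast
  have "v \<otimes> z = z \<otimes> v" using in_bicommutantD[OF z(4), of v] v(1) by (simp add: m_assoc)
  then have comm: "v \<otimes> (\<one> \<ominus> z) = (\<one> \<ominus> z) \<otimes> v"
    using v(1) z(1) by (simp add: a_minus_def l_distr r_distr l_minus r_minus)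
  have "v \<otimes> v \<oplus> (\<one> \<ominus> z) \<otimes> (\<one> \<ominus> z) = \<one>"
    unfolding z(3) using v(1) by (reify star_eqs, intro seqn_holdsI; simp)
  then have w: "cnorm A (\<one> \<ominus> z) \<le> 1"
    using cnorm_le_one_of_squares(2)[OF v _ _ comm] z by (simp add: cadj_minus)
  have "cnorm A (\<one> \<ominus> v \<otimes> v) \<le> 1"
    using cnorm_mult[of "\<one> \<ominus> z" "\<one> \<ominus> z"] z w mult_le_one[OF w _ w] by simp
  then have p: "psd (v \<otimes> v)"
    unfolding psd_def using v2 by (auto intro!: exI[of _ 1])
  have "of_real (r * r) \<odot> (v \<otimes> v) = y \<otimes> y"
    unfolding v_def using y(1) r by (reify star_eqs, intro seqn_holdsI; simp)
  then show ?thesis using psd_smult[OF p, of "r * r"] r by simp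
qed

lemma square_eq_zero: "\<lbrakk>x \<in> carrier A; cadj A x = x; x \<otimes> x = \<zero>\<rbrakk> \<Longrightarrow> x = \<zero>"
  using cadj_mult_eq_zero[of x] by simp

text \<open>Roots \<open>y\<close> of \<open>h\<close> and \<open>w\<close> of \<open>- h\<close>
  commute, so \<open>v = y + i w\<close> satisfies \<open>v^* v = h - h = 0\<close>. Hence
  \<open>v\<close> vanishes, and with it its real part \<open>y\<close>.\<close>

lemma psd_antisym: assumes "psd h" "psd (\<ominus> h)" shows "h = \<zero>"
proof -
  have h: "h \<in> carrier A" using psdD assms by blast
  obtain y where y: "psd y" "y \<otimes> y = h" "in_bicommutant h y"
    using psd_sqrt[OF assms(1)] by blast
  obtain w where w: "psd w" "w \<otimes> w = \<ominus> h" "in_bicommutant (\<ominus> h) w"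
    using psd_sqrt[OF assms(2)] by blast
  note c = psdD[OF y(1)] psdD[OF w(1)]
  have "h \<otimes> w = w \<otimes> h" using in_bicommutantD[OF w(3), of h] h by (simp add: l_minus r_minus)
  then have yw: "w \<otimes> y = y \<otimes> w" using in_bicommutantD[OF y(3), of w] c(3) by simp
  define v where "v = y \<oplus> \<i> \<odot> w"
  have v: "v \<in> carrier A" "cadj A v = y \<ominus> \<i> \<odot> w"
    using c by (simp_all add: v_def cadj_add cadj_smult neg_smult a_minus_def)
  have "cadj A v \<otimes> v = (y \<otimes> y \<oplus> w \<otimes> w) \<oplus> \<i> \<odot> (y \<otimes> w \<ominus> w \<otimes> y)"
    unfolding v(2) unfolding v_def using c by (reify star_eqs, intro seqn_holdsI; simp)
  also have "\<dots> = \<zero>" using c h by (simp add: a_minus_def r_neg yw y(2) w(2))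
  finally have v0: "v = \<zero>" using cadj_mult_eq_zero v by blast
  have "y = (1/2) \<odot> (v \<oplus> cadj A v)"
    unfolding v(2) unfolding v_def using c by (reify star_eqs, intro seqn_holdsI; simp)
  then have "y = \<zero>" unfolding v0 by simp
  then show ?thesis using y(2) by simp
qed

text \<open>With \<open>k = h / t\<close>, the roots of \<open>k\<close> and \<open>1 - k\<close>
  commute and their squares add up to 1. Hence the root of \<open>k\<close> is a contraction, and so
  is \<open>k\<close>.\<close>

lemma cnorm_le_of_psd_diff:
  assumes h: "psd h" and "psd (of_real t \<odot> \<one> \<ominus> h)" "t > 0"
  shows "cnorm A h \<le> t"
proof -
  note c = psdD[OF h]
  define k where "k = of_real (1/t) \<odot> h"
  have k: "psd k" unfolding k_def using h assms(3) by (intro psd_smult) auto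
  note kc = psdD[OF k]
  have "of_real (1/t) \<odot> (of_real t \<odot> \<one> \<ominus> h) = \<one> \<ominus> k"
    unfolding k_def using c assms(3) by (reify star_eqs, intro seqn_holdsI; simp)
  then have k': "psd (\<one> \<ominus> k)" using psd_smult[OF assms(2), of "1/t"] assms(3) by simp
  obtain y where y: "psd y" "y \<otimes> y = k" "in_bicommutant k y"
    using psd_sqrt[OF k] by blast
  obtain w where w: "psd w" "w \<otimes> w = \<one> \<ominus> k"
    "in_bicommutant (\<one> \<ominus> k) w"
    using psd_sqrt[OF k'] by blast
  have "k \<otimes> (\<one> \<ominus> k) = (\<one> \<ominus> k) \<otimes> k"
    using kc(1) by (reify star_eqs, intro seqn_holdsI; simp)
  then have "w \<otimes> y = y \<otimes> w"
    using in_bicommutantD[OF y(3), of w] in_bicommutantD[OF w(3), of k] kc(1) psdD(1)[OF w(1)] by simp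
  moreover have "y \<otimes> y \<oplus> w \<otimes> w = \<one>"
    unfolding y(2) w(2) using kc(1) by (reify star_eqs, intro seqn_holdsI; simp)
  ultimately have "cnorm A y \<le> 1"
    using cnorm_le_one_of_squares(1)[of y w] psdD[OF w(1)] psdD[OF y(1)] by simp
  then have "cnorm A k \<le> 1"
    using cnorm_mult[of y y] y(2) mult_le_one[of "cnorm A y" "cnorm A y"] psdD[OF y(1)] by simp
  then show ?thesis using c assms(3) by (simp add: k_def cnorm_smult norm_divide divide_le_eq)
qed

text \<open>Both elements lie below the scalar \<open>||k|| + e\<close>, which therefore bounds the
  norm of \<open>h\<close>. The \<open>e\<close> keeps this scalar positive when
  \<open>k = 0\<close>.\<close>

lemma psd_cnorm_mono:
  assumes "psd h" "psd (k \<ominus> h)" "k \<in> carrier A"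
  shows "cnorm A h \<le> cnorm A k"
proof (rule field_le_epsilon)
  fix e :: real assume "e > 0"
  have h: "h \<in> carrier A" "cadj A h = h" using psdD assms by blast+
  have k: "k = (k \<ominus> h) \<oplus> h" using h(1) assms(3) by (reify star_eqs, intro seqn_holdsI; simp)
  have "psd k" by (subst k) (intro psd_add assms)
  then have "psd (of_real (cnorm A k + e) \<odot> \<one> \<ominus> k)"
    using psdD[of k] \<open>e > 0\<close> by (intro psd_shift) auto
  from psd_add[OF this assms(2)]
  have "psd ((of_real (cnorm A k + e) \<odot> \<one> \<ominus> k) \<oplus> (k \<ominus> h))" .
  also have "(of_real (cnorm A k + e) \<odot> \<one> \<ominus> k) \<oplus> (k \<ominus> h) = of_real (cnorm A k + e) \<odot> \<one> \<ominus> h"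
    using h(1) assms(3) by (reify star_eqs, intro seqn_holdsI; simp)
  finally show "cnorm A h \<le> cnorm A k + e"
    using cnorm_le_of_psd_diff[OF assms(1)] cnorm_nonneg[OF assms(3)] \<open>e > 0\<close> by simp
qed


text \<open>The C*-identity for selfadjoint elements, iterated. It is the fragment of the spectral
  radius formula on which the comparison of powers below relies.\<close>

lemma pow_cnorm_selfadjoint:
  assumes "x \<in> carrier A" "cadj A x = x"
  shows "cnorm A (x [^] (2 ^ n :: nat)) = cnorm A x ^ (2 ^ n)" "cadj A (x [^] (2 ^ n :: nat)) = x [^] (2 ^ n :: nat)"
proof (induction n)
  case 0
  { case 1 show ?case using assms by simp }
  { case 2 show ?case using assms by simp }
next
  case (Suc n)
  have sq: "x [^] (2 ^ Suc n :: nat) = x [^] (2 ^ n :: nat) \<otimes> x [^] (2 ^ n :: nat)"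
    using assms nat_pow_mult[of x "2 ^ n" "2 ^ n"] by (simp add: mult_2)
  { case 1 show ?case
      using cnorm_cadj_mult[of "x [^] (2 ^ n :: nat)"] assms unfolding sq
      by (simp add: Suc power_even_eq) }
  { case 2 show ?case unfolding sq using assms by (simp add: Suc cadj_mult) }
qed

text \<open>\<open>c\<^sup>* c\<close> and \<open>c c\<^sup>*\<close> have essentially the same powers; comparing the norms of large
  powers of \<open>t - c\<^sup>* c\<close> and \<open>t - c c\<^sup>*\<close> replaces the usual comparison of spectra.\<close>

lemma psd_swap:
  assumes c: "c \<in> carrier A" and p: "psd (c \<otimes> cadj A c)"
  shows "psd (cadj A c \<otimes> c)"
proof -
  let ?X = "cadj A c \<otimes> c" and ?Y = "c \<otimes> cadj A c"
  obtain t where t: "t > 0" "cnorm A (of_real t \<odot> \<one> \<ominus> ?Y) \<le> t"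
    using psd_obtain_pos[OF p] .
  let ?H = "of_real t \<odot> \<one> \<ominus> ?X" and ?K = "of_real t \<odot> \<one> \<ominus> ?Y"
  have H: "?H \<in> carrier A" "cadj A ?H = ?H" and K: "?K \<in> carrier A"
    using c by (simp_all add: cadj_minus cadj_smult cadj_mult)
  have inter: "?H \<otimes> cadj A c = cadj A c \<otimes> ?K"
    using c by (reify star_eqs, intro seqn_holdsI; simp)
  have pow_inter: "?H [^] (n::nat) \<otimes> cadj A c = cadj A c \<otimes> ?K [^] n" for n
  proof (induction n)
    case (Suc n)
    have "?H [^] (Suc n) \<otimes> cadj A c = ?H [^] n \<otimes> (?H \<otimes> cadj A c)"
      using H c by (simp add: m_assoc)
    also have "\<dots> = (?H [^] n \<otimes> cadj A c) \<otimes> ?K"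
      unfolding inter using H(1) K c nat_pow_closed[OF H(1), of n] by (simp add: m_assoc del: minus_closed)
    also have "\<dots> = cadj A c \<otimes> ?K [^] (Suc n)"
      unfolding Suc using K c nat_pow_closed[OF K, of n] by (simp add: m_assoc)
    finally show ?case .
  qed (use c in simp)
  have powK: "cnorm A (?K [^] (n::nat)) \<le> t ^ n" for n
  proof (induction n)
    case (Suc n)
    have "cnorm A (?K [^] (Suc n)) \<le> cnorm A (?K [^] n) * cnorm A ?K"
      using cnorm_mult[OF nat_pow_closed[OF K] K, of n] by simp
    also have "\<dots> \<le> t ^ n * t"
      using Suc t K nat_pow_closed[OF K, of n] by (intro mult_mono) auto
    finally show ?case by (simp add: mult.commute)
  qed simp
  \<comment> \<open>\<open>H^(n+1) = t H^n - c^* K^n c\<close>: each step adds a term of norm at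
    most \<open>||c||^2 t^n\<close>, so the growth beyond \<open>t^n\<close> is only linear in
    \<open>n\<close>.\<close>
  have powH: "cnorm A (?H [^] (n::nat)) \<le> t ^ n * (1 + n * ((cnorm A c)\<^sup>2 / t))" for n
  proof (induction n)
    case (Suc n)
    let ?P = "?H [^] n" and ?Q = "?K [^] n"
    have PQ: "?P \<in> carrier A" "?Q \<in> carrier A" using H(1) K by blast+
    have "?H [^] (Suc n) = ?P \<otimes> ?H" by simp
    also have "\<dots> = of_real t \<odot> ?P \<ominus> (?P \<otimes> cadj A c) \<otimes> c"
    proof -
      have "q \<otimes> (of_real t \<odot> \<one> \<ominus> cadj A c \<otimes> c) = of_real t \<odot> q \<ominus> (q \<otimes> cadj A c) \<otimes> c"
        if "q \<in> carrier A" for q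
        using that c by (reify star_eqs, intro seqn_holdsI; simp)
      then show ?thesis using PQ by blast
    qed
    also have "\<dots> = of_real t \<odot> ?P \<ominus> cadj A c \<otimes> ?Q \<otimes> c" unfolding pow_inter ..
    finally have "cnorm A (?H [^] (Suc n)) \<le> cnorm A (of_real t \<odot> ?P) + cnorm A (cadj A c \<otimes> ?Q \<otimes> c)"
      using cnorm_minus[of "of_real t \<odot> ?P" "cadj A c \<otimes> ?Q \<otimes> c"] PQ c
      by (simp del: nat_pow_Suc)
    also have "\<dots> \<le> t * (t ^ n * (1 + n * ((cnorm A c)\<^sup>2 / t))) + cnorm A c * t ^ n * cnorm A c"
    proof (rule add_mono)
      show "cnorm A (of_real t \<odot> ?P) \<le> t * (t ^ n * (1 + n * ((cnorm A c)\<^sup>2 / t)))"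
        using Suc t PQ by (simp add: cnorm_smult)
      have "cnorm A (cadj A c \<otimes> ?Q \<otimes> c) \<le> cnorm A (cadj A c \<otimes> ?Q) * cnorm A c"
        using PQ c by (intro cnorm_mult) auto
      also have "\<dots> \<le> (cnorm A c * cnorm A ?Q) * cnorm A c"
        using cnorm_mult[of "cadj A c" ?Q] PQ c by (intro mult_right_mono) auto
      also have "\<dots> \<le> cnorm A c * t ^ n * cnorm A c"
        using powK[of n] c by (intro mult_right_mono mult_left_mono) auto
      finally show "cnorm A (cadj A c \<otimes> ?Q \<otimes> c) \<le> cnorm A c * t ^ n * cnorm A c" .
    qed
    also have "\<dots> = t ^ Suc n * (1 + Suc n * ((cnorm A c)\<^sup>2 / t))"
      using t by (simp add: field_simps power2_eq_square)
    finally show ?case .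
  qed simp
  have "cnorm A ?H \<le> t"
  proof (rule ccontr)
    assume "\<not> cnorm A ?H \<le> t"
    \<comment> \<open>Along powers of two the norm of \<open>H\<close> is multiplicative, so a norm
      above \<open>t\<close> would make powers of the ratio \<open>q > 1\<close> stay below a linear
      function of the exponent.\<close>
    define q where "q = cnorm A ?H / t"
    have q: "q > 1" using \<open>\<not> cnorm A ?H \<le> t\<close> t by (simp add: q_def)
    define K where "K = (cnorm A c)\<^sup>2 / t"
    have bound: "q ^ (2 ^ n) \<le> 1 + real (2 ^ n) * K" for n :: nat
    proof -
      have "cnorm A ?H ^ (2 ^ n) \<le> t ^ (2 ^ n) * (1 + real (2 ^ n) * K)"
        using powH[of "2 ^ n"] pow_cnorm_selfadjoint(1)[OF H, of n] by (simp add: K_def)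
      then show ?thesis using t by (simp add: q_def power_divide divide_le_eq mult.commute)
    qed
    have "(\<lambda>m::nat. (1 + real m * K) / q ^ m) \<longlonglongrightarrow> 0"
      using q by real_asymp
    then have "(\<lambda>n::nat. (1 + real (2 ^ n) * K) / q ^ (2 ^ n)) \<longlonglongrightarrow> 0"
      using LIMSEQ_subseq_LIMSEQ[of "\<lambda>m. (1 + real m * K) / q ^ m" 0 "\<lambda>n. 2 ^ n"]
      by (simp add: strict_mono_def o_def)
    moreover have "1 \<le> (1 + real (2 ^ n) * K) / q ^ (2 ^ n)" for n :: nat
      using bound[of n] q by (simp add: le_divide_eq)
    ultimately have "(1::real) \<le> 0" using LIMSEQ_le_const by blast
    then show False by simp
  qed
  then show ?thesis
    unfolding psd_def using c t by (auto simp: cadj_mult intro!: exI[of _ t])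
qed

text \<open>With \<open>x = a\<^sup>* a\<close> and \<open>p = |x|\<close>, the element \<open>c = a (|x| - x)\<close> satisfies
  \<open>c\<^sup>* c = - |x| (|x| - x)\<^sup>2 \<le> 0\<close>, which forces \<open>c\<^sup>* c = 0\<close> and hence \<open>|x| = x\<close>.\<close>

theorem psd_cadj_mult: assumes a: "a \<in> carrier A" shows "psd (cadj A a \<otimes> a)"
proof -
  define x where "x = cadj A a \<otimes> a"
  have x: "x \<in> carrier A" "cadj A x = x" using a by (simp_all add: x_def cadj_mult)
  obtain p where p: "psd p" "p \<otimes> p = x \<otimes> x"
    and pc: "in_bicommutant (x \<otimes> x) p"
    using psd_sqrt[OF psd_square[OF x]] by blast
  note pp = psdD[OF p(1)]
  have xp: "x \<otimes> p = p \<otimes> x" using in_bicommutantD[OF pc, of x] x(1) by (simp add: m_assoc)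
  obtain y where y: "psd y" "y \<otimes> y = p"
    and yc: "in_bicommutant p y"
    using psd_sqrt[OF p(1)] by blast
  note yy = psdD[OF y(1)]
  define d where "d = p \<ominus> x"
  have d: "d \<in> carrier A" "cadj A d = d" using x pp by (simp_all add: d_def cadj_minus)
  have "d \<otimes> p = p \<otimes> d"
    unfolding d_def using x(1) pp(1) xp by (simp add: a_minus_def l_distr r_distr l_minus r_minus)
  then have dy: "d \<otimes> y = y \<otimes> d" using in_bicommutantD[OF yc] d by blast
  have xd: "x \<otimes> d = \<ominus> (p \<otimes> d)"
    unfolding d_def using x(1) pp(1) p(2) xp
    by (simp add: a_minus_def r_distr r_minus minus_add a_comm)
  define c where "c = a \<otimes> d"
  have c: "c \<in> carrier A" using a d by (simp add: c_def)
  have yd: "y \<otimes> d \<in> carrier A" "cadj A (y \<otimes> d) = y \<otimes> d"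
    using d yy dy by (simp_all add: cadj_mult)
  have "cadj A c \<otimes> c = d \<otimes> (x \<otimes> d)"
    using a d by (simp add: c_def cadj_mult x_def m_assoc)
  also have "\<dots> = \<ominus> (d \<otimes> y \<otimes> (y \<otimes> d))"
    unfolding xd using d yy pp by (simp add: r_minus m_assoc flip: y(2))
  also have "\<dots> = \<ominus> ((y \<otimes> d) \<otimes> (y \<otimes> d))" unfolding dy ..
  finally have cc: "cadj A c \<otimes> c = \<ominus> ((y \<otimes> d) \<otimes> (y \<otimes> d))" .
  then have neg: "psd (\<ominus> (cadj A c \<otimes> c))" using psd_square[OF yd] yd by simp
  \<comment> \<open>The real and imaginary parts \<open>h\<close>, \<open>k\<close> of
    \<open>c\<close> satisfy \<open>c c^* + c^* c = 2 h^2 + 2 k^2\<close>. As \<open>- c^* c\<close>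
    is already positive, so is \<open>c c^*\<close>, and exchanging the factors makes
    \<open>c^* c\<close> positive as well.\<close>
  define h where "h = (1/2) \<odot> (c \<oplus> cadj A c)"
  define k where "k = (1/(2*\<i>)) \<odot> (c \<ominus> cadj A c)"
  have hk: "h \<in> carrier A" "k \<in> carrier A" using c by (simp_all add: h_def k_def)
  have h: "cadj A h = h"
    unfolding h_def using c by (reify star_eqs, intro seqn_holdsI; simp)
  have k: "cadj A k = k"
    unfolding k_def using c by (reify star_eqs, intro seqn_holdsI; simp)
  have "c \<otimes> cadj A c = (of_real 2 \<odot> (h \<otimes> h) \<oplus> of_real 2 \<odot> (k \<otimes> k)) \<oplus> \<ominus> (cadj A c \<otimes> c)"
    unfolding h_def k_def using c by (reify star_eqs, intro seqn_holdsI; simp add: field_simps)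
  moreover have "psd \<dots>"
    by (intro psd_add psd_smult psd_square h k hk neg) auto
  ultimately have "psd (cadj A c \<otimes> c)" using psd_swap[OF c] by simp
  then have "cadj A c \<otimes> c = \<zero>" using psd_antisym neg by blast
  then have "(y \<otimes> d) \<otimes> (y \<otimes> d) = \<zero>" using cc yd by (metis m_closed minus_minus minus_zero)
  then have "y \<otimes> d = \<zero>" using square_eq_zero yd by blast
  then have pd: "p \<otimes> d = \<zero>" using yy d by (simp add: m_assoc flip: y(2))
  \<comment> \<open>\<open>d^2 = p d - x d = 2 p d\<close>, because
    \<open>x d = - p d\<close>.\<close>
  have "d \<otimes> d = p \<otimes> d \<ominus> x \<otimes> d"
    unfolding d_def using x(1) pp(1) by (reify star_eqs, intro seqn_holdsI; simp)
  also have "\<dots> = \<zero>" using xd pd by (simp add: a_minus_def)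
  finally have "d = \<zero>" using square_eq_zero d by blast
  then have "x = p" using x pp by (simp add: d_def minus_eq_zero_iff)
  then show ?thesis using p(1) by (simp add: x_def)
qed

lemma psd_mult_cadj: "a \<in> carrier A \<Longrightarrow> psd (a \<otimes> cadj A a)"
  using psd_cadj_mult[of "cadj A a"] by simp

lemma psd_conj:
  assumes "psd h" "a \<in> carrier A" shows "psd (cadj A a \<otimes> h \<otimes> a)"
proof -
  obtain y where y: "psd y" "y \<otimes> y = h" using psd_sqrt[OF assms(1)] by blast
  then have "cadj A a \<otimes> h \<otimes> a = cadj A (y \<otimes> a) \<otimes> (y \<otimes> a)"
    using assms(2) psdD[OF y(1)] by (simp add: cadj_mult m_assoc flip: y(2))
  then show ?thesis using psd_cadj_mult[of "y \<otimes> a"] assms(2) psdD[OF y(1)] by simp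
qed

lemma psd_finsum: "\<lbrakk>finite I; \<And>i. i \<in> I \<Longrightarrow> psd (f i)\<rbrakk> \<Longrightarrow> psd (\<Oplus>i\<in>I. f i)"
proof (induction I rule: finite_induct)
  case (insert i I)
  then have "f \<in> I \<rightarrow> carrier A" "f i \<in> carrier A" using psdD by blast+
  with insert show ?case by (simp add: psd_add)
qed (simp add: psd_zero)

text \<open>The other summands are positive, so dropping them does not increase the norm. This is
  what passes from a sum of elements \<open>y y^*\<close> that tends to zero to its
  summands.\<close>

lemma cnorm_le_sum_mult_cadj:
  assumes "finite I" "j \<in> I" "\<And>i. i \<in> I \<Longrightarrow> a i \<in> carrier A"
  shows "(cnorm A (a j))\<^sup>2 \<le> cnorm A (\<Oplus>i\<in>I. a i \<otimes> cadj A (a i))"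
proof -
  let ?f = "\<lambda>i. a i \<otimes> cadj A (a i)"
  have c: "?f \<in> I - {j} \<rightarrow> carrier A" "?f \<in> I \<rightarrow> carrier A" "?f j \<in> carrier A"
    using assms by auto
  have "(\<Oplus>i\<in>I. ?f i) = ?f j \<oplus> (\<Oplus>i\<in>I-{j}. ?f i)"
    using finsum_insert[of "I - {j}" j ?f] c assms by (simp add: insert_absorb)
  then have "(\<Oplus>i\<in>I. ?f i) \<ominus> ?f j = (\<Oplus>i\<in>I-{j}. ?f i)"
    using c finsum_closed[OF c(1)] by (simp add: add_minus_cancel_left)
  moreover have "psd (\<Oplus>i\<in>I-{j}. ?f i)"
    using assms by (intro psd_finsum psd_mult_cadj) auto
  ultimately have "cnorm A (?f j) \<le> cnorm A (\<Oplus>i\<in>I. ?f i)"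
    using assms finsum_closed[OF c(2)] by (intro psd_cnorm_mono psd_mult_cadj) auto
  then show ?thesis using assms by (simp add: cnorm_mult_cadj)
qed

text \<open>\<open>r\<close> is the geometric series of \<open>z\<close>, where
  \<open>(1 - z)^2 = 1 - x\<close>. The final estimate is
  \<open>||r - 1|| \<le> ||x|| / (1 - ||x||)\<close> without the division; it comes from
  \<open>r - 1 = z + z (r - 1)\<close>.\<close>

lemma inverse_sqrt_one_minus:
  assumes x: "x \<in> carrier A" "cadj A x = x" and lt: "cnorm A x < 1"
  obtains r where "r \<in> carrier A" "cadj A r = r" "r \<otimes> (\<one> \<ominus> x) \<otimes> r = \<one>"
    "in_bicommutant x r"
    "cnorm A (r \<ominus> \<one>) * (1 - cnorm A x) \<le> cnorm A x"
proof -
  obtain z where z: "z \<in> carrier A" "cadj A z = z" "cnorm A z \<le> cnorm A x"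
    "(\<one> \<ominus> z) \<otimes> (\<one> \<ominus> z) = \<one> \<ominus> x"
    "in_bicommutant x z"
    using sqrt_one_minus[OF x] lt by (auto simp: less_imp_le)
  define f where "f n = (\<Oplus>k\<in>{..<n}. z [^] k)" for n :: nat
  have zk: "(\<lambda>k::nat. z [^] k) \<in> I \<rightarrow> carrier A" for I using z by auto
  have f: "f n \<in> carrier A" for n unfolding f_def using zk by (intro finsum_closed)
  have fSuc: "f (Suc n) = f n \<oplus> z [^] n" for n
    unfolding f_def using finsum_insert[of "{..<n}" n "\<lambda>k. z [^] k"] zk z(1)
    by (simp add: lessThan_Suc a_comm f[unfolded f_def])
  have zn: "cnorm A (z [^] (n::nat)) \<le> cnorm A x ^ n" for n
  proof (induction n)
    case (Suc n)
    have "cnorm A (z [^] Suc n) \<le> cnorm A (z [^] n) * cnorm A z"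
      using cnorm_mult[of "z [^] n" z] z by simp
    also have "\<dots> \<le> cnorm A x ^ n * cnorm A x"
      using Suc z x by (intro mult_mono) auto
    finally show ?case by (simp add: mult.commute)
  qed simp
  have "\<exists>r. clim f r"
  proof (rule clim_dominated)
    show "convergent (\<lambda>n. \<Sum>k<n. cnorm A x ^ k)"
      using lt x summable_iff_convergent[of "\<lambda>k. cnorm A x ^ k"] by (simp add: summable_geometric)
    have "f (Suc n) \<ominus> f n = z [^] n" for n
      unfolding fSuc using f[of n] z(1) by (simp add: add_minus_cancel_left)
    then show "cnorm A (f (Suc n) \<ominus> f n) \<le> (\<Sum>k<Suc n. cnorm A x ^ k) - (\<Sum>k<n. cnorm A x ^ k)" for n
      using zn by simp
  qed (use f in auto)
  then obtain r where r: "clim f r" by blast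
  have rA: "r \<in> carrier A" using r clim_carrier by blast
  have "f (Suc n) = \<one> \<oplus> z \<otimes> f n" for n
  proof (induction n)
    case 0
    show ?case using fSuc[of 0] z by (simp add: f_def)
  next
    case (Suc n)
    have "z \<otimes> z [^] n = z [^] Suc n" using z(1) nat_pow_Suc2 by simp
    then have "f (Suc (Suc n)) = \<one> \<oplus> z \<otimes> f n \<oplus> z \<otimes> z [^] n"
      using fSuc[of "Suc n"] Suc by (simp only:)
    then show ?case
      using z(1) f[of n] by (simp add: r_distr a_assoc fSuc[of n] del: nat_pow_Suc)
  qed
  moreover have "clim (\<lambda>n. \<one> \<oplus> z \<otimes> f n) (\<one> \<oplus> z \<otimes> r)"
    by (intro clim_add clim_mult clim_const r z) simp
  ultimately have "clim (\<lambda>n. f (Suc n)) (\<one> \<oplus> z \<otimes> r)" by (simp only:)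
  then have fixr: "r = \<one> \<oplus> z \<otimes> r" using clim_unique[OF clim_Suc[OF r]] by blast
  let ?y = "\<one> \<ominus> z"
  have y: "?y \<in> carrier A" "cadj A ?y = ?y" using z by (simp_all add: cadj_minus)
  have "?y \<otimes> r = r \<ominus> z \<otimes> r" using z(1) rA by (reify star_eqs, intro seqn_holdsI; simp)
  also have "\<dots> = (\<one> \<oplus> z \<otimes> r) \<ominus> z \<otimes> r" using fixr by simp
  also have "\<dots> = \<one>" using z(1) rA by (reify star_eqs, intro seqn_holdsI; simp)
  finally have yr: "?y \<otimes> r = \<one>" .
  then have ry': "cadj A r \<otimes> ?y = \<one>" using cadj_mult[of ?y r] y rA by simp
  have "cadj A r = cadj A r \<otimes> (?y \<otimes> r)" using yr rA by simp
  also have "\<dots> = r" using ry' rA y by (simp flip: m_assoc)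
  finally have adj: "cadj A r = r" .
  then have ry: "r \<otimes> ?y = \<one>" using ry' by simp
  have main: "r \<otimes> (\<one> \<ominus> x) \<otimes> r = \<one>"
  proof -
    have "r \<otimes> (?y \<otimes> ?y) \<otimes> r = (r \<otimes> ?y) \<otimes> (?y \<otimes> r)" using rA y(1) by (simp add: m_assoc)
    then show ?thesis using z(4) ry yr by simp
  qed
  have comm: "c \<otimes> r = r \<otimes> c" if c: "c \<in> carrier A" "c \<otimes> x = x \<otimes> c" for c
  proof -
    have "c \<otimes> z = z \<otimes> c" using in_bicommutantD[OF z(5)] c by blast
    then have cy: "c \<otimes> ?y = ?y \<otimes> c"
      using c(1) z(1) by (simp add: a_minus_def l_distr r_distr l_minus r_minus)
    have "c \<otimes> r = r \<otimes> ?y \<otimes> c \<otimes> r" using ry c rA by simp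
    also have "\<dots> = r \<otimes> (c \<otimes> ?y) \<otimes> r" unfolding cy using rA c(1) y(1) by (simp add: m_assoc)
    also have "\<dots> = r \<otimes> c \<otimes> (?y \<otimes> r)" using rA c(1) y(1) by (simp add: m_assoc)
    finally show ?thesis using yr rA c by simp
  qed
  have "r \<ominus> \<one> = z \<oplus> z \<otimes> (r \<ominus> \<one>)"
  proof -
    have "r \<ominus> \<one> = (\<one> \<oplus> z \<otimes> r) \<ominus> \<one>" using fixr by simp
    also have "\<dots> = z \<oplus> z \<otimes> (r \<ominus> \<one>)"
      using z(1) rA by (reify star_eqs, intro seqn_holdsI; simp)
    finally show ?thesis .
  qed
  then have "cnorm A (r \<ominus> \<one>) \<le> cnorm A z + cnorm A z * cnorm A (r \<ominus> \<one>)"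
    using cnorm_add[of z "z \<otimes> (r \<ominus> \<one>)"] cnorm_mult[of z "r \<ominus> \<one>"] z(1) rA by simp
  also have "\<dots> \<le> cnorm A x + cnorm A x * cnorm A (r \<ominus> \<one>)"
    using z rA by (intro add_mono mult_right_mono) auto
  finally have "cnorm A (r \<ominus> \<one>) * (1 - cnorm A x) \<le> cnorm A x" by (simp add: algebra_simps)
  then show thesis using that[OF rA adj main in_bicommutantI[OF comm]] by blast
qed

end

section \<open>Finite sums and additive maps\<close>

lemma (in abelian_monoid) finsum_lessThan_add:
  "f \<in> {..<n + m} \<rightarrow> carrier G \<Longrightarrow>
    (\<Oplus>k\<in>{..<n + m}. f k) = (\<Oplus>k\<in>{..<n}. f k) \<oplus> (\<Oplus>k\<in>{..<m :: nat}. f (n + k))"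
proof (induction m)
  case (Suc m)
  have "f \<in> {..<n} \<rightarrow> carrier G" "f \<in> {..<n + m} \<rightarrow> carrier G" "(\<lambda>k. f (n + k)) \<in> {..<m} \<rightarrow> carrier G" "f (n + m) \<in> carrier G"
    using Suc.prems by auto
  with Suc show ?case
    by (simp add: lessThan_Suc a_ac)
qed simp

text \<open>Infinite index sets are covered because \<open>finsum\<close> is then zero on both
  sides, so no finiteness hypothesis has to be carried along.\<close>

lemma finsum_additive:
  assumes "abelian_monoid G" "abelian_monoid H" "h \<in> carrier G \<rightarrow> carrier H"
    and add: "\<And>x y. \<lbrakk>x \<in> carrier G; y \<in> carrier G\<rbrakk> \<Longrightarrow> h (x \<oplus>\<^bsub>G\<^esub> y) = h x \<oplus>\<^bsub>H\<^esub> h y"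
    and zero: "h \<zero>\<^bsub>G\<^esub> = \<zero>\<^bsub>H\<^esub>"
  shows "f \<in> I \<rightarrow> carrier G \<Longrightarrow> h (\<Oplus>\<^bsub>G\<^esub>i\<in>I. f i) = (\<Oplus>\<^bsub>H\<^esub>i\<in>I. h (f i))"
proof (induction I rule: infinite_finite_induct)
  case (infinite I)
  then show ?case
    using zero by (simp add: abelian_monoid.finsum_infinite[OF assms(1)] abelian_monoid.finsum_infinite[OF assms(2)])
next
  case empty
  then show ?case
    using zero by (simp add: abelian_monoid.finsum_empty[OF assms(1)] abelian_monoid.finsum_empty[OF assms(2)])
next
  case (insert i I)
  interpret G: abelian_monoid G by fact
  interpret H: abelian_monoid H by fact
  have "f \<in> I \<rightarrow> carrier G" "f i \<in> carrier G" "(\<lambda>i. h (f i)) \<in> I \<rightarrow> carrier H" "h (f i) \<in> carrier H"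
    using insert.prems assms(3) by auto
  with insert show ?case
    using add[of "f i" "\<Oplus>\<^bsub>G\<^esub>i\<in>I. f i"] by simp
qed

context star_ring begin

lemma minus_l_distr:
  "\<lbrakk>x \<in> carrier A; y \<in> carrier A; z \<in> carrier A\<rbrakk> \<Longrightarrow> (x \<ominus> y) \<otimes> z = x \<otimes> z \<ominus> y \<otimes> z"
  by (reify star_eqs, intro seqn_holdsI; simp)

lemma minus_r_distr:
  "\<lbrakk>x \<in> carrier A; y \<in> carrier A; z \<in> carrier A\<rbrakk> \<Longrightarrow> z \<otimes> (x \<ominus> y) = z \<otimes> x \<ominus> z \<otimes> y"
  by (reify star_eqs, intro seqn_holdsI; simp)

lemma abelian_monoid_self: "abelian_monoid A"
  by (rule abelian_monoid_axioms)

lemma cadj_finsum: "f \<in> I \<rightarrow> carrier A \<Longrightarrow> cadj A (\<Oplus>i\<in>I. f i) = (\<Oplus>i\<in>I. cadj A (f i))"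
  by (rule finsum_additive) (auto simp: cadj_add abelian_monoid_self)

lemma finsum_minusf:
  assumes "f \<in> I \<rightarrow> carrier A" "g \<in> I \<rightarrow> carrier A"
  shows "(\<Oplus>i\<in>I. f i \<ominus> g i) = (\<Oplus>i\<in>I. f i) \<ominus> (\<Oplus>i\<in>I. g i)"
proof -
  have g: "(\<lambda>i. \<ominus> g i) \<in> I \<rightarrow> carrier A" using assms by auto
  have "(\<Oplus>i\<in>I. \<ominus> g i) = \<ominus> (\<Oplus>i\<in>I. g i)"
    by (rule finsum_additive[OF abelian_monoid_self abelian_monoid_self _ _ _ assms(2), symmetric, of "\<lambda>x. \<ominus> x"])
      (auto simp: minus_add)
  then show ?thesis
    unfolding a_minus_def using finsum_addf[OF assms(1) g] by simp
qed

end

context unital_cstar_algebra begin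

lemma cnorm_finsum:
  "\<lbrakk>finite I; f \<in> I \<rightarrow> carrier A\<rbrakk> \<Longrightarrow> cnorm A (\<Oplus>i\<in>I. f i) \<le> (\<Sum>i\<in>I. cnorm A (f i))"
proof (induction I rule: finite_induct)
  case (insert i I)
  then have "f \<in> I \<rightarrow> carrier A" "f i \<in> carrier A" by auto
  with insert show ?case using cnorm_add[of "f i" "\<Oplus>i\<in>I. f i"] by simp
qed simp

text \<open>\<open>s + k = (t + s) (1 - x)\<close> with \<open>||x|| \<le> t / (t + s) < 1\<close>,
  where \<open>t\<close> witnesses positivity of \<open>k\<close>. The strict inequality is due to
  the shift by \<open>s > 0\<close>.\<close>

lemma psd_plus_inverse_sqrt:
  assumes "psd k" "s > 0"
  obtains r where "r \<in> carrier A" "cadj A r = r" "r \<otimes> (of_real s \<odot> \<one> \<oplus> k) \<otimes> r = \<one>" "in_bicommutant k r"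
proof -
  note c = psdD[OF assms(1)]
  obtain t where t: "t > 0" "cnorm A (of_real t \<odot> \<one> \<ominus> k) \<le> t"
    using psd_obtain_pos[OF assms(1)] .
  define x where "x = of_real (1 / (t + s)) \<odot> (of_real t \<odot> \<one> \<ominus> k)"
  have ts: "t + s > 0" "t + s \<noteq> 0" using t assms by auto
  have x: "x \<in> carrier A" "cadj A x = x" using c by (simp_all add: x_def cadj_smult cadj_minus)
  have "cnorm A x = (1 / (t + s)) * cnorm A (of_real t \<odot> \<one> \<ominus> k)"
    unfolding x_def using c ts by (simp add: cnorm_smult del: of_real_add of_real_divide)
  also have "\<dots> \<le> (1 / (t + s)) * t"
    using t ts by (intro mult_left_mono) auto
  also have "\<dots> < 1" using t assms by (simp add: divide_less_eq)
  finally have "cnorm A x < 1" .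
  then obtain q where q: "q \<in> carrier A" "cadj A q = q" "q \<otimes> (\<one> \<ominus> x) \<otimes> q = \<one>" "in_bicommutant x q"
    using inverse_sqrt_one_minus[OF x] by blast
  define r where "r = of_real (1 / sqrt (t + s)) \<odot> q"
  have r: "r \<in> carrier A" "cadj A r = r" using q by (simp_all add: r_def cadj_smult)
  have sq: "of_real (1 / sqrt (t + s)) * of_real (1 / sqrt (t + s)) * of_real (t + s) = (1 :: complex)"
    using ts unfolding of_real_mult[symmetric] by simp
  have one_x: "of_real s \<odot> \<one> \<oplus> k = of_real (t + s) \<odot> (\<one> \<ominus> x)"
  proof -
    have "of_real (t + s) * of_real (1 / (t + s)) = (1 :: complex)"
      using ts unfolding of_real_mult[symmetric] by simp
    moreover have "of_real (t + s) \<odot> (\<one> \<ominus> x) =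
       of_real (t + s) \<odot> \<one> \<ominus> (of_real (t + s) * of_real (1 / (t + s))) \<odot> (of_real t \<odot> \<one> \<ominus> k)"
      unfolding x_def using c(1) by (reify star_eqs, intro seqn_holdsI; simp)
    ultimately have "of_real (t + s) \<odot> (\<one> \<ominus> x) = of_real (t + s) \<odot> \<one> \<ominus> 1 \<odot> (of_real t \<odot> \<one> \<ominus> k)"
      by simp
    also have "\<dots> = of_real s \<odot> \<one> \<oplus> k"
      using c(1) by (reify star_eqs, intro seqn_holdsI; simp)
    finally show ?thesis ..
  qed
  have "r \<otimes> (of_real s \<odot> \<one> \<oplus> k) \<otimes> r =
    (of_real (1 / sqrt (t + s)) * of_real (1 / sqrt (t + s)) * of_real (t + s)) \<odot> (q \<otimes> (\<one> \<ominus> x) \<otimes> q)"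
    unfolding one_x r_def using q(1) x(1) by (reify star_eqs, intro seqn_holdsI; simp)
  then have main: "r \<otimes> (of_real s \<odot> \<one> \<oplus> k) \<otimes> r = \<one>" unfolding sq q(3) by simp
  have "in_bicommutant k r"
  proof (rule in_bicommutantI)
    fix d assume d: "d \<in> carrier A" "d \<otimes> k = k \<otimes> d"
    have "d \<otimes> x = of_real (1 / (t + s)) \<odot> (of_real t \<odot> d \<ominus> d \<otimes> k)"
      unfolding x_def using c(1) d(1) by (reify star_eqs, intro seqn_holdsI; simp)
    also have "\<dots> = x \<otimes> d"
      unfolding x_def d(2) using c(1) d(1) by (reify star_eqs, intro seqn_holdsI; simp)
    finally have "d \<otimes> q = q \<otimes> d" using in_bicommutantD[OF q(4)] d by blast
    then show "d \<otimes> r = r \<otimes> d"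
      unfolding r_def using q(1) d(1) by (simp add: smult_mult_left smult_mult_right)
  qed
  then show thesis using that[OF r main] by blast
qed

end

subsection \<open>Conditional expectations of finite index\<close>

locale finite_index_expectation = unital_cstar_algebra A for A :: "'a cstar_alg" (structure) +
  fixes P :: "'a set" and E :: "'a \<Rightarrow> 'a"
  assumes P: "cstar_subalgebra A P" "\<one> \<in> P"
    and expectation: "conditional_expectation A P E"
    and index: "finite_index A E"
begin

lemma P_carrier [simp, intro]: "p \<in> P \<Longrightarrow> p \<in> carrier A"
  using P by (auto simp: cstar_subalgebra_def linear_subspace_def)

lemma P_closed [simp, intro]:
  "\<zero> \<in> P" "\<lbrakk>p \<in> P; q \<in> P\<rbrakk> \<Longrightarrow> p \<oplus> q \<in> P" "p \<in> P \<Longrightarrow> c \<odot> p \<in> P" "\<lbrakk>p \<in> P; q \<in> P\<rbrakk> \<Longrightarrow> p \<otimes> q \<in> P"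
  "p \<in> P \<Longrightarrow> cadj A p \<in> P" "closedin (ctopology A) P"
  using P by (auto simp: cstar_subalgebra_def linear_subspace_def)

lemma E_P [simp, intro]: "x \<in> carrier A \<Longrightarrow> E x \<in> P"
  using expectation by (auto simp: conditional_expectation_def)

lemma E_closed [simp, intro]: "x \<in> carrier A \<Longrightarrow> E x \<in> carrier A"
  by blast

lemma E_add: "\<lbrakk>x \<in> carrier A; y \<in> carrier A\<rbrakk> \<Longrightarrow> E (x \<oplus> y) = E x \<oplus> E y"
  using expectation by (auto simp: conditional_expectation_def)

lemma E_smult: "x \<in> carrier A \<Longrightarrow> E (c \<odot> x) = c \<odot> E x"
  using expectation by (auto simp: conditional_expectation_def)

lemma E_fix: "p \<in> P \<Longrightarrow> E p = p"
  using expectation by (auto simp: conditional_expectation_def)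

lemma E_bimodule: "\<lbrakk>x \<in> carrier A; p \<in> P; q \<in> P\<rbrakk> \<Longrightarrow> E (p \<otimes> x \<otimes> q) = p \<otimes> E x \<otimes> q"
  using expectation by (auto simp: conditional_expectation_def)

lemma E_mult_left: "\<lbrakk>x \<in> carrier A; p \<in> P\<rbrakk> \<Longrightarrow> E (p \<otimes> x) = p \<otimes> E x"
  using E_bimodule[of x p \<one>] P(2) by simp

lemma E_mult_right: "\<lbrakk>x \<in> carrier A; p \<in> P\<rbrakk> \<Longrightarrow> E (x \<otimes> p) = E x \<otimes> p"
  using E_bimodule[of x \<one> p] P(2) by simp

lemma E_cnorm_le: "x \<in> carrier A \<Longrightarrow> cnorm A (E x) \<le> cnorm A x"
  using expectation by (auto simp: conditional_expectation_def)

lemma E_zero [simp]: "E \<zero> = \<zero>" and E_one [simp]: "E \<one> = \<one>"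
  using P by (simp_all add: E_fix)

lemma E_neg: "x \<in> carrier A \<Longrightarrow> E (\<ominus> x) = \<ominus> E x"
  using E_smult[of x "-1"] by (simp add: smult_neg_one)

lemma E_minus: "\<lbrakk>x \<in> carrier A; y \<in> carrier A\<rbrakk> \<Longrightarrow> E (x \<ominus> y) = E x \<ominus> E y"
  by (simp add: a_minus_def E_add E_neg)

lemma E_finsum: "f \<in> I \<rightarrow> carrier A \<Longrightarrow> E (\<Oplus>i\<in>I. f i) = (\<Oplus>i\<in>I. E (f i))"
  by (rule finsum_additive) (auto simp: E_add abelian_monoid_self)

text \<open>An expectation is positive in the sense of elements of the form \<open>x^* x\<close>;
  square roots translate into this sense and \<open>psd_cadj_mult\<close> translates back.\<close>

lemma psd_E: assumes "psd h" shows "psd (E h)"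
proof -
  obtain y where y: "psd y" "y \<otimes> y = h" using psd_sqrt[OF assms] by blast
  then have "positive A h" using psdD[OF y(1)] unfolding positive_def by metis
  then have "positive A (E h)"
    using expectation psdD[OF assms] by (auto simp: conditional_expectation_def)
  then show ?thesis using psd_cadj_mult by (auto simp: positive_def)
qed

text \<open>\<open>||x|| - x\<close> is positive, so \<open>E\<close> maps it to a positive and
  hence selfadjoint element, from which \<open>E x\<close> is recovered.\<close>

lemma E_selfadjoint: assumes "x \<in> carrier A" "cadj A x = x" shows "cadj A (E x) = E x"
proof -
  let ?t = "cnorm A x"
  have "E (of_real ?t \<odot> \<one> \<ominus> x) = of_real ?t \<odot> \<one> \<ominus> E x"
    using assms by (simp add: E_minus E_smult)
  then have "psd (of_real ?t \<odot> \<one> \<ominus> E x)"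
    using psd_E[OF psd_shift[OF assms order_refl]] by simp
  then have *: "of_real ?t \<odot> \<one> \<ominus> cadj A (E x) = of_real ?t \<odot> \<one> \<ominus> E x"
    using psdD(2) assms by (fastforce simp: cadj_minus cadj_smult)
  have "y = of_real ?t \<odot> \<one> \<ominus> (of_real ?t \<odot> \<one> \<ominus> y)" if "y \<in> carrier A" for y
    using that by (reify star_eqs, intro seqn_holdsI; simp)
  then show ?thesis using * assms by (metis E_closed cadj_closed)
qed

lemma E_cadj: assumes x: "x \<in> carrier A" shows "E (cadj A x) = cadj A (E x)"
proof -
  define a where "a = (1/2) \<odot> (x \<oplus> cadj A x)"
  define b where "b = (1/(2*\<i>)) \<odot> (x \<ominus> cadj A x)"
  have ab: "a \<in> carrier A" "b \<in> carrier A" using x by (simp_all add: a_def b_def)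
  have a: "cadj A a = a" unfolding a_def using x by (reify star_eqs, intro seqn_holdsI; simp)
  have b: "cadj A b = b" unfolding b_def using x by (reify star_eqs, intro seqn_holdsI; simp)
  have x1: "x = a \<oplus> \<i> \<odot> b" and x2: "cadj A x = a \<oplus> (- \<i>) \<odot> b"
    unfolding a_def b_def using x by (reify star_eqs, intro seqn_holdsI; simp add: field_simps)+
  show ?thesis
    unfolding x2 by (subst x1) (use ab in \<open>simp add: E_add E_smult cadj_add cadj_smult E_selfadjoint a b\<close>)
qed

text \<open>The \<open>P\<close>-valued inner product of \<open>A\<close> as a right Hilbert module,
  conjugate linear in the first argument.\<close>

definition ip :: "'a \<Rightarrow> 'a \<Rightarrow> 'a" where "ip x y = E (cadj A x \<otimes> y)"

definition nrm :: "'a \<Rightarrow> real" where "nrm x = sqrt (cnorm A (ip x x))"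

lemma ip_P [simp, intro]: "\<lbrakk>x \<in> carrier A; y \<in> carrier A\<rbrakk> \<Longrightarrow> ip x y \<in> P"
  by (simp add: ip_def)

lemma ip_carrier [simp, intro]: "\<lbrakk>x \<in> carrier A; y \<in> carrier A\<rbrakk> \<Longrightarrow> ip x y \<in> carrier A"
  by blast

lemma ip_cadj: "\<lbrakk>x \<in> carrier A; y \<in> carrier A\<rbrakk> \<Longrightarrow> cadj A (ip x y) = ip y x"
  by (simp add: ip_def cadj_mult flip: E_cadj)

lemma ip_add_right: "\<lbrakk>x \<in> carrier A; y \<in> carrier A; z \<in> carrier A\<rbrakk> \<Longrightarrow> ip x (y \<oplus> z) = ip x y \<oplus> ip x z"
  by (simp add: ip_def r_distr E_add)

lemma ip_add_left: "\<lbrakk>x \<in> carrier A; y \<in> carrier A; z \<in> carrier A\<rbrakk> \<Longrightarrow> ip (x \<oplus> y) z = ip x z \<oplus> ip y z"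
  by (simp add: ip_def cadj_add l_distr E_add)

lemma ip_minus_right: "\<lbrakk>x \<in> carrier A; y \<in> carrier A; z \<in> carrier A\<rbrakk> \<Longrightarrow> ip x (y \<ominus> z) = ip x y \<ominus> ip x z"
  by (simp add: ip_def minus_r_distr E_minus)

lemma ip_minus_left: "\<lbrakk>x \<in> carrier A; y \<in> carrier A; z \<in> carrier A\<rbrakk> \<Longrightarrow> ip (x \<ominus> y) z = ip x z \<ominus> ip y z"
  by (simp add: ip_def cadj_minus minus_l_distr E_minus)

lemma ip_smult_right: "\<lbrakk>x \<in> carrier A; y \<in> carrier A\<rbrakk> \<Longrightarrow> ip x (c \<odot> y) = c \<odot> ip x y"
  by (simp add: ip_def smult_mult_right E_smult)

lemma ip_smult_left: "\<lbrakk>x \<in> carrier A; y \<in> carrier A\<rbrakk> \<Longrightarrow> ip (c \<odot> x) y = cnj c \<odot> ip x y"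
  by (simp add: ip_def cadj_smult smult_mult_left E_smult)

lemma ip_mult_right: "\<lbrakk>x \<in> carrier A; y \<in> carrier A; p \<in> P\<rbrakk> \<Longrightarrow> ip x (y \<otimes> p) = ip x y \<otimes> p"
  by (simp add: ip_def E_mult_right flip: m_assoc)

lemma ip_mult_left: "\<lbrakk>x \<in> carrier A; y \<in> carrier A; p \<in> P\<rbrakk> \<Longrightarrow> ip (x \<otimes> p) y = cadj A p \<otimes> ip x y"
  by (simp add: ip_def cadj_mult E_mult_left m_assoc)

lemma psd_ip: "x \<in> carrier A \<Longrightarrow> psd (ip x x)"
  by (simp add: ip_def psd_E psd_cadj_mult)

lemma nrm_nonneg [simp]: "x \<in> carrier A \<Longrightarrow> 0 \<le> nrm x"
  by (simp add: nrm_def)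

lemma nrm_sq: "x \<in> carrier A \<Longrightarrow> (nrm x)\<^sup>2 = cnorm A (ip x x)"
  by (simp add: nrm_def)

lemma nrm_le_cnorm: assumes "x \<in> carrier A" shows "nrm x \<le> cnorm A x"
proof -
  have "cnorm A (ip x x) \<le> (cnorm A x)\<^sup>2"
    using E_cnorm_le[of "cadj A x \<otimes> x"] assms by (simp add: ip_def cnorm_cadj_mult)
  then show ?thesis using assms by (simp add: nrm_def real_le_lsqrt)
qed

text \<open>Cauchy-Schwarz. With \<open>b = ip y x\<close> and \<open>s\<close> at least the norm of
  \<open>ip y y\<close>, positivity of \<open>ip z z\<close> for \<open>z = s x - y b\<close> gives
  \<open>s b^* b \<le> s^2 (ip x x)\<close>. The scalar \<open>s\<close> is taken positive so that
  it can be cancelled, and then it decreases to \<open>||ip y y||\<close>.\<close>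

lemma cnorm_ip_le:
  assumes x: "x \<in> carrier A" and y: "y \<in> carrier A"
  shows "cnorm A (ip y x) \<le> nrm y * nrm x"
proof -
  let ?b = "ip y x" and ?X = "ip x x" and ?Y = "ip y y"
  have b: "?b \<in> P" "?b \<in> carrier A" "cadj A ?b = ip x y" using x y by (simp_all add: ip_cadj)
  have XY: "?X \<in> carrier A" "?Y \<in> carrier A" "cadj A ?Y = ?Y" using x y by (simp_all add: ip_cadj)
  have *: "(cnorm A ?b)\<^sup>2 \<le> s * cnorm A ?X" if s: "s > 0" "cnorm A ?Y \<le> s" for s
  proof -
    let ?s = "of_real s :: complex"
    define z where "z = ?s \<odot> x \<ominus> y \<otimes> ?b"
    have z: "z \<in> carrier A" using x y by (simp add: z_def)
    have zx: "ip z x = ?s \<odot> ?X \<ominus> cadj A ?b \<otimes> ?b"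
      unfolding z_def using x y b(1,2) by (simp add: ip_minus_left ip_smult_left ip_mult_left)
    have zy: "ip z y = ?s \<odot> cadj A ?b \<ominus> cadj A ?b \<otimes> ?Y"
      unfolding z_def using x y b by (simp add: ip_minus_left ip_smult_left ip_mult_left)
    have "ip z z = ip z (?s \<odot> x \<ominus> y \<otimes> ?b)" by (subst (2) z_def) simp
    also have "\<dots> = ?s \<odot> ip z x \<ominus> ip z y \<otimes> ?b"
      using x y z b(1,2) by (simp add: ip_minus_right ip_smult_right ip_mult_right)
    also have "\<dots> = ?s \<odot> (?s \<odot> ?X) \<ominus> ?s \<odot> (cadj A ?b \<otimes> ?b) \<ominus> ?s \<odot> (cadj A ?b \<otimes> ?b) \<oplus> cadj A ?b \<otimes> ?Y \<otimes> ?b"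
      unfolding zx zy using XY(1,2) b(2) by (reify star_eqs, intro seqn_holdsI; simp)
    finally have "ip z z = ?s \<odot> (?s \<odot> ?X) \<ominus> ?s \<odot> (cadj A ?b \<otimes> ?b) \<ominus> ?s \<odot> (cadj A ?b \<otimes> ?b) \<oplus> cadj A ?b \<otimes> ?Y \<otimes> ?b" .
    moreover have "psd (cadj A ?b \<otimes> (?s \<odot> \<one> \<ominus> ?Y) \<otimes> ?b)"
      using XY s b by (intro psd_conj psd_shift) auto
    ultimately have "psd ((?s \<odot> (?s \<odot> ?X) \<ominus> ?s \<odot> (cadj A ?b \<otimes> ?b) \<ominus> ?s \<odot> (cadj A ?b \<otimes> ?b) \<oplus> cadj A ?b \<otimes> ?Y \<otimes> ?b)
      \<oplus> cadj A ?b \<otimes> (?s \<odot> \<one> \<ominus> ?Y) \<otimes> ?b)"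
      using psd_add[OF psd_ip[OF z]] by simp
    also have "(?s \<odot> (?s \<odot> ?X) \<ominus> ?s \<odot> (cadj A ?b \<otimes> ?b) \<ominus> ?s \<odot> (cadj A ?b \<otimes> ?b) \<oplus> cadj A ?b \<otimes> ?Y \<otimes> ?b)
      \<oplus> cadj A ?b \<otimes> (?s \<odot> \<one> \<ominus> ?Y) \<otimes> ?b = ?s \<odot> (?s \<odot> ?X) \<ominus> ?s \<odot> (cadj A ?b \<otimes> ?b)"
      using XY(1,2) b(2) by (reify star_eqs, intro seqn_holdsI; simp)
    finally have "cnorm A (?s \<odot> (cadj A ?b \<otimes> ?b)) \<le> cnorm A (?s \<odot> (?s \<odot> ?X))"
      using s XY b(2) by (intro psd_cnorm_mono psd_smult psd_cadj_mult) auto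
    then show ?thesis using s XY b(2) by (simp add: cnorm_smult cnorm_cadj_mult)
  qed
  have "(cnorm A ?b)\<^sup>2 \<le> cnorm A ?Y * cnorm A ?X"
  proof (rule field_le_epsilon)
    fix e :: real assume "e > 0"
    define d where "d = e / (cnorm A ?X + 1)"
    have X: "cnorm A ?X + 1 > 0" using cnorm_nonneg[OF XY(1)] by linarith
    have d: "d > 0" using \<open>e > 0\<close> X by (simp add: d_def)
    have "d * cnorm A ?X \<le> e"
      using X \<open>e > 0\<close> cnorm_nonneg[OF XY(1)] by (simp add: d_def field_simps)
    then show "(cnorm A ?b)\<^sup>2 \<le> cnorm A ?Y * cnorm A ?X + e"
      using *[of "cnorm A ?Y + d"] d cnorm_nonneg[OF XY(2)] by (simp add: algebra_simps)
  qed
  also have "\<dots> = (nrm y * nrm x)\<^sup>2" using x y by (simp add: power_mult_distrib nrm_sq)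
  finally show ?thesis using power2_le_imp_le x y by (meson mult_nonneg_nonneg nrm_nonneg)
qed

lemma nrm_add: assumes "x \<in> carrier A" "y \<in> carrier A" shows "nrm (x \<oplus> y) \<le> nrm x + nrm y"
proof -
  have "ip (x \<oplus> y) (x \<oplus> y) = (ip x x \<oplus> ip x y) \<oplus> (ip y x \<oplus> ip y y)"
    using assms by (simp add: ip_add_left ip_add_right a_ac)
  then have "cnorm A (ip (x \<oplus> y) (x \<oplus> y)) \<le> (cnorm A (ip x x) + cnorm A (ip x y)) + (cnorm A (ip y x) + cnorm A (ip y y))"
    using assms cnorm_add[of "ip x x" "ip x y"] cnorm_add[of "ip y x" "ip y y"]
      cnorm_add[of "ip x x \<oplus> ip x y" "ip y x \<oplus> ip y y"] by simp
  also have "\<dots> \<le> ((nrm x)\<^sup>2 + nrm x * nrm y) + (nrm y * nrm x + (nrm y)\<^sup>2)"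
    using assms by (intro add_mono cnorm_ip_le) (auto simp: nrm_sq)
  also have "\<dots> = (nrm x + nrm y)\<^sup>2" by (simp add: power2_eq_square algebra_simps)
  finally have "(nrm (x \<oplus> y))\<^sup>2 \<le> (nrm x + nrm y)\<^sup>2" using assms by (simp add: nrm_sq)
  then show ?thesis using assms by (meson add_nonneg_nonneg nrm_nonneg power2_le_imp_le)
qed

lemma nrm_smult: assumes "x \<in> carrier A" shows "nrm (c \<odot> x) = cmod c * nrm x"
proof -
  have "cnorm A (ip (c \<odot> x) (c \<odot> x)) = (cmod c)\<^sup>2 * cnorm A (ip x x)"
    using assms by (simp add: ip_smult_left ip_smult_right cnorm_smult power2_eq_square)
  then show ?thesis by (simp add: nrm_def real_sqrt_mult)
qed

text \<open>Finite index enters here: in \<open>x = \<Sum> u E(v x)\<close> Cauchy-Schwarz bounds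
  each coefficient \<open>E(v x)\<close> by a multiple of \<open>nrm x\<close>. Hence the module
  norm is equivalent to the norm of \<open>A\<close>; in particular it is definite and
  complete.\<close>

lemma cnorm_le_nrm: obtains K where "K > 0" "\<And>x. x \<in> carrier A \<Longrightarrow> cnorm A x \<le> K * nrm x"
proof -
  obtain n u v where uv: "quasi_basis A E n u v" using index by (auto simp: finite_index_def)
  have c: "i < n \<Longrightarrow> u i \<in> carrier A" "i < n \<Longrightarrow> v i \<in> carrier A" for i
    using uv by (auto simp: quasi_basis_def)
  define K where "K = (\<Sum>i<n. cnorm A (u i) * nrm (cadj A (v i)))"
  have K: "K \<ge> 0" unfolding K_def using c by (intro sum_nonneg mult_nonneg_nonneg) auto
  have le: "cnorm A x \<le> K * nrm x" if x: "x \<in> carrier A" for x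
  proof -
    have "x = (\<Oplus>i\<in>{..<n}. u i \<otimes> E (v i \<otimes> x))"
      using uv x unfolding quasi_basis_def by blast
    then have "cnorm A x \<le> (\<Sum>i<n. cnorm A (u i \<otimes> E (v i \<otimes> x)))"
      using cnorm_finsum[of "{..<n}" "\<lambda>i. u i \<otimes> E (v i \<otimes> x)"] c x by auto
    also have "\<dots> \<le> (\<Sum>i<n. (cnorm A (u i) * nrm (cadj A (v i))) * nrm x)"
    proof (rule sum_mono)
      fix i assume i: "i \<in> {..<n}"
      have "cnorm A (E (v i \<otimes> x)) \<le> nrm (cadj A (v i)) * nrm x"
        using cnorm_ip_le[of x "cadj A (v i)"] x c i by (simp add: ip_def)
      then have "cnorm A (u i) * cnorm A (E (v i \<otimes> x)) \<le> cnorm A (u i) * (nrm (cadj A (v i)) * nrm x)"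
        using c i by (intro mult_left_mono) auto
      moreover have "cnorm A (u i \<otimes> E (v i \<otimes> x)) \<le> cnorm A (u i) * cnorm A (E (v i \<otimes> x))"
        using c i x by (intro cnorm_mult) auto
      ultimately show "cnorm A (u i \<otimes> E (v i \<otimes> x)) \<le> (cnorm A (u i) * nrm (cadj A (v i))) * nrm x"
        by (simp add: mult.assoc)
    qed
    also have "\<dots> = K * nrm x" by (simp add: K_def sum_distrib_right)
    finally show ?thesis .
  qed
  have "cnorm A x \<le> (K + 1) * nrm x" if "x \<in> carrier A" for x
    using le[OF that] nrm_nonneg[OF that] by (simp add: algebra_simps)
  then show thesis using that[of "K + 1"] K by simp
qed

lemma nrm_eq_zero: assumes "x \<in> carrier A" "nrm x = 0" shows "x = \<zero>"
proof -
  have "cnorm A x \<le> 0" using assms cnorm_le_nrm by (metis mult_zero_right)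
  then have "cnorm A x = 0" using cnorm_nonneg[OF assms(1)] by linarith
  then show ?thesis using assms by (simp add: cnorm_eq_0)
qed

lemma ip_nondegenerate:
  assumes "x \<in> carrier A" "x' \<in> carrier A" "\<And>y. y \<in> carrier A \<Longrightarrow> ip x y = ip x' y"
  shows "x = x'"
proof -
  have "ip (x \<ominus> x') (x \<ominus> x') = \<zero>"
    using assms by (simp add: ip_minus_left minus_eq_zero_iff)
  then have "x \<ominus> x' = \<zero>" using assms by (intro nrm_eq_zero) (simp_all add: nrm_def)
  then show ?thesis using assms by (simp add: minus_eq_zero_iff)
qed

end

lemma (in abelian_monoid) finsum_swap:
  assumes "finite I" "finite J" "\<And>i j. \<lbrakk>i \<in> I; j \<in> J\<rbrakk> \<Longrightarrow> f i j \<in> carrier G"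
  shows "(\<Oplus>i\<in>I. \<Oplus>j\<in>J. f i j) = (\<Oplus>j\<in>J. \<Oplus>i\<in>I. f i j)"
  using assms(1,3)
proof (induction I rule: finite_induct)
  case (insert i I)
  have "f i \<in> J \<rightarrow> carrier G" "(\<lambda>i. \<Oplus>j\<in>J. f i j) \<in> I \<rightarrow> carrier G" "(\<lambda>j. \<Oplus>i\<in>I. f i j) \<in> J \<rightarrow> carrier G"
    using insert.prems by (auto intro!: finsum_closed)
  moreover have "(\<Oplus>j\<in>J. \<Oplus>i\<in>insert i I. f i j) = (\<Oplus>j\<in>J. f i j \<oplus> (\<Oplus>i\<in>I. f i j))"
    using insert.prems insert.hyps by (intro finsum_cong') (auto intro!: finsum_closed finsum_insert)
  ultimately show ?case
    using insert by (simp add: finsum_addf)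
qed (simp add: assms(2))

context star_ring begin

lemma minus_split:
  "\<lbrakk>x \<in> carrier A; y \<in> carrier A; z \<in> carrier A\<rbrakk> \<Longrightarrow> x \<ominus> z = (x \<ominus> y) \<oplus> (y \<ominus> z)"
  by (reify star_eqs, intro seqn_holdsI; simp)

lemma eq_add_neg_minus: "\<lbrakk>x \<in> carrier A; y \<in> carrier A\<rbrakk> \<Longrightarrow> y = x \<oplus> (-1) \<odot> (x \<ominus> y)"
  by (reify star_eqs, intro seqn_holdsI; simp)

end

section \<open>The C*-algebra of adjointable operators\<close>

context finite_index_expectation begin

definition op_bound :: "real \<Rightarrow> ('a \<Rightarrow> 'a) \<Rightarrow> bool" where
  "op_bound C T \<longleftrightarrow> 0 \<le> C \<and> (\<forall>x\<in>carrier A. nrm (T x) \<le> C * nrm x)"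

definition op_adj :: "('a \<Rightarrow> 'a) \<Rightarrow> ('a \<Rightarrow> 'a) \<Rightarrow> bool" where
  "op_adj T S \<longleftrightarrow> (\<forall>x\<in>carrier A. \<forall>y\<in>carrier A. ip (T x) y = ip x (S y))"

text \<open>Linearity is not asked for, because it follows once an adjoint exists. Extensionality
  makes operators equal when they agree on the carrier.\<close>

definition bounded_ops :: "('a \<Rightarrow> 'a) set" where
  "bounded_ops = {T \<in> carrier A \<rightarrow>\<^sub>E carrier A. \<exists>C. op_bound C T}"

text \<open>\<open>A\<close> is viewed as a Hilbert module over \<open>P\<close>.\<close>

definition op_alg :: "('a \<Rightarrow> 'a) cstar_alg" where
  "op_alg =
     \<lparr>carrier = {T \<in> bounded_ops. \<exists>S\<in>bounded_ops. op_adj T S},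
      mult = (\<lambda>S T. \<lambda>x\<in>carrier A. S (T x)),
      one = (\<lambda>x\<in>carrier A. x),
      zero = (\<lambda>x\<in>carrier A. \<zero>),
      add = (\<lambda>S T. \<lambda>x\<in>carrier A. S x \<oplus> T x),
      smult = (\<lambda>c T. \<lambda>x\<in>carrier A. c \<odot> T x),
      cadj = (\<lambda>T. SOME S. S \<in> bounded_ops \<and> op_adj T S),
      cnorm = (\<lambda>T. Inf {C. op_bound C T})\<rparr>"

lemma bounded_ops_closed: "\<lbrakk>T \<in> bounded_ops; x \<in> carrier A\<rbrakk> \<Longrightarrow> T x \<in> carrier A"
  by (auto simp: bounded_ops_def)

lemma bounded_ops_ext:
  "\<lbrakk>S \<in> bounded_ops; T \<in> bounded_ops; \<And>x. x \<in> carrier A \<Longrightarrow> S x = T x\<rbrakk> \<Longrightarrow> S = T"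
  by (auto simp: bounded_ops_def intro: PiE_ext)

lemma bounded_opsI:
  "\<lbrakk>\<And>x. x \<in> carrier A \<Longrightarrow> f x \<in> carrier A; 0 \<le> C; \<And>x. x \<in> carrier A \<Longrightarrow> nrm (f x) \<le> C * nrm x\<rbrakk>
    \<Longrightarrow> (\<lambda>x\<in>carrier A. f x) \<in> bounded_ops"
  unfolding bounded_ops_def op_bound_def by (auto intro!: exI[of _ C])

lemma op_adj_unique:
  assumes "S \<in> bounded_ops" "S' \<in> bounded_ops" "T \<in> bounded_ops" "op_adj T S" "op_adj T S'"
  shows "S = S'"
proof (rule bounded_ops_ext[OF assms(1,2)])
  fix y assume y: "y \<in> carrier A"
  have c: "S y \<in> carrier A" "S' y \<in> carrier A" using assms y bounded_ops_closed by blast+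
  have "ip (S y) x = ip (S' y) x" if x: "x \<in> carrier A" for x
  proof -
    have "ip x (S y) = ip x (S' y)" using assms(4,5) x y unfolding op_adj_def by metis
    then have "cadj A (ip x (S y)) = cadj A (ip x (S' y))" by simp
    then show ?thesis using x c by (simp add: ip_cadj)
  qed
  then show "S y = S' y" using ip_nondegenerate c by blast
qed

lemma op_adj_sym: assumes "T \<in> bounded_ops" "S \<in> bounded_ops" "op_adj T S" shows "op_adj S T"
  unfolding op_adj_def
proof (intro ballI)
  fix x y assume xy: "x \<in> carrier A" "y \<in> carrier A"
  have "cadj A (ip (T y) x) = cadj A (ip y (S x))" using assms(3) xy by (simp add: op_adj_def)
  then show "ip (S x) y = ip x (T y)" using xy assms bounded_ops_closed by (simp add: ip_cadj)
qed

lemma op_algD: "T \<in> carrier op_alg \<Longrightarrow> T \<in> bounded_ops"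
  by (simp add: op_alg_def)

lemma op_algI: "\<lbrakk>T \<in> bounded_ops; S \<in> bounded_ops; op_adj T S\<rbrakk> \<Longrightarrow> T \<in> carrier op_alg"
  by (auto simp: op_alg_def)

lemma op_cadj:
  assumes "T \<in> carrier op_alg"
  shows "cadj op_alg T \<in> bounded_ops" "op_adj T (cadj op_alg T)"
proof -
  have "\<exists>S. S \<in> bounded_ops \<and> op_adj T S" using assms by (auto simp: op_alg_def)
  from someI_ex[OF this] show "cadj op_alg T \<in> bounded_ops" "op_adj T (cadj op_alg T)"
    by (simp_all add: op_alg_def)
qed

lemma op_cadj_eq: "\<lbrakk>T \<in> bounded_ops; S \<in> bounded_ops; op_adj T S\<rbrakk> \<Longrightarrow> cadj op_alg T = S"
  using op_adj_unique[of "cadj op_alg T" S T] op_cadj[of T] op_algI by blast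

lemma op_cadj_closed: "T \<in> carrier op_alg \<Longrightarrow> cadj op_alg T \<in> carrier op_alg"
  using op_cadj[of T] op_adj_sym[of T "cadj op_alg T"] op_algI op_algD by blast

lemma op_closed [simp]: "\<lbrakk>T \<in> carrier op_alg; x \<in> carrier A\<rbrakk> \<Longrightarrow> T x \<in> carrier A"
  using op_algD bounded_ops_closed by blast

lemma op_ip: "\<lbrakk>T \<in> carrier op_alg; x \<in> carrier A; y \<in> carrier A\<rbrakk> \<Longrightarrow> ip (T x) y = ip x (cadj op_alg T y)"
  using op_cadj[of T] by (simp add: op_adj_def)

lemma op_ext:
  "\<lbrakk>S \<in> carrier op_alg; T \<in> carrier op_alg; \<And>x. x \<in> carrier A \<Longrightarrow> S x = T x\<rbrakk> \<Longrightarrow> S = T"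
  using bounded_ops_ext op_algD by blast

text \<open>An adjointable map is automatically linear: after \<open>T\<close> is moved to the other
  side of the inner product, the two elements pair equally with everything, and the inner product is
  nondegenerate. The same argument gives homogeneity and right \<open>P\<close>-linearity
  below.\<close>

lemma op_add: assumes T: "T \<in> carrier op_alg" and xy: "x \<in> carrier A" "y \<in> carrier A"
  shows "T (x \<oplus> y) = T x \<oplus> T y"
  using T xy op_cadj_closed[OF T] by - (rule ip_nondegenerate; simp add: op_ip ip_add_left)

lemma op_smult: assumes T: "T \<in> carrier op_alg" and x: "x \<in> carrier A"
  shows "T (c \<odot> x) = c \<odot> T x"
  using T x op_cadj_closed[OF T] by - (rule ip_nondegenerate; simp add: op_ip ip_smult_left)

lemma op_mult_right: assumes T: "T \<in> carrier op_alg" and x: "x \<in> carrier A" and p: "p \<in> P"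
  shows "T (x \<otimes> p) = T x \<otimes> p"
  using T x p op_cadj_closed[OF T] by - (rule ip_nondegenerate; simp add: op_ip ip_mult_left)

lemma op_zero_vec: "T \<in> carrier op_alg \<Longrightarrow> T \<zero> = \<zero>"
  using op_smult[of T \<zero> 0] by simp

lemma op_finsum: "\<lbrakk>T \<in> carrier op_alg; f \<in> I \<rightarrow> carrier A\<rbrakk> \<Longrightarrow> T (\<Oplus>i\<in>I. f i) = (\<Oplus>i\<in>I. T (f i))"
  by (rule finsum_additive) (auto simp: op_add op_zero_vec abelian_monoid_self)

text \<open>The norm is an infimum of bounds. It is a bound itself because for
  \<open>nrm x > 0\<close> the quotient \<open>nrm (T x) / nrm x\<close> lies below all of them, and
  for \<open>nrm x = 0\<close> any bound already forces \<open>nrm (T x)\<close> to vanish.\<close>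

lemma op_norm_bound:
  assumes "T \<in> bounded_ops" shows "op_bound (cnorm op_alg T) T"
proof -
  have ne: "{C. op_bound C T} \<noteq> {}" using assms by (auto simp: bounded_ops_def)
  have bdd: "bdd_below {C. op_bound C T}" by (auto simp: op_bound_def intro!: bdd_belowI[of _ 0])
  have "0 \<le> cnorm op_alg T"
    using ne unfolding op_alg_def by (auto simp: op_bound_def intro!: cInf_greatest)
  moreover have "nrm (T x) \<le> cnorm op_alg T * nrm x" if x: "x \<in> carrier A" for x
  proof (cases "nrm x = 0")
    case True
    then show ?thesis using ne x by (auto simp: op_bound_def)
  next
    case False
    then have pos: "nrm x > 0" using nrm_nonneg[OF x] by linarith
    have "nrm (T x) / nrm x \<le> Inf {C. op_bound C T}"
      using ne x pos by (intro cInf_greatest) (auto simp: op_bound_def divide_le_eq)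
    then show ?thesis using pos by (simp add: op_alg_def divide_le_eq)
  qed
  ultimately show ?thesis by (simp add: op_bound_def)
qed

lemma op_norm_le: "op_bound C T \<Longrightarrow> cnorm op_alg T \<le> C"
  unfolding op_alg_def by (auto simp: op_bound_def intro!: cInf_lower bdd_belowI[of _ 0])

lemma op_norm:
  assumes "T \<in> bounded_ops"
  shows "0 \<le> cnorm op_alg T" "x \<in> carrier A \<Longrightarrow> nrm (T x) \<le> cnorm op_alg T * nrm x"
  using op_norm_bound[OF assms] by (simp_all add: op_bound_def)

lemma op_apply [simp]:
  "x \<in> carrier A \<Longrightarrow> (S \<otimes>\<^bsub>op_alg\<^esub> T) x = S (T x)"
  "x \<in> carrier A \<Longrightarrow> (S \<oplus>\<^bsub>op_alg\<^esub> T) x = S x \<oplus> T x"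
  "x \<in> carrier A \<Longrightarrow> (c \<odot>\<^bsub>op_alg\<^esub> T) x = c \<odot> T x"
  "x \<in> carrier A \<Longrightarrow> \<one>\<^bsub>op_alg\<^esub> x = x"
  "x \<in> carrier A \<Longrightarrow> \<zero>\<^bsub>op_alg\<^esub> x = \<zero>"
  by (simp_all add: op_alg_def)

lemma op_mult_bounded:
  assumes "S \<in> bounded_ops" "T \<in> bounded_ops"
  shows "op_bound (cnorm op_alg S * cnorm op_alg T) (S \<otimes>\<^bsub>op_alg\<^esub> T)" "S \<otimes>\<^bsub>op_alg\<^esub> T \<in> bounded_ops"
proof -
  have "nrm (S (T x)) \<le> (cnorm op_alg S * cnorm op_alg T) * nrm x" if x: "x \<in> carrier A" for x
  proof -
    have "nrm (S (T x)) \<le> cnorm op_alg S * nrm (T x)"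
      using op_norm(2)[OF assms(1)] bounded_ops_closed[OF assms(2) x] .
    also have "\<dots> \<le> cnorm op_alg S * (cnorm op_alg T * nrm x)"
      using op_norm[OF assms(1)] op_norm(2)[OF assms(2) x] by (intro mult_left_mono)
    finally show ?thesis by (simp add: mult.assoc)
  qed
  then show b: "op_bound (cnorm op_alg S * cnorm op_alg T) (S \<otimes>\<^bsub>op_alg\<^esub> T)"
    using op_norm(1) assms by (simp add: op_bound_def)
  then show "S \<otimes>\<^bsub>op_alg\<^esub> T \<in> bounded_ops"
    using assms bounded_ops_closed by (auto simp: bounded_ops_def op_alg_def)
qed

lemma op_add_bounded:
  assumes "S \<in> bounded_ops" "T \<in> bounded_ops"
  shows "op_bound (cnorm op_alg S + cnorm op_alg T) (S \<oplus>\<^bsub>op_alg\<^esub> T)" "S \<oplus>\<^bsub>op_alg\<^esub> T \<in> bounded_ops"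
proof -
  have "nrm (S x \<oplus> T x) \<le> (cnorm op_alg S + cnorm op_alg T) * nrm x" if x: "x \<in> carrier A" for x
    using nrm_add[of "S x" "T x"] op_norm(2)[OF assms(1) x] op_norm(2)[OF assms(2) x]
      bounded_ops_closed[OF assms(1) x] bounded_ops_closed[OF assms(2) x]
    by (simp add: algebra_simps)
  then show b: "op_bound (cnorm op_alg S + cnorm op_alg T) (S \<oplus>\<^bsub>op_alg\<^esub> T)"
    using op_norm(1) assms by (simp add: op_bound_def)
  then show "S \<oplus>\<^bsub>op_alg\<^esub> T \<in> bounded_ops"
    using assms bounded_ops_closed by (auto simp: bounded_ops_def op_alg_def)
qed

lemma op_smult_bounded:
  assumes "T \<in> bounded_ops"
  shows "op_bound (cmod c * cnorm op_alg T) (c \<odot>\<^bsub>op_alg\<^esub> T)" "c \<odot>\<^bsub>op_alg\<^esub> T \<in> bounded_ops"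
proof -
  have "nrm (c \<odot> T x) \<le> (cmod c * cnorm op_alg T) * nrm x" if x: "x \<in> carrier A" for x
    using op_norm(2)[OF assms x] bounded_ops_closed[OF assms x]
    by (simp add: nrm_smult mult.assoc mult_left_mono)
  then show b: "op_bound (cmod c * cnorm op_alg T) (c \<odot>\<^bsub>op_alg\<^esub> T)"
    using op_norm(1) assms by (simp add: op_bound_def)
  then show "c \<odot>\<^bsub>op_alg\<^esub> T \<in> bounded_ops"
    using assms bounded_ops_closed by (auto simp: bounded_ops_def op_alg_def)
qed

lemma op_one_bounded: "\<one>\<^bsub>op_alg\<^esub> \<in> bounded_ops" and op_zero_bounded: "\<zero>\<^bsub>op_alg\<^esub> \<in> bounded_ops"
proof -
  show "\<one>\<^bsub>op_alg\<^esub> \<in> bounded_ops"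
    using bounded_opsI[of "\<lambda>x. x" 1] by (simp add: op_alg_def)
  have "nrm \<zero> = 0" using nrm_smult[of \<zero> 0] by simp
  then show "\<zero>\<^bsub>op_alg\<^esub> \<in> bounded_ops"
    using bounded_opsI[of "\<lambda>x. \<zero>" 0] by (simp add: op_alg_def)
qed

lemma op_adjI: "(\<And>x y. \<lbrakk>x \<in> carrier A; y \<in> carrier A\<rbrakk> \<Longrightarrow> ip (T x) y = ip x (S y)) \<Longrightarrow> op_adj T S"
  by (simp add: op_adj_def)

lemma op_adj_arith:
  assumes S: "S \<in> carrier op_alg" and T: "T \<in> carrier op_alg"
  shows "op_adj (S \<otimes>\<^bsub>op_alg\<^esub> T) (cadj op_alg T \<otimes>\<^bsub>op_alg\<^esub> cadj op_alg S)"
    and "op_adj (S \<oplus>\<^bsub>op_alg\<^esub> T) (cadj op_alg S \<oplus>\<^bsub>op_alg\<^esub> cadj op_alg T)"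
    and "op_adj (c \<odot>\<^bsub>op_alg\<^esub> T) (cnj c \<odot>\<^bsub>op_alg\<^esub> cadj op_alg T)"
  using S T op_cadj_closed[OF S] op_cadj_closed[OF T]
  by (auto intro!: op_adjI simp: op_ip ip_add_left ip_add_right ip_smult_left ip_smult_right)

lemma op_alg_closed:
  assumes S: "S \<in> carrier op_alg" and T: "T \<in> carrier op_alg"
  shows "S \<otimes>\<^bsub>op_alg\<^esub> T \<in> carrier op_alg" "S \<oplus>\<^bsub>op_alg\<^esub> T \<in> carrier op_alg" "c \<odot>\<^bsub>op_alg\<^esub> T \<in> carrier op_alg"
  using op_algI[OF _ _ op_adj_arith(1)[OF S T]] op_algI[OF _ _ op_adj_arith(2)[OF S T]]
    op_algI[OF _ _ op_adj_arith(3)[OF T T]] op_mult_bounded(2) op_add_bounded(2) op_smult_bounded(2)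
    op_algD[OF S] op_algD[OF T] op_cadj(1)[OF S] op_cadj(1)[OF T]
  by blast+

lemma op_units: "\<one>\<^bsub>op_alg\<^esub> \<in> carrier op_alg" "\<zero>\<^bsub>op_alg\<^esub> \<in> carrier op_alg"
proof -
  show "\<one>\<^bsub>op_alg\<^esub> \<in> carrier op_alg"
    by (intro op_algI[of _ "\<one>\<^bsub>op_alg\<^esub>"] op_one_bounded op_adjI) simp
  show "\<zero>\<^bsub>op_alg\<^esub> \<in> carrier op_alg"
    by (intro op_algI[of _ "\<zero>\<^bsub>op_alg\<^esub>"] op_zero_bounded op_adjI) (simp add: ip_def)
qed

lemma star_ring_op_alg: "star_ring op_alg"
proof (intro star_ring.intro ringI star_ring_axioms.intro)
  note [simp] = op_alg_closed op_units op_cadj_closed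
  show "abelian_group op_alg"
  proof (rule abelian_groupI)
    fix T assume T: "T \<in> carrier op_alg"
    show "\<exists>S\<in>carrier op_alg. S \<oplus>\<^bsub>op_alg\<^esub> T = \<zero>\<^bsub>op_alg\<^esub>"
    proof (rule bexI[of _ "(-1) \<odot>\<^bsub>op_alg\<^esub> T"])
      show "(-1) \<odot>\<^bsub>op_alg\<^esub> T \<oplus>\<^bsub>op_alg\<^esub> T = \<zero>\<^bsub>op_alg\<^esub>"
        using T by (intro op_ext) (auto simp: smult_neg_one l_neg)
    qed (use T in simp)
  qed (auto intro!: op_ext simp: a_ac)
  show "Group.monoid op_alg"
    by (rule monoidI) (auto intro!: op_ext)
  fix S T U assume STU: "S \<in> carrier op_alg" "T \<in> carrier op_alg" "U \<in> carrier op_alg"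
  show "(S \<oplus>\<^bsub>op_alg\<^esub> T) \<otimes>\<^bsub>op_alg\<^esub> U = S \<otimes>\<^bsub>op_alg\<^esub> U \<oplus>\<^bsub>op_alg\<^esub> T \<otimes>\<^bsub>op_alg\<^esub> U"
    using STU by (intro op_ext) auto
  show "U \<otimes>\<^bsub>op_alg\<^esub> (S \<oplus>\<^bsub>op_alg\<^esub> T) = U \<otimes>\<^bsub>op_alg\<^esub> S \<oplus>\<^bsub>op_alg\<^esub> U \<otimes>\<^bsub>op_alg\<^esub> T"
    using STU by (intro op_ext) (auto simp: op_add)
next
  note [simp] = op_alg_closed op_units op_cadj_closed
  fix S T c d assume S: "S \<in> carrier op_alg"
  show "c \<odot>\<^bsub>op_alg\<^esub> S \<in> carrier op_alg" using S by simp
  show "(c + d) \<odot>\<^bsub>op_alg\<^esub> S = c \<odot>\<^bsub>op_alg\<^esub> S \<oplus>\<^bsub>op_alg\<^esub> d \<odot>\<^bsub>op_alg\<^esub> S"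
    using S by (intro op_ext) (auto simp: smult_add_left)
  show "(c * d) \<odot>\<^bsub>op_alg\<^esub> S = c \<odot>\<^bsub>op_alg\<^esub> (d \<odot>\<^bsub>op_alg\<^esub> S)"
    using S by (intro op_ext) (auto simp: smult_smult)
  show "1 \<odot>\<^bsub>op_alg\<^esub> S = S" using S by (intro op_ext) auto
  show "cadj op_alg S \<in> carrier op_alg" using S by simp
  show "cadj op_alg (cadj op_alg S) = S"
    by (rule op_cadj_eq[OF op_cadj(1)[OF S] op_algD[OF S] op_adj_sym[OF op_algD[OF S] op_cadj[OF S]]])
  show "cadj op_alg (c \<odot>\<^bsub>op_alg\<^esub> S) = cnj c \<odot>\<^bsub>op_alg\<^esub> cadj op_alg S"
    using S by (intro op_cadj_eq op_algD op_adj_arith) auto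
  assume T: "T \<in> carrier op_alg"
  show "c \<odot>\<^bsub>op_alg\<^esub> (S \<oplus>\<^bsub>op_alg\<^esub> T) = c \<odot>\<^bsub>op_alg\<^esub> S \<oplus>\<^bsub>op_alg\<^esub> c \<odot>\<^bsub>op_alg\<^esub> T"
    using S T by (intro op_ext) (auto simp: smult_add_right)
  show "(c \<odot>\<^bsub>op_alg\<^esub> S) \<otimes>\<^bsub>op_alg\<^esub> T = c \<odot>\<^bsub>op_alg\<^esub> (S \<otimes>\<^bsub>op_alg\<^esub> T)"
    using S T by (intro op_ext) auto
  show "S \<otimes>\<^bsub>op_alg\<^esub> (c \<odot>\<^bsub>op_alg\<^esub> T) = c \<odot>\<^bsub>op_alg\<^esub> (S \<otimes>\<^bsub>op_alg\<^esub> T)"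
    using S T by (intro op_ext) (auto simp: op_smult)
  show "cadj op_alg (S \<oplus>\<^bsub>op_alg\<^esub> T) = cadj op_alg S \<oplus>\<^bsub>op_alg\<^esub> cadj op_alg T"
    using S T by (intro op_cadj_eq op_algD op_adj_arith) auto
  show "cadj op_alg (S \<otimes>\<^bsub>op_alg\<^esub> T) = cadj op_alg T \<otimes>\<^bsub>op_alg\<^esub> cadj op_alg S"
    using S T by (intro op_cadj_eq op_algD op_adj_arith) auto
qed

text \<open>\<open>(nrm (S y))^2\<close> is the norm of \<open>ip (T (S y)) y\<close> for the
  adjoint \<open>S\<close>; Cauchy-Schwarz bounds it by \<open>||T|| nrm (S y) nrm y\<close>, and
  one factor is cancelled.\<close>

lemma op_norm_cadj_le: assumes T: "T \<in> carrier op_alg" shows "cnorm op_alg (cadj op_alg T) \<le> cnorm op_alg T"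
proof (rule op_norm_le)
  let ?S = "cadj op_alg T"
  note S = op_cadj_closed[OF T]
  have "nrm (?S y) \<le> cnorm op_alg T * nrm y" if y: "y \<in> carrier A" for y
  proof (cases "nrm (?S y) = 0")
    case True
    then show ?thesis using op_norm(1)[OF op_algD[OF T]] y by simp
  next
    case False
    have "(nrm (?S y))\<^sup>2 = cnorm A (ip (T (?S y)) y)"
      using T S y by (simp add: nrm_sq op_ip)
    also have "\<dots> \<le> nrm (T (?S y)) * nrm y" using T S y by (intro cnorm_ip_le) auto
    also have "\<dots> \<le> (cnorm op_alg T * nrm (?S y)) * nrm y"
      using op_norm(2)[OF op_algD[OF T]] S y by (intro mult_right_mono) auto
    finally have "nrm (?S y) * nrm (?S y) \<le> (cnorm op_alg T * nrm y) * nrm (?S y)"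
      by (simp add: power2_eq_square mult_ac)
    moreover have "nrm (?S y) > 0" using False nrm_nonneg[OF op_closed[OF S y]] by linarith
    ultimately show ?thesis by (rule mult_right_le_imp_le)
  qed
  then show "op_bound (cnorm op_alg T) ?S"
    using op_norm(1)[OF op_algD[OF T]] by (simp add: op_bound_def)
qed

lemma pre_cstar_op_alg: "pre_cstar_algebra op_alg"
proof (intro pre_cstar_algebra.intro star_ring_op_alg pre_cstar_algebra_axioms.intro)
  note [simp] = op_alg_closed op_units op_cadj_closed
  fix T assume T: "T \<in> carrier op_alg"
  note Tb = op_algD[OF T]
  show "cnorm op_alg T = 0 \<longleftrightarrow> T = \<zero>\<^bsub>op_alg\<^esub>"
  proof
    assume 0: "cnorm op_alg T = 0"
    have "T x = \<zero>" if x: "x \<in> carrier A" for x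
    proof -
      have "nrm (T x) \<le> 0" using op_norm(2)[OF Tb x] 0 by simp
      then show ?thesis
        using nrm_eq_zero[OF op_closed[OF T x]] nrm_nonneg[OF op_closed[OF T x]] by linarith
    qed
    then show "T = \<zero>\<^bsub>op_alg\<^esub>" using T by (intro op_ext) auto
  next
    assume "T = \<zero>\<^bsub>op_alg\<^esub>"
    moreover have "op_bound 0 \<zero>\<^bsub>op_alg\<^esub>"
      using nrm_smult[of \<zero> 0] by (simp add: op_bound_def)
    ultimately show "cnorm op_alg T = 0" using op_norm_le op_norm(1)[OF Tb] by fastforce
  qed
  show "cnorm op_alg (c \<odot>\<^bsub>op_alg\<^esub> T) = cmod c * cnorm op_alg T" for c
  proof (rule antisym)
    show le: "cnorm op_alg (c \<odot>\<^bsub>op_alg\<^esub> T) \<le> cmod c * cnorm op_alg T"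
      using op_norm_le[OF op_smult_bounded(1)[OF Tb]] .
    show "cmod c * cnorm op_alg T \<le> cnorm op_alg (c \<odot>\<^bsub>op_alg\<^esub> T)"
    proof (cases "c = 0")
      case True
      then show ?thesis using op_norm(1)[OF op_smult_bounded(2)[OF Tb]] by simp
    next
      case False
      have "T = inverse c \<odot>\<^bsub>op_alg\<^esub> (c \<odot>\<^bsub>op_alg\<^esub> T)"
        using T False by (intro op_ext) (auto simp flip: smult_smult)
      then have "cnorm op_alg T \<le> cmod (inverse c) * cnorm op_alg (c \<odot>\<^bsub>op_alg\<^esub> T)"
        using op_norm_le[OF op_smult_bounded(1)[OF op_smult_bounded(2)[OF Tb]]] by metis
      from mult_left_mono[OF this, of "cmod c"] show ?thesis
        using False by (simp add: norm_inverse flip: mult.assoc)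
    qed
  qed
  show "cnorm op_alg (cadj op_alg T \<otimes>\<^bsub>op_alg\<^esub> T) = (cnorm op_alg T)\<^sup>2"
  proof (rule antisym)
    have "cnorm op_alg (cadj op_alg T \<otimes>\<^bsub>op_alg\<^esub> T) \<le> cnorm op_alg (cadj op_alg T) * cnorm op_alg T"
      using op_norm_le[OF op_mult_bounded(1)[OF op_cadj(1)[OF T] Tb]] .
    also have "\<dots> \<le> cnorm op_alg T * cnorm op_alg T"
      using op_norm_cadj_le[OF T] op_norm(1)[OF Tb] by (intro mult_right_mono)
    finally show "cnorm op_alg (cadj op_alg T \<otimes>\<^bsub>op_alg\<^esub> T) \<le> (cnorm op_alg T)\<^sup>2"
      by (simp add: power2_eq_square)
    let ?M = "cnorm op_alg (cadj op_alg T \<otimes>\<^bsub>op_alg\<^esub> T)"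
    have TT: "cadj op_alg T \<otimes>\<^bsub>op_alg\<^esub> T \<in> carrier op_alg" using T by simp
    have M: "?M \<ge> 0" using op_norm(1)[OF op_algD[OF TT]] .
    have "nrm (T x) \<le> sqrt ?M * nrm x" if x: "x \<in> carrier A" for x
    proof -
      have "(nrm (T x))\<^sup>2 = cnorm A (ip x ((cadj op_alg T \<otimes>\<^bsub>op_alg\<^esub> T) x))"
        using T x by (simp add: nrm_sq op_ip)
      also have "\<dots> \<le> nrm x * nrm ((cadj op_alg T \<otimes>\<^bsub>op_alg\<^esub> T) x)"
        using T x by (intro cnorm_ip_le) auto
      also have "\<dots> \<le> nrm x * (?M * nrm x)"
        using op_norm(2)[OF op_algD[OF TT] x] x by (intro mult_left_mono) auto
      also have "\<dots> = (sqrt ?M * nrm x)\<^sup>2" using M by (simp add: power2_eq_square mult_ac)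
      finally show ?thesis using M x by (meson mult_nonneg_nonneg nrm_nonneg power2_le_imp_le real_sqrt_ge_zero)
    qed
    then have "cnorm op_alg T \<le> sqrt ?M" using M by (intro op_norm_le) (simp add: op_bound_def)
    then have "(cnorm op_alg T)\<^sup>2 \<le> (sqrt ?M)\<^sup>2" using op_norm(1)[OF Tb] by (intro power_mono)
    then show "(cnorm op_alg T)\<^sup>2 \<le> ?M" using M by simp
  qed
  fix S assume S: "S \<in> carrier op_alg"
  show "cnorm op_alg (T \<oplus>\<^bsub>op_alg\<^esub> S) \<le> cnorm op_alg T + cnorm op_alg S"
    using op_norm_le[OF op_add_bounded(1)[OF Tb op_algD[OF S]]] .
  show "cnorm op_alg (T \<otimes>\<^bsub>op_alg\<^esub> S) \<le> cnorm op_alg T * cnorm op_alg S"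
    using op_norm_le[OF op_mult_bounded(1)[OF Tb op_algD[OF S]]] .
qed

lemma op_minus_apply:
  assumes "S \<in> carrier op_alg" "T \<in> carrier op_alg" "x \<in> carrier A"
  shows "(S \<ominus>\<^bsub>op_alg\<^esub> T) x = S x \<ominus> T x"
proof -
  interpret L: pre_cstar_algebra op_alg by (rule pre_cstar_op_alg)
  have "S \<ominus>\<^bsub>op_alg\<^esub> T = S \<oplus>\<^bsub>op_alg\<^esub> ((-1) \<odot>\<^bsub>op_alg\<^esub> T)"
    using assms by (simp add: a_minus_def L.smult_neg_one)
  then show ?thesis using assms by (simp add: smult_neg_one a_minus_def)
qed

lemma clim_E: assumes "clim f l" shows "clim (\<lambda>n. E (f n)) (E l)"
proof (rule clim_le)
  have c: "f n \<in> carrier A" "l \<in> carrier A" for n using clim_carrier assms by blast+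
  then show "range (\<lambda>n. E (f n)) \<subseteq> carrier A" "E l \<in> carrier A" by auto
  show "(\<lambda>n. cnorm A (f n \<ominus> l)) \<longlonglongrightarrow> 0" using assms by (simp add: clim_def)
  show "cnorm A (E (f n) \<ominus> E l) \<le> cnorm A (f n \<ominus> l)" for n
    using E_cnorm_le[of "f n \<ominus> l"] c by (simp add: E_minus)
qed

lemma clim_ip: "\<lbrakk>clim f l; clim g k\<rbrakk> \<Longrightarrow> clim (\<lambda>n. ip (f n) (g n)) (ip l k)"
  unfolding ip_def by (intro clim_E clim_mult clim_cadj)

text \<open>Equivalence of the two norms turns an operator Cauchy sequence into pointwise Cauchy
  sequences in the complete algebra \<open>A\<close>. The limit is uniform because the Cauchy
  estimate survives the limit in one index. No adjoint of the limit is produced here: the lemma is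
  applied once more to the sequence of adjoints, which is Cauchy as well.\<close>

lemma op_pointwise_limit:
  assumes F: "\<And>n. F n \<in> carrier op_alg"
    and Cauchy: "\<And>e. e > 0 \<Longrightarrow> \<exists>N. \<forall>m\<ge>N. \<forall>n\<ge>N. cnorm op_alg (F m \<ominus>\<^bsub>op_alg\<^esub> F n) < e"
  obtains T where "T \<in> bounded_ops" "\<And>x. x \<in> carrier A \<Longrightarrow> clim (\<lambda>n. F n x) (T x)"
    "\<And>e. e > 0 \<Longrightarrow> \<exists>N. \<forall>n\<ge>N. \<forall>x\<in>carrier A. nrm (F n x \<ominus> T x) \<le> e * nrm x"
proof -
  interpret L: pre_cstar_algebra op_alg by (rule pre_cstar_op_alg)
  have diff: "nrm (F m x \<ominus> F n x) \<le> cnorm op_alg (F m \<ominus>\<^bsub>op_alg\<^esub> F n) * nrm x" if x: "x \<in> carrier A" for m n x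
    using op_norm(2)[OF op_algD x, of "F m \<ominus>\<^bsub>op_alg\<^esub> F n"] F x by (simp add: op_minus_apply)
  obtain K where K: "K > 0" "\<And>x. x \<in> carrier A \<Longrightarrow> cnorm A x \<le> K * nrm x"
    using cnorm_le_nrm by blast
  have ex: "\<exists>l. clim (\<lambda>n. F n x) l" if x: "x \<in> carrier A" for x
  proof (rule Cauchy_clim)
    show "range (\<lambda>n. F n x) \<subseteq> carrier A" using F x by auto
    fix e :: real assume "e > 0"
    define d where "d = e / (K * (nrm x + 1))"
    have nx: "nrm x + 1 > 0" using nrm_nonneg[OF x] by linarith
    have "d > 0" using \<open>e > 0\<close> K nx by (simp add: d_def)
    then obtain N where N: "\<forall>m\<ge>N. \<forall>n\<ge>N. cnorm op_alg (F m \<ominus>\<^bsub>op_alg\<^esub> F n) < d" using Cauchy by blast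
    have "cnorm A (F m x \<ominus> F n x) < e" if "m \<ge> N" "n \<ge> N" for m n
    proof -
      have "cnorm A (F m x \<ominus> F n x) \<le> K * nrm (F m x \<ominus> F n x)" using K F x by simp
      also have "\<dots> \<le> K * (d * nrm x)"
      proof (rule mult_left_mono)
        have "cnorm op_alg (F m \<ominus>\<^bsub>op_alg\<^esub> F n) \<le> d" using N that by (simp add: less_imp_le)
        then have "cnorm op_alg (F m \<ominus>\<^bsub>op_alg\<^esub> F n) * nrm x \<le> d * nrm x"
          using nrm_nonneg[OF x] by (rule mult_right_mono)
        then show "nrm (F m x \<ominus> F n x) \<le> d * nrm x" using diff[OF x, of m n] by linarith
      qed (use K in simp)
      also have "\<dots> < K * (d * (nrm x + 1))" using K \<open>d > 0\<close> by simp
      also have "\<dots> = e" using K nx by (simp add: d_def)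
      finally show ?thesis .
    qed
    then show "\<exists>N. \<forall>m\<ge>N. \<forall>n\<ge>N. cnorm A (F m x \<ominus> F n x) < e" by blast
  qed
  define T where "T = (\<lambda>x\<in>carrier A. SOME l. clim (\<lambda>n. F n x) l)"
  have T: "clim (\<lambda>n. F n x) (T x)" if "x \<in> carrier A" for x
    using someI_ex[OF ex[OF that]] that by (simp add: T_def)
  have Tc: "T x \<in> carrier A" if "x \<in> carrier A" for x using clim_carrier(2)[OF T[OF that]] .
  have unif: "\<exists>N. \<forall>n\<ge>N. \<forall>x\<in>carrier A. nrm (F n x \<ominus> T x) \<le> e * nrm x" if e: "e > 0" for e
  proof -
    obtain N where N: "\<forall>m\<ge>N. \<forall>n\<ge>N. cnorm op_alg (F m \<ominus>\<^bsub>op_alg\<^esub> F n) < e" using Cauchy[OF e] by blast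
    have "nrm (F n x \<ominus> T x) \<le> e * nrm x" if n: "n \<ge> N" and x: "x \<in> carrier A" for n x
    proof -
      have le: "nrm (F n x \<ominus> T x) \<le> e * nrm x + cnorm A (F m x \<ominus> T x)" if m: "m \<ge> N" for m
      proof -
        have eq: "F n x \<ominus> T x = (F n x \<ominus> F m x) \<oplus> (F m x \<ominus> T x)"
          by (rule minus_split[OF op_closed[OF F x] op_closed[OF F x] Tc[OF x]])
        have "nrm (F n x \<ominus> T x) \<le> nrm (F n x \<ominus> F m x) + nrm (F m x \<ominus> T x)"
          by (subst eq) (rule nrm_add[OF minus_closed[OF op_closed[OF F x] op_closed[OF F x]] minus_closed[OF op_closed[OF F x] Tc[OF x]]])
        moreover have "nrm (F n x \<ominus> F m x) \<le> e * nrm x"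
        proof -
          have "cnorm op_alg (F n \<ominus>\<^bsub>op_alg\<^esub> F m) \<le> e" using N n m by (simp add: less_imp_le)
          then have "cnorm op_alg (F n \<ominus>\<^bsub>op_alg\<^esub> F m) * nrm x \<le> e * nrm x"
            using nrm_nonneg[OF x] by (rule mult_right_mono)
          then show ?thesis using diff[OF x, of n m] by linarith
        qed
        moreover have "nrm (F m x \<ominus> T x) \<le> cnorm A (F m x \<ominus> T x)" using F x Tc by (simp add: nrm_le_cnorm)
        ultimately show ?thesis by linarith
      qed
      have "(\<lambda>m. e * nrm x + cnorm A (F m x \<ominus> T x)) \<longlonglongrightarrow> e * nrm x + 0"
        using T[OF x] by (intro tendsto_intros) (simp add: clim_def)
      then show ?thesis using LIMSEQ_le_const le by fastforce
    qed
    then show ?thesis by blast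
  qed
  obtain N where N: "\<And>x. x \<in> carrier A \<Longrightarrow> nrm (F N x \<ominus> T x) \<le> 1 * nrm x"
    using unif[of 1] by (metis le_refl zero_less_one)
  have "(\<lambda>x\<in>carrier A. T x) \<in> bounded_ops"
  proof (rule bounded_opsI)
    show "0 \<le> cnorm op_alg (F N) + 1" using op_norm(1)[OF op_algD[OF F[of N]]] by simp
    fix x assume x: "x \<in> carrier A"
    show "T x \<in> carrier A" using Tc x .
    have eq: "T x = F N x \<oplus> (-1) \<odot> (F N x \<ominus> T x)"
      by (rule eq_add_neg_minus[OF op_closed[OF F x] Tc[OF x]])
    have "nrm (T x) \<le> nrm (F N x) + nrm ((-1) \<odot> (F N x \<ominus> T x))"
      by (subst eq) (rule nrm_add[OF op_closed[OF F x] smult_closed[OF minus_closed[OF op_closed[OF F x] Tc[OF x]]]])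
    then have "nrm (T x) \<le> nrm (F N x) + nrm (F N x \<ominus> T x)"
      using F[of N] x Tc by (simp add: nrm_smult)
    then show "nrm (T x) \<le> (cnorm op_alg (F N) + 1) * nrm x"
      using N[OF x] op_norm(2)[OF op_algD[OF F[of N]] x] by (simp add: algebra_simps)
  qed
  moreover have "(\<lambda>x\<in>carrier A. T x) = T" by (auto simp: T_def)
  ultimately show thesis using that T unif by metis
qed

lemma unital_cstar_op_alg: "unital_cstar_algebra op_alg"
proof -
  interpret L: pre_cstar_algebra op_alg by (rule pre_cstar_op_alg)
  show ?thesis
  proof (rule L.unital_cstar_algebraI)
    fix F :: "nat \<Rightarrow> 'a \<Rightarrow> 'a" assume "range F \<subseteq> carrier op_alg"
      and Cauchy: "\<And>e. e > 0 \<Longrightarrow> \<exists>N. \<forall>m\<ge>N. \<forall>n\<ge>N. cnorm op_alg (F m \<ominus>\<^bsub>op_alg\<^esub> F n) < e"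
    then have F: "F n \<in> carrier op_alg" for n by auto
    obtain T where T: "T \<in> bounded_ops" "\<And>x. x \<in> carrier A \<Longrightarrow> clim (\<lambda>n. F n x) (T x)"
      "\<And>e. e > 0 \<Longrightarrow> \<exists>N. \<forall>n\<ge>N. \<forall>x\<in>carrier A. nrm (F n x \<ominus> T x) \<le> e * nrm x"
      using op_pointwise_limit[OF F Cauchy] by blast
    have "\<exists>N. \<forall>m\<ge>N. \<forall>n\<ge>N. cnorm op_alg (cadj op_alg (F m) \<ominus>\<^bsub>op_alg\<^esub> cadj op_alg (F n)) < e" if "e > 0" for e
      using Cauchy[OF that]
      by (simp only: L.cadj_minus[OF F F, symmetric] L.cnorm_cadj[OF L.minus_closed[OF F F]])
    then obtain S where S: "S \<in> bounded_ops" "\<And>x. x \<in> carrier A \<Longrightarrow> clim (\<lambda>n. cadj op_alg (F n) x) (S x)"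
      using op_pointwise_limit[of "\<lambda>n. cadj op_alg (F n)", OF L.cadj_closed[OF F]] by metis
    have "op_adj T S"
    proof (rule op_adjI)
      fix x y assume xy: "x \<in> carrier A" "y \<in> carrier A"
      have "clim (\<lambda>n. ip (F n x) y) (ip (T x) y)" using T xy by (intro clim_ip clim_const)
      moreover have "clim (\<lambda>n. ip x (cadj op_alg (F n) y)) (ip x (S y))" using S xy by (intro clim_ip clim_const)
      ultimately show "ip (T x) y = ip x (S y)" using F xy by (simp add: op_ip clim_unique)
    qed
    then have TL: "T \<in> carrier op_alg" using op_algI T S by blast
    have "L.clim F T"
      unfolding L.clim_def
    proof (intro conjI TL LIMSEQ_I)
      show "range F \<subseteq> carrier op_alg" using F by auto
      fix r :: real assume "r > 0"
      then obtain N where N: "\<forall>n\<ge>N. \<forall>x\<in>carrier A. nrm (F n x \<ominus> T x) \<le> (r/2) * nrm x" using T(3)[of "r/2"] by auto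
      have "norm (cnorm op_alg (F n \<ominus>\<^bsub>op_alg\<^esub> T) - 0) < r" if "n \<ge> N" for n
      proof -
        have "op_bound (r/2) (F n \<ominus>\<^bsub>op_alg\<^esub> T)"
          using N that \<open>r > 0\<close> F TL by (simp add: op_bound_def op_minus_apply)
        then have "cnorm op_alg (F n \<ominus>\<^bsub>op_alg\<^esub> T) < r" using op_norm_le \<open>r > 0\<close> by fastforce
        then show ?thesis using F TL by simp
      qed
      then show "\<exists>N. \<forall>n\<ge>N. norm (cnorm op_alg (F n \<ominus>\<^bsub>op_alg\<^esub> T) - 0) < r" by blast
    qed
    then show "\<exists>l. L.clim F l" by blast
  qed
qed

definition rank_one :: "'a \<Rightarrow> 'a \<Rightarrow> 'a \<Rightarrow> 'a" where
  "rank_one a b = (\<lambda>x\<in>carrier A. a \<otimes> ip b x)"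

lemma rank_one_apply [simp]: "x \<in> carrier A \<Longrightarrow> rank_one a b x = a \<otimes> ip b x"
  by (simp add: rank_one_def)

lemma rank_one:
  assumes a: "a \<in> carrier A" and b: "b \<in> carrier A"
  shows "rank_one a b \<in> carrier op_alg" "cadj op_alg (rank_one a b) = rank_one b a"
proof -
  have bd: "rank_one a b \<in> bounded_ops" if a: "a \<in> carrier A" and b: "b \<in> carrier A" for a b
    unfolding rank_one_def
  proof (rule bounded_opsI)
    show "0 \<le> cnorm A a * nrm b" using a b by simp
    fix x assume x: "x \<in> carrier A"
    show "a \<otimes> ip b x \<in> carrier A" using a b x by simp
    have "nrm (a \<otimes> ip b x) \<le> cnorm A (a \<otimes> ip b x)" using a b x by (intro nrm_le_cnorm) simp
    also have "\<dots> \<le> cnorm A a * cnorm A (ip b x)" using a b x by (intro cnorm_mult) auto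
    also have "\<dots> \<le> cnorm A a * (nrm b * nrm x)" using a b x by (intro mult_left_mono cnorm_ip_le) auto
    finally show "nrm (a \<otimes> ip b x) \<le> cnorm A a * nrm b * nrm x" by (simp add: mult.assoc)
  qed
  have adj: "op_adj (rank_one a b) (rank_one b a)"
    using a b by (intro op_adjI) (simp add: ip_mult_left ip_mult_right ip_cadj)
  show "rank_one a b \<in> carrier op_alg" using bd[OF a b] bd[OF b a] adj by (rule op_algI)
  show "cadj op_alg (rank_one a b) = rank_one b a" using bd[OF a b] bd[OF b a] adj by (rule op_cadj_eq)
qed

lemma op_alg_finsum_apply:
  assumes "F \<in> I \<rightarrow> carrier op_alg" "x \<in> carrier A"
  shows "(\<Oplus>\<^bsub>op_alg\<^esub>i\<in>I. F i) x = (\<Oplus>i\<in>I. F i x)"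
proof -
  interpret L: pre_cstar_algebra op_alg by (rule pre_cstar_op_alg)
  show ?thesis
    using finsum_additive[OF L.abelian_monoid_self abelian_monoid_self, of "\<lambda>T. T x" F I] assms by auto
qed

text \<open>The operator is \<open>rank_one a \<one>\<close> times the adjoint of that operator,
  since \<open>ip \<one> p = p\<close> for \<open>p\<close> in \<open>P\<close>.\<close>

lemma psd_rank_one:
  assumes a: "a \<in> carrier A"
  shows "unital_cstar_algebra.psd op_alg (rank_one a a)"
proof -
  interpret L: unital_cstar_algebra op_alg by (rule unital_cstar_op_alg)
  note r = rank_one[OF a one_closed] rank_one[OF one_closed a] rank_one[OF a a]
  have "rank_one a \<one> \<otimes>\<^bsub>op_alg\<^esub> cadj op_alg (rank_one a \<one>) = rank_one a a"
  proof (rule op_ext)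
    show "rank_one a \<one> \<otimes>\<^bsub>op_alg\<^esub> cadj op_alg (rank_one a \<one>) \<in> carrier op_alg" "rank_one a a \<in> carrier op_alg"
      using r by simp_all
    show "(rank_one a \<one> \<otimes>\<^bsub>op_alg\<^esub> cadj op_alg (rank_one a \<one>)) x = rank_one a a x" if x: "x \<in> carrier A" for x
    proof -
      have "ip \<one> (ip a x) = ip a x" using a x E_fix by (simp add: ip_def)
      then show ?thesis using r a x by simp
    qed
  qed
  then show ?thesis using L.psd_mult_cadj[OF r(1)] by simp
qed

text \<open>If \<open>(u, v)\<close> is a quasi-basis, then \<open>\<theta> x = \<Sum> u E(u\<^sup>* x) + \<Sum> v\<^sup>* E(v x)\<close> differs from
  \<open>2\<close> by the positive operator \<open>\<Sum> (u - v\<^sup>*) E((u - v\<^sup>*)\<^sup>* \<sqdot>)\<close>, so \<open>\<theta>\<close> has an inverse square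
  root, which maps the \<open>u\<close> and \<open>v\<^sup>*\<close> to the desired basis.\<close>

theorem symmetric_quasi_basis:
  obtains n w where "w \<in> {..<n} \<rightarrow> carrier A" "quasi_basis A E n w (\<lambda>i. cadj A (w i))"
proof -
  interpret L: unital_cstar_algebra op_alg by (rule unital_cstar_op_alg)
  obtain n u v where uv: "quasi_basis A E n u v" using index by (auto simp: finite_index_def)
  have c: "i < n \<Longrightarrow> u i \<in> carrier A" "i < n \<Longrightarrow> v i \<in> carrier A" for i
    using uv by (auto simp: quasi_basis_def)
  define d where "d i = u i \<ominus> cadj A (v i)" for i
  have d: "i < n \<Longrightarrow> d i \<in> carrier A" for i using c by (simp add: d_def)
  define K where "K = (\<Oplus>\<^bsub>op_alg\<^esub>i\<in>{..<n}. rank_one (d i) (d i))"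
  have Kf: "(\<lambda>i. rank_one (d i) (d i)) \<in> {..<n} \<rightarrow> carrier op_alg" using rank_one(1) d by auto
  have "L.psd K" unfolding K_def using d by (intro L.psd_finsum psd_rank_one) auto
  \<comment> \<open>The shift is 2 because each of the mixed sums \<open>\<Sum> u E(v x)\<close> and
    \<open>\<Sum> v^* E(u^* x)\<close> reproduces \<open>x\<close>; expanding \<open>K\<close>
    therefore gives \<open>\<theta> = 2 + K\<close>.\<close>
  obtain R where R: "R \<in> carrier op_alg" "cadj op_alg R = R"
    "R \<otimes>\<^bsub>op_alg\<^esub> (of_real 2 \<odot>\<^bsub>op_alg\<^esub> \<one>\<^bsub>op_alg\<^esub> \<oplus>\<^bsub>op_alg\<^esub> K) \<otimes>\<^bsub>op_alg\<^esub> R = \<one>\<^bsub>op_alg\<^esub>"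
    using L.psd_plus_inverse_sqrt[OF \<open>L.psd K\<close>, of 2] by auto
  \<comment> \<open>All \<open>u\<close> followed by all adjoints of the \<open>v\<close>, so that
    \<open>\<theta> x = \<Sum> z E(z^* x)\<close>. The symmetric basis has twice the original
    length.\<close>
  define z where "z k = (if k < n then u k else cadj A (v (k - n)))" for k
  have z: "z \<in> {..<n + n} \<rightarrow> carrier A" using c by (auto simp: z_def)
  have basis1: "(\<Oplus>i\<in>{..<n}. u i \<otimes> ip (cadj A (v i)) x) = x" if "x \<in> carrier A" for x
  proof -
    have "x = (\<Oplus>i\<in>{..<n}. u i \<otimes> E (v i \<otimes> x))" using uv that unfolding quasi_basis_def by blast
    also have "\<dots> = (\<Oplus>i\<in>{..<n}. u i \<otimes> ip (cadj A (v i)) x)"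
      using c that by (intro finsum_cong') (auto simp: ip_def)
    finally show ?thesis ..
  qed
  have basis2: "(\<Oplus>i\<in>{..<n}. cadj A (v i) \<otimes> ip (u i) x) = x" if x: "x \<in> carrier A" for x
  proof -
    have "cadj A x = (\<Oplus>i\<in>{..<n}. E (cadj A x \<otimes> u i) \<otimes> v i)" using uv x unfolding quasi_basis_def by blast
    then have "x = cadj A (\<Oplus>i\<in>{..<n}. E (cadj A x \<otimes> u i) \<otimes> v i)" using x cadj_cadj by metis
    also have "\<dots> = (\<Oplus>i\<in>{..<n}. cadj A (E (cadj A x \<otimes> u i) \<otimes> v i))"
      using c x by (intro cadj_finsum) auto
    also have "\<dots> = (\<Oplus>i\<in>{..<n}. cadj A (v i) \<otimes> ip (u i) x)"
      using c x by (intro finsum_cong') (auto simp: ip_def cadj_mult simp flip: E_cadj)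
    finally show ?thesis ..
  qed
  have theta: "(of_real 2 \<odot>\<^bsub>op_alg\<^esub> \<one>\<^bsub>op_alg\<^esub> \<oplus>\<^bsub>op_alg\<^esub> K) x = (\<Oplus>k\<in>{..<n + n}. z k \<otimes> ip (z k) x)"
    if x: "x \<in> carrier A" for x
  proof -
    let ?a = "\<lambda>i. u i \<otimes> ip (u i) x" and ?b = "\<lambda>i. cadj A (v i) \<otimes> ip (cadj A (v i)) x"
    let ?e = "\<lambda>i. u i \<otimes> ip (cadj A (v i)) x" and ?f = "\<lambda>i. cadj A (v i) \<otimes> ip (u i) x"
    have cl: "?a \<in> {..<n} \<rightarrow> carrier A" "?b \<in> {..<n} \<rightarrow> carrier A" "?e \<in> {..<n} \<rightarrow> carrier A" "?f \<in> {..<n} \<rightarrow> carrier A"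
      using c x by auto
    note cls = finsum_closed[OF cl(1)] finsum_closed[OF cl(2)]
    have "K x = (\<Oplus>i\<in>{..<n}. d i \<otimes> ip (d i) x)"
      unfolding K_def op_alg_finsum_apply[OF Kf x] using x d by (intro finsum_cong') auto
    also have "\<dots> = (\<Oplus>i\<in>{..<n}. (?a i \<oplus> ?b i) \<ominus> (?e i \<oplus> ?f i))"
    proof (intro finsum_cong')
      fix i assume "i \<in> {..<n}"
      then have ci: "u i \<in> carrier A" "v i \<in> carrier A" using c by auto
      have exp: "(a \<ominus> b) \<otimes> (p \<ominus> q) = (a \<otimes> p \<oplus> b \<otimes> q) \<ominus> (a \<otimes> q \<oplus> b \<otimes> p)"
        if "a \<in> carrier A" "b \<in> carrier A" "p \<in> carrier A" "q \<in> carrier A" for a b p q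
        using that by (reify star_eqs, intro seqn_holdsI; simp)
      show "d i \<otimes> ip (d i) x = (?a i \<oplus> ?b i) \<ominus> (?e i \<oplus> ?f i)"
        unfolding d_def using ci x by (simp add: ip_minus_left exp)
    qed (use c x in auto)
    also have "\<dots> = ((\<Oplus>i\<in>{..<n}. ?a i) \<oplus> (\<Oplus>i\<in>{..<n}. ?b i)) \<ominus> (x \<oplus> x)"
      using cl x by (subst finsum_minusf) (auto simp: finsum_addf basis1 basis2)
    finally have "K x = ((\<Oplus>i\<in>{..<n}. ?a i) \<oplus> (\<Oplus>i\<in>{..<n}. ?b i)) \<ominus> (x \<oplus> x)" .
    then have "(of_real 2 \<odot>\<^bsub>op_alg\<^esub> \<one>\<^bsub>op_alg\<^esub> \<oplus>\<^bsub>op_alg\<^esub> K) x =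
      of_real 2 \<odot> x \<oplus> (((\<Oplus>i\<in>{..<n}. ?a i) \<oplus> (\<Oplus>i\<in>{..<n}. ?b i)) \<ominus> (x \<oplus> x))"
      using x by simp
    also have "\<dots> = (\<Oplus>i\<in>{..<n}. ?a i) \<oplus> (\<Oplus>i\<in>{..<n}. ?b i)"
    proof -
      have "of_real 2 \<odot> x \<oplus> ((a \<oplus> b) \<ominus> (x \<oplus> x)) = a \<oplus> b" if "a \<in> carrier A" "b \<in> carrier A" for a b
        using that x by (reify star_eqs, intro seqn_holdsI; simp)
      then show ?thesis using cls by blast
    qed
    also have "\<dots> = (\<Oplus>k\<in>{..<n}. z k \<otimes> ip (z k) x) \<oplus> (\<Oplus>k\<in>{..<n}. z (n + k) \<otimes> ip (z (n + k)) x)"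
      using cl by (intro arg_cong2[where f="(\<oplus>)"] finsum_cong') (auto simp: z_def)
    also have "\<dots> = (\<Oplus>k\<in>{..<n + n}. z k \<otimes> ip (z k) x)"
      using z x by (intro finsum_lessThan_add[symmetric]) auto
    finally show ?thesis .
  qed
  define w where "w k = R (z k)" for k
  have w: "w \<in> {..<n + n} \<rightarrow> carrier A" using op_closed[OF R(1) Pi_mem[OF z]] by (simp add: w_def)
  then have wc: "k < n + n \<Longrightarrow> w k \<in> carrier A" for k by auto
  have left: "(\<Oplus>k\<in>{..<n + n}. w k \<otimes> E (cadj A (w k) \<otimes> x)) = x" if x: "x \<in> carrier A" for x
  proof -
    have Rx: "R x \<in> carrier A" using R x by simp
    \<comment> \<open>\<open>x = R \<theta> R x\<close>: the outer \<open>R\<close> moves onto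
      \<open>z\<close> by right \<open>P\<close>-linearity and the inner one by selfadjointness, so
      that \<open>w = R z\<close> appears in both places.\<close>
    have "x = (R \<otimes>\<^bsub>op_alg\<^esub> (of_real 2 \<odot>\<^bsub>op_alg\<^esub> \<one>\<^bsub>op_alg\<^esub> \<oplus>\<^bsub>op_alg\<^esub> K) \<otimes>\<^bsub>op_alg\<^esub> R) x"
      unfolding R(3) using x by simp
    also have "\<dots> = R ((of_real 2 \<odot>\<^bsub>op_alg\<^esub> \<one>\<^bsub>op_alg\<^esub> \<oplus>\<^bsub>op_alg\<^esub> K) (R x))"
      by (simp only: op_apply(1)[OF x] op_apply(1)[OF Rx])
    also have "\<dots> = R (\<Oplus>k\<in>{..<n + n}. z k \<otimes> ip (z k) (R x))" unfolding theta[OF Rx] ..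
    also have "\<dots> = (\<Oplus>k\<in>{..<n + n}. R (z k \<otimes> ip (z k) (R x)))"
      using z Rx R(1) by (intro op_finsum) auto
    also have "\<dots> = (\<Oplus>k\<in>{..<n + n}. w k \<otimes> E (cadj A (w k) \<otimes> x))"
    proof (intro finsum_cong')
      fix k assume "k \<in> {..<n + n}"
      then have zk: "z k \<in> carrier A" using z by auto
      have "ip (z k) (R x) = ip (R (z k)) x" using op_ip[OF R(1) zk x] R(2) by simp
      then show "R (z k \<otimes> ip (z k) (R x)) = w k \<otimes> E (cadj A (w k) \<otimes> x)"
        using zk x R(1) op_mult_right[OF R(1) zk, of "ip (R (z k)) x"] by (simp add: w_def ip_def)
    qed (use wc x in auto)
    finally show ?thesis ..
  qed
  \<comment> \<open>The second identity of a quasi-basis is the adjoint of the first one taken at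
    the adjoint of \<open>x\<close>.\<close>
  have right: "(\<Oplus>k\<in>{..<n + n}. E (x \<otimes> w k) \<otimes> cadj A (w k)) = x" if x: "x \<in> carrier A" for x
  proof -
    have "x = cadj A (cadj A x)" using x by simp
    also have "\<dots> = cadj A (\<Oplus>k\<in>{..<n + n}. w k \<otimes> E (cadj A (w k) \<otimes> cadj A x))"
      using left[of "cadj A x"] x by simp
    also have "\<dots> = (\<Oplus>k\<in>{..<n + n}. cadj A (w k \<otimes> E (cadj A (w k) \<otimes> cadj A x)))"
      using wc x by (intro cadj_finsum) auto
    also have "\<dots> = (\<Oplus>k\<in>{..<n + n}. E (x \<otimes> w k) \<otimes> cadj A (w k))"
      using wc x by (intro finsum_cong') (auto simp: cadj_mult simp flip: E_cadj)
    finally show ?thesis ..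
  qed
  have "quasi_basis A E (n + n) w (\<lambda>i. cadj A (w i))"
    unfolding quasi_basis_def using w left right by auto
  then show thesis using that w by blast
qed

text \<open>Expand \<open>a u\<close> in the second quasi-basis, exchange the sums and contract with
  the first. The case \<open>a = \<one>\<close> gives independence of the quasi-basis, the case of
  equal bases gives centrality of the index.\<close>

lemma quasi_basis_sums:
  assumes uv: "quasi_basis A E n u v" and uv': "quasi_basis A E m u' v'" and a: "a \<in> carrier A"
  shows "(\<Oplus>i\<in>{..<n}. a \<otimes> u i \<otimes> v i) = (\<Oplus>j\<in>{..<m}. u' j \<otimes> v' j \<otimes> a)"
proof -
  have c: "i < n \<Longrightarrow> u i \<in> carrier A" "i < n \<Longrightarrow> v i \<in> carrier A" for i
    using uv by (auto simp: quasi_basis_def)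
  have c': "i < m \<Longrightarrow> u' i \<in> carrier A" "i < m \<Longrightarrow> v' i \<in> carrier A" for i
    using uv' by (auto simp: quasi_basis_def)
  have "(\<Oplus>i\<in>{..<n}. a \<otimes> u i \<otimes> v i) = (\<Oplus>i\<in>{..<n}. (\<Oplus>j\<in>{..<m}. u' j \<otimes> E (v' j \<otimes> (a \<otimes> u i))) \<otimes> v i)"
  proof (intro finsum_cong')
    fix i assume "i \<in> {..<n}"
    then have "a \<otimes> u i \<in> carrier A" using c a by auto
    then have "a \<otimes> u i = (\<Oplus>j\<in>{..<m}. u' j \<otimes> E (v' j \<otimes> (a \<otimes> u i)))"
      using uv' unfolding quasi_basis_def by blast
    then show "a \<otimes> u i \<otimes> v i = (\<Oplus>j\<in>{..<m}. u' j \<otimes> E (v' j \<otimes> (a \<otimes> u i))) \<otimes> v i" by (rule arg_cong)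
  qed (use a c c' in \<open>auto intro!: m_closed finsum_closed\<close>)
  also have "\<dots> = (\<Oplus>i\<in>{..<n}. \<Oplus>j\<in>{..<m}. u' j \<otimes> E (v' j \<otimes> (a \<otimes> u i)) \<otimes> v i)"
    using a c c' by (intro finsum_cong') (auto intro!: m_closed finsum_closed finsum_ldistr)
  also have "\<dots> = (\<Oplus>j\<in>{..<m}. \<Oplus>i\<in>{..<n}. u' j \<otimes> E (v' j \<otimes> (a \<otimes> u i)) \<otimes> v i)"
    using a c c' by (intro finsum_swap) auto
  also have "\<dots> = (\<Oplus>j\<in>{..<m}. u' j \<otimes> (\<Oplus>i\<in>{..<n}. E ((v' j \<otimes> a) \<otimes> u i) \<otimes> v i))"
  proof (intro finsum_cong')
    fix j assume j: "j \<in> {..<m}"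
    have "u' j \<otimes> (\<Oplus>i\<in>{..<n}. E ((v' j \<otimes> a) \<otimes> u i) \<otimes> v i) = (\<Oplus>i\<in>{..<n}. u' j \<otimes> (E ((v' j \<otimes> a) \<otimes> u i) \<otimes> v i))"
      using j a c c' by (intro finsum_rdistr) auto
    also have "\<dots> = (\<Oplus>i\<in>{..<n}. u' j \<otimes> E (v' j \<otimes> (a \<otimes> u i)) \<otimes> v i)"
      using j a c c' by (intro finsum_cong') (auto simp: m_assoc)
    finally show "(\<Oplus>i\<in>{..<n}. u' j \<otimes> E (v' j \<otimes> (a \<otimes> u i)) \<otimes> v i) = u' j \<otimes> (\<Oplus>i\<in>{..<n}. E ((v' j \<otimes> a) \<otimes> u i) \<otimes> v i)" ..
  qed (use a c c' in \<open>auto intro!: m_closed finsum_closed\<close>)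
  also have "\<dots> = (\<Oplus>j\<in>{..<m}. u' j \<otimes> (v' j \<otimes> a))"
  proof (intro finsum_cong')
    fix j assume j: "j \<in> {..<m}"
    then have "v' j \<otimes> a \<in> carrier A" using c' a by auto
    then have "v' j \<otimes> a = (\<Oplus>i\<in>{..<n}. E ((v' j \<otimes> a) \<otimes> u i) \<otimes> v i)"
      using uv unfolding quasi_basis_def by blast
    then show "u' j \<otimes> (\<Oplus>i\<in>{..<n}. E ((v' j \<otimes> a) \<otimes> u i) \<otimes> v i) = u' j \<otimes> (v' j \<otimes> a)" by simp
  qed (use a c' in auto)
  also have "\<dots> = (\<Oplus>j\<in>{..<m}. u' j \<otimes> v' j \<otimes> a)"
    using a c' by (intro finsum_cong') (auto simp: m_assoc)
  finally show ?thesis .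
qed

end

section \<open>Null sequences\<close>

context pre_cstar_algebra begin

definition null_seq :: "(nat \<Rightarrow> 'a) \<Rightarrow> bool" where
  "null_seq f \<longleftrightarrow> (\<forall>n. f n \<in> carrier A) \<and> (\<lambda>n. cnorm A (f n)) \<longlonglongrightarrow> 0"

lemma null_seqD: "null_seq f \<Longrightarrow> f n \<in> carrier A" "null_seq f \<Longrightarrow> (\<lambda>n. cnorm A (f n)) \<longlonglongrightarrow> 0"
  by (auto simp: null_seq_def)

lemma null_seq_le:
  assumes "g \<longlonglongrightarrow> 0" "\<And>n. f n \<in> carrier A" "\<And>n. cnorm A (f n) \<le> g n"
  shows "null_seq f"
  unfolding null_seq_def using assms
  by (auto intro!: Lim_null_comparison[OF _ assms(1)] always_eventually)

lemma null_seq_add: "\<lbrakk>null_seq f; null_seq g\<rbrakk> \<Longrightarrow> null_seq (\<lambda>n. f n \<oplus> g n)"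
  using tendsto_add[of "\<lambda>n. cnorm A (f n)" 0 sequentially "\<lambda>n. cnorm A (g n)" 0]
  by (intro null_seq_le[of "\<lambda>n. cnorm A (f n) + cnorm A (g n)"]) (auto simp: null_seq_def cnorm_add)

lemma null_seq_smult: "null_seq f \<Longrightarrow> null_seq (\<lambda>n. k \<odot> f n)"
  by (auto simp: null_seq_def cnorm_smult intro: tendsto_mult_right_zero)

lemma null_seq_cadj: "null_seq f \<Longrightarrow> null_seq (\<lambda>n. cadj A (f n))"
  by (simp add: null_seq_def)

lemma null_seq_mult_left:
  assumes "null_seq f" "\<And>n. g n \<in> carrier A" "\<And>n. cnorm A (g n) \<le> K"
  shows "null_seq (\<lambda>n. g n \<otimes> f n)"
proof (rule null_seq_le)
  show "(\<lambda>n. K * cnorm A (f n)) \<longlonglongrightarrow> 0" using tendsto_mult_right_zero null_seqD(2)[OF assms(1)] .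
  fix n
  have f: "f n \<in> carrier A" using null_seqD[OF assms(1)] by blast
  show "g n \<otimes> f n \<in> carrier A" using f assms by simp
  have "cnorm A (g n \<otimes> f n) \<le> cnorm A (g n) * cnorm A (f n)" using f assms cnorm_mult by blast
  also have "\<dots> \<le> K * cnorm A (f n)" using f assms by (intro mult_right_mono) auto
  finally show "cnorm A (g n \<otimes> f n) \<le> K * cnorm A (f n)" .
qed

lemma null_seq_mult_right:
  assumes "null_seq f" "\<And>n. g n \<in> carrier A" "\<And>n. cnorm A (g n) \<le> K"
  shows "null_seq (\<lambda>n. f n \<otimes> g n)"
proof -
  have "null_seq (\<lambda>n. cadj A (cadj A (g n) \<otimes> cadj A (f n)))"
    using assms by (intro null_seq_cadj null_seq_mult_left[where K=K]) auto
  then show ?thesis using assms null_seqD(1)[OF assms(1)] by (simp add: cadj_mult)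
qed

lemma null_seq_zero: "null_seq (\<lambda>n. \<zero>)"
  by (simp add: null_seq_def)

lemma null_seq_finsum:
  "\<lbrakk>finite I; \<And>i. i \<in> I \<Longrightarrow> null_seq (f i)\<rbrakk> \<Longrightarrow> null_seq (\<lambda>n. \<Oplus>i\<in>I. f i n)"
proof (induction I rule: finite_induct)
  case (insert i I)
  have "(\<lambda>i. f i n) \<in> I \<rightarrow> carrier A" "f i n \<in> carrier A" for n
    using insert.prems null_seqD(1) by blast+
  then show ?case
    using insert by (simp add: null_seq_add)
qed (simp add: null_seq_zero)

lemma null_seq_cong: "\<lbrakk>null_seq f; \<And>n. f n = g n\<rbrakk> \<Longrightarrow> null_seq g"
  by (simp add: null_seq_def)

end

section \<open>The index of an expectation\<close>

context finite_index_expectation begin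

lemma null_seq_E: "null_seq f \<Longrightarrow> null_seq (\<lambda>n. E (f n))"
  by (rule null_seq_le[of "\<lambda>n. cnorm A (f n)"]) (auto simp: null_seq_def E_cnorm_le)

lemma quasi_basisD:
  assumes "quasi_basis A E n u v" "a \<in> carrier A"
  shows "(\<Oplus>i\<in>{..<n}. u i \<otimes> E (v i \<otimes> a)) = a" "(\<Oplus>i\<in>{..<n}. E (a \<otimes> u i) \<otimes> v i) = a"
proof -
  have "a = (\<Oplus>i\<in>{..<n}. u i \<otimes> E (v i \<otimes> a)) \<and> a = (\<Oplus>i\<in>{..<n}. E (a \<otimes> u i) \<otimes> v i)"
    using assms unfolding quasi_basis_def by blast
  then show "(\<Oplus>i\<in>{..<n}. u i \<otimes> E (v i \<otimes> a)) = a" "(\<Oplus>i\<in>{..<n}. E (a \<otimes> u i) \<otimes> v i) = a"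
    by presburger+
qed

lemma Index_eq:
  assumes "quasi_basis A E n u v"
  shows "Index A E = (\<Oplus>i\<in>{..<n}. u i \<otimes> v i)"
  unfolding Index_def
proof (rule the_equality)
  show "\<exists>m u' v'. quasi_basis A E m u' v' \<and> (\<Oplus>i\<in>{..<n}. u i \<otimes> v i) = (\<Oplus>i\<in>{..<m}. u' i \<otimes> v' i)"
    using assms by blast
  fix c assume "\<exists>m u' v'. quasi_basis A E m u' v' \<and> c = (\<Oplus>i\<in>{..<m}. u' i \<otimes> v' i)"
  then obtain m u' v' where *: "quasi_basis A E m u' v'" "c = (\<Oplus>i\<in>{..<m}. u' i \<otimes> v' i)" by blast
  have c: "i < n \<Longrightarrow> u i \<in> carrier A" "i < n \<Longrightarrow> v i \<in> carrier A" for i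
    using assms by (auto simp: quasi_basis_def)
  have c': "i < m \<Longrightarrow> u' i \<in> carrier A" "i < m \<Longrightarrow> v' i \<in> carrier A" for i
    using * by (auto simp: quasi_basis_def)
  have "c = (\<Oplus>i\<in>{..<m}. \<one> \<otimes> u' i \<otimes> v' i)"
    unfolding *(2) using c' by (intro finsum_cong') auto
  also have "\<dots> = (\<Oplus>i\<in>{..<n}. u i \<otimes> v i \<otimes> \<one>)" by (rule quasi_basis_sums[OF *(1) assms one_closed])
  also have "\<dots> = (\<Oplus>i\<in>{..<n}. u i \<otimes> v i)" using c by (intro finsum_cong') auto
  finally show "c = (\<Oplus>i\<in>{..<n}. u i \<otimes> v i)" .
qed

lemma Index_central:
  shows "Index A E \<in> carrier A" "a \<in> carrier A \<Longrightarrow> a \<otimes> Index A E = Index A E \<otimes> a"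
proof -
  obtain n u v where uv: "quasi_basis A E n u v" using index by (auto simp: finite_index_def)
  have c: "i < n \<Longrightarrow> u i \<in> carrier A" "i < n \<Longrightarrow> v i \<in> carrier A" for i
    using uv by (auto simp: quasi_basis_def)
  show "Index A E \<in> carrier A" unfolding Index_eq[OF uv] using c by (intro finsum_closed) auto
  assume a: "a \<in> carrier A"
  have "a \<otimes> Index A E = (\<Oplus>i\<in>{..<n}. a \<otimes> (u i \<otimes> v i))"
    unfolding Index_eq[OF uv] using a c by (intro finsum_rdistr) auto
  also have "\<dots> = (\<Oplus>i\<in>{..<n}. a \<otimes> u i \<otimes> v i)"
    using a c by (intro finsum_cong') (auto simp: m_assoc)
  also have "\<dots> = (\<Oplus>i\<in>{..<n}. u i \<otimes> v i \<otimes> a)" by (rule quasi_basis_sums[OF uv uv a])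
  also have "\<dots> = Index A E \<otimes> a"
    unfolding Index_eq[OF uv] using a c by (intro finsum_ldistr[symmetric]) auto
  finally show "a \<otimes> Index A E = Index A E \<otimes> a" .
qed

lemma Index_selfadjoint: "cadj A (Index A E) = Index A E"
proof -
  obtain n w where w: "w \<in> {..<n} \<rightarrow> carrier A" "quasi_basis A E n w (\<lambda>i. cadj A (w i))"
    using symmetric_quasi_basis .
  then have wc: "i < n \<Longrightarrow> w i \<in> carrier A" for i by auto
  show ?thesis
    unfolding Index_eq[OF w(2)] using wc
    by (subst cadj_finsum) (auto intro!: finsum_cong' simp: cadj_mult)
qed

text \<open>The index is at least 1: for a symmetric quasi-basis the positive sum \<open>k\<close>
  of the elements \<open>(w - E w) (w - E w)^*\<close> equals the index minus 1, because the two
  mixed sums and the sum of the \<open>E w (E w)^*\<close> are all 1. Centrality then makes the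
  square of an inverse root of \<open>1 + k\<close> an inverse of the index.\<close>

lemma Index_Units: "Index A E \<in> Units A"
proof -
  obtain n w where w: "w \<in> {..<n} \<rightarrow> carrier A" "quasi_basis A E n w (\<lambda>i. cadj A (w i))"
    using symmetric_quasi_basis .
  then have wc: "i < n \<Longrightarrow> w i \<in> carrier A" for i by auto
  let ?I = "Index A E"
  define k where "k = (\<Oplus>i\<in>{..<n}. (w i \<ominus> E (w i)) \<otimes> cadj A (w i \<ominus> E (w i)))"
  have psdk: "psd k" unfolding k_def using wc by (intro psd_finsum psd_mult_cadj) auto
  let ?a = "\<lambda>i. w i \<otimes> cadj A (w i)" and ?b = "\<lambda>i. E (w i) \<otimes> cadj A (E (w i))"
  let ?e = "\<lambda>i. w i \<otimes> cadj A (E (w i))" and ?f = "\<lambda>i. E (w i) \<otimes> cadj A (w i)"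
  have s1: "(\<Oplus>i\<in>{..<n}. ?e i) = \<one>"
  proof -
    have "\<one> = (\<Oplus>i\<in>{..<n}. w i \<otimes> E (cadj A (w i) \<otimes> \<one>))" using w(2) unfolding quasi_basis_def by blast
    also have "\<dots> = (\<Oplus>i\<in>{..<n}. ?e i)" using wc by (intro finsum_cong') (auto simp: E_cadj)
    finally show ?thesis ..
  qed
  have s2: "(\<Oplus>i\<in>{..<n}. ?f i) = \<one>"
  proof -
    have "\<one> = (\<Oplus>i\<in>{..<n}. E (\<one> \<otimes> w i) \<otimes> cadj A (w i))" using w(2) unfolding quasi_basis_def by blast
    also have "\<dots> = (\<Oplus>i\<in>{..<n}. ?f i)" using wc by (intro finsum_cong') auto
    finally show ?thesis ..
  qed
  have s3: "(\<Oplus>i\<in>{..<n}. ?b i) = \<one>"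
  proof -
    have "(\<Oplus>i\<in>{..<n}. ?b i) = (\<Oplus>i\<in>{..<n}. E (?e i))"
      using wc by (intro finsum_cong') (auto simp: E_mult_right)
    also have "\<dots> = E (\<Oplus>i\<in>{..<n}. ?e i)" using wc by (intro E_finsum[symmetric]) auto
    finally show ?thesis unfolding s1 by simp
  qed
  have "k = (\<Oplus>i\<in>{..<n}. (?a i \<oplus> ?b i) \<ominus> (?e i \<oplus> ?f i))"
    unfolding k_def
  proof (intro finsum_cong')
    fix i assume "i \<in> {..<n}"
    then have "w i \<in> carrier A" "E (w i) \<in> carrier A" using wc by auto
    then show "(w i \<ominus> E (w i)) \<otimes> cadj A (w i \<ominus> E (w i)) = (?a i \<oplus> ?b i) \<ominus> (?e i \<oplus> ?f i)"
      by (reify star_eqs, intro seqn_holdsI; simp)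
  qed (use wc in auto)
  also have "\<dots> = ((\<Oplus>i\<in>{..<n}. ?a i) \<oplus> (\<Oplus>i\<in>{..<n}. ?b i)) \<ominus> ((\<Oplus>i\<in>{..<n}. ?e i) \<oplus> (\<Oplus>i\<in>{..<n}. ?f i))"
    using wc by (subst finsum_minusf) (auto simp: finsum_addf)
  also have "\<dots> = ?I \<oplus> \<one> \<ominus> (\<one> \<oplus> \<one>)" unfolding s1 s2 s3 Index_eq[OF w(2)] ..
  finally have k: "k = ?I \<oplus> \<one> \<ominus> (\<one> \<oplus> \<one>)" .
  note Ic = Index_central
  have kc: "k \<in> carrier A" using psdk psdD by blast
  have I: "of_real 1 \<odot> \<one> \<oplus> k = ?I"
    unfolding k using Ic(1) by (reify star_eqs, intro seqn_holdsI; simp)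
  obtain r where r: "r \<in> carrier A" "r \<otimes> (of_real 1 \<odot> \<one> \<oplus> k) \<otimes> r = \<one>"
    using psd_plus_inverse_sqrt[OF psdk, of 1] by auto
  then have "r \<otimes> ?I \<otimes> r = \<one>" unfolding I by simp
  then have "?I \<otimes> (r \<otimes> r) = \<one>" "(r \<otimes> r) \<otimes> ?I = \<one>"
    using Ic r(1) by (simp_all add: m_assoc)
  then show ?thesis unfolding Units_def using Ic(1) r(1) by blast
qed

end

subsection \<open>Homomorphisms from Rohlin projections\<close>

text \<open>The data of the Rohlin property in terms of a representing sequence \<open>e\<close> of selfadjoint
  elements; \<open>c\<close> is the index.\<close>

locale rohlin_sequence = finite_index_expectation A P E for A :: "'a cstar_alg" (structure) and P E +
  fixes e :: "nat \<Rightarrow> 'a" and M :: real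
  assumes e_closed [simp]: "e n \<in> carrier A" and e_bound: "cnorm A (e n) \<le> M"
    and e_selfadjoint [simp]: "cadj A (e n) = e n"
    and e_idem: "null_seq (\<lambda>n. e n \<otimes> e n \<ominus> e n)"
    and e_central: "a \<in> carrier A \<Longrightarrow> null_seq (\<lambda>n. e n \<otimes> a \<ominus> a \<otimes> e n)"
    and e_expectation: "null_seq (\<lambda>n. E (e n) \<ominus> inv (Index A E))"
begin

abbreviation c where "c \<equiv> Index A E"

lemma c_closed [simp]: "c \<in> carrier A" "inv c \<in> carrier A"
  using Index_Units by auto

lemma c_inv: "c \<otimes> inv c = \<one>" "inv c \<otimes> c = \<one>"
  using Index_Units by auto

lemma M_nonneg: "M \<ge> 0"
  using e_bound[of 0] cnorm_nonneg[OF e_closed] order_trans by blast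

text \<open>The Rohlin condition exhibits \<open>inv c\<close> as a limit of the elements
  \<open>E (e n)\<close> of the closed subalgebra \<open>P\<close>.\<close>

lemma inv_c_P: "inv c \<in> P"
proof (rule closedin_clim[OF P_closed(6)])
  show "clim (\<lambda>n. E (e n)) (inv c)" using e_expectation by (auto simp: clim_def null_seq_def)
  show "E (e n) \<in> P" for n by simp
qed

text \<open>\<open>E c\<close> is another left inverse of \<open>inv c\<close>, hence equal to
  \<open>c\<close>.\<close>

lemma c_P: "c \<in> P"
proof -
  have "E c \<otimes> inv c = \<one>" using E_mult_right[OF c_closed(1) inv_c_P] c_inv by simp
  then have "E c = E c \<otimes> (inv c \<otimes> c)" "E c \<otimes> inv c \<otimes> c = c" using c_inv by simp_all
  then have "E c = c" by (simp add: m_assoc)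
  then show ?thesis using E_P[OF c_closed(1)] by simp
qed

text \<open>As \<open>c\<close> is central, vanishing in the limit means
  \<open>e y = e (c E(e y))\<close>: the relation that intertwines \<open>e\<close> with the
  homomorphism and yields its multiplicativity.\<close>

definition defect :: "nat \<Rightarrow> 'a \<Rightarrow> 'a" where
  "defect n y = e n \<otimes> y \<ominus> c \<otimes> e n \<otimes> E (e n \<otimes> y)"

lemma defect_closed [simp]: "y \<in> carrier A \<Longrightarrow> defect n y \<in> carrier A"
  by (simp add: defect_def)

text \<open>In the basic construction \<open>1 - c e e\<^sub>P e\<close> restricts to a projection on the range of \<open>e\<close>
  whose dual expectation vanishes; the following sum is that dual expectation.\<close>

lemma sum_defect:
  assumes w: "w \<in> {..<m} \<rightarrow> carrier A" "quasi_basis A E m w (\<lambda>i. cadj A (w i))"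
  shows "(\<Oplus>j\<in>{..<m}. defect n (w j) \<otimes> cadj A (defect n (w j))) =
    (-2) \<odot> (c \<otimes> e n \<otimes> (e n \<otimes> e n \<ominus> e n)) \<oplus>
    c \<otimes> c \<otimes> e n \<otimes> (E (e n \<otimes> e n \<ominus> e n) \<oplus> (E (e n) \<ominus> inv c)) \<otimes> e n"
proof -
  let ?e = "e n"
  have wc: "j < m \<Longrightarrow> w j \<in> carrier A" for j using w by auto
  note cc = Index_central(2)
  let ?f = "\<lambda>j. E (?e \<otimes> w j)"
  let ?g = "\<lambda>j. w j \<otimes> E (cadj A (w j) \<otimes> ?e)" and ?h = "\<lambda>j. ?f j \<otimes> cadj A (w j)"
  let ?k = "\<lambda>j. ?f j \<otimes> E (cadj A (w j) \<otimes> ?e)"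
  have fcadj: "cadj A (?f j) = E (cadj A (w j) \<otimes> ?e)" if "j < m" for j
    using wc[OF that] by (simp add: cadj_mult flip: E_cadj)
  have sw: "(\<Oplus>j\<in>{..<m}. w j \<otimes> cadj A (w j)) = c" using Index_eq[OF w(2)] ..
  have sg: "(\<Oplus>j\<in>{..<m}. ?g j) = ?e" and sh: "(\<Oplus>j\<in>{..<m}. ?h j) = ?e"
    using quasi_basisD[OF w(2) e_closed[of n]] by simp_all
  have sk: "(\<Oplus>j\<in>{..<m}. ?k j) = E (?e \<otimes> ?e)"
  proof -
    have "(\<Oplus>j\<in>{..<m}. ?k j) = (\<Oplus>j\<in>{..<m}. E (?h j \<otimes> ?e))"
      using wc by (intro finsum_cong') (auto simp: m_assoc E_mult_left)
    also have "\<dots> = E (\<Oplus>j\<in>{..<m}. ?h j \<otimes> ?e)" using wc by (intro E_finsum[symmetric]) auto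
    also have "(\<Oplus>j\<in>{..<m}. ?h j \<otimes> ?e) = (\<Oplus>j\<in>{..<m}. ?h j) \<otimes> ?e"
      using wc by (intro finsum_ldistr[symmetric]) auto
    finally show ?thesis unfolding sh .
  qed
  \<comment> \<open>Up to central factors \<open>c\<close>, all terms of the expanded product are
    compressed by \<open>e n\<close> from both sides, so the sums over the quasi-basis can be taken
    inside; they give \<open>c\<close>, \<open>E (e e)\<close>, \<open>e\<close> and
    \<open>e\<close>.\<close>
  define L where "L x = ?e \<otimes> x \<otimes> ?e" for x
  have L_add: "L (x \<oplus> y) = L x \<oplus> L y" if "x \<in> carrier A" "y \<in> carrier A" for x y
    using that by (simp add: L_def l_distr r_distr)
  have L_closed: "L x \<in> carrier A" if "x \<in> carrier A" for x using that by (simp add: L_def)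
  have L_sum: "L (\<Oplus>j\<in>{..<m}. f j) = (\<Oplus>j\<in>{..<m}. L (f j))" if "f \<in> {..<m} \<rightarrow> carrier A" for f
    using that by (intro finsum_additive) (auto simp: abelian_monoid_self L_add L_closed, simp add: L_def)
  have summand: "defect n (w j) \<otimes> cadj A (defect n (w j)) =
    (L (w j \<otimes> cadj A (w j)) \<oplus> c \<otimes> c \<otimes> L (?k j)) \<ominus> (c \<otimes> L (?g j) \<oplus> c \<otimes> L (?h j))" if j: "j < m" for j
  proof -
    note wj = wc[OF j]
    have fj: "?f j \<in> carrier A" using wj by simp
    have "defect n (w j) = ?e \<otimes> w j \<ominus> c \<otimes> (?e \<otimes> ?f j)" using wj by (simp add: defect_def m_assoc)
    moreover have "cadj A (defect n (w j)) = cadj A (w j) \<otimes> ?e \<ominus> c \<otimes> (cadj A (?f j) \<otimes> ?e)"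
      using wj fj Index_selfadjoint cc[of "cadj A (?f j) \<otimes> ?e"]
      by (simp add: defect_def cadj_minus cadj_mult m_assoc)
    ultimately have "defect n (w j) \<otimes> cadj A (defect n (w j)) =
      (?e \<otimes> w j \<ominus> c \<otimes> (?e \<otimes> ?f j)) \<otimes> (cadj A (w j) \<otimes> ?e) \<ominus> c \<otimes> ((?e \<otimes> w j \<ominus> c \<otimes> (?e \<otimes> ?f j)) \<otimes> (cadj A (?f j) \<otimes> ?e))"
      using wj fj cc[of "?e \<otimes> w j \<ominus> c \<otimes> (?e \<otimes> ?f j)"] by (simp add: minus_r_distr flip: m_assoc)
    also have "\<dots> = (?e \<otimes> (w j \<otimes> cadj A (w j)) \<otimes> ?e \<oplus> c \<otimes> c \<otimes> (?e \<otimes> (?f j \<otimes> cadj A (?f j)) \<otimes> ?e)) \<ominus>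
      (c \<otimes> (?e \<otimes> (w j \<otimes> cadj A (?f j)) \<otimes> ?e) \<oplus> c \<otimes> (?e \<otimes> (?f j \<otimes> cadj A (w j)) \<otimes> ?e))"
      using wj fj c_closed(1) e_closed[of n] by (reify star_eqs, intro seqn_holdsI; simp)
    finally show ?thesis unfolding L_def fcadj[OF j] .
  qed
  have cl: "(\<lambda>j. L (w j \<otimes> cadj A (w j))) \<in> {..<m} \<rightarrow> carrier A" "(\<lambda>j. L (?k j)) \<in> {..<m} \<rightarrow> carrier A"
    "(\<lambda>j. L (?g j)) \<in> {..<m} \<rightarrow> carrier A" "(\<lambda>j. L (?h j)) \<in> {..<m} \<rightarrow> carrier A"
    using wc by (auto intro!: L_closed)
  have "(\<Oplus>j\<in>{..<m}. defect n (w j) \<otimes> cadj A (defect n (w j))) =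
    (\<Oplus>j\<in>{..<m}. (L (w j \<otimes> cadj A (w j)) \<oplus> c \<otimes> c \<otimes> L (?k j)) \<ominus> (c \<otimes> L (?g j) \<oplus> c \<otimes> L (?h j)))"
    using wc by (intro finsum_cong') (auto simp: summand intro!: L_closed minus_closed a_closed m_closed)
  also have "\<dots> = ((\<Oplus>j\<in>{..<m}. L (w j \<otimes> cadj A (w j))) \<oplus> c \<otimes> c \<otimes> (\<Oplus>j\<in>{..<m}. L (?k j))) \<ominus>
    (c \<otimes> (\<Oplus>j\<in>{..<m}. L (?g j)) \<oplus> c \<otimes> (\<Oplus>j\<in>{..<m}. L (?h j)))"
    using cl by (simp add: finsum_minusf finsum_addf finsum_rdistr Pi_iff)
  also have "\<dots> = (L c \<oplus> c \<otimes> c \<otimes> L (E (?e \<otimes> ?e))) \<ominus> (c \<otimes> L ?e \<oplus> c \<otimes> L ?e)"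
    using wc by (simp add: sw sk sg sh flip: L_sum)
  \<comment> \<open>Inserting \<open>c\<close> times its inverse gives this term the same factor
    \<open>c c\<close> as the term with \<open>E (e e)\<close>, so that \<open>inv c\<close> can be
    compared with \<open>E (e e)\<close>.\<close>
  also have "L c = c \<otimes> c \<otimes> (?e \<otimes> inv c \<otimes> ?e)"
  proof -
    have "c \<otimes> c \<otimes> (?e \<otimes> inv c \<otimes> ?e) = c \<otimes> ((c \<otimes> ?e) \<otimes> inv c \<otimes> ?e)" by (simp add: m_assoc)
    also have "c \<otimes> ?e = ?e \<otimes> c" using cc[of ?e] by simp
    also have "?e \<otimes> c \<otimes> inv c \<otimes> ?e = ?e \<otimes> ?e" using c_inv by (simp add: m_assoc)
    also have "c \<otimes> (?e \<otimes> ?e) = (c \<otimes> ?e) \<otimes> ?e" by (simp add: m_assoc)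
    also have "c \<otimes> ?e = ?e \<otimes> c" using cc[of ?e] by simp
    finally show ?thesis by (simp add: L_def)
  qed
  also have "(c \<otimes> c \<otimes> (?e \<otimes> inv c \<otimes> ?e) \<oplus> c \<otimes> c \<otimes> L (E (?e \<otimes> ?e))) \<ominus> (c \<otimes> L ?e \<oplus> c \<otimes> L ?e) =
    (-2) \<odot> (c \<otimes> ?e \<otimes> (?e \<otimes> ?e \<ominus> ?e)) \<oplus>
    c \<otimes> c \<otimes> ?e \<otimes> (E (?e \<otimes> ?e \<ominus> ?e) \<oplus> (E ?e \<ominus> inv c)) \<otimes> ?e"
  proof -
    have ce: "c \<otimes> (?e \<otimes> ?e) = c \<otimes> c \<otimes> (?e \<otimes> inv c \<otimes> ?e)"
    proof -
      have "c \<otimes> c \<otimes> (?e \<otimes> inv c \<otimes> ?e) = c \<otimes> ((c \<otimes> ?e) \<otimes> inv c \<otimes> ?e)" by (simp add: m_assoc)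
      also have "c \<otimes> ?e = ?e \<otimes> c" using cc[of ?e] by simp
      also have "?e \<otimes> c \<otimes> inv c \<otimes> ?e = ?e \<otimes> ?e" using c_inv by (simp add: m_assoc)
      finally show ?thesis ..
    qed
    have "E (?e \<otimes> ?e \<ominus> ?e) \<oplus> (E ?e \<ominus> inv c) = E (?e \<otimes> ?e) \<ominus> inv c"
    proof -
      have "a \<ominus> b \<oplus> (b \<ominus> d) = a \<ominus> d" if "a \<in> carrier A" "b \<in> carrier A" "d \<in> carrier A" for a b d
        using that by (reify star_eqs, intro seqn_holdsI; simp)
      then show ?thesis by (simp add: E_minus)
    qed
    moreover have "(-2) \<odot> (c \<otimes> x \<otimes> (x \<otimes> x \<ominus> x)) \<oplus> c \<otimes> c \<otimes> x \<otimes> (y \<ominus> d) \<otimes> x =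
      ((of_real 2 \<odot> (c \<otimes> (x \<otimes> x)) \<ominus> c \<otimes> c \<otimes> (x \<otimes> d \<otimes> x)) \<oplus> c \<otimes> c \<otimes> (x \<otimes> y \<otimes> x)) \<ominus> (c \<otimes> (x \<otimes> x \<otimes> x) \<oplus> c \<otimes> (x \<otimes> x \<otimes> x))"
      if "x \<in> carrier A" "y \<in> carrier A" "d \<in> carrier A" for x y d
      using that c_closed(1) by (reify star_eqs, intro seqn_holdsI; simp)
    moreover have "of_real 2 \<odot> x \<ominus> x = x" if "x \<in> carrier A" for x
      using that by (reify star_eqs, intro seqn_holdsI; simp)
    ultimately show ?thesis
      by (simp add: L_def ce)
  qed
  finally show ?thesis .
qed

text \<open>For the members of a symmetric quasi-basis the sum just computed is null, because
  \<open>e\<close> is asymptotically idempotent and \<open>E e\<close> tends to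
  \<open>inv c\<close>; it dominates each summand. The defect is additive and right
  \<open>P\<close>-linear, so expanding \<open>y\<close> in the quasi-basis extends this to all
  \<open>y\<close>.\<close>

lemma null_seq_defect: assumes y: "y \<in> carrier A" shows "null_seq (\<lambda>n. defect n y)"
proof -
  obtain m w where w: "w \<in> {..<m} \<rightarrow> carrier A" "quasi_basis A E m w (\<lambda>i. cadj A (w i))"
    using symmetric_quasi_basis .
  then have wc: "j < m \<Longrightarrow> w j \<in> carrier A" for j by auto
  define r where "r n = (\<Oplus>j\<in>{..<m}. defect n (w j) \<otimes> cadj A (defect n (w j)))" for n
  have ce: "cnorm A (c \<otimes> e n) \<le> cnorm A c * M" and cce: "cnorm A (c \<otimes> c \<otimes> e n) \<le> cnorm A (c \<otimes> c) * M" for n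
    using cnorm_mult[of c "e n"] cnorm_mult[of "c \<otimes> c" "e n"] e_bound[of n]
      mult_left_mono[OF e_bound[of n], of "cnorm A c"] mult_left_mono[OF e_bound[of n], of "cnorm A (c \<otimes> c)"]
    by simp_all
  have "null_seq r"
    unfolding r_def sum_defect[OF w]
    by (intro null_seq_add null_seq_smult null_seq_mult_right[where K=M and g=e] null_seq_E e_idem e_expectation e_bound e_closed
      null_seq_mult_left[where K="cnorm A c * M" and g="\<lambda>n. c \<otimes> e n", OF _ _ ce]
      null_seq_mult_left[where K="cnorm A (c \<otimes> c) * M" and g="\<lambda>n. c \<otimes> c \<otimes> e n", OF _ _ cce] m_closed c_closed)
  have dw: "null_seq (\<lambda>n. defect n (w j))" if j: "j < m" for j
  proof (rule null_seq_le)
    show "(\<lambda>n. sqrt (cnorm A (r n))) \<longlonglongrightarrow> 0"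
      using tendsto_real_sqrt[OF null_seqD(2)[OF \<open>null_seq r\<close>]] by simp
    show "defect n (w j) \<in> carrier A" for n using wc j by simp
    show "cnorm A (defect n (w j)) \<le> sqrt (cnorm A (r n))" for n
      unfolding r_def using cnorm_le_sum_mult_cadj[of "{..<m}" j "\<lambda>j. defect n (w j)"] wc j
      by (simp add: real_le_rsqrt)
  qed
  have "null_seq (\<lambda>n. \<Oplus>j\<in>{..<m}. defect n (w j) \<otimes> E (cadj A (w j) \<otimes> y))"
    using wc y by (intro null_seq_finsum null_seq_mult_right[OF dw _ order_refl]) auto
  moreover have "(\<Oplus>j\<in>{..<m}. defect n (w j) \<otimes> E (cadj A (w j) \<otimes> y)) = defect n y" for n
  proof -
    define D where "D x = defect n x" for x
    have D_add: "D (x \<oplus> z) = D x \<oplus> D z" if "x \<in> carrier A" "z \<in> carrier A" for x z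
    proof -
      have "x' \<oplus> z' \<ominus> (p \<oplus> q) = (x' \<ominus> p) \<oplus> (z' \<ominus> q)"
        if "x' \<in> carrier A" "z' \<in> carrier A" "p \<in> carrier A" "q \<in> carrier A" for x' z' p q
        using that by (reify star_eqs, intro seqn_holdsI; simp)
      then show ?thesis using that by (simp add: D_def defect_def r_distr E_add)
    qed
    have D_zero: "D \<zero> = \<zero>" by (simp add: D_def defect_def a_minus_def)
    have "D y = D (\<Oplus>j\<in>{..<m}. w j \<otimes> E (cadj A (w j) \<otimes> y))"
      using quasi_basisD(1)[OF w(2) y] by simp
    also have "\<dots> = (\<Oplus>j\<in>{..<m}. D (w j \<otimes> E (cadj A (w j) \<otimes> y)))"
      using wc y by (intro finsum_additive) (auto simp: abelian_monoid_self D_add D_zero, simp add: D_def)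
    also have "\<dots> = (\<Oplus>j\<in>{..<m}. D (w j) \<otimes> E (cadj A (w j) \<otimes> y))"
    proof (intro finsum_cong')
      fix j assume "j \<in> {..<m}"
      then have "w j \<in> carrier A" "E (cadj A (w j) \<otimes> y) \<in> P" using wc y by auto
      then show "D (w j \<otimes> E (cadj A (w j) \<otimes> y)) = D (w j) \<otimes> E (cadj A (w j) \<otimes> y)"
        using E_mult_right[of "e n \<otimes> w j" "E (cadj A (w j) \<otimes> y)"] y
        by (simp add: D_def defect_def minus_l_distr m_assoc)
    qed (use wc y in \<open>auto simp: D_def\<close>)
    finally show ?thesis by (simp add: D_def)
  qed
  ultimately show ?thesis by (rule null_seq_cong)
qed

text \<open>Represents the image of \<open>x\<close> under the homomorphism into the sequence
  algebra of \<open>P\<close>.\<close>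

definition approx :: "'a \<Rightarrow> nat \<Rightarrow> 'a" where
  "approx x n = c \<otimes> E (x \<otimes> e n)"

lemma approx_P [simp, intro]: "x \<in> carrier A \<Longrightarrow> approx x n \<in> P"
  using c_P by (simp add: approx_def)

lemma approx_closed [simp]: "x \<in> carrier A \<Longrightarrow> approx x n \<in> carrier A"
  by blast

lemma cnorm_approx_le: assumes x: "x \<in> carrier A" shows "cnorm A (approx x n) \<le> cnorm A c * M * cnorm A x"
proof -
  have "cnorm A (approx x n) \<le> cnorm A c * cnorm A (E (x \<otimes> e n))"
    unfolding approx_def using x by (intro cnorm_mult) auto
  also have "\<dots> \<le> cnorm A c * (cnorm A x * M)"
  proof (rule mult_left_mono)
    have "cnorm A (E (x \<otimes> e n)) \<le> cnorm A x * cnorm A (e n)"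
      using E_cnorm_le[of "x \<otimes> e n"] cnorm_mult[of x "e n"] x by simp
    also have "\<dots> \<le> cnorm A x * M" using x e_bound by (intro mult_left_mono) auto
    finally show "cnorm A (E (x \<otimes> e n)) \<le> cnorm A x * M" .
  qed simp
  finally show ?thesis by (simp add: mult_ac)
qed

lemma approx_add: "\<lbrakk>x \<in> carrier A; y \<in> carrier A\<rbrakk> \<Longrightarrow> approx (x \<oplus> y) n = approx x n \<oplus> approx y n"
  by (simp add: approx_def l_distr r_distr E_add)

lemma approx_smult: "x \<in> carrier A \<Longrightarrow> approx (k \<odot> x) n = k \<odot> approx x n"
  by (simp add: approx_def smult_mult_left E_smult smult_mult_right)

lemma null_seq_const_mult: "\<lbrakk>null_seq f; a \<in> carrier A\<rbrakk> \<Longrightarrow> null_seq (\<lambda>n. a \<otimes> f n)"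
  by (rule null_seq_mult_left) auto

text \<open>Taking adjoints puts \<open>e\<close> on the other side of the argument of
  \<open>E\<close>, so up to the factor \<open>c\<close> the error is the image under
  \<open>E\<close> of a commutator with \<open>e\<close>.\<close>

lemma approx_cadj:
  assumes x: "x \<in> carrier A" shows "null_seq (\<lambda>n. approx (cadj A x) n \<ominus> cadj A (approx x n))"
proof -
  have "null_seq (\<lambda>n. (-1) \<odot> (c \<otimes> E (e n \<otimes> cadj A x \<ominus> cadj A x \<otimes> e n)))"
    using x by (intro null_seq_smult null_seq_const_mult null_seq_E e_central) auto
  moreover have "(-1) \<odot> (c \<otimes> E (e n \<otimes> cadj A x \<ominus> cadj A x \<otimes> e n)) = approx (cadj A x) n \<ominus> cadj A (approx x n)" for n
  proof -
    have "cadj A (approx x n) = c \<otimes> E (e n \<otimes> cadj A x)"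
      using x Index_selfadjoint Index_central(2)[of "E (e n \<otimes> cadj A x)"]
      by (simp add: approx_def cadj_mult flip: E_cadj)
    moreover have "(-1) \<odot> (c \<otimes> (a \<ominus> b)) = c \<otimes> b \<ominus> c \<otimes> a" if "a \<in> carrier A" "b \<in> carrier A" for a b
      using that c_closed(1) by (reify star_eqs, intro seqn_holdsI; simp)
    ultimately show ?thesis using x by (simp add: approx_def E_minus)
  qed
  ultimately show ?thesis by (rule null_seq_cong)
qed

text \<open>Pulling \<open>p\<close> out of \<open>E\<close> leaves \<open>p (c E(e) - 1)\<close>,
  which the Rohlin condition makes null.\<close>

lemma approx_fix:
  assumes p: "p \<in> P" shows "null_seq (\<lambda>n. approx p n \<ominus> p)"
proof -
  have "null_seq (\<lambda>n. (p \<otimes> c) \<otimes> (E (e n) \<ominus> inv c))"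
    using p by (intro null_seq_const_mult e_expectation) auto
  moreover have "(p \<otimes> c) \<otimes> (E (e n) \<ominus> inv c) = approx p n \<ominus> p" for n
  proof -
    have "(p \<otimes> c) \<otimes> (E (e n) \<ominus> inv c) = c \<otimes> (p \<otimes> E (e n)) \<ominus> p \<otimes> (c \<otimes> inv c)"
      using p Index_central(2)[of p] by (simp add: minus_r_distr flip: m_assoc)
    then show ?thesis using p c_inv by (simp add: approx_def E_mult_left)
  qed
  ultimately show ?thesis by (rule null_seq_cong)
qed

text \<open>Inside \<open>E\<close>, \<open>x y e\<close> is replaced by \<open>x e y\<close> and
  then by \<open>x e (c E(e y))\<close>; the factor \<open>c E(e y)\<close> lies in \<open>P\<close>
  and is pulled out, and finally \<open>E(e y)\<close> is replaced by \<open>E(y e)\<close>. The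
  three null terms are the errors made: a commutator, the defect, and the commutator again.\<close>

lemma approx_mult:
  assumes x: "x \<in> carrier A" and y: "y \<in> carrier A"
  shows "null_seq (\<lambda>n. approx (x \<otimes> y) n \<ominus> approx x n \<otimes> approx y n)"
proof -
  let ?k = "\<lambda>n. e n \<otimes> y \<ominus> y \<otimes> e n"
  have k: "?k n \<in> carrier A" for n using y by simp
  have "null_seq (\<lambda>n. (-1) \<odot> (c \<otimes> E (x \<otimes> ?k n)) \<oplus> c \<otimes> E (x \<otimes> defect n y) \<oplus> approx x n \<otimes> (c \<otimes> E (?k n)))"
    using x y cnorm_approx_le[OF x]
    by (intro null_seq_add null_seq_smult null_seq_const_mult null_seq_E e_central null_seq_defect
      null_seq_mult_left[where g="approx x"]) auto
  moreover have "(-1) \<odot> (c \<otimes> E (x \<otimes> ?k n)) \<oplus> c \<otimes> E (x \<otimes> defect n y) \<oplus> approx x n \<otimes> (c \<otimes> E (?k n))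
    = approx (x \<otimes> y) n \<ominus> approx x n \<otimes> approx y n" for n
  proof -
    have Eey: "E (e n \<otimes> y) \<in> P" "c \<otimes> E (e n \<otimes> y) \<in> P" using y c_P by auto
    have "x \<otimes> (c \<otimes> e n \<otimes> E (e n \<otimes> y)) = (x \<otimes> e n) \<otimes> (c \<otimes> E (e n \<otimes> y))"
      using x y Index_central(2)[of "e n"] by (simp add: m_assoc flip: Index_central(2)[of "e n"])
    then have d: "E (x \<otimes> defect n y) = E (x \<otimes> (e n \<otimes> y)) \<ominus> E (x \<otimes> e n) \<otimes> (c \<otimes> E (e n \<otimes> y))"
      using x y E_mult_right[OF _ Eey(2), of "x \<otimes> e n"] by (simp add: defect_def minus_r_distr E_minus)
    have "(-1) \<odot> (c \<otimes> (u \<ominus> v)) \<oplus> c \<otimes> (u \<ominus> s \<otimes> (c \<otimes> t)) \<oplus> (c \<otimes> s) \<otimes> (c \<otimes> (t \<ominus> r)) =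
      c \<otimes> v \<ominus> (c \<otimes> s) \<otimes> (c \<otimes> r)"
      if "u \<in> carrier A" "v \<in> carrier A" "s \<in> carrier A" "t \<in> carrier A" "r \<in> carrier A" for u v s t r
      using that c_closed(1) by (reify star_eqs, intro seqn_holdsI; simp)
    then show ?thesis
      unfolding d using x y by (simp add: approx_def E_minus minus_r_distr m_assoc)
  qed
  ultimately show ?thesis by (rule null_seq_cong)
qed

end

context unital_cstar_algebra begin

subsection \<open>Subalgebras and bounded sequences\<close>

lemma subalg_simps [simp]:
  "carrier (subalg A P) = P" "mult (subalg A P) = mult A" "add (subalg A P) = add A"
  "one (subalg A P) = \<one>" "zero (subalg A P) = \<zero>" "smult (subalg A P) = smult A"
  "cadj (subalg A P) = cadj A" "cnorm (subalg A P) = cnorm A"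
  by (simp_all add: subalg_def)

text \<open>Additive inverses are determined by the carrier, so subtraction in the subalgebra does
  not coincide with that of \<open>A\<close> by definition; in both it is addition of the multiple
  by -1.\<close>

lemma subalg_unital_cstar:
  assumes "cstar_subalgebra A P" "\<one> \<in> P"
  shows "unital_cstar_algebra (subalg A P)"
    and "\<lbrakk>x \<in> P; y \<in> P\<rbrakk> \<Longrightarrow> x \<ominus>\<^bsub>subalg A P\<^esub> y = x \<ominus> y"
proof -
  have PA: "x \<in> P \<Longrightarrow> x \<in> carrier A" for x
    using assms by (auto simp: cstar_subalgebra_def linear_subspace_def)
  have cl: "\<zero> \<in> P" "\<lbrakk>x \<in> P; y \<in> P\<rbrakk> \<Longrightarrow> x \<oplus> y \<in> P" "x \<in> P \<Longrightarrow> k \<odot> x \<in> P"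
    "\<lbrakk>x \<in> P; y \<in> P\<rbrakk> \<Longrightarrow> x \<otimes> y \<in> P" "x \<in> P \<Longrightarrow> cadj A x \<in> P" "closedin (ctopology A) P" for x y k
    using assms by (auto simp: cstar_subalgebra_def linear_subspace_def)
  have "abelian_group (subalg A P)"
  proof (rule abelian_groupI)
    show "\<exists>y\<in>carrier (subalg A P). y \<oplus>\<^bsub>subalg A P\<^esub> x = \<zero>\<^bsub>subalg A P\<^esub>" if "x \<in> carrier (subalg A P)" for x
      using that cl(3)[of x "-1"] by (auto simp: PA smult_neg_one l_neg intro!: bexI[of _ "\<ominus> x"])
  qed (use cl PA in \<open>auto simp: a_ac\<close>)
  then have "ring (subalg A P)"
    using cl PA assms(2) by (intro ringI monoidI) (auto simp: m_assoc l_distr r_distr)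
  then have "star_ring (subalg A P)"
    using cl PA by (intro star_ring.intro star_ring_axioms.intro)
      (auto simp: smult_add_left smult_add_right smult_smult smult_mult_left smult_mult_right cadj_add cadj_smult cadj_mult)
  then interpret B: pre_cstar_algebra "subalg A P"
    using PA by (intro pre_cstar_algebra.intro pre_cstar_algebra_axioms.intro)
      (auto simp: cnorm_eq_0 cnorm_add cnorm_smult cnorm_mult cnorm_cadj_mult)
  have minus: "x \<ominus>\<^bsub>subalg A P\<^esub> y = x \<ominus> y" if "x \<in> P" "y \<in> P" for x y
    using that B.smult_neg_one[of y] PA by (simp add: a_minus_def smult_neg_one)
  then show "\<lbrakk>x \<in> P; y \<in> P\<rbrakk> \<Longrightarrow> x \<ominus>\<^bsub>subalg A P\<^esub> y = x \<ominus> y" .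
  show "unital_cstar_algebra (subalg A P)"
  proof (rule B.unital_cstar_algebraI)
    fix f :: "nat \<Rightarrow> 'a" assume f: "range f \<subseteq> carrier (subalg A P)"
      and C: "\<And>e. e > 0 \<Longrightarrow> \<exists>N. \<forall>m\<ge>N. \<forall>n\<ge>N. cnorm (subalg A P) (f m \<ominus>\<^bsub>subalg A P\<^esub> f n) < e"
    have fP: "f n \<in> P" for n using f by auto
    have "\<exists>l. clim f l"
      using f C fP PA by (intro Cauchy_clim) (auto simp: minus)
    then obtain l where l: "clim f l" by blast
    then have "l \<in> P" using closedin_clim[OF cl(6)] fP by blast
    then show "\<exists>l. B.clim f l"
      using l fP by (auto simp: B.clim_def clim_def minus)
  qed
qed

lemma ell_inf_simps [simp]:
  "(f \<otimes>\<^bsub>ell_inf A\<^esub> g) = (\<lambda>n. f n \<otimes> g n)" "(f \<oplus>\<^bsub>ell_inf A\<^esub> g) = (\<lambda>n. f n \<oplus> g n)"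
  "(k \<odot>\<^bsub>ell_inf A\<^esub> f) = (\<lambda>n. k \<odot> f n)" "\<one>\<^bsub>ell_inf A\<^esub> = (\<lambda>n. \<one>)" "\<zero>\<^bsub>ell_inf A\<^esub> = (\<lambda>n. \<zero>)"
  "cadj (ell_inf A) f = (\<lambda>n. cadj A (f n))" "cnorm (ell_inf A) f = (SUP n. cnorm A (f n))"
  by (simp_all add: ell_inf_def)

lemma ell_infI: "\<lbrakk>\<And>n. f n \<in> carrier A; \<And>n. cnorm A (f n) \<le> K\<rbrakk> \<Longrightarrow> f \<in> carrier (ell_inf A)"
  by (auto simp: ell_inf_def intro!: bdd_aboveI)

lemma ell_infE:
  assumes "f \<in> carrier (ell_inf A)"
  obtains K where "K \<ge> 0" "\<And>n. f n \<in> carrier A" "\<And>n. cnorm A (f n) \<le> K"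
proof -
  obtain K where K: "\<And>n. cnorm A (f n) \<le> K" "\<And>n. f n \<in> carrier A"
    using assms by (auto simp: ell_inf_def bdd_above_def)
  then have "K \<ge> 0" using cnorm_nonneg[OF K(2)] order_trans by blast
  then show thesis using that K by blast
qed

lemma ell_inf_nth [simp]: "f \<in> carrier (ell_inf A) \<Longrightarrow> f n \<in> carrier A"
  by (auto simp: ell_inf_def)

lemma ell_inf_norm_ge: assumes "f \<in> carrier (ell_inf A)" shows "cnorm A (f n) \<le> cnorm (ell_inf A) f"
proof -
  have "bdd_above (range (\<lambda>n. cnorm A (f n)))" using assms by (simp add: ell_inf_def)
  then show ?thesis unfolding ell_inf_simps by (rule cSUP_upper[OF UNIV_I])
qed

lemma ell_inf_norm_le: "(\<And>n. cnorm A (f n) \<le> K) \<Longrightarrow> cnorm (ell_inf A) f \<le> K"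
  by (simp add: cSUP_least)

lemma ell_inf_closed:
  assumes f: "f \<in> carrier (ell_inf A)" and g: "g \<in> carrier (ell_inf A)"
  shows "(\<lambda>n. f n \<oplus> g n) \<in> carrier (ell_inf A)" "(\<lambda>n. f n \<otimes> g n) \<in> carrier (ell_inf A)"
    "(\<lambda>n. k \<odot> f n) \<in> carrier (ell_inf A)" "(\<lambda>n. cadj A (f n)) \<in> carrier (ell_inf A)"
proof -
  obtain K where K: "K \<ge> 0" "\<And>n. f n \<in> carrier A" "\<And>n. cnorm A (f n) \<le> K" using ell_infE[OF f] by blast
  obtain L where L: "L \<ge> 0" "\<And>n. g n \<in> carrier A" "\<And>n. cnorm A (g n) \<le> L" using ell_infE[OF g] by blast
  show "(\<lambda>n. f n \<oplus> g n) \<in> carrier (ell_inf A)"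
  proof (rule ell_infI)
    show "cnorm A (f n \<oplus> g n) \<le> K + L" for n
      using cnorm_add[OF K(2) L(2), of n n] K(3)[of n] L(3)[of n] by linarith
  qed (use K L in simp)
  show "(\<lambda>n. f n \<otimes> g n) \<in> carrier (ell_inf A)"
  proof (rule ell_infI)
    show "cnorm A (f n \<otimes> g n) \<le> K * L" for n
      using cnorm_mult[OF K(2) L(2), of n n] mult_mono[OF K(3)[of n] L(3)[of n] K(1)] L(2) by (meson cnorm_nonneg order_trans)
  qed (use K L in simp)
  show "(\<lambda>n. k \<odot> f n) \<in> carrier (ell_inf A)"
    using K by (intro ell_infI[of _ "cmod k * K"]) (simp_all add: cnorm_smult mult_left_mono)
  show "(\<lambda>n. cadj A (f n)) \<in> carrier (ell_inf A)"
    using K by (intro ell_infI[of _ K]) simp_all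
qed

lemma ell_inf_const: "a \<in> carrier A \<Longrightarrow> (\<lambda>n. a) \<in> carrier (ell_inf A)"
  by (rule ell_infI[of _ "cnorm A a"]) auto

lemma star_ring_ell_inf: "star_ring (ell_inf A)"
proof -
  note cl = ell_inf_closed ell_inf_const
  have "abelian_group (ell_inf A)"
  proof (rule abelian_groupI)
    show "\<exists>g\<in>carrier (ell_inf A). g \<oplus>\<^bsub>ell_inf A\<^esub> f = \<zero>\<^bsub>ell_inf A\<^esub>" if "f \<in> carrier (ell_inf A)" for f
      using that cl(3)[OF that that, of "-1"]
      by (intro bexI[of _ "\<lambda>n. (-1) \<odot> f n"]) (simp_all add: smult_neg_one l_neg)
  qed (auto simp: cl a_ac)
  then have "ring (ell_inf A)"
    by (intro ringI monoidI) (auto simp: cl m_assoc l_distr r_distr)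
  then show ?thesis
    by (intro star_ring.intro star_ring_axioms.intro)
      (auto simp: cl smult_add_left smult_add_right smult_smult smult_mult_left smult_mult_right cadj_add cadj_smult cadj_mult)
qed

lemma ell_inf_minus:
  assumes "f \<in> carrier (ell_inf A)" "g \<in> carrier (ell_inf A)"
  shows "f \<ominus>\<^bsub>ell_inf A\<^esub> g = (\<lambda>n. f n \<ominus> g n)"
proof -
  interpret L: star_ring "ell_inf A" by (rule star_ring_ell_inf)
  have "f \<ominus>\<^bsub>ell_inf A\<^esub> g = f \<oplus>\<^bsub>ell_inf A\<^esub> ((-1) \<odot>\<^bsub>ell_inf A\<^esub> g)"
    using assms by (simp only: a_minus_def L.smult_neg_one)
  then show ?thesis using assms by (simp add: smult_neg_one a_minus_def)
qed

lemma unital_cstar_ell_inf: "unital_cstar_algebra (ell_inf A)"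
proof -
  interpret L: star_ring "ell_inf A" by (rule star_ring_ell_inf)
  have nonneg: "0 \<le> cnorm (ell_inf A) f" if "f \<in> carrier (ell_inf A)" for f
    using ell_inf_norm_ge[OF that, of 0] cnorm_nonneg[OF ell_inf_nth[OF that]] order_trans by blast
  interpret L: pre_cstar_algebra "ell_inf A"
  proof
    fix f assume f: "f \<in> carrier (ell_inf A)"
    have fn: "f n \<in> carrier A" for n using f by simp
    show "cnorm (ell_inf A) f = 0 \<longleftrightarrow> f = \<zero>\<^bsub>ell_inf A\<^esub>"
    proof
      assume 0: "cnorm (ell_inf A) f = 0"
      have "cnorm A (f n) = 0" for n
        using ell_inf_norm_ge[OF f, of n] cnorm_nonneg[OF fn, of n] unfolding 0 by linarith
      then have "f n = \<zero>" for n using fn cnorm_eq_0 by blast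
      then show "f = \<zero>\<^bsub>ell_inf A\<^esub>" by auto
    qed simp
    show "cnorm (ell_inf A) (k \<odot>\<^bsub>ell_inf A\<^esub> f) = cmod k * cnorm (ell_inf A) f" for k
    proof (cases "k = 0")
      case False
      show ?thesis
      proof (rule antisym)
        show "cnorm (ell_inf A) (k \<odot>\<^bsub>ell_inf A\<^esub> f) \<le> cmod k * cnorm (ell_inf A) f"
          using ell_inf_norm_ge[OF f] fn by (intro ell_inf_norm_le) (simp add: cnorm_smult mult_left_mono)
        have "cnorm A (f n) \<le> cnorm (ell_inf A) (k \<odot>\<^bsub>ell_inf A\<^esub> f) / cmod k" for n
          using ell_inf_norm_ge[OF L.smult_closed[OF f, of k], of n] fn[of n] False
          by (simp add: cnorm_smult pos_le_divide_eq mult.commute)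
        then have "cnorm (ell_inf A) f \<le> cnorm (ell_inf A) (k \<odot>\<^bsub>ell_inf A\<^esub> f) / cmod k"
          by (rule ell_inf_norm_le)
        then show "cmod k * cnorm (ell_inf A) f \<le> cnorm (ell_inf A) (k \<odot>\<^bsub>ell_inf A\<^esub> f)"
          using False by (simp add: pos_le_divide_eq mult.commute)
      qed
    qed (use fn in simp)
    show "cnorm (ell_inf A) (cadj (ell_inf A) f \<otimes>\<^bsub>ell_inf A\<^esub> f) = (cnorm (ell_inf A) f)\<^sup>2"
    proof (rule antisym)
      show "cnorm (ell_inf A) (cadj (ell_inf A) f \<otimes>\<^bsub>ell_inf A\<^esub> f) \<le> (cnorm (ell_inf A) f)\<^sup>2"
        using ell_inf_norm_ge[OF f] fn by (intro ell_inf_norm_le) (simp add: cnorm_cadj_mult power_mono)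
      let ?g = "cadj (ell_inf A) f \<otimes>\<^bsub>ell_inf A\<^esub> f"
      have g: "?g \<in> carrier (ell_inf A)" using f by blast
      have "cnorm A (f n) \<le> sqrt (cnorm (ell_inf A) ?g)" for n
        using ell_inf_norm_ge[OF g, of n] fn by (simp add: cnorm_cadj_mult real_le_rsqrt)
      then have "cnorm (ell_inf A) f \<le> sqrt (cnorm (ell_inf A) ?g)" by (rule ell_inf_norm_le)
      then have "(cnorm (ell_inf A) f)\<^sup>2 \<le> (sqrt (cnorm (ell_inf A) ?g))\<^sup>2" using nonneg[OF f] by (rule power_mono)
      then show "(cnorm (ell_inf A) f)\<^sup>2 \<le> cnorm (ell_inf A) ?g" using nonneg[OF g] by simp
    qed
    fix g assume g: "g \<in> carrier (ell_inf A)"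
    have gn: "g n \<in> carrier A" for n using g by simp
    show "cnorm (ell_inf A) (f \<oplus>\<^bsub>ell_inf A\<^esub> g) \<le> cnorm (ell_inf A) f + cnorm (ell_inf A) g"
    proof (rule ell_inf_norm_le)
      show "cnorm A ((f \<oplus>\<^bsub>ell_inf A\<^esub> g) n) \<le> cnorm (ell_inf A) f + cnorm (ell_inf A) g" for n
        using cnorm_add[OF fn gn, of n n] ell_inf_norm_ge[OF f, of n] ell_inf_norm_ge[OF g, of n]
        unfolding ell_inf_simps(2) by linarith
    qed
    show "cnorm (ell_inf A) (f \<otimes>\<^bsub>ell_inf A\<^esub> g) \<le> cnorm (ell_inf A) f * cnorm (ell_inf A) g"
    proof (rule ell_inf_norm_le)
      show "cnorm A ((f \<otimes>\<^bsub>ell_inf A\<^esub> g) n) \<le> cnorm (ell_inf A) f * cnorm (ell_inf A) g" for n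
        using cnorm_mult[OF fn gn, of n n] mult_mono[OF ell_inf_norm_ge[OF f, of n] ell_inf_norm_ge[OF g, of n] nonneg[OF f] cnorm_nonneg[OF gn]]
        unfolding ell_inf_simps(1) by linarith
    qed
  qed
  show ?thesis
  proof (rule L.unital_cstar_algebraI)
    fix F :: "nat \<Rightarrow> nat \<Rightarrow> 'a" assume F0: "range F \<subseteq> carrier (ell_inf A)"
      and C: "\<And>e. e > 0 \<Longrightarrow> \<exists>N. \<forall>m\<ge>N. \<forall>n\<ge>N. cnorm (ell_inf A) (F m \<ominus>\<^bsub>ell_inf A\<^esub> F n) < e"
    have F: "F n \<in> carrier (ell_inf A)" for n using F0 by auto
    have Fk: "F n k \<in> carrier A" for n k using F by simp
    have diff: "cnorm A (F m k \<ominus> F n k) \<le> cnorm (ell_inf A) (F m \<ominus>\<^bsub>ell_inf A\<^esub> F n)" for m n k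
      using ell_inf_norm_ge[OF L.minus_closed[OF F F], of m n k] unfolding ell_inf_minus[OF F F] .
    have "\<exists>l. clim (\<lambda>n. F n k) l" for k
    proof (rule Cauchy_clim)
      fix e :: real assume "e > 0"
      then obtain N where "\<forall>m\<ge>N. \<forall>n\<ge>N. cnorm (ell_inf A) (F m \<ominus>\<^bsub>ell_inf A\<^esub> F n) < e" using C by blast
      then show "\<exists>N. \<forall>m\<ge>N. \<forall>n\<ge>N. cnorm A (F m k \<ominus> F n k) < e" using diff le_less_trans by blast
    qed (use Fk in auto)
    then obtain f where f: "\<And>k. clim (\<lambda>n. F n k) (f k)" by metis
    have fk: "f k \<in> carrier A" for k using clim_carrier(2)[OF f] .
    \<comment> \<open>The Cauchy estimate in the supremum norm does not depend on the coordinate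
      \<open>k\<close>, so the coordinatewise limits are attained uniformly.\<close>
    have unif: "\<exists>N. \<forall>n\<ge>N. \<forall>k. cnorm A (F n k \<ominus> f k) \<le> e" if e: "e > 0" for e
    proof -
      obtain N where N: "\<forall>m\<ge>N. \<forall>n\<ge>N. cnorm (ell_inf A) (F m \<ominus>\<^bsub>ell_inf A\<^esub> F n) < e" using C[OF e] by blast
      have "cnorm A (F n k \<ominus> f k) \<le> e" if n: "n \<ge> N" for n k
      proof -
        have "cnorm A (F n k \<ominus> f k) \<le> e + cnorm A (F m k \<ominus> f k)" if m: "m \<ge> N" for m
        proof -
          have "cnorm (ell_inf A) (F n \<ominus>\<^bsub>ell_inf A\<^esub> F m) < e" using N n m by blast
          then show ?thesis using cnorm_triangle[OF Fk[of n k] Fk[of m k] fk[of k]] diff[of n k m] by linarith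
        qed
        moreover have "(\<lambda>m. e + cnorm A (F m k \<ominus> f k)) \<longlonglongrightarrow> e + 0"
          using f[of k] by (intro tendsto_intros) (simp add: clim_def)
        ultimately show ?thesis using LIMSEQ_le_const by fastforce
      qed
      then show ?thesis by blast
    qed
    have fL: "f \<in> carrier (ell_inf A)"
    proof -
      obtain N where N: "\<And>k. cnorm A (F N k \<ominus> f k) \<le> 1" using unif[of 1] by auto
      obtain K where K: "\<And>k. cnorm A (F N k) \<le> K" using ell_infE[OF F] by metis
      have "cnorm A (f k) \<le> K + 1" for k
        using cnorm_le_diff[OF fk Fk, of k N k] N[of k] K[of k] cnorm_minus_commute[OF fk Fk, of k N k] by linarith
      then show ?thesis using fk by (intro ell_infI)
    qed
    have "L.clim F f"
      unfolding L.clim_def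
    proof (intro conjI fL F0 LIMSEQ_I)
      fix r :: real assume "r > 0"
      then obtain N where N: "\<forall>n\<ge>N. \<forall>k. cnorm A (F n k \<ominus> f k) \<le> r / 2" using unif[of "r/2"] by auto
      have "norm (cnorm (ell_inf A) (F n \<ominus>\<^bsub>ell_inf A\<^esub> f) - 0) < r" if "n \<ge> N" for n
      proof -
        have "cnorm (ell_inf A) (F n \<ominus>\<^bsub>ell_inf A\<^esub> f) \<le> r / 2"
          unfolding ell_inf_minus[OF F fL] using N that by (intro ell_inf_norm_le) blast
        moreover have "0 \<le> cnorm (ell_inf A) (F n \<ominus>\<^bsub>ell_inf A\<^esub> f)" using nonneg[OF L.minus_closed[OF F fL]] .
        ultimately show ?thesis using \<open>r > 0\<close> unfolding real_norm_def by linarith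
      qed
      then show "\<exists>N. \<forall>n\<ge>N. norm (cnorm (ell_inf A) (F n \<ominus>\<^bsub>ell_inf A\<^esub> f) - 0) < r" by blast
    qed
    then show "\<exists>l. L.clim F l" by blast
  qed
qed

subsection \<open>Asymptotic homomorphisms and their lifts\<close>

text \<open>For bounded sequences this is equality of their classes modulo null sequences. With
  representatives the quotient norm never has to be computed.\<close>

definition asym_eq :: "(nat \<Rightarrow> 'a) \<Rightarrow> (nat \<Rightarrow> 'a) \<Rightarrow> bool" where
  "asym_eq f g \<longleftrightarrow> (\<forall>n. f n \<in> carrier A) \<and> (\<forall>n. g n \<in> carrier A) \<and> null_seq (\<lambda>n. f n \<ominus> g n)"

text \<open>An asymptotic homomorphism is a *-homomorphism into \<open>A\<^sup>\<infinity>\<close>, given by representatives.\<close>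

definition asym_hom :: "'d cstar_alg \<Rightarrow> ('d \<Rightarrow> nat \<Rightarrow> 'a) \<Rightarrow> bool" where
  "asym_hom D \<phi> \<longleftrightarrow> (\<forall>x\<in>carrier D. \<phi> x \<in> carrier (ell_inf A)) \<and>
     (\<forall>x\<in>carrier D. \<forall>y\<in>carrier D. asym_eq (\<phi> (x \<oplus>\<^bsub>D\<^esub> y)) (\<lambda>n. \<phi> x n \<oplus> \<phi> y n) \<and>
        asym_eq (\<phi> (x \<otimes>\<^bsub>D\<^esub> y)) (\<lambda>n. \<phi> x n \<otimes> \<phi> y n)) \<and>
     (\<forall>k. \<forall>x\<in>carrier D. asym_eq (\<phi> (k \<odot>\<^bsub>D\<^esub> x)) (\<lambda>n. k \<odot> \<phi> x n)) \<and>
     (\<forall>x\<in>carrier D. asym_eq (\<phi> (cadj D x)) (\<lambda>n. cadj A (\<phi> x n)))"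

definition liftable :: "'d cstar_alg \<Rightarrow> ('d \<Rightarrow> nat \<Rightarrow> 'a) \<Rightarrow> bool" where
  "liftable D \<phi> \<longleftrightarrow> (\<exists>\<psi>. star_hom D (ell_inf A) \<psi> \<and> (\<forall>x\<in>carrier D. asym_eq (\<psi> x) (\<phi> x)))"

text \<open>The property is relative to the target \<open>A\<close>, the algebra of this locale; it
  is finally used with \<open>P\<close> as target. Neither the maps nor their lifts are assumed to
  be unital, so that summands and corners can be treated.\<close>

definition has_lifts :: "'d cstar_alg \<Rightarrow> bool" where
  "has_lifts D \<longleftrightarrow> (\<forall>\<phi>. asym_hom D \<phi> \<longrightarrow> liftable D \<phi>)"

lemma asym_eq_carrier: "asym_eq f g \<Longrightarrow> f n \<in> carrier A" "asym_eq f g \<Longrightarrow> g n \<in> carrier A"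
  by (auto simp: asym_eq_def)

lemma asym_eq_refl: "(\<And>n. f n \<in> carrier A) \<Longrightarrow> asym_eq f f"
  by (simp add: asym_eq_def null_seq_def a_minus_def r_neg)

lemma asym_eq_sym: "asym_eq f g \<Longrightarrow> asym_eq g f"
  by (simp add: asym_eq_def null_seq_def cnorm_minus_commute)

lemma asym_eq_trans [trans]: assumes "asym_eq f g" "asym_eq g h" shows "asym_eq f h"
proof -
  have c: "f n \<in> carrier A" "g n \<in> carrier A" "h n \<in> carrier A" for n
    using assms asym_eq_carrier by blast+
  have "null_seq (\<lambda>n. (f n \<ominus> g n) \<oplus> (g n \<ominus> h n))"
    using assms by (intro null_seq_add) (simp_all add: asym_eq_def)
  moreover have "(f n \<ominus> g n) \<oplus> (g n \<ominus> h n) = f n \<ominus> h n" for n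
    using minus_split[of "f n" "g n" "h n"] c by simp
  ultimately show ?thesis using c by (simp add: asym_eq_def)
qed

lemma asym_eq_add:
  assumes "asym_eq f g" "asym_eq f' g'" shows "asym_eq (\<lambda>n. f n \<oplus> f' n) (\<lambda>n. g n \<oplus> g' n)"
proof -
  have c: "f n \<in> carrier A" "g n \<in> carrier A" "f' n \<in> carrier A" "g' n \<in> carrier A" for n
    using assms asym_eq_carrier by blast+
  have "null_seq (\<lambda>n. (f n \<ominus> g n) \<oplus> (f' n \<ominus> g' n))"
    using assms by (intro null_seq_add) (simp_all add: asym_eq_def)
  moreover have "(f n \<ominus> g n) \<oplus> (f' n \<ominus> g' n) = (f n \<oplus> f' n) \<ominus> (g n \<oplus> g' n)" for n
  proof -
    have "(a \<ominus> b) \<oplus> (a' \<ominus> b') = (a \<oplus> a') \<ominus> (b \<oplus> b')"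
      if "a \<in> carrier A" "b \<in> carrier A" "a' \<in> carrier A" "b' \<in> carrier A" for a b a' b'
      using that by (reify star_eqs, intro seqn_holdsI; simp)
    then show ?thesis using c by simp
  qed
  ultimately show ?thesis using c by (simp add: asym_eq_def)
qed

lemma asym_eq_mult:
  assumes "asym_eq f g" "asym_eq f' g'" "g \<in> carrier (ell_inf A)" "f' \<in> carrier (ell_inf A)"
  shows "asym_eq (\<lambda>n. f n \<otimes> f' n) (\<lambda>n. g n \<otimes> g' n)"
proof -
  have c: "f n \<in> carrier A" "g n \<in> carrier A" "f' n \<in> carrier A" "g' n \<in> carrier A" for n
    using assms asym_eq_carrier by blast+
  note KL = ell_inf_norm_ge[OF assms(3)] ell_inf_norm_ge[OF assms(4)]
  have "null_seq (\<lambda>n. (f n \<ominus> g n) \<otimes> f' n \<oplus> g n \<otimes> (f' n \<ominus> g' n))"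
    using assms(1,2) c
    by (intro null_seq_add null_seq_mult_left[OF _ _ KL(1)] null_seq_mult_right[OF _ _ KL(2)])
      (simp_all add: asym_eq_def)
  moreover have "(f n \<ominus> g n) \<otimes> f' n \<oplus> g n \<otimes> (f' n \<ominus> g' n) = f n \<otimes> f' n \<ominus> g n \<otimes> g' n" for n
  proof -
    have "(a \<ominus> b) \<otimes> a' \<oplus> b \<otimes> (a' \<ominus> b') = a \<otimes> a' \<ominus> b \<otimes> b'"
      if "a \<in> carrier A" "b \<in> carrier A" "a' \<in> carrier A" "b' \<in> carrier A" for a b a' b'
      using that by (reify star_eqs, intro seqn_holdsI; simp)
    then show ?thesis using c by simp
  qed
  ultimately show ?thesis using c by (simp add: asym_eq_def)
qed

lemma asym_eq_cadj: assumes "asym_eq f g" shows "asym_eq (\<lambda>n. cadj A (f n)) (\<lambda>n. cadj A (g n))"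
proof -
  have c: "f n \<in> carrier A" "g n \<in> carrier A" for n using assms asym_eq_carrier by blast+
  have "null_seq (\<lambda>n. cadj A (f n \<ominus> g n))" using assms by (intro null_seq_cadj) (simp add: asym_eq_def)
  then show ?thesis using c by (simp add: asym_eq_def cadj_minus)
qed

lemma asym_eq_smult: assumes "asym_eq f g" shows "asym_eq (\<lambda>n. k \<odot> f n) (\<lambda>n. k \<odot> g n)"
proof -
  have c: "f n \<in> carrier A" "g n \<in> carrier A" for n using assms asym_eq_carrier by blast+
  have "null_seq (\<lambda>n. k \<odot> (f n \<ominus> g n))" using assms by (intro null_seq_smult) (simp add: asym_eq_def)
  moreover have "k \<odot> (f n \<ominus> g n) = k \<odot> f n \<ominus> k \<odot> g n" for n
  proof -
    have "k \<odot> (a \<ominus> b) = k \<odot> a \<ominus> k \<odot> b" if "a \<in> carrier A" "b \<in> carrier A" for a b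
      using that by (reify star_eqs, intro seqn_holdsI; simp)
    then show ?thesis using c by simp
  qed
  ultimately show ?thesis using c by (simp add: asym_eq_def)
qed

lemma asym_homD:
  assumes "asym_hom D \<phi>" "x \<in> carrier D"
  shows "\<phi> x \<in> carrier (ell_inf A)"
    and "y \<in> carrier D \<Longrightarrow> asym_eq (\<phi> (x \<oplus>\<^bsub>D\<^esub> y)) (\<lambda>n. \<phi> x n \<oplus> \<phi> y n)"
    and "y \<in> carrier D \<Longrightarrow> asym_eq (\<phi> (x \<otimes>\<^bsub>D\<^esub> y)) (\<lambda>n. \<phi> x n \<otimes> \<phi> y n)"
    and "asym_eq (\<phi> (k \<odot>\<^bsub>D\<^esub> x)) (\<lambda>n. k \<odot> \<phi> x n)"
    and "asym_eq (\<phi> (cadj D x)) (\<lambda>n. cadj A (\<phi> x n))"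
  using assms by (auto simp: asym_hom_def)

lemma asym_hom_comp:
  assumes "star_hom D' D f" "asym_hom D \<phi>" shows "asym_hom D' (\<lambda>x. \<phi> (f x))"
  using assms unfolding asym_hom_def star_hom_def Pi_iff by simp

lemma liftable_comp:
  assumes "star_hom D' D f" "liftable D \<phi>" shows "liftable D' (\<lambda>x. \<phi> (f x))"
proof -
  obtain \<psi> where "star_hom D (ell_inf A) \<psi>" "\<forall>x\<in>carrier D. asym_eq (\<psi> x) (\<phi> x)"
    using assms(2) by (auto simp: liftable_def)
  then show ?thesis
    using assms(1) unfolding liftable_def star_hom_def Pi_iff
    by (intro exI[of _ "\<lambda>x. \<psi> (f x)"]) (simp del: ell_inf_simps)
qed

lemma liftable_cong:
  assumes "liftable D \<phi>" "\<And>x. x \<in> carrier D \<Longrightarrow> asym_eq (\<phi> x) (\<phi>' x)"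
  shows "liftable D \<phi>'"
  using assms asym_eq_trans unfolding liftable_def by blast

text \<open>Precompose with \<open>g\<close>, lift on \<open>D\<close>, and restrict along
  \<open>f\<close>. This covers isomorphisms as well as two records with the same elements and
  operations.\<close>

lemma has_lifts_retract:
  assumes f: "star_hom D' D f" and g: "star_hom D D' g" and gf: "\<And>x. x \<in> carrier D' \<Longrightarrow> g (f x) = x"
    and "has_lifts D"
  shows "has_lifts D'"
  unfolding has_lifts_def
proof (intro allI impI)
  fix \<phi> assume \<phi>: "asym_hom D' \<phi>"
  then have "liftable D (\<lambda>x. \<phi> (g x))" using asym_hom_comp[OF g] assms(4) by (auto simp: has_lifts_def)
  then have "liftable D' (\<lambda>x. \<phi> (g (f x)))" using liftable_comp[OF f] by blast
  then show "liftable D' \<phi>"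
  proof (rule liftable_cong)
    fix x assume x: "x \<in> carrier D'"
    then have "\<phi> x n \<in> carrier A" for n using asym_homD(1)[OF \<phi>] by simp
    then show "asym_eq (\<phi> (g (f x))) (\<phi> x)" using gf[OF x] by (simp add: asym_eq_refl)
  qed
qed

text \<open>Serves the corner at the zero projection, about which flexibility asserts
  nothing.\<close>

lemma has_lifts_zero:
  assumes "carrier D = {\<zero>\<^bsub>D\<^esub>}" "0 \<odot>\<^bsub>D\<^esub> \<zero>\<^bsub>D\<^esub> = \<zero>\<^bsub>D\<^esub>"
  shows "has_lifts D"
  unfolding has_lifts_def
proof (intro allI impI)
  fix \<phi> assume \<phi>: "asym_hom D \<phi>"
  have "asym_eq (\<phi> \<zero>\<^bsub>D\<^esub>) (\<lambda>n. 0 \<odot> \<phi> \<zero>\<^bsub>D\<^esub> n)" using asym_homD(4)[OF \<phi>, of "\<zero>\<^bsub>D\<^esub>" 0] assms by simp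
  moreover have "\<phi> \<zero>\<^bsub>D\<^esub> n \<in> carrier A" for n using asym_homD(1)[OF \<phi>, of "\<zero>\<^bsub>D\<^esub>"] assms(1) by simp
  ultimately have "asym_eq (\<phi> \<zero>\<^bsub>D\<^esub>) (\<lambda>n. \<zero>)" by simp
  then have "asym_eq (\<lambda>n. \<zero>) (\<phi> \<zero>\<^bsub>D\<^esub>)" by (rule asym_eq_sym)
  moreover have "star_hom D (ell_inf A) (\<lambda>x n. \<zero>)"
    using ell_inf_const[OF zero_closed] by (simp add: star_hom_def)
  ultimately show "liftable D \<phi>" unfolding liftable_def using assms(1) by auto
qed

lemma projection_cnorm_le: assumes "projection A p" shows "cnorm A p \<le> 1"
proof -
  have "cnorm A p = (cnorm A p)\<^sup>2"
    using cnorm_cadj_mult[of p] assms by (simp add: projection_def)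
  then have "cnorm A p = 0 \<or> cnorm A p = 1" by (auto simp: power2_eq_square)
  then show ?thesis by auto
qed

text \<open>\<open>1 - p\<close> is a projection, and the C*-identity leaves only 0 and 1 as its
  norm.\<close>

lemma projection_near_one:
  assumes p: "projection A p" and lt: "cnorm A (p \<ominus> \<one>) < 1" shows "p = \<one>"
proof -
  have pA: "p \<in> carrier A" "cadj A p = p" "p \<otimes> p = p" using p by (simp_all add: projection_def)
  let ?q = "p \<ominus> \<one>"
  have "cadj A ?q \<otimes> ?q = p \<otimes> p \<ominus> p \<ominus> p \<oplus> \<one>"
    using pA(1) by (simp add: cadj_minus pA(2)) (reify star_eqs, intro seqn_holdsI; simp)
  also have "\<dots> = (-1) \<odot> ?q"
    unfolding pA(3) using pA(1) by (reify star_eqs, intro seqn_holdsI; simp)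
  finally have "cnorm A ?q = (cnorm A ?q)\<^sup>2"
    using cnorm_cadj_mult[of ?q] pA by (simp add: cnorm_smult)
  then have "cnorm A ?q = 0 \<or> cnorm A ?q = 1" by (auto simp: power2_eq_square)
  then have "cnorm A ?q = 0" using lt by auto
  then show ?thesis using pA by (simp add: cnorm_eq_0 minus_eq_zero_iff)
qed

text \<open>The witness is \<open>W = (1 - p) q (1 - q p q)\<^sup>-\<^sup>1\<^sup>/\<^sup>2\<close>\<close>

lemma orthogonalise:
  assumes p: "projection A p" and q: "projection A q" and small: "cnorm A (p \<otimes> q) \<le> 1/2"
  obtains W where "W \<in> carrier A" "cadj A W \<otimes> W = q" "p \<otimes> W = \<zero>" "W \<otimes> q = W"
    "cnorm A (W \<ominus> q) \<le> 5 * cnorm A (p \<otimes> q)"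
proof -
  have pA: "p \<in> carrier A" "cadj A p = p" "p \<otimes> p = p" and qA: "q \<in> carrier A" "cadj A q = q" "q \<otimes> q = q"
    using p q by (simp_all add: projection_def)
  have pp: "p \<otimes> (p \<otimes> y) = p \<otimes> y" and qq: "q \<otimes> (q \<otimes> y) = q \<otimes> y" if "y \<in> carrier A" for y
    using that pA qA by (simp_all flip: m_assoc)
  define x where "x = q \<otimes> p \<otimes> q"
  have x: "x \<in> carrier A" "cadj A x = x" using pA qA by (simp_all add: x_def cadj_mult m_assoc)
  have "cnorm A x \<le> cnorm A q * cnorm A (p \<otimes> q)"
    unfolding x_def using cnorm_mult[of q "p \<otimes> q"] pA qA by (simp add: m_assoc)
  also have "\<dots> \<le> 1 * cnorm A (p \<otimes> q)"
    using projection_cnorm_le[OF q] pA qA by (intro mult_right_mono) auto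
  finally have xle: "cnorm A x \<le> cnorm A (p \<otimes> q)" by simp
  then have "cnorm A x < 1" using small by simp
  then obtain r where r: "r \<in> carrier A" "cadj A r = r" "r \<otimes> (\<one> \<ominus> x) \<otimes> r = \<one>" "in_bicommutant x r"
    "cnorm A (r \<ominus> \<one>) * (1 - cnorm A x) \<le> cnorm A x"
    using inverse_sqrt_one_minus[OF x] by blast
  have "q \<otimes> x = x \<otimes> q" unfolding x_def using pA qA by (simp add: m_assoc qq)
  then have qr: "q \<otimes> r = r \<otimes> q" using in_bicommutantD[OF r(4) qA(1)] by blast
  define W where "W = (\<one> \<ominus> p) \<otimes> (q \<otimes> r)"
  have W: "W \<in> carrier A" using pA qA r by (simp add: W_def)
  \<comment> \<open>The compression of \<open>1 - p\<close> by \<open>q\<close> is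
    \<open>q - q p q = q (1 - x)\<close>. Since \<open>r\<close> commutes with \<open>q\<close> and
    is an inverse root of \<open>1 - x\<close>, multiplying by \<open>r\<close> on both sides leaves
    \<open>q\<close>.\<close>
  have "cadj A W \<otimes> W = r \<otimes> (q \<otimes> ((\<one> \<ominus> p) \<otimes> (\<one> \<ominus> p)) \<otimes> q) \<otimes> r"
    using pA(1,2) qA(1,2) r(1,2) by (simp add: W_def cadj_mult cadj_minus m_assoc)
  also have "q \<otimes> ((\<one> \<ominus> p) \<otimes> (\<one> \<ominus> p)) \<otimes> q = q \<otimes> q \<ominus> q \<otimes> p \<otimes> q \<ominus> q \<otimes> p \<otimes> q \<oplus> q \<otimes> (p \<otimes> p) \<otimes> q"
    using pA(1) qA(1) by (reify star_eqs, intro seqn_holdsI; simp)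
  also have "\<dots> = q \<otimes> (\<one> \<ominus> x)"
  proof -
    have "q \<otimes> x = x" unfolding x_def using pA qA by (simp add: m_assoc qq)
    moreover have "q \<ominus> y \<ominus> y \<oplus> y = q \<ominus> y" if "y \<in> carrier A" for y
      using that qA(1) by (reify star_eqs, intro seqn_holdsI; simp)
    ultimately show ?thesis using x(1) qA(1) by (simp add: minus_r_distr pA(3) qA(3) x_def[symmetric])
  qed
  also have "r \<otimes> (q \<otimes> (\<one> \<ominus> x)) \<otimes> r = (r \<otimes> q) \<otimes> ((\<one> \<ominus> x) \<otimes> r)"
    using r(1) qA(1) x(1) by (simp add: m_assoc)
  also have "\<dots> = q \<otimes> (r \<otimes> (\<one> \<ominus> x) \<otimes> r)"
    unfolding qr[symmetric] using r(1) qA(1) x(1) by (simp add: m_assoc)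
  finally have WW: "cadj A W \<otimes> W = q" using r(3) qA by simp
  have "p \<otimes> W = (p \<ominus> p \<otimes> p) \<otimes> (q \<otimes> r)"
    unfolding W_def using pA(1) qA(1) r(1) by (reify star_eqs, intro seqn_holdsI; simp)
  then have pW: "p \<otimes> W = \<zero>" using pA qA r by (simp add: a_minus_def r_neg)
  have Wq: "W \<otimes> q = W"
    unfolding W_def using pA(1) qA r(1) by (simp add: m_assoc qq flip: qr)
  have "W \<ominus> q = q \<otimes> (r \<ominus> \<one>) \<ominus> (p \<otimes> q) \<otimes> r"
    unfolding W_def using pA(1) qA(1) r(1) by (reify star_eqs, intro seqn_holdsI; simp)
  moreover have "r = \<one> \<oplus> (r \<ominus> \<one>)" using r(1) by (reify star_eqs, intro seqn_holdsI; simp)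
  ultimately have eq: "W \<ominus> q = q \<otimes> (r \<ominus> \<one>) \<ominus> (p \<otimes> q) \<otimes> (\<one> \<oplus> (r \<ominus> \<one>))" by simp
  let ?d = "cnorm A (r \<ominus> \<one>)" and ?s = "cnorm A (p \<otimes> q)"
  have s0: "0 \<le> ?s" "0 \<le> ?d" using pA qA r by simp_all
  have "?d * (1/2) \<le> ?d * (1 - cnorm A x)" using xle small s0 by (intro mult_left_mono) auto
  then have "?d \<le> 2 * cnorm A x" using r(5) by linarith
  then have d: "?d \<le> 2 * ?s" using xle by linarith
  have "cnorm A (W \<ominus> q) \<le> cnorm A (q \<otimes> (r \<ominus> \<one>)) + cnorm A ((p \<otimes> q) \<otimes> (\<one> \<oplus> (r \<ominus> \<one>)))"
    unfolding eq using pA qA r by (intro cnorm_minus) auto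
  also have "\<dots> \<le> 1 * ?d + ?s * (1 + ?d)"
  proof (rule add_mono)
    show "cnorm A (q \<otimes> (r \<ominus> \<one>)) \<le> 1 * ?d"
      using cnorm_mult[of q "r \<ominus> \<one>"] mult_right_mono[OF projection_cnorm_le[OF q] s0(2)] qA r by simp
    have "cnorm A (\<one> \<oplus> (r \<ominus> \<one>)) \<le> 1 + ?d"
      using cnorm_add[OF one_closed minus_closed[OF r(1) one_closed]] cnorm_one_le by linarith
    then show "cnorm A ((p \<otimes> q) \<otimes> (\<one> \<oplus> (r \<ominus> \<one>))) \<le> ?s * (1 + ?d)"
      using cnorm_mult[of "p \<otimes> q" "\<one> \<oplus> (r \<ominus> \<one>)"] mult_left_mono[OF _ s0(1)] pA qA r
      by (meson a_closed m_closed minus_closed one_closed order_trans)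
  qed
  \<comment> \<open>With \<open>?s \<le> 1/2\<close> and \<open>?d \<le> 2 * ?s\<close> the three
    terms are at most \<open>2 * ?s\<close>, \<open>?s\<close> and \<open>?s\<close>, so the
    constant 5 leaves room.\<close>
  also have "\<dots> \<le> 5 * ?s"
  proof -
    have "?s * ?d \<le> ?s * 1" using d small s0 by (intro mult_left_mono) auto
    then show ?thesis using d s0 by (simp add: algebra_simps)
  qed
  finally have "cnorm A (W \<ominus> q) \<le> 5 * ?s" .
  then show thesis using that[OF W WW pW Wq] by simp
qed

end

subsection \<open>Corners, direct sums and matrix algebras\<close>

context star_ring begin

lemma corner_simps [simp]:
  "mult (corner A p) = mult A" "add (corner A p) = add A" "one (corner A p) = p"
  "zero (corner A p) = \<zero>" "smult (corner A p) = smult A" "cadj (corner A p) = cadj A"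
  by (simp_all add: corner_def)

lemma projectionD:
  assumes "projection A p" shows "p \<in> carrier A" "p \<otimes> p = p" "cadj A p = p"
  using assms by (simp_all add: projection_def)

lemma carrier_corner:
  assumes p: "projection A p"
  shows "x \<in> carrier (corner A p) \<longleftrightarrow> x \<in> carrier A \<and> p \<otimes> x = x \<and> x \<otimes> p = x"
proof
  note pp = projectionD[OF p]
  assume "x \<in> carrier (corner A p)"
  then obtain y where y: "y \<in> carrier A" "x = p \<otimes> y \<otimes> p" by (auto simp: corner_def)
  have "p \<otimes> x = (p \<otimes> p) \<otimes> y \<otimes> p" "x \<otimes> p = p \<otimes> y \<otimes> (p \<otimes> p)"
    unfolding y(2) using y(1) pp(1) by (simp_all add: m_assoc)
  then show "x \<in> carrier A \<and> p \<otimes> x = x \<and> x \<otimes> p = x" using y pp by simp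
next
  assume "x \<in> carrier A \<and> p \<otimes> x = x \<and> x \<otimes> p = x"
  then have "x \<in> carrier A" "x = p \<otimes> x \<otimes> p" by simp_all
  then show "x \<in> carrier (corner A p)" unfolding corner_def by auto
qed

text \<open>For corners, matrix algebras and direct sums only the algebraic axioms are established:
  lifting problems involve the operations of the source, while norms occur on the target
  side.\<close>

lemma star_ring_corner:
  assumes p: "projection A p" shows "star_ring (corner A p)"
proof -
  note pp = projectionD[OF p] and [simp] = carrier_corner[OF p]
  have lin: "p \<otimes> (k \<odot> x) = k \<odot> (p \<otimes> x)" "(k \<odot> x) \<otimes> p = k \<odot> (x \<otimes> p)" if "x \<in> carrier A" for k x
    using that pp by (simp_all add: smult_mult_left smult_mult_right)
  have adj: "p \<otimes> cadj A x = cadj A (x \<otimes> p)" "cadj A x \<otimes> p = cadj A (p \<otimes> x)" if "x \<in> carrier A" for x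
    using that pp by (simp_all add: cadj_mult)
  have mul: "p \<otimes> (x \<otimes> y) = (p \<otimes> x) \<otimes> y" if "x \<in> carrier A" "y \<in> carrier A" for x y
    using that pp by (simp add: m_assoc)
  have "abelian_group (corner A p)"
  proof (rule abelian_groupI)
    show "\<exists>y\<in>carrier (corner A p). y \<oplus>\<^bsub>corner A p\<^esub> x = \<zero>\<^bsub>corner A p\<^esub>" if "x \<in> carrier (corner A p)" for x
      using that pp by (intro bexI[of _ "\<ominus> x"]) (auto simp: l_neg r_minus l_minus)
  qed (use pp in \<open>auto simp: a_ac r_distr l_distr\<close>)
  then have "ring (corner A p)"
    using pp by (intro ringI monoidI) (auto simp: m_assoc l_distr r_distr mul)
  then show ?thesis
    using pp by (intro star_ring.intro star_ring_axioms.intro)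
      (auto simp: smult_add_left smult_add_right smult_smult smult_mult_left smult_mult_right cadj_add
        cadj_smult cadj_mult lin adj)
qed

text \<open>\<open>finsum\<close> depends on the carrier of the record, so equality of the additions
  does not identify the sums at once; the inclusion is used as an additive map.\<close>

lemma corner_finsum:
  assumes p: "projection A p" and f: "f \<in> I \<rightarrow> carrier (corner A p)"
  shows "(\<Oplus>\<^bsub>corner A p\<^esub>i\<in>I. f i) = (\<Oplus>i\<in>I. f i)"
proof -
  interpret C: star_ring "corner A p" by (rule star_ring_corner[OF p])
  show ?thesis
    using finsum_additive[OF C.abelian_monoid_self abelian_monoid_self _ _ _ f, of "\<lambda>x. x"]
    by (simp add: carrier_corner[OF p] Pi_iff)
qed

lemma matrix_simps [simp]:
  "carrier (matrix_alg n A) = {..<n} \<times> {..<n} \<rightarrow>\<^sub>E carrier A"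
  "mult (matrix_alg n A) S T = (\<lambda>(i, j)\<in>{..<n} \<times> {..<n}. \<Oplus>k\<in>{..<n}. S (i, k) \<otimes> T (k, j))"
  "one (matrix_alg n A) = (\<lambda>(i, j)\<in>{..<n} \<times> {..<n}. if i = j then \<one> else \<zero>)"
  "zero (matrix_alg n A) = (\<lambda>(i, j)\<in>{..<n} \<times> {..<n}. \<zero>)"
  "add (matrix_alg n A) S T = (\<lambda>(i, j)\<in>{..<n} \<times> {..<n}. S (i, j) \<oplus> T (i, j))"
  "smult (matrix_alg n A) c T = (\<lambda>(i, j)\<in>{..<n} \<times> {..<n}. c \<odot> T (i, j))"
  "cadj (matrix_alg n A) T = (\<lambda>(i, j)\<in>{..<n} \<times> {..<n}. cadj A (T (j, i)))"
  by (simp_all add: matrix_alg_def)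

lemma matrix_entry:
  "\<lbrakk>T \<in> {..<n} \<times> {..<n} \<rightarrow>\<^sub>E carrier A; i < n; j < n\<rbrakk> \<Longrightarrow> T (i, j) \<in> carrier A"
  by auto

lemma matrix_outside:
  "\<lbrakk>T \<in> {..<n :: nat} \<times> {..<n} \<rightarrow>\<^sub>E C; \<not> (i < n \<and> j < n)\<rbrakk> \<Longrightarrow> T (i, j) = undefined"
  by (rule PiE_arb) auto

lemma matrix_ext:
  fixes n :: nat
  assumes "S \<in> {..<n} \<times> {..<n} \<rightarrow>\<^sub>E B" "T \<in> {..<n} \<times> {..<n} \<rightarrow>\<^sub>E B'"
    and "\<And>i j. \<lbrakk>i < n; j < n\<rbrakk> \<Longrightarrow> S (i, j) = T (i, j)"
  shows "S = T"
proof
  fix x :: "nat \<times> nat"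
  obtain i j where x: "x = (i, j)" by (cases x)
  show "S x = T x"
    unfolding x using assms(3)[of i j] matrix_outside[OF assms(1), of i j] matrix_outside[OF assms(2), of i j]
    by (cases "i < n \<and> j < n") auto
qed

lemma matrix_mult_closed:
  assumes "S \<in> {..<n} \<times> {..<n} \<rightarrow>\<^sub>E carrier A" "T \<in> {..<n} \<times> {..<n} \<rightarrow>\<^sub>E carrier A"
  shows "(\<lambda>(i, j)\<in>{..<n} \<times> {..<n}. \<Oplus>k\<in>{..<n}. S (i, k) \<otimes> T (k, j)) \<in> {..<n} \<times> {..<n} \<rightarrow>\<^sub>E carrier A"
  using matrix_entry[OF assms(1)] matrix_entry[OF assms(2)]
  by (auto intro!: finsum_closed)

lemma star_ring_matrix: "star_ring (matrix_alg n A)"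
proof -
  let ?M = "matrix_alg n A" and ?C = "{..<n} \<times> {..<n} \<rightarrow>\<^sub>E carrier A"
  note cl = matrix_mult_closed
  have fs: "(\<Oplus>k\<in>{..<n}. S (i, k) \<otimes> T (k, j)) \<in> carrier A"
    if "S \<in> ?C" "T \<in> ?C" "i < n" "j < n" for S T i j
    using matrix_entry[OF that(1)] matrix_entry[OF that(2)] that(3,4) by (auto intro!: finsum_closed)
  have "abelian_group ?M"
  proof (rule abelian_groupI)
    fix T assume T: "T \<in> carrier ?M"
    show "\<exists>S\<in>carrier ?M. S \<oplus>\<^bsub>?M\<^esub> T = \<zero>\<^bsub>?M\<^esub>"
    proof (rule bexI[of _ "\<lambda>(i, j)\<in>{..<n} \<times> {..<n}. \<ominus> T (i, j)"])
      show "(\<lambda>(i, j)\<in>{..<n} \<times> {..<n}. \<ominus> T (i, j)) \<oplus>\<^bsub>?M\<^esub> T = \<zero>\<^bsub>?M\<^esub>"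
        using T by (auto simp: fun_eq_iff l_neg matrix_entry)
    qed (use T in \<open>auto simp: matrix_entry\<close>)
    show "\<zero>\<^bsub>?M\<^esub> \<oplus>\<^bsub>?M\<^esub> T = T"
      using T by (auto simp: fun_eq_iff matrix_entry matrix_outside)
  qed (auto simp: matrix_entry a_ac fun_eq_iff)
  moreover have "monoid ?M"
  proof (rule monoidI)
    fix S T assume "S \<in> carrier ?M" "T \<in> carrier ?M"
    then show "S \<otimes>\<^bsub>?M\<^esub> T \<in> carrier ?M" using cl by simp
  next
    show "\<one>\<^bsub>?M\<^esub> \<in> carrier ?M" by auto
  next
    fix S T U assume S: "S \<in> carrier ?M" and T: "T \<in> carrier ?M" and U: "U \<in> carrier ?M"
    then have C: "S \<in> ?C" "T \<in> ?C" "U \<in> ?C" by simp_all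
    note e = matrix_entry[OF C(1)] matrix_entry[OF C(2)] matrix_entry[OF C(3)]
    have "(\<Oplus>k\<in>{..<n}. (\<Oplus>l\<in>{..<n}. S (i, l) \<otimes> T (l, k)) \<otimes> U (k, j)) =
      (\<Oplus>l\<in>{..<n}. S (i, l) \<otimes> (\<Oplus>k\<in>{..<n}. T (l, k) \<otimes> U (k, j)))" if ij: "i < n" "j < n" for i j
    proof -
      have "(\<Oplus>k\<in>{..<n}. (\<Oplus>l\<in>{..<n}. S (i, l) \<otimes> T (l, k)) \<otimes> U (k, j)) =
        (\<Oplus>k\<in>{..<n}. \<Oplus>l\<in>{..<n}. S (i, l) \<otimes> T (l, k) \<otimes> U (k, j))"
        using ij e by (intro finsum_cong') (auto intro!: finsum_closed finsum_ldistr)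
      also have "\<dots> = (\<Oplus>l\<in>{..<n}. \<Oplus>k\<in>{..<n}. S (i, l) \<otimes> T (l, k) \<otimes> U (k, j))"
        using ij e by (intro finsum_swap) auto
      also have "\<dots> = (\<Oplus>l\<in>{..<n}. S (i, l) \<otimes> (\<Oplus>k\<in>{..<n}. T (l, k) \<otimes> U (k, j)))"
      proof (intro finsum_cong')
        fix l assume l: "l \<in> {..<n}"
        have "S (i, l) \<otimes> (\<Oplus>k\<in>{..<n}. T (l, k) \<otimes> U (k, j)) = (\<Oplus>k\<in>{..<n}. S (i, l) \<otimes> (T (l, k) \<otimes> U (k, j)))"
          using ij e l by (intro finsum_rdistr) auto
        also have "\<dots> = (\<Oplus>k\<in>{..<n}. S (i, l) \<otimes> T (l, k) \<otimes> U (k, j))"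
          using ij e l by (intro finsum_cong') (auto simp: m_assoc)
        finally show "(\<Oplus>k\<in>{..<n}. S (i, l) \<otimes> T (l, k) \<otimes> U (k, j)) = S (i, l) \<otimes> (\<Oplus>k\<in>{..<n}. T (l, k) \<otimes> U (k, j))" ..
      qed (use ij e in \<open>auto intro!: finsum_closed m_closed\<close>)
      finally show ?thesis .
    qed
    then show "S \<otimes>\<^bsub>?M\<^esub> T \<otimes>\<^bsub>?M\<^esub> U = S \<otimes>\<^bsub>?M\<^esub> (T \<otimes>\<^bsub>?M\<^esub> U)"
      using e fs[OF C(1,2)] fs[OF C(2,3)]
      by (auto simp: fun_eq_iff cong: finsum_cong)
  next
    fix T assume T: "T \<in> carrier ?M"
    then have C: "T \<in> ?C" by simp
    note e = matrix_entry[OF C]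
    have one: "\<one>\<^bsub>?M\<^esub> \<in> ?C" by auto
    show "\<one>\<^bsub>?M\<^esub> \<otimes>\<^bsub>?M\<^esub> T = T"
    proof (rule matrix_ext)
      show "\<one>\<^bsub>?M\<^esub> \<otimes>\<^bsub>?M\<^esub> T \<in> ?C" using cl[OF one C] by simp
      fix i j assume ij: "i < n" "j < n"
      have "(\<Oplus>k\<in>{..<n}. (if i = k then \<one> else \<zero>) \<otimes> T (k, j)) = (\<Oplus>k\<in>{..<n}. if i = k then T (k, j) else \<zero>)"
        using ij e by (intro finsum_cong') auto
      also have "\<dots> = T (i, j)" using ij e by (intro finsum_singleton) auto
      finally have "(\<Oplus>k\<in>{..<n}. (if i = k then \<one> else \<zero>) \<otimes> T (k, j)) = T (i, j)" .
      moreover have "(\<Oplus>k\<in>{..<n}. \<one>\<^bsub>?M\<^esub> (i, k) \<otimes> T (k, j)) = (\<Oplus>k\<in>{..<n}. (if i = k then \<one> else \<zero>) \<otimes> T (k, j))"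
        using ij e by (intro finsum_cong') auto
      ultimately show "(\<one>\<^bsub>?M\<^esub> \<otimes>\<^bsub>?M\<^esub> T) (i, j) = T (i, j)" using ij by (simp del: matrix_simps(3))
    qed (rule C)
    show "T \<otimes>\<^bsub>?M\<^esub> \<one>\<^bsub>?M\<^esub> = T"
    proof (rule matrix_ext)
      show "T \<otimes>\<^bsub>?M\<^esub> \<one>\<^bsub>?M\<^esub> \<in> ?C" using cl[OF C one] by simp
      fix i j assume ij: "i < n" "j < n"
      have "(\<Oplus>k\<in>{..<n}. T (i, k) \<otimes> (if k = j then \<one> else \<zero>)) = (\<Oplus>k\<in>{..<n}. if j = k then T (i, k) else \<zero>)"
        using ij e by (intro finsum_cong') auto
      also have "\<dots> = T (i, j)" using ij e by (intro finsum_singleton) auto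
      finally have "(\<Oplus>k\<in>{..<n}. T (i, k) \<otimes> (if k = j then \<one> else \<zero>)) = T (i, j)" .
      moreover have "(\<Oplus>k\<in>{..<n}. T (i, k) \<otimes> \<one>\<^bsub>?M\<^esub> (k, j)) = (\<Oplus>k\<in>{..<n}. T (i, k) \<otimes> (if k = j then \<one> else \<zero>))"
        using ij e by (intro finsum_cong') auto
      ultimately show "(T \<otimes>\<^bsub>?M\<^esub> \<one>\<^bsub>?M\<^esub>) (i, j) = T (i, j)" using ij by (simp del: matrix_simps(3))
    qed (rule C)
  qed
  moreover have "(S \<oplus>\<^bsub>?M\<^esub> T) \<otimes>\<^bsub>?M\<^esub> U = S \<otimes>\<^bsub>?M\<^esub> U \<oplus>\<^bsub>?M\<^esub> T \<otimes>\<^bsub>?M\<^esub> U"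
    "U \<otimes>\<^bsub>?M\<^esub> (S \<oplus>\<^bsub>?M\<^esub> T) = U \<otimes>\<^bsub>?M\<^esub> S \<oplus>\<^bsub>?M\<^esub> U \<otimes>\<^bsub>?M\<^esub> T"
    if STU: "S \<in> carrier ?M" "T \<in> carrier ?M" "U \<in> carrier ?M" for S T U
  proof -
    have C: "S \<in> ?C" "T \<in> ?C" "U \<in> ?C" using STU by simp_all
    note e = matrix_entry[OF C(1)] matrix_entry[OF C(2)] matrix_entry[OF C(3)]
    have "(\<Oplus>k\<in>{..<n}. (S (i, k) \<oplus> T (i, k)) \<otimes> U (k, j)) =
      (\<Oplus>k\<in>{..<n}. S (i, k) \<otimes> U (k, j)) \<oplus> (\<Oplus>k\<in>{..<n}. T (i, k) \<otimes> U (k, j))" if ij: "i < n" "j < n" for i j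
    proof -
      have "(\<Oplus>k\<in>{..<n}. (S (i, k) \<oplus> T (i, k)) \<otimes> U (k, j)) = (\<Oplus>k\<in>{..<n}. S (i, k) \<otimes> U (k, j) \<oplus> T (i, k) \<otimes> U (k, j))"
        using ij e by (intro finsum_cong') (auto simp: l_distr)
      also have "\<dots> = (\<Oplus>k\<in>{..<n}. S (i, k) \<otimes> U (k, j)) \<oplus> (\<Oplus>k\<in>{..<n}. T (i, k) \<otimes> U (k, j))"
        using ij e by (intro finsum_addf) auto
      finally show ?thesis .
    qed
    then show "(S \<oplus>\<^bsub>?M\<^esub> T) \<otimes>\<^bsub>?M\<^esub> U = S \<otimes>\<^bsub>?M\<^esub> U \<oplus>\<^bsub>?M\<^esub> T \<otimes>\<^bsub>?M\<^esub> U"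
      using e by (auto simp: fun_eq_iff cong: finsum_cong)
    have "(\<Oplus>k\<in>{..<n}. U (i, k) \<otimes> (S (k, j) \<oplus> T (k, j))) =
      (\<Oplus>k\<in>{..<n}. U (i, k) \<otimes> S (k, j)) \<oplus> (\<Oplus>k\<in>{..<n}. U (i, k) \<otimes> T (k, j))" if ij: "i < n" "j < n" for i j
    proof -
      have "(\<Oplus>k\<in>{..<n}. U (i, k) \<otimes> (S (k, j) \<oplus> T (k, j))) = (\<Oplus>k\<in>{..<n}. U (i, k) \<otimes> S (k, j) \<oplus> U (i, k) \<otimes> T (k, j))"
        using ij e by (intro finsum_cong') (auto simp: r_distr)
      also have "\<dots> = (\<Oplus>k\<in>{..<n}. U (i, k) \<otimes> S (k, j)) \<oplus> (\<Oplus>k\<in>{..<n}. U (i, k) \<otimes> T (k, j))"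
        using ij e by (intro finsum_addf) auto
      finally show ?thesis .
    qed
    then show "U \<otimes>\<^bsub>?M\<^esub> (S \<oplus>\<^bsub>?M\<^esub> T) = U \<otimes>\<^bsub>?M\<^esub> S \<oplus>\<^bsub>?M\<^esub> U \<otimes>\<^bsub>?M\<^esub> T"
      using e by (auto simp: fun_eq_iff cong: finsum_cong)
  qed
  ultimately have ring: "ring ?M" by (intro ringI)
  have fsm: "(\<Oplus>k\<in>{..<n}. c \<odot> f k) = c \<odot> (\<Oplus>k\<in>{..<n}. f k)" if "f \<in> {..<n} \<rightarrow> carrier A" for c f
    using that by (intro finsum_additive[symmetric]) (auto simp: abelian_monoid_self smult_add_right)
  show ?thesis
  proof (intro star_ring.intro ring star_ring_axioms.intro)
    fix S T c assume S: "S \<in> carrier ?M" and T: "T \<in> carrier ?M"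
    then have C: "S \<in> ?C" "T \<in> ?C" by simp_all
    note e = matrix_entry[OF C(1)] matrix_entry[OF C(2)]
    have "(\<Oplus>k\<in>{..<n}. (c \<odot> S (i, k)) \<otimes> T (k, j)) = c \<odot> (\<Oplus>k\<in>{..<n}. S (i, k) \<otimes> T (k, j))"
      if "i < n" "j < n" for i j
      using that e by (subst fsm[symmetric]) (auto intro!: finsum_cong' simp: smult_mult_left)
    then show "(c \<odot>\<^bsub>?M\<^esub> S) \<otimes>\<^bsub>?M\<^esub> T = c \<odot>\<^bsub>?M\<^esub> (S \<otimes>\<^bsub>?M\<^esub> T)"
      using e by (auto simp: fun_eq_iff cong: finsum_cong)
    have "(\<Oplus>k\<in>{..<n}. S (i, k) \<otimes> (c \<odot> T (k, j))) = c \<odot> (\<Oplus>k\<in>{..<n}. S (i, k) \<otimes> T (k, j))"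
      if "i < n" "j < n" for i j
      using that e by (subst fsm[symmetric]) (auto intro!: finsum_cong' simp: smult_mult_right)
    then show "S \<otimes>\<^bsub>?M\<^esub> (c \<odot>\<^bsub>?M\<^esub> T) = c \<odot>\<^bsub>?M\<^esub> (S \<otimes>\<^bsub>?M\<^esub> T)"
      using e by (auto simp: fun_eq_iff cong: finsum_cong)
    have "cadj A (\<Oplus>k\<in>{..<n}. S (j, k) \<otimes> T (k, i)) = (\<Oplus>k\<in>{..<n}. cadj A (T (k, i)) \<otimes> cadj A (S (j, k)))"
      if "i < n" "j < n" for i j
      using that e by (subst cadj_finsum) (auto intro!: finsum_cong' simp: cadj_mult)
    then show "cadj ?M (S \<otimes>\<^bsub>?M\<^esub> T) = cadj ?M T \<otimes>\<^bsub>?M\<^esub> cadj ?M S"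
      using e by (auto simp: fun_eq_iff cong: finsum_cong)
  qed (auto simp: matrix_entry smult_add_left smult_add_right smult_smult cadj_add cadj_smult fun_eq_iff matrix_outside)
qed

end

section \<open>Homomorphisms and direct sums of *-algebras\<close>

lemma star_homD:
  assumes "star_hom A B f" "x \<in> carrier A"
  shows "f x \<in> carrier B" "y \<in> carrier A \<Longrightarrow> f (x \<oplus>\<^bsub>A\<^esub> y) = f x \<oplus>\<^bsub>B\<^esub> f y"
    "y \<in> carrier A \<Longrightarrow> f (x \<otimes>\<^bsub>A\<^esub> y) = f x \<otimes>\<^bsub>B\<^esub> f y" "f (k \<odot>\<^bsub>A\<^esub> x) = k \<odot>\<^bsub>B\<^esub> f x"
    "f (cadj A x) = cadj B (f x)"
  using assms by (auto simp: star_hom_def)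

lemma star_homI:
  assumes "\<And>x. x \<in> carrier A \<Longrightarrow> f x \<in> carrier B"
    and "\<And>x y. \<lbrakk>x \<in> carrier A; y \<in> carrier A\<rbrakk> \<Longrightarrow> f (x \<oplus>\<^bsub>A\<^esub> y) = f x \<oplus>\<^bsub>B\<^esub> f y"
    and "\<And>x y. \<lbrakk>x \<in> carrier A; y \<in> carrier A\<rbrakk> \<Longrightarrow> f (x \<otimes>\<^bsub>A\<^esub> y) = f x \<otimes>\<^bsub>B\<^esub> f y"
    and "\<And>k x. x \<in> carrier A \<Longrightarrow> f (k \<odot>\<^bsub>A\<^esub> x) = k \<odot>\<^bsub>B\<^esub> f x"
    and "\<And>x. x \<in> carrier A \<Longrightarrow> f (cadj A x) = cadj B (f x)"
  shows "star_hom A B f"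
  using assms by (auto simp: star_hom_def)

lemma star_hom_comp: "\<lbrakk>star_hom A B f; star_hom B C g\<rbrakk> \<Longrightarrow> star_hom A C (\<lambda>x. g (f x))"
  unfolding star_hom_def Pi_iff by simp

lemma star_hom_zero:
  assumes "star_ring A" "star_ring B" "star_hom A B f" shows "f \<zero>\<^bsub>A\<^esub> = \<zero>\<^bsub>B\<^esub>"
proof -
  interpret A: star_ring A by fact
  interpret B: star_ring B by fact
  have "f (0 \<odot>\<^bsub>A\<^esub> \<zero>\<^bsub>A\<^esub>) = 0 \<odot>\<^bsub>B\<^esub> f \<zero>\<^bsub>A\<^esub>"
    by (rule star_homD(4)[OF assms(3) A.zero_closed])
  then show ?thesis using star_homD(1)[OF assms(3), of "\<zero>\<^bsub>A\<^esub>"] by simp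
qed

lemma star_hom_finsum:
  assumes "star_ring A" "star_ring B" "star_hom A B f" "g \<in> I \<rightarrow> carrier A"
  shows "f (\<Oplus>\<^bsub>A\<^esub>i\<in>I. g i) = (\<Oplus>\<^bsub>B\<^esub>i\<in>I. f (g i))"
proof -
  interpret A: star_ring A by fact
  interpret B: star_ring B by fact
  show ?thesis
    using assms star_homD(1,2)[OF assms(3)] star_hom_zero[OF assms(1-3)]
    by (intro finsum_additive) (auto simp: A.abelian_monoid_self B.abelian_monoid_self)
qed

lemma star_hom_inverse:
  assumes "star_ring A" "star_hom A B f" "bij_betw f (carrier A) (carrier B)"
  shows "star_hom B A (inv_into (carrier A) f)"
proof -
  interpret A: star_ring A by fact
  let ?g = "inv_into (carrier A) f"
  have inj: "inj_on f (carrier A)" and im: "f ` carrier A = carrier B"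
    using assms(3) by (auto simp: bij_betw_def)
  have g: "y \<in> carrier B \<Longrightarrow> ?g y \<in> carrier A" "y \<in> carrier B \<Longrightarrow> f (?g y) = y" for y
    using im by (auto intro: inv_into_into f_inv_into_f)
  have eq: "?g y = x" if "x \<in> carrier A" "f x = y" for x y
    using inv_into_f_f[OF inj that(1)] that(2) by simp
  show ?thesis
    by (rule star_homI) (auto intro!: eq simp: g star_homD[OF assms(2)])
qed

lemma star_hom_projection:
  assumes "star_hom A B f" "projection A p" shows "projection B (f p)"
  using assms star_homD(1)[OF assms(1), of p] star_homD(3)[OF assms(1), of p p] star_homD(5)[OF assms(1), of p]
  by (simp add: projection_def)

lemma star_hom_corner:
  assumes "star_ring A" "star_ring B" "star_hom A B f" "projection A p"
  shows "star_hom (corner A p) (corner B (f p)) f"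
proof -
  interpret A: star_ring A by fact
  interpret B: star_ring B by fact
  have p: "p \<in> carrier A" using assms(4) by (simp add: projection_def)
  note [simp] = A.carrier_corner[OF assms(4)] B.carrier_corner[OF star_hom_projection[OF assms(3,4)]]
  show ?thesis
  proof (rule star_homI)
    fix x assume "x \<in> carrier (corner A p)"
    then have x: "x \<in> carrier A" "p \<otimes>\<^bsub>A\<^esub> x = x" "x \<otimes>\<^bsub>A\<^esub> p = x" by simp_all
    show "f x \<in> carrier (corner B (f p))"
      using star_homD(1,3)[OF assms(3)] x p by (simp flip: star_homD(3)[OF assms(3)])
  qed (simp_all add: star_homD[OF assms(3)])
qed

lemma star_hom_id:
  assumes "carrier A \<subseteq> carrier B"
    "\<And>x y. \<lbrakk>x \<in> carrier A; y \<in> carrier A\<rbrakk> \<Longrightarrow> x \<oplus>\<^bsub>A\<^esub> y = x \<oplus>\<^bsub>B\<^esub> y"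
    "\<And>x y. \<lbrakk>x \<in> carrier A; y \<in> carrier A\<rbrakk> \<Longrightarrow> x \<otimes>\<^bsub>A\<^esub> y = x \<otimes>\<^bsub>B\<^esub> y"
    "\<And>k x. x \<in> carrier A \<Longrightarrow> k \<odot>\<^bsub>A\<^esub> x = k \<odot>\<^bsub>B\<^esub> x" "\<And>x. x \<in> carrier A \<Longrightarrow> cadj A x = cadj B x"
  shows "star_hom A B (\<lambda>x. x)"
  using assms by (intro star_homI) auto

lemma direct_sum_simps [simp]:
  "carrier (direct_sum n D) = (\<Pi>\<^sub>E k\<in>{..<n}. carrier (D k))"
  "mult (direct_sum n D) f g = (\<lambda>k\<in>{..<n}. f k \<otimes>\<^bsub>D k\<^esub> g k)"
  "add (direct_sum n D) f g = (\<lambda>k\<in>{..<n}. f k \<oplus>\<^bsub>D k\<^esub> g k)"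
  "one (direct_sum n D) = (\<lambda>k\<in>{..<n}. \<one>\<^bsub>D k\<^esub>)" "zero (direct_sum n D) = (\<lambda>k\<in>{..<n}. \<zero>\<^bsub>D k\<^esub>)"
  "smult (direct_sum n D) c f = (\<lambda>k\<in>{..<n}. c \<odot>\<^bsub>D k\<^esub> f k)"
  "cadj (direct_sum n D) f = (\<lambda>k\<in>{..<n}. cadj (D k) (f k))"
  by (simp_all add: direct_sum_def)

lemma direct_sum_ext:
  assumes "f \<in> (\<Pi>\<^sub>E k\<in>{..<n :: nat}. C k)" "g \<in> (\<Pi>\<^sub>E k\<in>{..<n}. C' k)" "\<And>k. k < n \<Longrightarrow> f k = g k"
  shows "f = g"
proof
  fix k show "f k = g k"
    using assms(3)[of k] PiE_arb[OF assms(1), of k] PiE_arb[OF assms(2), of k] by (cases "k < n") auto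
qed

lemma star_ring_direct_sum:
  assumes D: "\<And>k. k < n \<Longrightarrow> star_ring (D k)"
  shows "star_ring (direct_sum n D)"
proof -
  let ?S = "direct_sum n D"
  have el: "f k \<in> carrier (D k)" if "f \<in> carrier ?S" "k < n" for f k using that by auto
  have abg: "abelian_group (D k)" and rg: "ring (D k)" if "k < n" for k
    using D[OF that] by (auto simp: star_ring_def ring_def)
  note add_facts = abelian_monoid.a_closed[OF abelian_group.axioms(1)[OF abg]]
    abelian_monoid.zero_closed[OF abelian_group.axioms(1)[OF abg]]
  note mult_facts = monoid.m_closed[OF ring.is_monoid[OF rg]] monoid.one_closed[OF ring.is_monoid[OF rg]]
  have "abelian_group ?S"
  proof (rule abelian_groupI)
    fix f assume f: "f \<in> carrier ?S"
    show "\<exists>g\<in>carrier ?S. g \<oplus>\<^bsub>?S\<^esub> f = \<zero>\<^bsub>?S\<^esub>"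
    proof (rule bexI[of _ "\<lambda>k\<in>{..<n}. \<ominus>\<^bsub>D k\<^esub> f k"])
      show "(\<lambda>k\<in>{..<n}. \<ominus>\<^bsub>D k\<^esub> f k) \<oplus>\<^bsub>?S\<^esub> f = \<zero>\<^bsub>?S\<^esub>"
        using el[OF f] abg by (auto simp: fun_eq_iff abelian_group.l_neg)
    qed (use el[OF f] abg in \<open>auto simp: abelian_group.a_inv_closed\<close>)
    show "\<zero>\<^bsub>?S\<^esub> \<oplus>\<^bsub>?S\<^esub> f = f"
    proof (rule direct_sum_ext)
      show "f \<in> (\<Pi>\<^sub>E k\<in>{..<n}. carrier (D k))" using f by simp
      show "\<zero>\<^bsub>?S\<^esub> \<oplus>\<^bsub>?S\<^esub> f \<in> (\<Pi>\<^sub>E k\<in>{..<n}. carrier (D k))" using el[OF f] add_facts by auto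
    qed (use el[OF f] abg in \<open>simp add: abelian_monoid.l_zero[OF abelian_group.axioms(1)]\<close>)
  next
    fix f g assume f: "f \<in> carrier ?S" and g: "g \<in> carrier ?S"
    show "f \<oplus>\<^bsub>?S\<^esub> g \<in> carrier ?S" using el[OF f] el[OF g] add_facts by auto
    show "f \<oplus>\<^bsub>?S\<^esub> g = g \<oplus>\<^bsub>?S\<^esub> f"
      using el[OF f] el[OF g] abg by (auto simp: fun_eq_iff abelian_monoid.a_comm[OF abelian_group.axioms(1)])
    fix h assume h: "h \<in> carrier ?S"
    show "f \<oplus>\<^bsub>?S\<^esub> g \<oplus>\<^bsub>?S\<^esub> h = f \<oplus>\<^bsub>?S\<^esub> (g \<oplus>\<^bsub>?S\<^esub> h)"
      using el[OF f] el[OF g] el[OF h] abg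
      by (auto simp: fun_eq_iff abelian_monoid.a_assoc[OF abelian_group.axioms(1)])
  next
    show "\<zero>\<^bsub>?S\<^esub> \<in> carrier ?S" using add_facts by auto
  qed
  moreover have "monoid ?S"
  proof (rule monoidI)
    show "\<one>\<^bsub>?S\<^esub> \<in> carrier ?S" using mult_facts by auto
    fix f assume f: "f \<in> carrier ?S"
    show "\<one>\<^bsub>?S\<^esub> \<otimes>\<^bsub>?S\<^esub> f = f"
    proof (rule direct_sum_ext)
      show "f \<in> (\<Pi>\<^sub>E k\<in>{..<n}. carrier (D k))" using f by simp
      show "\<one>\<^bsub>?S\<^esub> \<otimes>\<^bsub>?S\<^esub> f \<in> (\<Pi>\<^sub>E k\<in>{..<n}. carrier (D k))" using el[OF f] mult_facts by auto
    qed (use el[OF f] rg in \<open>simp add: monoid.l_one[OF ring.is_monoid]\<close>)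
    show "f \<otimes>\<^bsub>?S\<^esub> \<one>\<^bsub>?S\<^esub> = f"
    proof (rule direct_sum_ext)
      show "f \<in> (\<Pi>\<^sub>E k\<in>{..<n}. carrier (D k))" using f by simp
      show "f \<otimes>\<^bsub>?S\<^esub> \<one>\<^bsub>?S\<^esub> \<in> (\<Pi>\<^sub>E k\<in>{..<n}. carrier (D k))" using el[OF f] mult_facts by auto
    qed (use el[OF f] rg in \<open>simp add: monoid.r_one[OF ring.is_monoid]\<close>)
    fix g assume g: "g \<in> carrier ?S"
    show "f \<otimes>\<^bsub>?S\<^esub> g \<in> carrier ?S" using el[OF f] el[OF g] mult_facts by auto
    fix h assume h: "h \<in> carrier ?S"
    show "f \<otimes>\<^bsub>?S\<^esub> g \<otimes>\<^bsub>?S\<^esub> h = f \<otimes>\<^bsub>?S\<^esub> (g \<otimes>\<^bsub>?S\<^esub> h)"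
      using el[OF f] el[OF g] el[OF h] rg by (auto simp: fun_eq_iff monoid.m_assoc[OF ring.is_monoid])
  qed
  moreover have "(f \<oplus>\<^bsub>?S\<^esub> g) \<otimes>\<^bsub>?S\<^esub> h = f \<otimes>\<^bsub>?S\<^esub> h \<oplus>\<^bsub>?S\<^esub> g \<otimes>\<^bsub>?S\<^esub> h"
    "h \<otimes>\<^bsub>?S\<^esub> (f \<oplus>\<^bsub>?S\<^esub> g) = h \<otimes>\<^bsub>?S\<^esub> f \<oplus>\<^bsub>?S\<^esub> h \<otimes>\<^bsub>?S\<^esub> g"
    if "f \<in> carrier ?S" "g \<in> carrier ?S" "h \<in> carrier ?S" for f g h
  proof -
    have "(x \<oplus>\<^bsub>D k\<^esub> y) \<otimes>\<^bsub>D k\<^esub> z = x \<otimes>\<^bsub>D k\<^esub> z \<oplus>\<^bsub>D k\<^esub> y \<otimes>\<^bsub>D k\<^esub> z"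
      "z \<otimes>\<^bsub>D k\<^esub> (x \<oplus>\<^bsub>D k\<^esub> y) = z \<otimes>\<^bsub>D k\<^esub> x \<oplus>\<^bsub>D k\<^esub> z \<otimes>\<^bsub>D k\<^esub> y"
      if k: "k < n" and "x \<in> carrier (D k)" "y \<in> carrier (D k)" "z \<in> carrier (D k)" for k x y z
    proof -
      interpret Dk: star_ring "D k" by (rule D[OF k])
      show "(x \<oplus>\<^bsub>D k\<^esub> y) \<otimes>\<^bsub>D k\<^esub> z = x \<otimes>\<^bsub>D k\<^esub> z \<oplus>\<^bsub>D k\<^esub> y \<otimes>\<^bsub>D k\<^esub> z"
        "z \<otimes>\<^bsub>D k\<^esub> (x \<oplus>\<^bsub>D k\<^esub> y) = z \<otimes>\<^bsub>D k\<^esub> x \<oplus>\<^bsub>D k\<^esub> z \<otimes>\<^bsub>D k\<^esub> y"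
        using that by (simp_all add: Dk.l_distr Dk.r_distr)
    qed
    then show "(f \<oplus>\<^bsub>?S\<^esub> g) \<otimes>\<^bsub>?S\<^esub> h = f \<otimes>\<^bsub>?S\<^esub> h \<oplus>\<^bsub>?S\<^esub> g \<otimes>\<^bsub>?S\<^esub> h"
      "h \<otimes>\<^bsub>?S\<^esub> (f \<oplus>\<^bsub>?S\<^esub> g) = h \<otimes>\<^bsub>?S\<^esub> f \<oplus>\<^bsub>?S\<^esub> h \<otimes>\<^bsub>?S\<^esub> g"
      using el[OF that(1)] el[OF that(2)] el[OF that(3)] by (auto simp: fun_eq_iff)
  qed
  ultimately have ring: "ring ?S" by (intro ringI)
  show ?thesis
  proof (intro star_ring.intro ring star_ring_axioms.intro)
    fix f c d assume f: "f \<in> carrier ?S"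
    show "c \<odot>\<^bsub>?S\<^esub> f \<in> carrier ?S" using el[OF f] star_ring.smult_closed[OF D] by auto
    show "(c + d) \<odot>\<^bsub>?S\<^esub> f = c \<odot>\<^bsub>?S\<^esub> f \<oplus>\<^bsub>?S\<^esub> d \<odot>\<^bsub>?S\<^esub> f"
      using el[OF f] star_ring.smult_add_left[OF D] by (auto simp: fun_eq_iff)
    show "(c * d) \<odot>\<^bsub>?S\<^esub> f = c \<odot>\<^bsub>?S\<^esub> (d \<odot>\<^bsub>?S\<^esub> f)"
      using el[OF f] star_ring.smult_smult[OF D] by (auto simp: fun_eq_iff)
    show "1 \<odot>\<^bsub>?S\<^esub> f = f"
    proof (rule direct_sum_ext)
      show "f \<in> (\<Pi>\<^sub>E k\<in>{..<n}. carrier (D k))" using f by simp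
      show "1 \<odot>\<^bsub>?S\<^esub> f \<in> (\<Pi>\<^sub>E k\<in>{..<n}. carrier (D k))" using el[OF f] star_ring.smult_closed[OF D] by auto
    qed (use el[OF f] star_ring.smult_one[OF D] in simp)
    show "cadj ?S f \<in> carrier ?S" using el[OF f] star_ring.cadj_closed[OF D] by auto
    show "cadj ?S (cadj ?S f) = f"
    proof (rule direct_sum_ext)
      show "f \<in> (\<Pi>\<^sub>E k\<in>{..<n}. carrier (D k))" using f by simp
      show "cadj ?S (cadj ?S f) \<in> (\<Pi>\<^sub>E k\<in>{..<n}. carrier (D k))" using el[OF f] star_ring.cadj_closed[OF D] by auto
    qed (use el[OF f] star_ring.cadj_cadj[OF D] in simp)
    show "cadj ?S (c \<odot>\<^bsub>?S\<^esub> f) = cnj c \<odot>\<^bsub>?S\<^esub> cadj ?S f"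
      using el[OF f] star_ring.cadj_smult[OF D] by (auto simp: fun_eq_iff)
    fix g assume g: "g \<in> carrier ?S"
    show "c \<odot>\<^bsub>?S\<^esub> (f \<oplus>\<^bsub>?S\<^esub> g) = c \<odot>\<^bsub>?S\<^esub> f \<oplus>\<^bsub>?S\<^esub> c \<odot>\<^bsub>?S\<^esub> g"
      using el[OF f] el[OF g] star_ring.smult_add_right[OF D] by (auto simp: fun_eq_iff)
    show "(c \<odot>\<^bsub>?S\<^esub> f) \<otimes>\<^bsub>?S\<^esub> g = c \<odot>\<^bsub>?S\<^esub> (f \<otimes>\<^bsub>?S\<^esub> g)"
      using el[OF f] el[OF g] star_ring.smult_mult_left[OF D] by (auto simp: fun_eq_iff)
    show "f \<otimes>\<^bsub>?S\<^esub> (c \<odot>\<^bsub>?S\<^esub> g) = c \<odot>\<^bsub>?S\<^esub> (f \<otimes>\<^bsub>?S\<^esub> g)"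
      using el[OF f] el[OF g] star_ring.smult_mult_right[OF D] by (auto simp: fun_eq_iff)
    show "cadj ?S (f \<oplus>\<^bsub>?S\<^esub> g) = cadj ?S f \<oplus>\<^bsub>?S\<^esub> cadj ?S g"
      using el[OF f] el[OF g] star_ring.cadj_add[OF D] by (auto simp: fun_eq_iff)
    show "cadj ?S (f \<otimes>\<^bsub>?S\<^esub> g) = cadj ?S g \<otimes>\<^bsub>?S\<^esub> cadj ?S f"
      using el[OF f] el[OF g] star_ring.cadj_mult[OF D] by (auto simp: fun_eq_iff)
  qed
qed

section \<open>Lifting from finite direct sums\<close>

context unital_cstar_algebra begin

text \<open>\<open>\<psi>1\<close> and \<open>\<psi>2\<close> send the unit to projections
  \<open>p\<close> and \<open>q\<close> that are orthogonal only asymptotically, so the sum of the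
  two maps need not be multiplicative. Conjugating \<open>\<psi>2\<close> by partial isometries
  \<open>W\<close> from \<open>q\<close> into the complement of \<open>p\<close> makes the ranges
  orthogonal at every index; as \<open>W\<close> is asymptotically \<open>q\<close>, the class is
  unchanged.\<close>

lemma liftable_orthogonal_sum:
  assumes "star_ring D" and s1: "star_hom D (ell_inf A) \<psi>1" and s2: "star_hom D (ell_inf A) \<psi>2"
    and null: "null_seq (\<lambda>n. \<psi>1 \<one>\<^bsub>D\<^esub> n \<otimes> \<psi>2 \<one>\<^bsub>D\<^esub> n)"
  shows "liftable D (\<lambda>x n. \<psi>1 x n \<oplus> \<psi>2 x n)"
proof -
  interpret D: star_ring D by fact
  let ?p = "\<psi>1 \<one>\<^bsub>D\<^esub>" and ?q = "\<psi>2 \<one>\<^bsub>D\<^esub>"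
  have one: "projection D \<one>\<^bsub>D\<^esub>" by (simp add: projection_def)
  have pr: "projection A (\<psi> \<one>\<^bsub>D\<^esub> n)" if "star_hom D (ell_inf A) \<psi>" for \<psi> n
    using star_hom_projection[OF that one] by (auto simp: projection_def fun_eq_iff)
  note p = pr[OF s1] and q = pr[OF s2]
  \<comment> \<open>At an index where \<open>p q\<close> is not small, \<open>W = \<zero>\<close> is
    taken: conjugation by zero is still a homomorphism, and \<open>||q|| \<le> 1\<close> makes the
    norm bound hold. As \<open>p q\<close> is null, this concerns finitely many indices
    only.\<close>
  have "\<exists>W. W \<in> carrier A \<and> (cadj A W \<otimes> W = ?q n \<or> W = \<zero>) \<and> ?p n \<otimes> W = \<zero> \<and> W \<otimes> ?q n = W \<and>
      cnorm A (W \<ominus> ?q n) \<le> 5 * cnorm A (?p n \<otimes> ?q n)" for n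
  proof (cases "cnorm A (?p n \<otimes> ?q n) \<le> 1/2")
    case True
    then show ?thesis using orthogonalise[OF p[of n] q[of n]] by metis
  next
    case False
    then have "cnorm A (\<zero> \<ominus> ?q n) \<le> 5 * cnorm A (?p n \<otimes> ?q n)"
      using projection_cnorm_le[OF q[of n]] projectionD(1)[OF q[of n]] by (simp add: a_minus_def)
    then show ?thesis using projectionD(1)[OF p[of n]] projectionD(1)[OF q[of n]] by (intro exI[of _ \<zero>]) simp
  qed
  then obtain W where W: "\<And>n. W n \<in> carrier A" "\<And>n. cadj A (W n) \<otimes> W n = ?q n \<or> W n = \<zero>"
    "\<And>n. ?p n \<otimes> W n = \<zero>" "\<And>n. W n \<otimes> ?q n = W n"
    "\<And>n. cnorm A (W n \<ominus> ?q n) \<le> 5 * cnorm A (?p n \<otimes> ?q n)"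
    by metis
  have Wq: "asym_eq W ?q"
  proof -
    have "null_seq (\<lambda>n. W n \<ominus> ?q n)"
    proof (rule null_seq_le)
      show "(\<lambda>n. 5 * cnorm A (?p n \<otimes> ?q n)) \<longlonglongrightarrow> 0"
        using tendsto_mult_right_zero[OF null_seqD(2)[OF null]] .
    qed (use W projectionD(1)[OF q] in auto)
    then show ?thesis using W projectionD(1)[OF q] by (simp add: asym_eq_def)
  qed
  have Wn: "cnorm A (W n) \<le> 1" for n
  proof (cases "W n = \<zero>")
    case False
    then have "(cnorm A (W n))\<^sup>2 = cnorm A (?q n)" using W(2)[of n] cnorm_cadj_mult[OF W(1), of n] by simp
    then have "(cnorm A (W n))\<^sup>2 \<le> 1\<^sup>2" using projection_cnorm_le[OF q[of n]] by simp
    then show ?thesis using power2_le_imp_le[of "cnorm A (W n)" 1] by simp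
  qed simp
  then have WL: "W \<in> carrier (ell_inf A)" using W(1) by (intro ell_infI)
  have c1: "\<psi>1 x \<in> carrier (ell_inf A)" and c2: "\<psi>2 x \<in> carrier (ell_inf A)" if "x \<in> carrier D" for x
    using star_homD(1)[OF s1 that] star_homD(1)[OF s2 that] .
  have a_p: "\<psi>1 x n \<otimes> ?p n = \<psi>1 x n" if "x \<in> carrier D" for x n
    using star_homD(3)[OF s1 that D.one_closed] that by (simp add: fun_eq_iff)
  have b_q: "?q n \<otimes> \<psi>2 x n = \<psi>2 x n" "\<psi>2 x n \<otimes> ?q n = \<psi>2 x n" if "x \<in> carrier D" for x n
    using star_homD(3)[OF s2 that D.one_closed] star_homD(3)[OF s2 D.one_closed that] that by (simp_all add: fun_eq_iff)
  have aW: "\<psi>1 x n \<otimes> W n = \<zero>" if x: "x \<in> carrier D" for x n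
  proof -
    have "\<psi>1 x n \<otimes> W n = (\<psi>1 x n \<otimes> ?p n) \<otimes> W n" using a_p[OF x] by simp
    also have "\<dots> = \<psi>1 x n \<otimes> (?p n \<otimes> W n)" using c1[OF x] W(1) projectionD(1)[OF p] by (simp add: m_assoc)
    finally show ?thesis using W(3) c1[OF x] by simp
  qed
  have Wa: "cadj A (W n) \<otimes> \<psi>1 x n = \<zero>" if x: "x \<in> carrier D" for x n
  proof -
    have "cadj A (\<psi>1 (cadj D x) n \<otimes> W n) = \<zero>" using aW[of "cadj D x"] x by simp
    then show ?thesis using star_homD(5)[OF s1 x] x c1[OF x] W(1) by (simp add: cadj_mult)
  qed
  define \<psi> where "\<psi> x n = \<psi>1 x n \<oplus> W n \<otimes> \<psi>2 x n \<otimes> cadj A (W n)" for x n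
  note L = ell_inf_closed
  have "star_hom D (ell_inf A) \<psi>"
  proof (rule star_homI)
    fix x assume x: "x \<in> carrier D"
    note cx = ell_inf_nth[OF c1[OF x]] ell_inf_nth[OF c2[OF x]]
    have "(\<lambda>n. \<psi>1 x n \<oplus> W n \<otimes> \<psi>2 x n \<otimes> cadj A (W n)) \<in> carrier (ell_inf A)"
      by (rule L(1)[OF c1[OF x] L(2)[OF L(2)[OF WL c2[OF x]] L(4)[OF WL WL]]])
    moreover have "(\<lambda>n. \<psi>1 x n \<oplus> W n \<otimes> \<psi>2 x n \<otimes> cadj A (W n)) = \<psi> x" by (simp add: \<psi>_def fun_eq_iff)
    ultimately show "\<psi> x \<in> carrier (ell_inf A)" by simp
    show "\<psi> (k \<odot>\<^bsub>D\<^esub> x) = k \<odot>\<^bsub>ell_inf A\<^esub> \<psi> x" for k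
      using star_homD(4)[OF s1 x] star_homD(4)[OF s2 x] cx W(1)
      by (simp add: \<psi>_def fun_eq_iff smult_add_right smult_mult_left smult_mult_right)
    show "\<psi> (cadj D x) = cadj (ell_inf A) (\<psi> x)"
      using star_homD(5)[OF s1 x] star_homD(5)[OF s2 x] cx W(1)
      by (simp add: \<psi>_def fun_eq_iff cadj_add cadj_mult m_assoc)
    fix y assume y: "y \<in> carrier D"
    note cy = ell_inf_nth[OF c1[OF y]] ell_inf_nth[OF c2[OF y]]
    show "\<psi> (x \<oplus>\<^bsub>D\<^esub> y) = \<psi> x \<oplus>\<^bsub>ell_inf A\<^esub> \<psi> y"
      using star_homD(2)[OF s1 x y] star_homD(2)[OF s2 x y] cx cy W(1)
      by (simp add: \<psi>_def fun_eq_iff l_distr r_distr a_ac)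
    have "\<psi> (x \<otimes>\<^bsub>D\<^esub> y) n = \<psi> x n \<otimes> \<psi> y n" for n
    proof -
      let ?a = "\<psi>1 x n" and ?a' = "\<psi>1 y n" and ?b = "\<psi>2 x n" and ?b' = "\<psi>2 y n" and ?W = "W n"
      \<comment> \<open>The cross terms contain \<open>?a\<close> next to \<open>?W\<close>, or the
        adjoint of \<open>?W\<close> next to \<open>?a'\<close>, and vanish. In the last term
        \<open>?W\<close> preceded by its adjoint is \<open>q\<close>, which \<open>?b'\<close>
        absorbs, or else \<open>?W\<close> is zero.\<close>
      have "\<psi> x n \<otimes> \<psi> y n = ?a \<otimes> ?a' \<oplus> (?a \<otimes> ?W) \<otimes> (?b' \<otimes> cadj A ?W) \<oplus> (?W \<otimes> ?b) \<otimes> (cadj A ?W \<otimes> ?a')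
          \<oplus> (?W \<otimes> ?b) \<otimes> ((cadj A ?W \<otimes> ?W) \<otimes> ?b') \<otimes> cadj A ?W"
        unfolding \<psi>_def using cx[of n] cy[of n] W(1)[of n] by (reify star_eqs, intro seqn_holdsI; simp)
      also have "\<dots> = ?a \<otimes> ?a' \<oplus> (?W \<otimes> ?b) \<otimes> ((cadj A ?W \<otimes> ?W) \<otimes> ?b') \<otimes> cadj A ?W"
        using cx[of n] cy[of n] W(1)[of n] aW[OF x, of n] Wa[OF y, of n] by simp
      also have "(?W \<otimes> ?b) \<otimes> ((cadj A ?W \<otimes> ?W) \<otimes> ?b') \<otimes> cadj A ?W = ?W \<otimes> (?b \<otimes> ?b') \<otimes> cadj A ?W"
        using W(2)[of n]
      proof
        assume "cadj A ?W \<otimes> ?W = ?q n"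
        then show ?thesis using cx[of n] cy[of n] W(1)[of n] b_q[OF y, of n] by (simp add: m_assoc)
      next
        assume "?W = \<zero>"
        then show ?thesis using cx[of n] cy[of n] by simp
      qed
      finally show ?thesis using star_homD(3)[OF s1 x y] star_homD(3)[OF s2 x y] by (simp add: \<psi>_def)
    qed
    then show "\<psi> (x \<otimes>\<^bsub>D\<^esub> y) = \<psi> x \<otimes>\<^bsub>ell_inf A\<^esub> \<psi> y" by auto
  qed
  moreover have "asym_eq (\<psi> x) (\<lambda>n. \<psi>1 x n \<oplus> \<psi>2 x n)" if x: "x \<in> carrier D" for x
  proof -
    have qL: "?q \<in> carrier (ell_inf A)" using c2 by simp
    have r: "asym_eq (\<psi>2 x) (\<psi>2 x)" "asym_eq (\<psi>1 x) (\<psi>1 x)"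
      using c1[OF x] c2[OF x] by (auto intro: asym_eq_refl)
    have "asym_eq (\<lambda>n. W n \<otimes> \<psi>2 x n) (\<lambda>n. ?q n \<otimes> \<psi>2 x n)"
      by (rule asym_eq_mult[OF Wq r(1) qL c2[OF x]])
    then have "asym_eq (\<lambda>n. W n \<otimes> \<psi>2 x n \<otimes> cadj A (W n)) (\<lambda>n. ?q n \<otimes> \<psi>2 x n \<otimes> cadj A (?q n))"
      by (rule asym_eq_mult[OF _ asym_eq_cadj[OF Wq] L(2)[OF qL c2[OF x]] L(4)[OF WL WL]])
    also have "(\<lambda>n. ?q n \<otimes> \<psi>2 x n \<otimes> cadj A (?q n)) = \<psi>2 x"
      using b_q[OF x] projectionD(3)[OF q] by auto
    finally show ?thesis using asym_eq_add[OF r(2)] unfolding \<psi>_def by blast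
  qed
  ultimately show ?thesis unfolding liftable_def by blast
qed

end

context unital_cstar_algebra begin

text \<open>Induction on the number \<open>m\<close> of coordinates kept by \<open>cut m\<close>;
  the next coordinate enters through \<open>inj m\<close>. The unit has images with product zero
  under the two maps, so the lifts of these images have a product that tends to zero, and the
  orthogonal sum applies.\<close>

lemma has_lifts_direct_sum:
  assumes D: "\<And>k. k < n \<Longrightarrow> star_ring (D k)" and lift: "\<And>k. k < n \<Longrightarrow> has_lifts (D k)"
  shows "has_lifts (direct_sum n D)"
  unfolding has_lifts_def
proof (intro allI impI)
  fix \<phi> assume \<phi>: "asym_hom (direct_sum n D) \<phi>"
  let ?S = "direct_sum n D"
  interpret S: star_ring ?S by (rule star_ring_direct_sum[OF D])
  have el: "x k \<in> carrier (D k)" if "x \<in> carrier ?S" "k < n" for x k using that by auto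
  have zero_el: "\<zero>\<^bsub>D k\<^esub> \<in> carrier (D k)" if "k < n" for k
    using D[OF that] by (simp add: star_ring_def ring_def abelian_group_def abelian_monoid.zero_closed)
  have zero_arith: "\<zero>\<^bsub>D k\<^esub> \<oplus>\<^bsub>D k\<^esub> \<zero>\<^bsub>D k\<^esub> = \<zero>\<^bsub>D k\<^esub>" "\<zero>\<^bsub>D k\<^esub> \<otimes>\<^bsub>D k\<^esub> \<zero>\<^bsub>D k\<^esub> = \<zero>\<^bsub>D k\<^esub>"
    "c \<odot>\<^bsub>D k\<^esub> \<zero>\<^bsub>D k\<^esub> = \<zero>\<^bsub>D k\<^esub>" "cadj (D k) \<zero>\<^bsub>D k\<^esub> = \<zero>\<^bsub>D k\<^esub>"
    "x \<in> carrier (D k) \<Longrightarrow> \<zero>\<^bsub>D k\<^esub> \<oplus>\<^bsub>D k\<^esub> x = x" "x \<in> carrier (D k) \<Longrightarrow> x \<oplus>\<^bsub>D k\<^esub> \<zero>\<^bsub>D k\<^esub> = x"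
    "x \<in> carrier (D k) \<Longrightarrow> \<zero>\<^bsub>D k\<^esub> \<otimes>\<^bsub>D k\<^esub> x = \<zero>\<^bsub>D k\<^esub>" "x \<in> carrier (D k) \<Longrightarrow> x \<otimes>\<^bsub>D k\<^esub> \<zero>\<^bsub>D k\<^esub> = \<zero>\<^bsub>D k\<^esub>"
    if "k < n" for k c x
  proof -
    interpret Dk: star_ring "D k" by (rule D[OF that])
    show "\<zero>\<^bsub>D k\<^esub> \<oplus>\<^bsub>D k\<^esub> \<zero>\<^bsub>D k\<^esub> = \<zero>\<^bsub>D k\<^esub>" "\<zero>\<^bsub>D k\<^esub> \<otimes>\<^bsub>D k\<^esub> \<zero>\<^bsub>D k\<^esub> = \<zero>\<^bsub>D k\<^esub>"
      "c \<odot>\<^bsub>D k\<^esub> \<zero>\<^bsub>D k\<^esub> = \<zero>\<^bsub>D k\<^esub>" "cadj (D k) \<zero>\<^bsub>D k\<^esub> = \<zero>\<^bsub>D k\<^esub>"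
      "x \<in> carrier (D k) \<Longrightarrow> \<zero>\<^bsub>D k\<^esub> \<oplus>\<^bsub>D k\<^esub> x = x" "x \<in> carrier (D k) \<Longrightarrow> x \<oplus>\<^bsub>D k\<^esub> \<zero>\<^bsub>D k\<^esub> = x"
      "x \<in> carrier (D k) \<Longrightarrow> \<zero>\<^bsub>D k\<^esub> \<otimes>\<^bsub>D k\<^esub> x = \<zero>\<^bsub>D k\<^esub>" "x \<in> carrier (D k) \<Longrightarrow> x \<otimes>\<^bsub>D k\<^esub> \<zero>\<^bsub>D k\<^esub> = \<zero>\<^bsub>D k\<^esub>"
      by simp_all
  qed
  define cut where "cut m x = (\<lambda>k\<in>{..<n}. if k < m then x k else \<zero>\<^bsub>D k\<^esub>)" for m and x :: "nat \<Rightarrow> 'b"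
  define inj where "inj m t = (\<lambda>k\<in>{..<n}. if k = m then t else \<zero>\<^bsub>D k\<^esub>)" for m and t :: 'b
  have cut: "star_hom ?S ?S (cut m)" for m
  proof (rule star_homI)
    fix x assume x: "x \<in> carrier ?S"
    show "cut m x \<in> carrier ?S" using el[OF x] zero_el by (simp add: cut_def PiE_iff)
    show "cut m (c \<odot>\<^bsub>?S\<^esub> x) = c \<odot>\<^bsub>?S\<^esub> cut m x" for c
      using zero_arith(3) by (simp add: cut_def fun_eq_iff)
    show "cut m (cadj ?S x) = cadj ?S (cut m x)"
      using zero_arith(4) by (simp add: cut_def fun_eq_iff)
    fix y
    show "cut m (x \<oplus>\<^bsub>?S\<^esub> y) = cut m x \<oplus>\<^bsub>?S\<^esub> cut m y"
      using zero_arith(1) by (simp add: cut_def fun_eq_iff)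
    show "cut m (x \<otimes>\<^bsub>?S\<^esub> y) = cut m x \<otimes>\<^bsub>?S\<^esub> cut m y"
      using zero_arith(2) by (simp add: cut_def fun_eq_iff)
  qed
  have inj: "star_hom (D m) ?S (inj m)" if "m < n" for m
    by (rule star_homI) (use zero_el zero_arith(1-4) in \<open>simp_all add: inj_def fun_eq_iff PiE_iff\<close>)
  have proj: "star_hom ?S (D m) (\<lambda>x. x m)" if "m < n" for m
    by (rule star_homI) (use that in \<open>auto\<close>)
  have phi_zero: "asym_eq (\<phi> \<zero>\<^bsub>?S\<^esub>) (\<lambda>n. \<zero>)"
  proof -
    have "asym_eq (\<phi> (0 \<odot>\<^bsub>?S\<^esub> \<zero>\<^bsub>?S\<^esub>)) (\<lambda>n. 0 \<odot> \<phi> \<zero>\<^bsub>?S\<^esub> n)"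
      by (rule asym_homD(4)[OF \<phi> S.zero_closed])
    moreover have "0 \<odot>\<^bsub>?S\<^esub> \<zero>\<^bsub>?S\<^esub> = \<zero>\<^bsub>?S\<^esub>" using S.smult_zero_right .
    moreover have "0 \<odot> \<phi> \<zero>\<^bsub>?S\<^esub> n = \<zero>" for n using asym_homD(1)[OF \<phi> S.zero_closed] by (simp del: direct_sum_simps)
    ultimately show ?thesis by (simp del: direct_sum_simps)
  qed
  have "liftable ?S (\<lambda>x. \<phi> (cut m x))" if "m \<le> n" for m
    using that
  proof (induction m)
    case 0
    have "star_hom ?S (ell_inf A) (\<lambda>x n. \<zero>)"
      using ell_inf_const[OF zero_closed] by (simp add: star_hom_def)
    moreover have "cut 0 x = \<zero>\<^bsub>?S\<^esub>" for x by (simp add: cut_def)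
    ultimately show ?case
      unfolding liftable_def using asym_eq_sym[OF phi_zero] by (intro exI[of _ "\<lambda>x n. \<zero>"]) (simp del: direct_sum_simps)
  next
    case (Suc m)
    then have m: "m < n" by simp
    let ?single = "\<lambda>x. inj m (x m)"
    have single: "star_hom ?S ?S ?single" using star_hom_comp[OF proj[OF m] inj[OF m]] .
    obtain \<psi>1 where s1: "star_hom ?S (ell_inf A) \<psi>1" and e1: "\<And>x. x \<in> carrier ?S \<Longrightarrow> asym_eq (\<psi>1 x) (\<phi> (cut m x))"
      using Suc by (auto simp: liftable_def simp del: direct_sum_simps)
    have "liftable (D m) (\<lambda>t. \<phi> (inj m t))"
      using lift[OF m] asym_hom_comp[OF inj[OF m] \<phi>] by (simp add: has_lifts_def)
    from liftable_comp[OF proj[OF m] this] have "liftable ?S (\<lambda>x. \<phi> (?single x))" .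
    then obtain \<psi>2 where s2: "star_hom ?S (ell_inf A) \<psi>2" and e2: "\<And>x. x \<in> carrier ?S \<Longrightarrow> asym_eq (\<psi>2 x) (\<phi> (?single x))"
      by (auto simp: liftable_def simp del: direct_sum_simps)
    have c: "cut m x \<in> carrier ?S" "?single x \<in> carrier ?S" if "x \<in> carrier ?S" for x
      using star_homD(1)[OF cut that] star_homD(1)[OF single that] .
    note one = S.one_closed
    have prod0: "cut m \<one>\<^bsub>?S\<^esub> \<otimes>\<^bsub>?S\<^esub> ?single \<one>\<^bsub>?S\<^esub> = \<zero>\<^bsub>?S\<^esub>"
    proof -
      have "\<one>\<^bsub>?S\<^esub> k \<in> carrier (D k)" if "k < n" for k using el[OF one that] .
      then show ?thesis using m by (auto simp: cut_def inj_def fun_eq_iff zero_el zero_arith)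
    qed
    have "asym_eq (\<lambda>n. \<psi>1 \<one>\<^bsub>?S\<^esub> n \<otimes> \<psi>2 \<one>\<^bsub>?S\<^esub> n) (\<lambda>n. \<phi> (cut m \<one>\<^bsub>?S\<^esub>) n \<otimes> \<phi> (?single \<one>\<^bsub>?S\<^esub>) n)"
      by (rule asym_eq_mult[OF e1[OF one] e2[OF one] asym_homD(1)[OF \<phi> c(1)[OF one]] star_homD(1)[OF s2 one]])
    also have "asym_eq \<dots> (\<phi> (cut m \<one>\<^bsub>?S\<^esub> \<otimes>\<^bsub>?S\<^esub> ?single \<one>\<^bsub>?S\<^esub>))"
      by (rule asym_eq_sym[OF asym_homD(3)[OF \<phi> c(1)[OF one] c(2)[OF one]]])
    also have "asym_eq (\<phi> (cut m \<one>\<^bsub>?S\<^esub> \<otimes>\<^bsub>?S\<^esub> ?single \<one>\<^bsub>?S\<^esub>)) (\<lambda>n. \<zero>)"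
      unfolding prod0 by (rule phi_zero)
    finally have *: "asym_eq (\<lambda>n. \<psi>1 \<one>\<^bsub>?S\<^esub> n \<otimes> \<psi>2 \<one>\<^bsub>?S\<^esub> n) (\<lambda>n. \<zero>)" .
    have "null_seq (\<lambda>n. \<psi>1 \<one>\<^bsub>?S\<^esub> n \<otimes> \<psi>2 \<one>\<^bsub>?S\<^esub> n)"
      using * by (rule null_seq_cong[OF conjunct2[OF conjunct2[OF iffD1[OF asym_eq_def]]]])
        (use asym_eq_carrier(1)[OF *] in \<open>simp add: a_minus_def\<close>)
    then have "liftable ?S (\<lambda>x n. \<psi>1 x n \<oplus> \<psi>2 x n)"
      by (rule liftable_orthogonal_sum[OF S.star_ring_axioms s1 s2])
    then show ?case
    proof (rule liftable_cong)
      fix x assume x: "x \<in> carrier ?S"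
      have split: "cut (Suc m) x = cut m x \<oplus>\<^bsub>?S\<^esub> ?single x"
        using el[OF x] m by (auto simp: cut_def inj_def fun_eq_iff zero_el zero_arith)
      show "asym_eq (\<lambda>n. \<psi>1 x n \<oplus> \<psi>2 x n) (\<phi> (cut (Suc m) x))"
        unfolding split
        by (rule asym_eq_trans[OF asym_eq_add[OF e1[OF x] e2[OF x]] asym_eq_sym[OF asym_homD(2)[OF \<phi> c(1)[OF x] c(2)[OF x]]]])
    qed
  qed
  then have "liftable ?S (\<lambda>x. \<phi> (cut n x))" by simp
  then show "liftable ?S \<phi>"
  proof (rule liftable_cong)
    fix x assume x: "x \<in> carrier ?S"
    have "cut n x = x"
    proof (rule direct_sum_ext)
      show "x \<in> (\<Pi>\<^sub>E k\<in>{..<n}. carrier (D k))" using x by simp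
      show "cut n x \<in> (\<Pi>\<^sub>E k\<in>{..<n}. carrier (D k))" using star_homD(1)[OF cut x] by simp
    qed (simp add: cut_def)
    moreover have "\<phi> x k \<in> carrier A" for k using asym_homD(1)[OF \<phi> x] by simp
    ultimately show "asym_eq (\<phi> (cut n x)) (\<phi> x)" by (simp add: asym_eq_refl)
  qed
qed

definition corners_lift :: "'d cstar_alg \<Rightarrow> bool" where
  "corners_lift B \<longleftrightarrow> (\<forall>n\<ge>1. \<forall>p. projection (matrix_alg n B) p \<longrightarrow> has_lifts (corner (matrix_alg n B) p))"

lemma has_lifts_corner_iso:
  assumes "star_ring M" "star_ring N" and f: "star_hom M N f" and bij: "bij_betw f (carrier M) (carrier N)"
    and p: "projection M p" and lift: "has_lifts (corner N (f p))"
  shows "has_lifts (corner M p)"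
proof (rule has_lifts_retract[OF _ _ _ lift])
  interpret M: star_ring M by fact
  let ?g = "inv_into (carrier M) f"
  have gf: "?g (f x) = x" if "x \<in> carrier M" for x
    using that bij inv_into_f_f by (force simp: bij_betw_def)
  have pM: "p \<in> carrier M" using p by (simp add: projection_def)
  show "star_hom (corner M p) (corner N (f p)) f" by (rule star_hom_corner[OF assms(1,2) f p])
  have "star_hom (corner N (f p)) (corner M (?g (f p))) ?g"
    by (rule star_hom_corner[OF assms(2,1) star_hom_inverse[OF assms(1) f bij] star_hom_projection[OF f p]])
  then show "star_hom (corner N (f p)) (corner M p) ?g" using gf[OF pM] by simp
  show "?g (f x) = x" if "x \<in> carrier (corner M p)" for x
    using that gf M.carrier_corner[OF p] by simp
qed

end

section \<open>Stability of the lifting property under the operations of a finite saturation\<close>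

lemma star_hom_matrix_map:
  assumes "star_ring A" "star_ring B" "star_hom A B f"
  shows "star_hom (matrix_alg n A) (matrix_alg n B) (\<lambda>T. \<lambda>(i, j)\<in>{..<n} \<times> {..<n}. f (T (i, j)))"
proof -
  interpret A: star_ring A by fact
  interpret B: star_ring B by fact
  note f = star_homD[OF assms(3)]
  note e = A.matrix_entry
  show ?thesis
  proof (rule star_homI)
    fix S T assume "S \<in> carrier (matrix_alg n A)" "T \<in> carrier (matrix_alg n A)"
    then have e: "\<lbrakk>i < n; j < n\<rbrakk> \<Longrightarrow> S (i, j) \<in> carrier A" "\<lbrakk>i < n; j < n\<rbrakk> \<Longrightarrow> T (i, j) \<in> carrier A" for i j by auto
    have "f (\<Oplus>\<^bsub>A\<^esub>k\<in>{..<n}. S (i, k) \<otimes>\<^bsub>A\<^esub> T (k, j)) = (\<Oplus>\<^bsub>B\<^esub>k\<in>{..<n}. f (S (i, k)) \<otimes>\<^bsub>B\<^esub> f (T (k, j)))"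
      if "i < n" "j < n" for i j
      using that e f(1) by (subst star_hom_finsum[OF assms]) (auto intro!: B.finsum_cong' simp: f)
    then show "(\<lambda>(i, j)\<in>{..<n} \<times> {..<n}. f ((S \<otimes>\<^bsub>matrix_alg n A\<^esub> T) (i, j))) =
      (\<lambda>(i, j)\<in>{..<n} \<times> {..<n}. f (S (i, j))) \<otimes>\<^bsub>matrix_alg n B\<^esub> (\<lambda>(i, j)\<in>{..<n} \<times> {..<n}. f (T (i, j)))"
      using e f(1) by (auto simp: fun_eq_iff cong: B.finsum_cong)
  next
    fix T k assume "T \<in> carrier (matrix_alg n A)"
    then have e: "\<lbrakk>i < n; j < n\<rbrakk> \<Longrightarrow> T (i, j) \<in> carrier A" for i j by auto
    let ?f = "\<lambda>T. \<lambda>(i, j)\<in>{..<n} \<times> {..<n}. f (T (i, j))"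
    show "?f T \<in> carrier (matrix_alg n B)" using f(1)[OF e] by auto
    show "?f (k \<odot>\<^bsub>matrix_alg n A\<^esub> T) = k \<odot>\<^bsub>matrix_alg n B\<^esub> ?f T"
      using f(4)[OF e] by (auto simp: fun_eq_iff)
    show "?f (cadj (matrix_alg n A) T) = cadj (matrix_alg n B) (?f T)"
      using f(5)[OF e] by (auto simp: fun_eq_iff)
    fix S assume "S \<in> carrier (matrix_alg n A)"
    then have e': "\<lbrakk>i < n; j < n\<rbrakk> \<Longrightarrow> S (i, j) \<in> carrier A" for i j by auto
    show "?f (T \<oplus>\<^bsub>matrix_alg n A\<^esub> S) = ?f T \<oplus>\<^bsub>matrix_alg n B\<^esub> ?f S"
      using f(2)[OF e e'] by (auto simp: fun_eq_iff)
  qed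
qed

lemma bij_matrix_map:
  assumes "star_ring A" "star_ring B" "bij_betw f (carrier A) (carrier B)"
  shows "bij_betw (\<lambda>T. \<lambda>(i, j)\<in>{..<n} \<times> {..<n}. f (T (i, j))) (carrier (matrix_alg n A)) (carrier (matrix_alg n B))"
proof -
  interpret A: star_ring A by fact
  interpret B: star_ring B by fact
  let ?g = "inv_into (carrier A) f"
  have f: "x \<in> carrier A \<Longrightarrow> f x \<in> carrier B" "x \<in> carrier A \<Longrightarrow> ?g (f x) = x" for x
    using assms(3) by (auto simp: bij_betw_def)
  have g: "y \<in> carrier B \<Longrightarrow> ?g y \<in> carrier A" "y \<in> carrier B \<Longrightarrow> f (?g y) = y" for y
    using assms(3) by (auto simp: bij_betw_def inv_into_into f_inv_into_f)
  show ?thesis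
  proof (rule bij_betwI[where g="\<lambda>T. \<lambda>(i, j)\<in>{..<n} \<times> {..<n}. ?g (T (i, j))", OF Pi_I Pi_I])
    fix T assume T: "T \<in> carrier (matrix_alg n A)"
    then have e: "\<lbrakk>i < n; j < n\<rbrakk> \<Longrightarrow> T (i, j) \<in> carrier A" for i j by auto
    then show "(\<lambda>(i, j)\<in>{..<n} \<times> {..<n}. ?g ((\<lambda>(i, j)\<in>{..<n} \<times> {..<n}. f (T (i, j))) (i, j))) = T"
      using f(2) A.matrix_outside[OF T[unfolded A.matrix_simps]] by (auto simp: fun_eq_iff)
    show "(\<lambda>(i, j)\<in>{..<n} \<times> {..<n}. f (T (i, j))) \<in> carrier (matrix_alg n B)"
      using f(1)[OF e] by auto
  next
    fix T assume T: "T \<in> carrier (matrix_alg n B)"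
    then have e: "\<lbrakk>i < n; j < n\<rbrakk> \<Longrightarrow> T (i, j) \<in> carrier B" for i j by auto
    then show "(\<lambda>(i, j)\<in>{..<n} \<times> {..<n}. f ((\<lambda>(i, j)\<in>{..<n} \<times> {..<n}. ?g (T (i, j))) (i, j))) = T"
      using g(2) B.matrix_outside[OF T[unfolded B.matrix_simps]] by (auto simp: fun_eq_iff)
    show "(\<lambda>(i, j)\<in>{..<n} \<times> {..<n}. ?g (T (i, j))) \<in> carrier (matrix_alg n A)"
      using g(1)[OF e] by auto
  qed
qed

text \<open>Indices are written as \<open>k = a * m + b\<close>; this is what identifies products of
  block matrices with products of large matrices.\<close>

lemma (in abelian_monoid) finsum_lessThan_mult:
  "(\<And>k. k < n * m \<Longrightarrow> f k \<in> carrier G) \<Longrightarrow>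
    (\<Oplus>k\<in>{..<n * m}. f k) = (\<Oplus>a\<in>{..<n}. \<Oplus>b\<in>{..<m :: nat}. f (a * m + b))"
proof (induction n)
  case (Suc n)
  have idx: "a * m + b < Suc n * m" if "a \<le> n" "b < m" for a b
    unfolding mult_Suc using mult_le_mono1[OF that(1), of m] that(2) by linarith
  have c: "f (a * m + b) \<in> carrier G" if "a \<le> n" "b < m" for a b using Suc.prems idx[OF that] by blast
  have "(\<Oplus>k\<in>{..<n * m + m}. f k) = (\<Oplus>k\<in>{..<n * m}. f k) \<oplus> (\<Oplus>b\<in>{..<m}. f (n * m + b))"
    using Suc.prems by (intro finsum_lessThan_add) (auto simp: add.commute)
  also have "\<dots> = (\<Oplus>a\<in>{..<n}. \<Oplus>b\<in>{..<m}. f (a * m + b)) \<oplus> (\<Oplus>b\<in>{..<m}. f (n * m + b))"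
    using Suc by simp
  also have "\<dots> = (\<Oplus>a\<in>{..<Suc n}. \<Oplus>b\<in>{..<m}. f (a * m + b))"
    using c by (simp add: lessThan_Suc finsum_insert Pi_iff finsum_closed a_comm)
  finally show ?case by (simp add: add.commute)
qed simp

context unital_cstar_algebra begin

lemma corners_lift_iso:
  assumes "star_ring B" "star_ring C" "star_hom B C f" "bij_betw f (carrier B) (carrier C)" "corners_lift C"
  shows "corners_lift B"
  unfolding corners_lift_def
proof (intro allI impI)
  fix n :: nat and p assume n: "n \<ge> 1" and p: "projection (matrix_alg n B) p"
  note h = star_hom_matrix_map[OF assms(1-3), of n]
  show "has_lifts (corner (matrix_alg n B) p)"
    using assms(5) n star_hom_projection[OF h p] unfolding corners_lift_def
    by (intro has_lifts_corner_iso[OF star_ring.star_ring_matrix[OF assms(1)] star_ring.star_ring_matrix[OF assms(2)]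
      h bij_matrix_map[OF assms(1,2,4)] p]) blast
qed

text \<open>A projection \<open>q\<close> over \<open>p B p\<close> is also one over
  \<open>B\<close>. If \<open>T\<close> lies in the corner of the matrices over \<open>B\<close> at
  \<open>q\<close>, then \<open>T = q T = T q\<close>, and the entries of \<open>q\<close> absorb
  \<open>p\<close>; so the entries of \<open>T\<close> lie in \<open>p B p\<close> already. Hence
  both corners have the same elements.\<close>

lemma corners_lift_corner:
  assumes B: "star_ring B" and p: "projection B p" and lift: "corners_lift B"
  shows "corners_lift (corner B p)"
  unfolding corners_lift_def
proof (intro allI impI)
  fix n :: nat and q assume n: "n \<ge> 1" and q: "projection (matrix_alg n (corner B p)) q"
  interpret B: star_ring B by fact
  interpret C: star_ring "corner B p" by (rule B.star_ring_corner[OF p])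
  interpret M: star_ring "matrix_alg n B" by (rule B.star_ring_matrix)
  interpret N: star_ring "matrix_alg n (corner B p)" by (rule C.star_ring_matrix)
  have mem: "x \<in> carrier (corner B p) \<longleftrightarrow> x \<in> carrier B \<and> p \<otimes>\<^bsub>B\<^esub> x = x \<and> x \<otimes>\<^bsub>B\<^esub> p = x" for x
    by (rule B.carrier_corner[OF p])
  have pB: "p \<in> carrier B" using p by (simp add: projection_def)
  have sum_eq: "(\<Oplus>\<^bsub>corner B p\<^esub>k\<in>{..<n}. S (i, k) \<otimes>\<^bsub>B\<^esub> T (k, j)) = (\<Oplus>\<^bsub>B\<^esub>k\<in>{..<n}. S (i, k) \<otimes>\<^bsub>B\<^esub> T (k, j))"
    if "S \<in> carrier (matrix_alg n (corner B p))" "T \<in> carrier (matrix_alg n (corner B p))" "i < n" "j < n" for S T i j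
  proof (rule B.corner_finsum[OF p])
    have "S (i, k) \<in> carrier (corner B p)" "T (k, j) \<in> carrier (corner B p)" if "k < n" for k
      using that \<open>i < n\<close> \<open>j < n\<close> \<open>S \<in> _\<close> \<open>T \<in> _\<close> C.matrix_entry by simp_all
    then show "(\<lambda>k. S (i, k) \<otimes>\<^bsub>B\<^esub> T (k, j)) \<in> {..<n} \<rightarrow> carrier (corner B p)"
      using C.m_closed by auto
  qed
  have incl: "star_hom (matrix_alg n (corner B p)) (matrix_alg n B) (\<lambda>T. T)"
  proof (rule star_hom_id)
    show "carrier (matrix_alg n (corner B p)) \<subseteq> carrier (matrix_alg n B)"
      using mem by (auto simp: PiE_iff)
    show "S \<otimes>\<^bsub>matrix_alg n (corner B p)\<^esub> T = S \<otimes>\<^bsub>matrix_alg n B\<^esub> T"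
      if "S \<in> carrier (matrix_alg n (corner B p))" "T \<in> carrier (matrix_alg n (corner B p))" for S T
      using sum_eq[OF that] by (auto simp: fun_eq_iff)
  qed (auto simp: fun_eq_iff)
  note q' = star_hom_projection[OF incl q]
  have lift': "has_lifts (corner (matrix_alg n B) q)" using lift n q' unfolding corners_lift_def by blast
  have qe: "q (i, j) \<in> carrier (corner B p)" if "i < n" "j < n" for i j
  proof -
    have "q \<in> {..<n} \<times> {..<n} \<rightarrow>\<^sub>E carrier (corner B p)" using q by (simp add: projection_def)
    then show ?thesis using C.matrix_entry that by blast
  qed
  have sub: "carrier (corner (matrix_alg n B) q) \<subseteq> carrier (matrix_alg n (corner B p))"
  proof
    fix T assume "T \<in> carrier (corner (matrix_alg n B) q)"
    then have T: "T \<in> carrier (matrix_alg n B)" "q \<otimes>\<^bsub>matrix_alg n B\<^esub> T = T" "T \<otimes>\<^bsub>matrix_alg n B\<^esub> q = T"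
      using M.carrier_corner[OF q'] by (simp_all del: B.matrix_simps)
    have te: "T (i, j) \<in> carrier B" if "i < n" "j < n" for i j using T(1) B.matrix_entry that by simp
    have "T (i, j) \<in> carrier (corner B p)" if ij: "i < n" "j < n" for i j
    proof -
      have qk: "q (i, k) \<in> carrier B" "p \<otimes>\<^bsub>B\<^esub> q (i, k) = q (i, k)" "q (k, j) \<in> carrier B" "q (k, j) \<otimes>\<^bsub>B\<^esub> p = q (k, j)" if "k < n" for k
        using qe[OF ij(1) that] qe[OF that ij(2)] mem by simp_all
      have t1: "T (i, j) = (\<Oplus>\<^bsub>B\<^esub>k\<in>{..<n}. q (i, k) \<otimes>\<^bsub>B\<^esub> T (k, j))"
        using fun_cong[OF T(2), of "(i, j)"] ij by simp
      have t2: "T (i, j) = (\<Oplus>\<^bsub>B\<^esub>k\<in>{..<n}. T (i, k) \<otimes>\<^bsub>B\<^esub> q (k, j))"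
        using fun_cong[OF T(3), of "(i, j)"] ij by simp
      have "p \<otimes>\<^bsub>B\<^esub> T (i, j) = (\<Oplus>\<^bsub>B\<^esub>k\<in>{..<n}. p \<otimes>\<^bsub>B\<^esub> (q (i, k) \<otimes>\<^bsub>B\<^esub> T (k, j)))"
        by (subst t1, rule B.finsum_rdistr) (use pB qk te ij in auto)
      also have "\<dots> = (\<Oplus>\<^bsub>B\<^esub>k\<in>{..<n}. q (i, k) \<otimes>\<^bsub>B\<^esub> T (k, j))"
        using pB qk te ij by (intro B.finsum_cong') (auto simp flip: B.m_assoc)
      finally have l: "p \<otimes>\<^bsub>B\<^esub> T (i, j) = T (i, j)" using t1 by simp
      have "T (i, j) \<otimes>\<^bsub>B\<^esub> p = (\<Oplus>\<^bsub>B\<^esub>k\<in>{..<n}. T (i, k) \<otimes>\<^bsub>B\<^esub> q (k, j) \<otimes>\<^bsub>B\<^esub> p)"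
        by (subst t2, rule B.finsum_ldistr) (use pB qk te ij in auto)
      also have "\<dots> = (\<Oplus>\<^bsub>B\<^esub>k\<in>{..<n}. T (i, k) \<otimes>\<^bsub>B\<^esub> q (k, j))"
        using pB qk te ij by (intro B.finsum_cong') (auto simp: B.m_assoc)
      finally have "T (i, j) \<otimes>\<^bsub>B\<^esub> p = T (i, j)" using t2 by simp
      then show ?thesis using l te[OF ij] mem by simp
    qed
    then show "T \<in> carrier (matrix_alg n (corner B p))"
      using T(1) by (auto simp: PiE_iff)
  qed
  show "has_lifts (corner (matrix_alg n (corner B p)) q)"
  proof (rule has_lifts_retract[OF _ _ _ lift'])
    show "star_hom (corner (matrix_alg n (corner B p)) q) (corner (matrix_alg n B) q) (\<lambda>T. T)"
      by (rule star_hom_corner[OF N.star_ring_axioms M.star_ring_axioms incl q])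
    show "star_hom (corner (matrix_alg n B) q) (corner (matrix_alg n (corner B p)) q) (\<lambda>T. T)"
    proof (rule star_hom_id)
      have mult_eq: "S \<otimes>\<^bsub>matrix_alg n (corner B p)\<^esub> T = S \<otimes>\<^bsub>matrix_alg n B\<^esub> T"
        if "S \<in> carrier (matrix_alg n (corner B p))" "T \<in> carrier (matrix_alg n (corner B p))" for S T
        using star_homD(3)[OF incl that] .
      have qN: "q \<in> carrier (matrix_alg n (corner B p))" using q by (simp add: projection_def)
      show "carrier (corner (matrix_alg n B) q) \<subseteq> carrier (corner (matrix_alg n (corner B p)) q)"
      proof
        fix T assume T: "T \<in> carrier (corner (matrix_alg n B) q)"
        then have TN: "T \<in> carrier (matrix_alg n (corner B p))" using sub by blast
        show "T \<in> carrier (corner (matrix_alg n (corner B p)) q)"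
          using T TN unfolding M.carrier_corner[OF q'] N.carrier_corner[OF q] mult_eq[OF qN TN] mult_eq[OF TN qN] by blast
      qed
      show "S \<otimes>\<^bsub>corner (matrix_alg n B) q\<^esub> T = S \<otimes>\<^bsub>corner (matrix_alg n (corner B p)) q\<^esub> T"
        if "S \<in> carrier (corner (matrix_alg n B) q)" "T \<in> carrier (corner (matrix_alg n B) q)" for S T
        using mult_eq sub that unfolding M.corner_simps N.corner_simps by (simp add: subset_iff del: B.matrix_simps C.matrix_simps)
    qed (simp_all add: fun_eq_iff)
  qed simp
qed

end

lemma (in star_ring) matrix_finsum_entry:
  assumes "F \<in> I \<rightarrow> carrier (matrix_alg m A)" "i < m" "j < m"
  shows "(\<Oplus>\<^bsub>matrix_alg m A\<^esub>k\<in>I. F k) (i, j) = (\<Oplus>k\<in>I. F k (i, j))"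
proof -
  interpret M: star_ring "matrix_alg m A" by (rule star_ring_matrix)
  show ?thesis
    using assms by (intro finsum_additive[where h="\<lambda>T. T (i, j)"]) (auto simp: M.abelian_monoid_self abelian_monoid_self)
qed

context unital_cstar_algebra begin

text \<open>Matrices of size \<open>n\<close> over matrices of size \<open>m\<close> are matrices of
  size \<open>n * m\<close>: the index \<open>i\<close> stands for the block \<open>i div m\<close>
  and the position \<open>i mod m\<close> in it. Corners correspond under this isomorphism.\<close>

lemma corners_lift_matrix:
  assumes B: "star_ring B" and m: "m \<ge> 1" and lift: "corners_lift B"
  shows "corners_lift (matrix_alg m B)"
  unfolding corners_lift_def
proof (intro allI impI)
  fix n :: nat and q assume n: "n \<ge> 1" and q: "projection (matrix_alg n (matrix_alg m B)) q"
  interpret B: star_ring B by fact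
  interpret M: star_ring "matrix_alg m B" by (rule B.star_ring_matrix)
  let ?MM = "matrix_alg n (matrix_alg m B)" and ?N = "matrix_alg (n * m) B"
  define f where "f T = (\<lambda>(i, j)\<in>{..<n * m} \<times> {..<n * m}. T (i div m, j div m) (i mod m, j mod m))"
    for T :: "nat \<times> nat \<Rightarrow> nat \<times> nat \<Rightarrow> 'b"
  define g where "g S = (\<lambda>(a, b)\<in>{..<n} \<times> {..<n}. \<lambda>(k, l)\<in>{..<m} \<times> {..<m}. S (a * m + k, b * m + l))"
    for S :: "nat \<times> nat \<Rightarrow> 'b"
  have dm: "i div m < n" "i mod m < m" if "i < n * m" for i
    using that m by (simp_all add: less_mult_imp_div_less)
  have idx: "a * m + k < n * m" if "a < n" "k < m" for a k
  proof -
    have "Suc a * m \<le> n * m" using that by (intro mult_le_mono1) simp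
    then show ?thesis using that by simp
  qed
  have e1: "T (a, b) \<in> carrier (matrix_alg m B)" if "T \<in> carrier ?MM" "a < n" "b < n" for T a b
    using M.matrix_entry that unfolding M.matrix_simps by blast
  have e2: "T (a, b) (k, l) \<in> carrier B" if "T \<in> carrier ?MM" "a < n" "b < n" "k < m" "l < m" for T a b k l
    using B.matrix_entry e1[OF that(1-3)] that(4,5) unfolding B.matrix_simps by blast
  have hom: "star_hom ?MM ?N f"
  proof (rule star_homI)
    fix S assume S: "S \<in> carrier ?MM"
    show "f S \<in> carrier ?N" using e2[OF S] dm by (auto simp: f_def)
    show "f (c \<odot>\<^bsub>?MM\<^esub> S) = c \<odot>\<^bsub>?N\<^esub> f S" for c
      using dm by (auto simp: f_def fun_eq_iff)
    show "f (cadj ?MM S) = cadj ?N (f S)"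
      using dm by (auto simp: f_def fun_eq_iff)
    fix T assume T: "T \<in> carrier ?MM"
    show "f (S \<oplus>\<^bsub>?MM\<^esub> T) = f S \<oplus>\<^bsub>?N\<^esub> f T"
      using dm by (auto simp: f_def fun_eq_iff)
    have "(S \<otimes>\<^bsub>?MM\<^esub> T) (i div m, j div m) (i mod m, j mod m) =
      (\<Oplus>\<^bsub>B\<^esub>e\<in>{..<n * m}. f S (i, e) \<otimes>\<^bsub>B\<^esub> f T (e, j))" if ij: "i < n * m" "j < n * m" for i j
    proof -
      let ?a = "i div m" and ?b = "j div m" and ?k = "i mod m" and ?l = "j mod m"
      note d = dm[OF ij(1)] dm[OF ij(2)]
      have "(S \<otimes>\<^bsub>?MM\<^esub> T) (?a, ?b) (?k, ?l) =
        (\<Oplus>\<^bsub>matrix_alg m B\<^esub>c\<in>{..<n}. S (?a, c) \<otimes>\<^bsub>matrix_alg m B\<^esub> T (c, ?b)) (?k, ?l)"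
        using d by simp
      also have "\<dots> = (\<Oplus>\<^bsub>B\<^esub>c\<in>{..<n}. (S (?a, c) \<otimes>\<^bsub>matrix_alg m B\<^esub> T (c, ?b)) (?k, ?l))"
        using d e1[OF S] e1[OF T] by (intro B.matrix_finsum_entry) (auto simp del: B.matrix_simps)
      also have "\<dots> = (\<Oplus>\<^bsub>B\<^esub>c\<in>{..<n}. \<Oplus>\<^bsub>B\<^esub>d\<in>{..<m}. S (?a, c) (?k, d) \<otimes>\<^bsub>B\<^esub> T (c, ?b) (d, ?l))"
        using d e2[OF S] e2[OF T] by (intro B.finsum_cong') (auto intro!: B.finsum_closed)
      also have "\<dots> = (\<Oplus>\<^bsub>B\<^esub>c\<in>{..<n}. \<Oplus>\<^bsub>B\<^esub>d\<in>{..<m}. f S (i, c * m + d) \<otimes>\<^bsub>B\<^esub> f T (c * m + d, j))"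
        using d e2[OF S] e2[OF T] idx ij by (intro B.finsum_cong') (auto intro!: B.finsum_closed B.finsum_cong' simp: f_def)
      also have "\<dots> = (\<Oplus>\<^bsub>B\<^esub>e\<in>{..<n * m}. f S (i, e) \<otimes>\<^bsub>B\<^esub> f T (e, j))"
        using d e2[OF S] e2[OF T] dm ij by (intro B.finsum_lessThan_mult[symmetric]) (auto simp: f_def)
      finally show ?thesis .
    qed
    then have "f (S \<otimes>\<^bsub>?MM\<^esub> T) (i, j) = (f S \<otimes>\<^bsub>?N\<^esub> f T) (i, j)" if "i < n * m" "j < n * m" for i j
      using that by (subst f_def) (simp del: M.matrix_simps(2))
    then show "f (S \<otimes>\<^bsub>?MM\<^esub> T) = f S \<otimes>\<^bsub>?N\<^esub> f T"
      by (auto simp: fun_eq_iff f_def)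
  qed
  have "bij_betw f (carrier ?MM) (carrier ?N)"
  proof (rule bij_betwI[where g=g, OF Pi_I Pi_I])
    fix T assume T: "T \<in> carrier ?MM"
    show "f T \<in> carrier ?N" using star_homD(1)[OF hom T] .
    have "g (f T) (a, b) (k, l) = T (a, b) (k, l)" for a b k l
    proof (cases "a < n \<and> b < n")
      case True
      then show ?thesis
        using idx B.matrix_outside[OF e1[OF T, of a b, unfolded B.matrix_simps], of k l]
        by (cases "k < m \<and> l < m") (auto simp: g_def f_def)
    next
      case False
      then have "T (a, b) = undefined" using M.matrix_outside[OF T[unfolded M.matrix_simps]] by blast
      with False show ?thesis by (auto simp: g_def)
    qed
    then show "g (f T) = T" by (auto simp: fun_eq_iff)
  next
    fix S assume S: "S \<in> carrier ?N"
    then have e: "S (i, j) \<in> carrier B" if "i < n * m" "j < n * m" for i j using that by auto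
    show "g S \<in> carrier ?MM" using e idx by (simp add: g_def PiE_iff split_beta)
    have "f (g S) (i, j) = S (i, j)" for i j
      using dm B.matrix_outside[OF S[unfolded B.matrix_simps], of i j]
      by (cases "i < n * m \<and> j < n * m") (auto simp: f_def g_def)
    then show "f (g S) = S" by (auto simp: fun_eq_iff)
  qed
  then show "has_lifts (corner ?MM q)"
    using lift n m star_hom_projection[OF hom q] unfolding corners_lift_def
    by (intro has_lifts_corner_iso[OF M.star_ring_matrix B.star_ring_matrix hom _ q]) auto
qed

text \<open>Matrices over a direct sum are a direct sum of matrix algebras. The corner at
  \<open>q\<close> splits into the corners at the components of \<open>q\<close>, which have lifts
  by assumption, and direct sums preserve the existence of lifts.\<close>

lemma corners_lift_direct_sum:
  assumes D: "\<And>k. k < n \<Longrightarrow> star_ring (D k)" and lift: "\<And>k. k < n \<Longrightarrow> corners_lift (D k)"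
  shows "corners_lift (direct_sum n D)"
  unfolding corners_lift_def
proof (intro allI impI)
  fix N :: nat and q assume N: "N \<ge> 1" and q: "projection (matrix_alg N (direct_sum n D)) q"
  interpret S: star_ring "direct_sum n D" by (rule star_ring_direct_sum[OF D])
  let ?MS = "matrix_alg N (direct_sum n D)" and ?M = "\<lambda>k. matrix_alg N (D k)"
  have M: "star_ring (?M k)" if "k < n" for k by (rule star_ring.star_ring_matrix[OF D[OF that]])
  interpret R: star_ring "direct_sum n ?M" by (rule star_ring_direct_sum[OF M])
  have MD: "carrier (?M k) = {..<N} \<times> {..<N} \<rightarrow>\<^sub>E carrier (D k)"
    "mult (?M k) T U = (\<lambda>(i, j)\<in>{..<N} \<times> {..<N}. \<Oplus>\<^bsub>D k\<^esub>l\<in>{..<N}. T (i, l) \<otimes>\<^bsub>D k\<^esub> U (l, j))"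
    "add (?M k) T U = (\<lambda>(i, j)\<in>{..<N} \<times> {..<N}. T (i, j) \<oplus>\<^bsub>D k\<^esub> U (i, j))"
    "smult (?M k) c T = (\<lambda>(i, j)\<in>{..<N} \<times> {..<N}. c \<odot>\<^bsub>D k\<^esub> T (i, j))"
    "cadj (?M k) T = (\<lambda>(i, j)\<in>{..<N} \<times> {..<N}. cadj (D k) (T (j, i)))" for k T U c
    by (simp_all add: matrix_alg_def)
  define f where "f T = (\<lambda>k\<in>{..<n}. \<lambda>(i, j)\<in>{..<N} \<times> {..<N}. T (i, j) k)" for T :: "nat \<times> nat \<Rightarrow> nat \<Rightarrow> 'b"
  define g where "g U = (\<lambda>(i, j)\<in>{..<N} \<times> {..<N}. \<lambda>k\<in>{..<n}. U k (i, j))" for U :: "nat \<Rightarrow> nat \<times> nat \<Rightarrow> 'b"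
  have e1: "T (i, j) \<in> carrier (direct_sum n D)" if "T \<in> carrier ?MS" "i < N" "j < N" for T i j
    using S.matrix_entry that unfolding S.matrix_simps by blast
  have e2: "T (i, j) k \<in> carrier (D k)" if "T \<in> carrier ?MS" "i < N" "j < N" "k < n" for T i j k
    using e1[OF that(1-3)] that(4) by auto
  have hom: "star_hom ?MS (direct_sum n ?M) f"
  proof (rule star_homI)
    fix T assume T: "T \<in> carrier ?MS"
    show "f T \<in> carrier (direct_sum n ?M)" using e2[OF T] by (simp add: f_def MD PiE_iff)
    show "f (c \<odot>\<^bsub>?MS\<^esub> T) = c \<odot>\<^bsub>direct_sum n ?M\<^esub> f T" for c
      by (auto simp: f_def fun_eq_iff MD)
    show "f (cadj ?MS T) = cadj (direct_sum n ?M) (f T)"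
      by (auto simp: f_def fun_eq_iff MD)
    fix U assume U: "U \<in> carrier ?MS"
    show "f (T \<oplus>\<^bsub>?MS\<^esub> U) = f T \<oplus>\<^bsub>direct_sum n ?M\<^esub> f U"
      by (auto simp: f_def fun_eq_iff MD)
    have "(T \<otimes>\<^bsub>?MS\<^esub> U) (i, j) k = (\<Oplus>\<^bsub>D k\<^esub>l\<in>{..<N}. T (i, l) k \<otimes>\<^bsub>D k\<^esub> U (l, j) k)"
      if ij: "i < N" "j < N" and k: "k < n" for i j k
    proof -
      interpret Dk: star_ring "D k" by (rule D[OF k])
      have "(T \<otimes>\<^bsub>?MS\<^esub> U) (i, j) k = (\<Oplus>\<^bsub>direct_sum n D\<^esub>l\<in>{..<N}. T (i, l) \<otimes>\<^bsub>direct_sum n D\<^esub> U (l, j)) k"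
        using ij by simp
      also have "\<dots> = (\<Oplus>\<^bsub>D k\<^esub>l\<in>{..<N}. (T (i, l) \<otimes>\<^bsub>direct_sum n D\<^esub> U (l, j)) k)"
      proof (rule finsum_additive[OF S.abelian_monoid_self Dk.abelian_monoid_self, of "\<lambda>x. x k"])
        show "(\<lambda>l. T (i, l) \<otimes>\<^bsub>direct_sum n D\<^esub> U (l, j)) \<in> {..<N} \<rightarrow> carrier (direct_sum n D)"
        proof
          fix l assume "l \<in> {..<N}"
          then show "T (i, l) \<otimes>\<^bsub>direct_sum n D\<^esub> U (l, j) \<in> carrier (direct_sum n D)"
            using S.m_closed[OF e1[OF T, of i l] e1[OF U, of l j]] ij by blast
        qed
      qed (use k in auto)
      also have "\<dots> = (\<Oplus>\<^bsub>D k\<^esub>l\<in>{..<N}. T (i, l) k \<otimes>\<^bsub>D k\<^esub> U (l, j) k)"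
        using k by simp
      finally show ?thesis .
    qed
    then have "f (T \<otimes>\<^bsub>?MS\<^esub> U) k (i, j) = (f T \<otimes>\<^bsub>direct_sum n ?M\<^esub> f U) k (i, j)" for k i j
    proof (cases "k < n \<and> i < N \<and> j < N")
      case True
      interpret Dk: star_ring "D k" using D True by blast
      have "(\<Oplus>\<^bsub>D k\<^esub>l\<in>{..<N}. T (i, l) k \<otimes>\<^bsub>D k\<^esub> U (l, j) k) = (\<Oplus>\<^bsub>D k\<^esub>l\<in>{..<N}. f T k (i, l) \<otimes>\<^bsub>D k\<^esub> f U k (l, j))"
        using True e2[OF T] e2[OF U] by (intro Dk.finsum_cong') (auto simp: f_def)
      then show ?thesis
        using True \<open>\<And>i j k. \<lbrakk>i < N; j < N; k < n\<rbrakk> \<Longrightarrow> (T \<otimes>\<^bsub>?MS\<^esub> U) (i, j) k = _ i j k\<close>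
        by (subst f_def) (simp add: MD del: S.matrix_simps(2))
    qed (auto simp: f_def MD)
    then show "f (T \<otimes>\<^bsub>?MS\<^esub> U) = f T \<otimes>\<^bsub>direct_sum n ?M\<^esub> f U"
      by (auto simp: fun_eq_iff)
  qed
  have bij: "bij_betw f (carrier ?MS) (carrier (direct_sum n ?M))"
  proof (rule bij_betwI[where g=g, OF Pi_I Pi_I])
    fix T assume T: "T \<in> carrier ?MS"
    show "f T \<in> carrier (direct_sum n ?M)" using star_homD(1)[OF hom T] .
    have "g (f T) (i, j) k = T (i, j) k" for i j k
    proof (cases "i < N \<and> j < N")
      case True
      then have "T (i, j) \<in> (\<Pi>\<^sub>E k\<in>{..<n}. carrier (D k))" using e1[OF T, of i j] by simp
      then show ?thesis using True PiE_arb[of "T (i, j)" "{..<n}" _ k] by (cases "k < n") (auto simp: g_def f_def)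
    next
      case False
      then have "T (i, j) = undefined" using S.matrix_outside[OF T[unfolded S.matrix_simps]] by blast
      with False show ?thesis by (auto simp: g_def)
    qed
    then show "g (f T) = T" by (auto simp: fun_eq_iff)
  next
    fix U assume U: "U \<in> carrier (direct_sum n ?M)"
    then have Uk: "U k \<in> {..<N} \<times> {..<N} \<rightarrow>\<^sub>E carrier (D k)" if "k < n" for k using that by (auto simp: MD)
    then have e: "U k (i, j) \<in> carrier (D k)" if "k < n" "i < N" "j < N" for k i j using that by fastforce
    show "g U \<in> carrier ?MS" using e by (simp add: g_def PiE_iff split_beta)
    have "f (g U) k (i, j) = U k (i, j)" for i j k
    proof (cases "k < n")
      case True
      then show ?thesis using PiE_arb[OF Uk[OF True], of "(i, j)"] by (cases "i < N \<and> j < N") (auto simp: g_def f_def)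
    next
      case False
      then have "U k = undefined" using U PiE_arb[of U "{..<n}" _ k] by simp
      with False show ?thesis by (auto simp: f_def)
    qed
    then show "f (g U) = U" by (auto simp: fun_eq_iff)
  qed
  note q' = star_hom_projection[OF hom q]
  let ?q = "f q"
  have qk: "projection (?M k) (?q k)" if k: "k < n" for k
  proof -
    have "(?q \<otimes>\<^bsub>direct_sum n ?M\<^esub> ?q) k = ?q k" "cadj (direct_sum n ?M) ?q k = ?q k" "?q \<in> carrier (direct_sum n ?M)"
      using q' by (simp_all add: projection_def)
    then show ?thesis using k by (auto simp: projection_def)
  qed
  have "has_lifts (corner (?M k) (?q k))" if "k < n" for k
    using lift[OF that] qk[OF that] N unfolding corners_lift_def by blast
  then have dl: "has_lifts (direct_sum n (\<lambda>k. corner (?M k) (?q k)))"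
    using star_ring.star_ring_corner[OF M qk] by (intro has_lifts_direct_sum)
  have mem: "x \<in> carrier (corner (direct_sum n ?M) ?q) \<longleftrightarrow> x \<in> carrier (direct_sum n (\<lambda>k. corner (?M k) (?q k)))" for x
  proof -
    have "x \<in> carrier (direct_sum n (\<lambda>k. corner (?M k) (?q k))) \<longleftrightarrow> x \<in> carrier (direct_sum n ?M) \<and>
      (\<forall>k<n. ?q k \<otimes>\<^bsub>?M k\<^esub> x k = x k \<and> x k \<otimes>\<^bsub>?M k\<^esub> ?q k = x k)"
      using star_ring.carrier_corner[OF M qk] by (auto simp: PiE_iff)
    also have "\<dots> \<longleftrightarrow> x \<in> carrier (direct_sum n ?M) \<and> ?q \<otimes>\<^bsub>direct_sum n ?M\<^esub> x = x \<and> x \<otimes>\<^bsub>direct_sum n ?M\<^esub> ?q = x"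
    proof -
      have "(?q \<otimes>\<^bsub>direct_sum n ?M\<^esub> x = x) \<longleftrightarrow> (\<forall>k<n. ?q k \<otimes>\<^bsub>?M k\<^esub> x k = x k)"
        "(x \<otimes>\<^bsub>direct_sum n ?M\<^esub> ?q = x) \<longleftrightarrow> (\<forall>k<n. x k \<otimes>\<^bsub>?M k\<^esub> ?q k = x k)"
        if x: "x \<in> carrier (direct_sum n ?M)"
        using PiE_arb[of x "{..<n}" "\<lambda>k. carrier (?M k)"] x by (auto simp: fun_eq_iff restrict_def)
      then show ?thesis by blast
    qed
    finally show ?thesis using R.carrier_corner[OF q'] by blast
  qed
  have cs: "mult (corner (?M k) (?q k)) = mult (?M k)" "add (corner (?M k) (?q k)) = add (?M k)"
    "smult (corner (?M k) (?q k)) = smult (?M k)" "cadj (corner (?M k) (?q k)) = cadj (?M k)" for k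
    by (simp_all add: corner_def)
  have "has_lifts (corner (direct_sum n ?M) ?q)"
  proof (rule has_lifts_retract[OF _ _ _ dl])
    show "star_hom (corner (direct_sum n ?M) ?q) (direct_sum n (\<lambda>k. corner (?M k) (?q k))) (\<lambda>x. x)"
      by (rule star_hom_id) (use mem in \<open>simp_all add: subset_iff cs del: direct_sum_simps(1)\<close>)
    show "star_hom (direct_sum n (\<lambda>k. corner (?M k) (?q k))) (corner (direct_sum n ?M) ?q) (\<lambda>x. x)"
      by (rule star_hom_id) (use mem in \<open>simp_all add: subset_iff cs del: direct_sum_simps(1)\<close>)
  qed simp
  then show "has_lifts (corner ?MS q)"
    by (rule has_lifts_corner_iso[OF S.star_ring_matrix R.star_ring_axioms hom bij q])
qed

lemma corners_lift_cstar_iso: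
  assumes "separable_unital_cstar B \<and> B \<simeq>\<^sub>* C" "star_ring C" "corners_lift C"
  shows "separable_unital_cstar B \<and> corners_lift B"
proof -
  interpret B: unital_cstar_algebra B using assms by (simp add: separable_unital_cstar_def)
  show ?thesis
    using assms corners_lift_iso[OF B.star_ring_axioms] unfolding cstar_iso_def by blast
qed

text \<open>Minimality of the finite saturation turns this into an induction principle: it is enough
  to know the lifting property on the class itself.\<close>

lemma finitely_saturated_corners_lift:
  "finitely_saturated {B. separable_unital_cstar B \<and> corners_lift B}"
proof -
  have sr: "star_ring B" if "separable_unital_cstar B" for B :: "'b cstar_alg"
  proof -
    interpret B: unital_cstar_algebra B using that by (simp add: separable_unital_cstar_def)
    show ?thesis by (rule B.star_ring_axioms)
  qed
  show ?thesis
    unfolding finitely_saturated_def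
  proof (intro conjI ballI allI impI CollectI; (elim CollectE)?)
    fix B C :: "'b cstar_alg"
    assume C: "separable_unital_cstar C \<and> corners_lift C" and B: "separable_unital_cstar B \<and> B \<simeq>\<^sub>* C"
    show "separable_unital_cstar B" "corners_lift B"
      using corners_lift_cstar_iso[OF B sr] C by blast+
  next
    fix n :: nat and D :: "nat \<Rightarrow> 'b cstar_alg" and B :: "'b cstar_alg"
    assume D: "\<forall>k<n. D k \<in> {B. separable_unital_cstar B \<and> corners_lift B}" and B: "separable_unital_cstar B \<and> B \<simeq>\<^sub>* direct_sum n D"
    have "star_ring (D k)" "corners_lift (D k)" if "k < n" for k using D that sr by blast+
    then show "separable_unital_cstar B" "corners_lift B"
      using corners_lift_cstar_iso[OF B star_ring_direct_sum corners_lift_direct_sum] by blast+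
  next
    fix C B :: "'b cstar_alg" and n :: nat
    assume C: "separable_unital_cstar C \<and> corners_lift C" and n: "1 \<le> n" and B: "separable_unital_cstar B \<and> B \<simeq>\<^sub>* matrix_alg n C"
    show "separable_unital_cstar B" "corners_lift B"
      using corners_lift_cstar_iso[OF B star_ring.star_ring_matrix corners_lift_matrix[OF _ n]] sr C by blast+
  next
    fix C B :: "'b cstar_alg" and p
    assume C: "separable_unital_cstar C \<and> corners_lift C" and p: "projection C p \<and> p \<noteq> \<zero>\<^bsub>C\<^esub>"
      and B: "separable_unital_cstar B \<and> B \<simeq>\<^sub>* corner C p"
    show "separable_unital_cstar B" "corners_lift B"
      using corners_lift_cstar_iso[OF B star_ring.star_ring_corner corners_lift_corner] sr C p by blast+
  qed auto
qed

text \<open>\<open>B\<close> is isomorphic to the corner of its one by one matrices at the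
  unit.\<close>

lemma has_lifts_of_corners_lift:
  assumes B: "star_ring B" and lift: "corners_lift B" shows "has_lifts B"
proof -
  interpret B: star_ring B by fact
  interpret M: star_ring "matrix_alg 1 B" by (rule B.star_ring_matrix)
  have "projection (matrix_alg 1 B) \<one>\<^bsub>matrix_alg 1 B\<^esub>"
    unfolding projection_def using M.one_closed M.l_one[OF M.one_closed] M.cadj_one by blast
  then have one: "projection (matrix_alg 1 B) \<one>\<^bsub>matrix_alg 1 B\<^esub>"
    and lift1: "has_lifts (corner (matrix_alg 1 B) \<one>\<^bsub>matrix_alg 1 B\<^esub>)"
    using lift unfolding corners_lift_def by blast+
  have mem: "x \<in> carrier (corner (matrix_alg 1 B) \<one>\<^bsub>matrix_alg 1 B\<^esub>) \<longleftrightarrow> x \<in> carrier (matrix_alg 1 B)" for x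
    unfolding M.carrier_corner[OF one] using M.l_one M.r_one by blast
  have sum1: "(\<Oplus>\<^bsub>B\<^esub>k\<in>{..<1::nat}. h k) = h 0" if "h 0 \<in> carrier B" for h
    using that by (simp add: lessThan_Suc)
  show ?thesis
  proof (rule has_lifts_retract[OF _ _ _ lift1])
    show "star_hom B (corner (matrix_alg 1 B) \<one>\<^bsub>matrix_alg 1 B\<^esub>) (\<lambda>x. \<lambda>(i, j)\<in>{..<1} \<times> {..<1}. x)"
      by (rule star_homI; unfold mem M.corner_simps) (auto simp: fun_eq_iff sum1 simp del: One_nat_def)
    show "star_hom (corner (matrix_alg 1 B) \<one>\<^bsub>matrix_alg 1 B\<^esub>) B (\<lambda>T. T (0, 0))"
    proof (rule star_homI; unfold mem M.corner_simps)
      fix T assume "T \<in> carrier (matrix_alg 1 B)"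
      then show T: "T (0, 0) \<in> carrier B" by auto
      show "(k \<odot>\<^bsub>matrix_alg 1 B\<^esub> T) (0, 0) = k \<odot>\<^bsub>B\<^esub> T (0, 0)" for k by simp
      show "cadj (matrix_alg 1 B) T (0, 0) = cadj B (T (0, 0))" by simp
      fix S assume "S \<in> carrier (matrix_alg 1 B)"
      then have S: "S (0, 0) \<in> carrier B" by auto
      show "(T \<oplus>\<^bsub>matrix_alg 1 B\<^esub> S) (0, 0) = T (0, 0) \<oplus>\<^bsub>B\<^esub> S (0, 0)" by simp
      show "(T \<otimes>\<^bsub>matrix_alg 1 B\<^esub> S) (0, 0) = T (0, 0) \<otimes>\<^bsub>B\<^esub> S (0, 0)"
        using S T sum1[of "\<lambda>k. T (0, k) \<otimes>\<^bsub>B\<^esub> S (k, 0)"] by simp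
    qed
  qed simp
qed

end

subsection \<open>Quotients\<close>

text \<open>The quotient is handled through operations on cosets, so the algebraic properties are
  listed. Invariance under the adjoint makes the adjoint of a coset well defined; for ideals of
  sequences it is visible entrywise.\<close>

locale star_ideal = star_ring A for A :: "'a cstar_alg" (structure) +
  fixes I :: "'a set"
  assumes subspace: "linear_subspace A I"
    and two_sided: "\<lbrakk>a \<in> carrier A; x \<in> I\<rbrakk> \<Longrightarrow> a \<otimes> x \<in> I" "\<lbrakk>a \<in> carrier A; x \<in> I\<rbrakk> \<Longrightarrow> x \<otimes> a \<in> I"
    and cadj_ideal: "x \<in> I \<Longrightarrow> cadj A x \<in> I"
begin

lemma ideal_elems: "x \<in> I \<Longrightarrow> x \<in> carrier A" "\<zero> \<in> I" "\<lbrakk>x \<in> I; y \<in> I\<rbrakk> \<Longrightarrow> x \<oplus> y \<in> I" "x \<in> I \<Longrightarrow> k \<odot> x \<in> I"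
  using subspace by (auto simp: linear_subspace_def)

sublocale ideal I A
proof (rule idealI)
  show "ring A" by (rule ring_axioms)
  have neg: "x \<in> I \<Longrightarrow> \<ominus> x \<in> I" for x
    using ideal_elems(4)[of x "-1"] ideal_elems(1)[of x] by (simp add: smult_neg_one)
  show "subgroup I (add_monoid A)"
    using ideal_elems neg by (intro subgroup.intro) (auto simp flip: a_inv_def)
qed (use two_sided in auto)

lemma coset_eq_iff: "\<lbrakk>x \<in> carrier A; y \<in> carrier A\<rbrakk> \<Longrightarrow> I +> x = I +> y \<longleftrightarrow> x \<ominus> y \<in> I"
  using quotient_eq_iff_same_a_r_cos[OF ideal_axioms] by blast

lemma coset_memD:
  assumes "x \<in> carrier A" "z \<in> I +> x" shows "z \<in> carrier A" "z \<ominus> x \<in> I"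
  using assms a_rcos_module[OF assms(1), of z] ideal_elems(1)
  by (auto simp: a_r_coset_def' a_minus_def)

text \<open>\<open>quot\<close> defines multiples and adjoints of a coset as unions over its
  representatives. All representatives yield the same coset, so the union collapses to it.\<close>

lemma quot_simps:
  assumes x: "x \<in> carrier A"
  shows "y \<in> carrier A \<Longrightarrow> (I +> x) \<otimes>\<^bsub>quot A I\<^esub> (I +> y) = I +> (x \<otimes> y)"
    and "y \<in> carrier A \<Longrightarrow> (I +> x) \<oplus>\<^bsub>quot A I\<^esub> (I +> y) = I +> (x \<oplus> y)"
    and "k \<odot>\<^bsub>quot A I\<^esub> (I +> x) = I +> (k \<odot> x)"
    and "cadj (quot A I) (I +> x) = I +> cadj A x"
    and "I +> x \<in> carrier (quot A I)"
proof -
  show "(I +> x) \<otimes>\<^bsub>quot A I\<^esub> (I +> y) = I +> (x \<otimes> y)" if "y \<in> carrier A"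
    using x that by (simp add: quot_def FactRing_def rcoset_mult_add)
  show "(I +> x) \<oplus>\<^bsub>quot A I\<^esub> (I +> y) = I +> (x \<oplus> y)" if "y \<in> carrier A"
    using x that by (simp add: quot_def FactRing_def a_rcos_sum)
  show "I +> x \<in> carrier (quot A I)"
    using x by (auto simp: quot_def FactRing_def A_RCOSETS_def')
  have self: "x \<in> I +> x" using a_rcos_self[OF x] .
  have "I +> (k \<odot> z) = I +> (k \<odot> x)" if "z \<in> I +> x" for z
  proof -
    note z = coset_memD[OF x that]
    have "k \<odot> z \<ominus> k \<odot> x = k \<odot> (z \<ominus> x)"
      using z(1) x by (reify star_eqs, intro seqn_holdsI; simp)
    then show ?thesis using z x ideal_elems(4)[OF z(2), of k] by (simp add: coset_eq_iff)
  qed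
  then have "(\<Union>z\<in>I +> x. I +> (k \<odot> z)) = (\<Union>z\<in>I +> x. I +> (k \<odot> x))" by (intro SUP_cong) auto
  also have "\<dots> = I +> (k \<odot> x)" using self by blast
  finally show "k \<odot>\<^bsub>quot A I\<^esub> (I +> x) = I +> (k \<odot> x)" by (simp add: quot_def)
  have "I +> cadj A z = I +> cadj A x" if "z \<in> I +> x" for z
  proof -
    note z = coset_memD[OF x that]
    show ?thesis using z x cadj_ideal[OF z(2)] by (simp add: coset_eq_iff cadj_minus)
  qed
  then have "(\<Union>z\<in>I +> x. I +> cadj A z) = (\<Union>z\<in>I +> x. I +> cadj A x)" by (intro SUP_cong) auto
  also have "\<dots> = I +> cadj A x" using self by blast
  finally show "cadj (quot A I) (I +> x) = I +> cadj A x" by (simp add: quot_def)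
qed

lemma quot_carrierE:
  assumes "X \<in> carrier (quot A I)" obtains x where "x \<in> carrier A" "X = I +> x"
  using assms by (auto simp: quot_def FactRing_def A_RCOSETS_def')

end

subsection \<open>Transport of structure\<close>

text \<open>Carries the whole structure along a map that is injective on the carrier. The norm is
  moved too, because closed ideals and closures have to correspond.\<close>

definition copy_alg :: "('a \<Rightarrow> 'b) \<Rightarrow> 'a cstar_alg \<Rightarrow> 'b cstar_alg" where
  "copy_alg \<iota> A = (let \<rho> = inv_into (carrier A) \<iota> in
     \<lparr>carrier = \<iota> ` carrier A,
      mult = (\<lambda>x y. \<iota> (\<rho> x \<otimes>\<^bsub>A\<^esub> \<rho> y)),
      one = \<iota> \<one>\<^bsub>A\<^esub>,
      zero = \<iota> \<zero>\<^bsub>A\<^esub>,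
      add = (\<lambda>x y. \<iota> (\<rho> x \<oplus>\<^bsub>A\<^esub> \<rho> y)),
      smult = (\<lambda>k x. \<iota> (k \<odot>\<^bsub>A\<^esub> \<rho> x)),
      cadj = (\<lambda>x. \<iota> (cadj A (\<rho> x))),
      cnorm = (\<lambda>x. cnorm A (\<rho> x))\<rparr>)"

context unital_cstar_algebra begin

context
  fixes \<iota> :: "'a \<Rightarrow> 'b"
  assumes inj: "inj_on \<iota> (carrier A)"
begin

lemma copy_simps:
  "carrier (copy_alg \<iota> A) = \<iota> ` carrier A" "\<one>\<^bsub>copy_alg \<iota> A\<^esub> = \<iota> \<one>" "\<zero>\<^bsub>copy_alg \<iota> A\<^esub> = \<iota> \<zero>"
  "\<lbrakk>x \<in> carrier A; y \<in> carrier A\<rbrakk> \<Longrightarrow> \<iota> x \<otimes>\<^bsub>copy_alg \<iota> A\<^esub> \<iota> y = \<iota> (x \<otimes> y)"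
  "\<lbrakk>x \<in> carrier A; y \<in> carrier A\<rbrakk> \<Longrightarrow> \<iota> x \<oplus>\<^bsub>copy_alg \<iota> A\<^esub> \<iota> y = \<iota> (x \<oplus> y)"
  "x \<in> carrier A \<Longrightarrow> k \<odot>\<^bsub>copy_alg \<iota> A\<^esub> \<iota> x = \<iota> (k \<odot> x)"
  "x \<in> carrier A \<Longrightarrow> cadj (copy_alg \<iota> A) (\<iota> x) = \<iota> (cadj A x)"
  "x \<in> carrier A \<Longrightarrow> cnorm (copy_alg \<iota> A) (\<iota> x) = cnorm A x"
  by (simp_all add: copy_alg_def Let_def inv_into_f_f[OF inj])

lemma star_ring_copy: "star_ring (copy_alg \<iota> A)"
proof -
  note [simp] = copy_simps
  have "abelian_group (copy_alg \<iota> A)"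
  proof (rule abelian_groupI)
    fix X assume "X \<in> carrier (copy_alg \<iota> A)"
    then obtain x where x: "x \<in> carrier A" "X = \<iota> x" by auto
    then show "\<exists>Y\<in>carrier (copy_alg \<iota> A). Y \<oplus>\<^bsub>copy_alg \<iota> A\<^esub> X = \<zero>\<^bsub>copy_alg \<iota> A\<^esub>"
      by (intro bexI[of _ "\<iota> (\<ominus> x)"]) (auto simp: l_neg)
  qed (auto simp: a_ac)
  then have "ring (copy_alg \<iota> A)"
    by (intro ringI monoidI) (auto simp: m_assoc l_distr r_distr)
  then show ?thesis
    by (intro star_ring.intro star_ring_axioms.intro)
      (auto simp: smult_add_left smult_add_right smult_smult smult_mult_left smult_mult_right cadj_add cadj_smult cadj_mult)
qed

lemma copy_minus:
  assumes "x \<in> carrier A" "y \<in> carrier A" shows "\<iota> x \<ominus>\<^bsub>copy_alg \<iota> A\<^esub> \<iota> y = \<iota> (x \<ominus> y)"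
proof -
  interpret C: star_ring "copy_alg \<iota> A" by (rule star_ring_copy)
  have "\<iota> y \<in> carrier (copy_alg \<iota> A)" using assms by (simp add: copy_simps)
  then have "\<ominus>\<^bsub>copy_alg \<iota> A\<^esub> \<iota> y = \<iota> (\<ominus> y)"
    using C.smult_neg_one[of "\<iota> y"] assms by (simp add: copy_simps smult_neg_one)
  then show ?thesis using assms by (simp add: a_minus_def copy_simps)
qed

lemma unital_cstar_copy: "unital_cstar_algebra (copy_alg \<iota> A)"
proof -
  note [simp] = copy_simps
  interpret C: star_ring "copy_alg \<iota> A" by (rule star_ring_copy)
  interpret C: pre_cstar_algebra "copy_alg \<iota> A"
    by unfold_locales
      (auto simp: cnorm_eq_0 cnorm_add cnorm_smult cnorm_mult cnorm_cadj_mult inj_on_eq_iff[OF inj])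
  show ?thesis
  proof (rule C.unital_cstar_algebraI)
    fix F :: "nat \<Rightarrow> 'b"
    assume F: "range F \<subseteq> carrier (copy_alg \<iota> A)"
      and Ca: "\<And>e. e > 0 \<Longrightarrow> \<exists>N. \<forall>m\<ge>N. \<forall>n\<ge>N. cnorm (copy_alg \<iota> A) (F m \<ominus>\<^bsub>copy_alg \<iota> A\<^esub> F n) < e"
    have "\<exists>f. f \<in> carrier A \<and> F n = \<iota> f" for n using F by (auto simp: image_subset_iff)
    then obtain f where f: "\<And>n. f n \<in> carrier A" "\<And>n. F n = \<iota> (f n)" by metis
    have "\<exists>l. clim f l"
    proof (rule Cauchy_clim)
      show "\<exists>N. \<forall>m\<ge>N. \<forall>n\<ge>N. cnorm A (f m \<ominus> f n) < e" if "e > 0" for e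
        using Ca[OF that] by (simp add: f copy_minus)
    qed (use f in auto)
    then obtain l where l: "clim f l" by blast
    then have "C.clim F (\<iota> l)"
      using f by (auto simp: C.clim_def clim_def copy_minus)
    then show "\<exists>l. C.clim F l" by blast
  qed
qed

lemma star_hom_copy: "star_hom A (copy_alg \<iota> A) \<iota>"
  by (rule star_homI) (simp_all add: copy_simps)

lemma bij_copy: "bij_betw \<iota> (carrier A) (carrier (copy_alg \<iota> A))"
  using inj by (simp add: bij_betw_def copy_simps)

lemma copy_ideal:
  assumes I: "cstar_ideal A I" shows "cstar_ideal (copy_alg \<iota> A) (\<iota> ` I)"
proof -
  note [simp] = copy_simps
  interpret C: unital_cstar_algebra "copy_alg \<iota> A" by (rule unital_cstar_copy)
  have IA: "x \<in> carrier A" if "x \<in> I" for x using I that by (auto simp: cstar_ideal_def linear_subspace_def)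
  have "closedin (ctopology (copy_alg \<iota> A)) (\<iota> ` I)"
  proof (rule C.closedinI)
    fix F L assume lim: "C.clim F L" and F: "\<And>n. F n \<in> \<iota> ` I"
    obtain f where f: "\<And>n. f n \<in> I" "\<And>n. F n = \<iota> (f n)" using F unfolding image_iff by metis
    obtain l where l: "l \<in> carrier A" "L = \<iota> l" using C.clim_carrier(2)[OF lim] by auto
    have "clim f l"
      using lim f IA l by (auto simp: clim_def C.clim_def copy_minus)
    then have "l \<in> I" using closedin_clim I f by (auto simp: cstar_ideal_def)
    then show "L \<in> \<iota> ` I" using l by simp
  qed (use IA in auto)
  moreover have "linear_subspace (copy_alg \<iota> A) (\<iota> ` I)"
    using I IA unfolding linear_subspace_def cstar_ideal_def by (auto intro!: imageI)
  ultimately show ?thesis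
    using I IA unfolding cstar_ideal_def by (auto intro!: imageI)
qed

lemma copy_closure:
  assumes S: "S \<subseteq> carrier A"
  shows "ctopology (copy_alg \<iota> A) closure_of (\<iota> ` S) = \<iota> ` (ctopology A closure_of S)"
proof -
  interpret C: unital_cstar_algebra "copy_alg \<iota> A" by (rule unital_cstar_copy)
  have iS: "\<iota> ` S \<subseteq> carrier (copy_alg \<iota> A)" using S by (auto simp: copy_simps)
  have *: "cnorm (copy_alg \<iota> A) (\<iota> x \<ominus>\<^bsub>copy_alg \<iota> A\<^esub> \<iota> y) = cnorm A (x \<ominus> y)" if "x \<in> carrier A" "y \<in> S" for x y
    using that S by (simp add: copy_minus copy_simps subset_iff)
  show ?thesis
  proof (intro equalityI subsetI)
    fix X assume X: "X \<in> ctopology (copy_alg \<iota> A) closure_of (\<iota> ` S)"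
    then obtain x where x: "x \<in> carrier A" "X = \<iota> x" unfolding C.closure_of_iff[OF iS] by (auto simp: copy_simps)
    then have "x \<in> ctopology A closure_of S"
      using X * unfolding C.closure_of_iff[OF iS] closure_of_iff[OF S] by simp
    then show "X \<in> \<iota> ` (ctopology A closure_of S)" using x by blast
  next
    fix X assume "X \<in> \<iota> ` (ctopology A closure_of S)"
    then obtain x where x: "X = \<iota> x" "x \<in> ctopology A closure_of S" by blast
    then have xA: "x \<in> carrier A" unfolding closure_of_iff[OF S] by blast
    then have "\<iota> x \<in> carrier (copy_alg \<iota> A)" by (simp add: copy_simps)
    then show "X \<in> ctopology (copy_alg \<iota> A) closure_of (\<iota> ` S)"
      using x xA * unfolding C.closure_of_iff[OF iS] closure_of_iff[OF S] by simp
  qed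
qed

end

subsection \<open>Semiprojectivity yields lifts\<close>

declare ell_inf_nth [simp del]

text \<open>This increasing chain of ideals presents the null sequences in the form in which
  semiprojectivity speaks of ideals. Modulo the \<open>n\<close>-th ideal, elements are compared
  from index \<open>n\<close> on only.\<close>

definition tail_zero :: "nat \<Rightarrow> (nat \<Rightarrow> 'a) set" where
  "tail_zero n = {f \<in> carrier (ell_inf A). \<forall>k\<ge>n. f k = \<zero>}"

lemma c_zero_iff: "f \<in> c_zero A \<longleftrightarrow> f \<in> carrier (ell_inf A) \<and> null_seq f"
  by (auto simp: c_zero_def null_seq_def intro: ell_inf_nth)

lemma star_ideal_c_zero: "star_ideal (ell_inf A) (c_zero A)"
proof -
  interpret L: unital_cstar_algebra "ell_inf A" by (rule unital_cstar_ell_inf)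
  show ?thesis
  proof unfold_locales
    show "linear_subspace (ell_inf A) (c_zero A)"
      unfolding linear_subspace_def
    proof (intro conjI ballI allI)
      show "c_zero A \<subseteq> carrier (ell_inf A)" unfolding c_zero_def by blast
      show "\<zero>\<^bsub>ell_inf A\<^esub> \<in> c_zero A" using L.zero_closed null_seq_zero by (simp add: c_zero_iff)
      fix f assume "f \<in> c_zero A"
      then have f: "f \<in> carrier (ell_inf A)" "null_seq f" by (simp_all add: c_zero_iff)
      show "k \<odot>\<^bsub>ell_inf A\<^esub> f \<in> c_zero A" for k
        using ell_inf_closed(3)[OF f(1) f(1)] null_seq_smult[OF f(2)] by (simp add: c_zero_iff)
      fix g assume "g \<in> c_zero A"
      then have g: "g \<in> carrier (ell_inf A)" "null_seq g" by (simp_all add: c_zero_iff)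
      show "f \<oplus>\<^bsub>ell_inf A\<^esub> g \<in> c_zero A"
        using ell_inf_closed(1)[OF f(1) g(1)] null_seq_add[OF f(2) g(2)] by (simp add: c_zero_iff)
    qed
    fix f assume f: "f \<in> c_zero A"
    then have fL: "f \<in> carrier (ell_inf A)" "null_seq f" by (simp_all add: c_zero_iff)
    show "cadj (ell_inf A) f \<in> c_zero A"
      using ell_inf_closed(4)[OF fL(1) fL(1)] null_seq_cadj[OF fL(2)] by (simp add: c_zero_iff)
    fix g assume g: "g \<in> carrier (ell_inf A)"
    note b = ell_inf_norm_ge[OF g]
    show "g \<otimes>\<^bsub>ell_inf A\<^esub> f \<in> c_zero A"
      using ell_inf_closed(2)[OF g fL(1)] null_seq_mult_left[OF fL(2) ell_inf_nth[OF g] b] by (simp add: c_zero_iff)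
    show "f \<otimes>\<^bsub>ell_inf A\<^esub> g \<in> c_zero A"
      using ell_inf_closed(2)[OF fL(1) g] null_seq_mult_right[OF fL(2) ell_inf_nth[OF g] b] by (simp add: c_zero_iff)
  qed
qed

lemma star_ideal_tail_zero: "star_ideal (ell_inf A) (tail_zero n)"
proof -
  interpret L: unital_cstar_algebra "ell_inf A" by (rule unital_cstar_ell_inf)
  show ?thesis
  proof unfold_locales
    show "linear_subspace (ell_inf A) (tail_zero n)"
      unfolding linear_subspace_def
    proof (intro conjI ballI allI)
      show "tail_zero n \<subseteq> carrier (ell_inf A)" unfolding tail_zero_def by blast
      show "\<zero>\<^bsub>ell_inf A\<^esub> \<in> tail_zero n" using L.zero_closed by (simp add: tail_zero_def)
      fix f assume "f \<in> tail_zero n"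
      then have f: "f \<in> carrier (ell_inf A)" "\<forall>k\<ge>n. f k = \<zero>" by (simp_all add: tail_zero_def)
      show "k \<odot>\<^bsub>ell_inf A\<^esub> f \<in> tail_zero n" for k
        using ell_inf_closed(3)[OF f(1) f(1)] f(2) by (simp add: tail_zero_def)
      fix g assume "g \<in> tail_zero n"
      then have g: "g \<in> carrier (ell_inf A)" "\<forall>k\<ge>n. g k = \<zero>" by (simp_all add: tail_zero_def)
      show "f \<oplus>\<^bsub>ell_inf A\<^esub> g \<in> tail_zero n"
        using ell_inf_closed(1)[OF f(1) g(1)] f(2) g(2) by (simp add: tail_zero_def)
    qed
    fix f assume "f \<in> tail_zero n"
    then have f: "f \<in> carrier (ell_inf A)" "\<forall>k\<ge>n. f k = \<zero>" by (simp_all add: tail_zero_def)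
    show "cadj (ell_inf A) f \<in> tail_zero n"
      using ell_inf_closed(4)[OF f(1) f(1)] f(2) by (simp add: tail_zero_def)
    fix g assume g: "g \<in> carrier (ell_inf A)"
    note gn = ell_inf_nth[OF g]
    show "g \<otimes>\<^bsub>ell_inf A\<^esub> f \<in> tail_zero n" "f \<otimes>\<^bsub>ell_inf A\<^esub> g \<in> tail_zero n"
      using ell_inf_closed(2)[OF g f(1)] ell_inf_closed(2)[OF f(1) g] f(2) gn by (simp_all add: tail_zero_def)
  qed
qed

lemma cstar_ideal_tail_zero: "cstar_ideal (ell_inf A) (tail_zero n)"
proof -
  interpret L: unital_cstar_algebra "ell_inf A" by (rule unital_cstar_ell_inf)
  interpret I: star_ideal "ell_inf A" "tail_zero n" by (rule star_ideal_tail_zero)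
  have "closedin (ctopology (ell_inf A)) (tail_zero n)"
  proof (rule L.closedinI)
    show "tail_zero n \<subseteq> carrier (ell_inf A)" unfolding tail_zero_def by blast
    fix F l assume lim: "L.clim F l" and F: "\<And>m. F m \<in> tail_zero n"
    have lL: "l \<in> carrier (ell_inf A)" and FL: "F m \<in> carrier (ell_inf A)" for m
      using L.clim_carrier(2)[OF lim] L.clim_carrier(1)[OF lim] .
    have "l k = \<zero>" if k: "k \<ge> n" for k
    proof -
      have "cnorm A (l k) \<le> cnorm (ell_inf A) (F m \<ominus>\<^bsub>ell_inf A\<^esub> l)" for m
      proof -
        have "F m k = \<zero>" using F[of m] k unfolding tail_zero_def by blast
        moreover have "cnorm A (F m k \<ominus> l k) \<le> cnorm (ell_inf A) (F m \<ominus>\<^bsub>ell_inf A\<^esub> l)"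
          using ell_inf_norm_ge[OF L.minus_closed[OF FL[of m] lL], of k]
          by (simp only: ell_inf_minus[OF FL[of m] lL])
        moreover have "cnorm A (\<zero> \<ominus> l k) = cnorm A (l k)"
          using ell_inf_nth[OF lL, of k] by (simp add: a_minus_def)
        ultimately show ?thesis by (simp only:)
      qed
      moreover have "(\<lambda>m. cnorm (ell_inf A) (F m \<ominus>\<^bsub>ell_inf A\<^esub> l)) \<longlonglongrightarrow> 0"
        using lim unfolding L.clim_def by blast
      ultimately have "cnorm A (l k) \<le> 0" using LIMSEQ_le_const by blast
      then have "cnorm A (l k) = 0" using cnorm_nonneg[OF ell_inf_nth[OF lL, of k]] by linarith
      then show ?thesis using cnorm_eq_0[OF ell_inf_nth[OF lL, of k]] by blast
    qed
    then show "l \<in> tail_zero n" using lL unfolding tail_zero_def by blast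
  qed
  then show ?thesis using I.subspace I.two_sided unfolding cstar_ideal_def by blast
qed

text \<open>A null sequence is the norm limit of its truncations, and a uniform limit of sequences
  that are eventually zero is null.\<close>

lemma closure_tail_zero: "ctopology (ell_inf A) closure_of (\<Union>n. tail_zero n) = c_zero A"
proof -
  interpret L: unital_cstar_algebra "ell_inf A" by (rule unital_cstar_ell_inf)
  have sub: "(\<Union>n. tail_zero n) \<subseteq> carrier (ell_inf A)" unfolding tail_zero_def by blast
  show ?thesis
  proof (intro equalityI subsetI)
    fix f assume "f \<in> ctopology (ell_inf A) closure_of (\<Union>n. tail_zero n)"
    then have f: "f \<in> carrier (ell_inf A)"
      and ap: "\<And>e. e > 0 \<Longrightarrow> \<exists>g\<in>(\<Union>n. tail_zero n). cnorm (ell_inf A) (f \<ominus>\<^bsub>ell_inf A\<^esub> g) < e"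
      unfolding L.closure_of_iff[OF sub] by blast+
    have "(\<lambda>k. cnorm A (f k)) \<longlonglongrightarrow> 0"
    proof (rule LIMSEQ_I)
      fix r :: real assume "r > 0"
      then obtain g n where g: "g \<in> tail_zero n" "cnorm (ell_inf A) (f \<ominus>\<^bsub>ell_inf A\<^esub> g) < r" using ap by blast
      have gL: "g \<in> carrier (ell_inf A)" using g by (simp add: tail_zero_def)
      have "norm (cnorm A (f k) - 0) < r" if "k \<ge> n" for k
      proof -
        have "g k = \<zero>" using g that by (simp add: tail_zero_def)
        moreover have "cnorm A (f k \<ominus> g k) \<le> cnorm (ell_inf A) (f \<ominus>\<^bsub>ell_inf A\<^esub> g)"
          using ell_inf_norm_ge[OF L.minus_closed[OF f gL], of k] by (simp only: ell_inf_minus[OF f gL])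
        moreover have "cnorm A (f k \<ominus> \<zero>) = cnorm A (f k)"
          using ell_inf_nth[OF f, of k] by (simp add: a_minus_def)
        ultimately have "cnorm A (f k) \<le> cnorm (ell_inf A) (f \<ominus>\<^bsub>ell_inf A\<^esub> g)" by (simp only:)
        then show ?thesis using g(2) cnorm_nonneg[OF ell_inf_nth[OF f, of k]] by (simp only: real_norm_def diff_zero abs_of_nonneg)
      qed
      then show "\<exists>n. \<forall>k\<ge>n. norm (cnorm A (f k) - 0) < r" by blast
    qed
    then show "f \<in> c_zero A" using f by (simp add: c_zero_def)
  next
    fix f assume "f \<in> c_zero A"
    then have f: "f \<in> carrier (ell_inf A)" "(\<lambda>k. cnorm A (f k)) \<longlonglongrightarrow> 0" by (simp_all add: c_zero_def)
    have "\<exists>g\<in>(\<Union>n. tail_zero n). cnorm (ell_inf A) (f \<ominus>\<^bsub>ell_inf A\<^esub> g) < e" if "e > 0" for e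
    proof -
      obtain n where n: "\<forall>k\<ge>n. norm (cnorm A (f k) - 0) < e / 2"
        using LIMSEQ_D[OF f(2), of "e / 2"] \<open>e > 0\<close> by auto
      define g where "g k = (if k < n then f k else \<zero>)" for k
      have gL: "g \<in> carrier (ell_inf A)"
      proof (rule ell_infI)
        show "g k \<in> carrier A" for k using ell_inf_nth[OF f(1)] by (simp add: g_def)
        show "cnorm A (g k) \<le> cnorm (ell_inf A) f" for k
          using ell_inf_norm_ge[OF f(1), of k] cnorm_nonneg[OF ell_inf_nth[OF f(1), of k]] unfolding g_def by auto
      qed
      have "cnorm A (f k \<ominus> g k) \<le> e / 2" for k
      proof (cases "k < n")
        case True
        then show ?thesis using ell_inf_nth[OF f(1), of k] \<open>e > 0\<close> by (simp add: g_def a_minus_def r_neg)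
      next
        case False
        then have "\<bar>cnorm A (f k)\<bar> < e / 2" using n by simp
        then show ?thesis using False ell_inf_nth[OF f(1), of k] by (simp add: g_def a_minus_def)
      qed
      then have "cnorm (ell_inf A) (f \<ominus>\<^bsub>ell_inf A\<^esub> g) \<le> e / 2"
        unfolding ell_inf_minus[OF f(1) gL] by (rule ell_inf_norm_le)
      moreover have "g \<in> tail_zero n" using gL by (simp add: tail_zero_def g_def)
      ultimately show ?thesis using \<open>e > 0\<close> by (intro bexI[of _ g]) auto
    qed
    then show "f \<in> ctopology (ell_inf A) closure_of (\<Union>n. tail_zero n)"
      unfolding L.closure_of_iff[OF sub] using f(1) by blast
  qed
qed

end

context unital_cstar_algebra begin

text \<open>Semiprojectivity lifts to the quotient by some \<open>tail_zero n\<close>.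
  Representatives of the lifted map satisfy all relations of a homomorphism exactly at the indices
  from \<open>n\<close> on; replacing the earlier entries by zero gives a homomorphism into bounded
  sequences without changing classes modulo null sequences.\<close>

lemma semiprojective_liftable:
  fixes \<iota> :: "(nat \<Rightarrow> 'a) \<Rightarrow> 'u"
  assumes inj: "inj_on \<iota> (carrier (ell_inf A))" and sp: "semiprojective TYPE('u) D" and D: "star_ring D"
  shows "has_lifts D"
  unfolding has_lifts_def
proof (intro allI impI)
  fix \<phi> assume \<phi>: "asym_hom D \<phi>"
  interpret D: star_ring D by (rule D)
  interpret L: unital_cstar_algebra "ell_inf A" by (rule unital_cstar_ell_inf)
  let ?L = "ell_inf A"
  define C where "C = copy_alg \<iota> ?L"
  interpret C: unital_cstar_algebra C unfolding C_def by (rule L.unital_cstar_copy[OF inj])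
  note hom = L.star_hom_copy[OF inj, folded C_def] and bij = L.bij_copy[OF inj, folded C_def]
  note \<iota>_minus = L.copy_minus[OF inj, folded C_def]
  define J where "J n = \<iota> ` tail_zero n" for n
  define K where "K = \<iota> ` c_zero A"
  have tz: "tail_zero n \<subseteq> carrier ?L" for n unfolding tail_zero_def by blast
  have J: "cstar_ideal C (J n)" for n
    unfolding J_def C_def by (rule L.copy_ideal[OF inj cstar_ideal_tail_zero])
  have "incseq J"
  proof (rule incseq_SucI)
    have "tail_zero n \<subseteq> tail_zero (Suc n)" for n by (auto simp: tail_zero_def)
    then show "J n \<le> J (Suc n)" for n unfolding J_def by (rule image_mono)
  qed
  have K: "ctopology C closure_of (\<Union>n. J n) = K"
  proof -
    have "(\<Union>n. J n) = \<iota> ` (\<Union>n. tail_zero n)" by (auto simp: J_def)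
    moreover have "(\<Union>n. tail_zero n) \<subseteq> carrier ?L" using tz by blast
    ultimately show ?thesis
      using L.copy_closure[OF inj, of "\<Union>n. tail_zero n", folded C_def] unfolding K_def closure_tail_zero[symmetric] by simp
  qed
  have image_ideal: "star_ideal C (\<iota> ` I)" if "star_ideal ?L I" for I
  proof -
    interpret I: star_ideal ?L I by fact
    have mem: "\<exists>x. x \<in> carrier ?L \<and> X = \<iota> x" if "X \<in> carrier C" for X
      using that L.copy_simps(1)[OF inj] unfolding C_def by auto
    show ?thesis
    proof unfold_locales
      show "linear_subspace C (\<iota> ` I)"
        unfolding linear_subspace_def
      proof (intro conjI ballI allI)
        show "\<iota> ` I \<subseteq> carrier C" using star_homD(1)[OF hom I.ideal_elems(1)] by blast
        show "\<zero>\<^bsub>C\<^esub> \<in> \<iota> ` I" using L.copy_simps(3)[OF inj] I.ideal_elems(2) unfolding C_def by simp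
        fix X assume "X \<in> \<iota> ` I"
        then obtain x where x: "x \<in> I" "X = \<iota> x" by blast
        show "k \<odot>\<^bsub>C\<^esub> X \<in> \<iota> ` I" for k
          unfolding x(2) star_homD(4)[OF hom I.ideal_elems(1)[OF x(1)], symmetric] using I.ideal_elems(4)[OF x(1)] by (rule imageI)
        fix Y assume "Y \<in> \<iota> ` I"
        then obtain y where y: "y \<in> I" "Y = \<iota> y" by blast
        show "X \<oplus>\<^bsub>C\<^esub> Y \<in> \<iota> ` I"
          unfolding x(2) y(2) star_homD(2)[OF hom I.ideal_elems(1)[OF x(1)] I.ideal_elems(1)[OF y(1)], symmetric]
          using I.ideal_elems(3)[OF x(1) y(1)] by (rule imageI)
      qed
      fix X assume "X \<in> \<iota> ` I"
      then obtain x where x: "x \<in> I" "X = \<iota> x" by blast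
      note xL = I.ideal_elems(1)[OF x(1)]
      show "cadj C X \<in> \<iota> ` I"
        unfolding x(2) star_homD(5)[OF hom xL, symmetric] using I.cadj_ideal[OF x(1)] by (rule imageI)
      fix Y assume "Y \<in> carrier C"
      then obtain y where y: "y \<in> carrier ?L" "Y = \<iota> y" using mem by blast
      show "Y \<otimes>\<^bsub>C\<^esub> X \<in> \<iota> ` I"
        unfolding x(2) y(2) star_homD(3)[OF hom y(1) xL, symmetric] using I.two_sided(1)[OF y(1) x(1)] by (rule imageI)
      show "X \<otimes>\<^bsub>C\<^esub> Y \<in> \<iota> ` I"
        unfolding x(2) y(2) star_homD(3)[OF hom xL y(1), symmetric] using I.two_sided(2)[OF y(1) x(1)] by (rule imageI)
    qed
  qed
  interpret K: star_ideal C K unfolding K_def by (rule image_ideal[OF star_ideal_c_zero])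
  have SJ: "star_ideal C (J n)" for n unfolding J_def by (rule image_ideal[OF star_ideal_tail_zero])
  have \<iota>_mem: "\<iota> f \<in> \<iota> ` I \<longleftrightarrow> f \<in> I" if "f \<in> carrier ?L" "I \<subseteq> carrier ?L" for f I
    using that inj by (auto simp: inj_on_image_mem_iff)
  note \<phi>D = asym_homD[OF \<phi>]
  have K_eq: "K +>\<^bsub>C\<^esub> \<iota> f = K +>\<^bsub>C\<^esub> \<iota> g" if f: "f \<in> carrier ?L" and g: "g \<in> carrier ?L" and "asym_eq f g" for f g
  proof -
    have "f \<ominus>\<^bsub>?L\<^esub> g \<in> c_zero A"
      using that L.minus_closed[OF f g] unfolding c_zero_iff asym_eq_def ell_inf_minus[OF f g] by blast
    then have "\<iota> f \<ominus>\<^bsub>C\<^esub> \<iota> g \<in> K" unfolding \<iota>_minus[OF f g] K_def by blast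
    then show ?thesis using K.coset_eq_iff[OF star_homD(1)[OF hom f] star_homD(1)[OF hom g]] by blast
  qed
  let ?\<Phi> = "\<lambda>d. K +>\<^bsub>C\<^esub> \<iota> (\<phi> d)"
  have "star_hom D (quot C K) ?\<Phi>"
  proof (rule star_homI)
    fix x assume x: "x \<in> carrier D"
    note fx = \<phi>D(1)[OF x] and cx = star_homD(1)[OF hom \<phi>D(1)[OF x]]
    show "?\<Phi> x \<in> carrier (quot C K)" using K.quot_simps(5)[OF cx] .
    show "?\<Phi> (k \<odot>\<^bsub>D\<^esub> x) = k \<odot>\<^bsub>quot C K\<^esub> ?\<Phi> x" for k
      unfolding K.quot_simps(3)[OF cx] star_homD(4)[OF hom fx, symmetric] ell_inf_simps
      by (rule K_eq[OF \<phi>D(1)[OF D.smult_closed[OF x]] ell_inf_closed(3)[OF fx fx] \<phi>D(4)[OF x]])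
    show "?\<Phi> (cadj D x) = cadj (quot C K) (?\<Phi> x)"
      unfolding K.quot_simps(4)[OF cx] star_homD(5)[OF hom fx, symmetric] ell_inf_simps
      by (rule K_eq[OF \<phi>D(1)[OF D.cadj_closed[OF x]] ell_inf_closed(4)[OF fx fx] \<phi>D(5)[OF x]])
    fix y assume y: "y \<in> carrier D"
    note fy = \<phi>D(1)[OF y] and cy = star_homD(1)[OF hom \<phi>D(1)[OF y]]
    show "?\<Phi> (x \<oplus>\<^bsub>D\<^esub> y) = ?\<Phi> x \<oplus>\<^bsub>quot C K\<^esub> ?\<Phi> y"
      unfolding K.quot_simps(2)[OF cx cy] star_homD(2)[OF hom fx fy, symmetric] ell_inf_simps
      by (rule K_eq[OF \<phi>D(1)[OF D.a_closed[OF x y]] ell_inf_closed(1)[OF fx fy] \<phi>D(2)[OF x y]])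
    show "?\<Phi> (x \<otimes>\<^bsub>D\<^esub> y) = ?\<Phi> x \<otimes>\<^bsub>quot C K\<^esub> ?\<Phi> y"
      unfolding K.quot_simps(1)[OF cx cy] star_homD(3)[OF hom fx fy, symmetric] ell_inf_simps
      by (rule K_eq[OF \<phi>D(1)[OF D.m_closed[OF x y]] ell_inf_closed(2)[OF fx fy] \<phi>D(3)[OF x y]])
  qed
  then have "\<exists>n \<psi>. star_hom D (quot C (J n)) \<psi> \<and> (\<forall>d\<in>carrier D. quot_map C K (\<psi> d) = ?\<Phi> d)"
    using sp[unfolded semiprojective_def, rule_format, of C J ?\<Phi>] C.cstar_algebra_axioms J \<open>incseq J\<close>
    unfolding K by blast
  then obtain n \<psi> where \<psi>: "star_hom D (quot C (J n)) \<psi>" "\<And>d. d \<in> carrier D \<Longrightarrow> quot_map C K (\<psi> d) = ?\<Phi> d"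
    by blast
  interpret J: star_ideal C "J n" by (rule SJ)
  have "\<exists>f. f \<in> carrier ?L \<and> \<psi> d = J n +>\<^bsub>C\<^esub> \<iota> f" if d: "d \<in> carrier D" for d
  proof -
    obtain X where "X \<in> carrier C" "\<psi> d = J n +>\<^bsub>C\<^esub> X"
      by (rule J.quot_carrierE[OF star_homD(1)[OF \<psi>(1) d]])
    moreover from this obtain f where "f \<in> carrier ?L" "X = \<iota> f" using bij by (auto simp: bij_betw_def)
    ultimately show ?thesis by blast
  qed
  then obtain h where h: "\<And>d. d \<in> carrier D \<Longrightarrow> h d \<in> carrier ?L" "\<And>d. d \<in> carrier D \<Longrightarrow> \<psi> d = J n +>\<^bsub>C\<^esub> \<iota> (h d)"
    by metis
  have ch: "\<iota> (h d) \<in> carrier C" if "d \<in> carrier D" for d using star_homD(1)[OF hom h(1)[OF that]] .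
  have J_eq: "f k = g k" if f: "f \<in> carrier ?L" and g: "g \<in> carrier ?L"
    and eq: "J n +>\<^bsub>C\<^esub> \<iota> f = J n +>\<^bsub>C\<^esub> \<iota> g" and k: "k \<ge> n" for f g k
  proof -
    have "\<iota> (f \<ominus>\<^bsub>?L\<^esub> g) \<in> J n"
      using eq J.coset_eq_iff[OF star_homD(1)[OF hom f] star_homD(1)[OF hom g]] unfolding \<iota>_minus[OF f g] by blast
    then have "f \<ominus>\<^bsub>?L\<^esub> g \<in> tail_zero n"
      unfolding J_def \<iota>_mem[OF L.minus_closed[OF f g] tz] .
    then have "f k \<ominus> g k = \<zero>" using k unfolding tail_zero_def ell_inf_minus[OF f g] by blast
    then show ?thesis using minus_eq_zero_iff[OF ell_inf_nth[OF f] ell_inf_nth[OF g]] by blast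
  qed
  \<comment> \<open>Zero below \<open>n\<close> is a homomorphism at each of these indices, since
    lifts need not be unital.\<close>
  define \<theta> where "\<theta> d k = (if k < n then \<zero> else h d k)" for d k
  have cl: "h x \<in> carrier ?L" "h x k \<in> carrier A" if "x \<in> carrier D" for x k
    using h(1)[OF that] ell_inf_nth by blast+
  have "star_hom D ?L \<theta>"
  proof (rule star_homI)
    fix x assume x: "x \<in> carrier D"
    show "\<theta> x \<in> carrier ?L"
    proof (rule ell_infI)
      show "\<theta> x k \<in> carrier A" for k using cl(2)[OF x] by (simp add: \<theta>_def)
      show "cnorm A (\<theta> x k) \<le> cnorm ?L (h x)" for k
        using ell_inf_norm_ge[OF cl(1)[OF x], of k] cnorm_nonneg[OF cl(2)[OF x, of k]] unfolding \<theta>_def by auto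
    qed
    have "h (c \<odot>\<^bsub>D\<^esub> x) k = c \<odot> h x k" if "k \<ge> n" for c k
    proof -
      have "J n +>\<^bsub>C\<^esub> \<iota> (h (c \<odot>\<^bsub>D\<^esub> x)) = J n +>\<^bsub>C\<^esub> \<iota> (c \<odot>\<^bsub>?L\<^esub> h x)"
        using star_homD(4)[OF \<psi>(1) x, of c] x
        by (simp only: h(2) D.smult_closed J.quot_simps(3)[OF ch[OF x]] star_homD(4)[OF hom cl(1)[OF x]])
      then show ?thesis
        using J_eq[OF cl(1)[OF D.smult_closed[OF x]] L.smult_closed[OF cl(1)[OF x]] _ that] by simp
    qed
    then show "\<theta> (c \<odot>\<^bsub>D\<^esub> x) = c \<odot>\<^bsub>?L\<^esub> \<theta> x" for c by (simp add: \<theta>_def fun_eq_iff)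
    have "h (cadj D x) k = cadj A (h x k)" if "k \<ge> n" for k
    proof -
      have "J n +>\<^bsub>C\<^esub> \<iota> (h (cadj D x)) = J n +>\<^bsub>C\<^esub> \<iota> (cadj ?L (h x))"
        using star_homD(5)[OF \<psi>(1) x] x
        by (simp only: h(2) D.cadj_closed J.quot_simps(4)[OF ch[OF x]] star_homD(5)[OF hom cl(1)[OF x]])
      then show ?thesis
        using J_eq[OF cl(1)[OF D.cadj_closed[OF x]] L.cadj_closed[OF cl(1)[OF x]] _ that] by simp
    qed
    then show "\<theta> (cadj D x) = cadj ?L (\<theta> x)" by (simp add: \<theta>_def fun_eq_iff)
    fix y assume y: "y \<in> carrier D"
    have "h (x \<oplus>\<^bsub>D\<^esub> y) k = h x k \<oplus> h y k" if "k \<ge> n" for k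
    proof -
      have "J n +>\<^bsub>C\<^esub> \<iota> (h (x \<oplus>\<^bsub>D\<^esub> y)) = J n +>\<^bsub>C\<^esub> \<iota> (h x \<oplus>\<^bsub>?L\<^esub> h y)"
        using star_homD(2)[OF \<psi>(1) x y] x y
        by (simp only: h(2) D.a_closed J.quot_simps(2)[OF ch[OF x] ch[OF y]] star_homD(2)[OF hom cl(1)[OF x] cl(1)[OF y]])
      then show ?thesis
        using J_eq[OF cl(1)[OF D.a_closed[OF x y]] L.a_closed[OF cl(1)[OF x] cl(1)[OF y]] _ that] by simp
    qed
    then show "\<theta> (x \<oplus>\<^bsub>D\<^esub> y) = \<theta> x \<oplus>\<^bsub>?L\<^esub> \<theta> y" by (simp add: \<theta>_def fun_eq_iff)
    have "h (x \<otimes>\<^bsub>D\<^esub> y) k = h x k \<otimes> h y k" if "k \<ge> n" for k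
    proof -
      have "J n +>\<^bsub>C\<^esub> \<iota> (h (x \<otimes>\<^bsub>D\<^esub> y)) = J n +>\<^bsub>C\<^esub> \<iota> (h x \<otimes>\<^bsub>?L\<^esub> h y)"
        using star_homD(3)[OF \<psi>(1) x y] x y
        by (simp only: h(2) D.m_closed J.quot_simps(1)[OF ch[OF x] ch[OF y]] star_homD(3)[OF hom cl(1)[OF x] cl(1)[OF y]])
      then show ?thesis
        using J_eq[OF cl(1)[OF D.m_closed[OF x y]] L.m_closed[OF cl(1)[OF x] cl(1)[OF y]] _ that] by simp
    qed
    then show "\<theta> (x \<otimes>\<^bsub>D\<^esub> y) = \<theta> x \<otimes>\<^bsub>?L\<^esub> \<theta> y" by (simp add: \<theta>_def fun_eq_iff)
  qed
  moreover have "asym_eq (\<theta> d) (\<phi> d)" if d: "d \<in> carrier D" for d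
  proof -
    have cz: "c_zero A \<subseteq> carrier ?L" unfolding c_zero_def by blast
    \<comment> \<open>\<open>quot_map\<close> is a union over representatives of
      \<open>\<psi> d\<close>. The representative \<open>h d\<close> contributes one coset to it,
      and this inclusion is enough to compare \<open>h d\<close> with
      \<open>\<phi> d\<close>.\<close>
    have self: "\<iota> (h d) \<in> \<psi> d" unfolding h(2)[OF d] using J.a_rcos_self[OF ch[OF d]] .
    have "K +>\<^bsub>C\<^esub> \<iota> (h d) \<subseteq> K +>\<^bsub>C\<^esub> \<iota> (\<phi> d)"
      using self \<psi>(2)[OF d] unfolding quot_map_def by blast
    then have "\<iota> (h d) \<in> K +>\<^bsub>C\<^esub> \<iota> (\<phi> d)" using K.a_rcos_self[OF ch[OF d]] by blast
    then have "\<iota> (h d) \<ominus>\<^bsub>C\<^esub> \<iota> (\<phi> d) \<in> K"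
      using K.coset_memD(2)[OF star_homD(1)[OF hom \<phi>D(1)[OF d]]] by blast
    then have "h d \<ominus>\<^bsub>?L\<^esub> \<phi> d \<in> c_zero A"
      unfolding \<iota>_minus[OF cl(1)[OF d] \<phi>D(1)[OF d]] K_def \<iota>_mem[OF L.minus_closed[OF cl(1)[OF d] \<phi>D(1)[OF d]] cz] .
    then have null: "null_seq (\<lambda>k. h d k \<ominus> \<phi> d k)"
      unfolding c_zero_iff ell_inf_minus[OF cl(1)[OF d] \<phi>D(1)[OF d]] by blast
    have c: "\<theta> d k \<in> carrier A" "\<phi> d k \<in> carrier A" for k
      using cl(2)[OF d] ell_inf_nth[OF \<phi>D(1)[OF d]] by (simp_all add: \<theta>_def)
    have "(\<lambda>k. cnorm A (\<theta> d k \<ominus> \<phi> d k)) \<longlonglongrightarrow> 0"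
    proof (rule Lim_transform_eventually[OF null_seqD(2)[OF null]])
      show "\<forall>\<^sub>F k in sequentially. cnorm A (h d k \<ominus> \<phi> d k) = cnorm A (\<theta> d k \<ominus> \<phi> d k)"
        using eventually_ge_at_top[of n] by eventually_elim (simp add: \<theta>_def)
    qed
    then show ?thesis using c by (simp add: asym_eq_def null_seq_def)
  qed
  ultimately show "liftable D \<phi>" unfolding liftable_def by blast
qed

text \<open>Semiprojectivity is stated for \<open>C\<^sup>*\<close>-algebras over the element type of the class, so the
  bounded sequences are transported to that type; a nonzero algebra over it contains a copy of the
  complex numbers, and separability bounds the cardinality of the sequence algebra.\<close>

lemma ell_inf_embeds:
  fixes B :: "'u cstar_alg"
  assumes sep: "separable_space (ctopology A)"
    and B: "unital_cstar_algebra B" "b \<in> carrier B" "b \<noteq> \<zero>\<^bsub>B\<^esub>"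
  obtains \<iota> :: "(nat \<Rightarrow> 'a) \<Rightarrow> 'u" where "inj_on \<iota> (carrier (ell_inf A))"
proof -
  interpret B: unital_cstar_algebra B by fact
  have top: "topspace (ctopology A) = carrier A" by (simp add: ctopology_def)
  obtain Q where Q: "countable Q" "Q \<subseteq> carrier A" "ctopology A closure_of Q = carrier A"
    using sep unfolding separable_space_def top by blast
  have dense: "\<exists>q\<in>Q. cnorm A (x \<ominus> q) < e" if "x \<in> carrier A" "e > 0" for x e
    using that Q(3) closure_of_iff[OF Q(2), of x] by blast
  have "Q \<noteq> {}" using dense[of \<zero> 1] by auto
  define d where "d = from_nat_into Q"
  have d: "range d = Q" unfolding d_def using range_from_nat_into[OF \<open>Q \<noteq> {}\<close> Q(1)] .
  \<comment> \<open>Records which balls of radius \<open>inverse (real (Suc m))\<close> around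
    points of a dense sequence contain the entries of \<open>f\<close>. These data determine
    \<open>f\<close>, so there are at most as many bounded sequences as sets of natural numbers,
    hence as real numbers.\<close>
  define code :: "(nat \<Rightarrow> 'a) \<Rightarrow> nat set" where
    "code f = to_nat ` {(n, k, m). cnorm A (f n \<ominus> d k) < inverse (real (Suc m))}" for f
  have code: "inj_on code (carrier (ell_inf A))"
  proof (rule inj_onI)
    fix f g assume f: "f \<in> carrier (ell_inf A)" and g: "g \<in> carrier (ell_inf A)" and eq: "code f = code g"
    have "inj (to_nat :: nat \<times> nat \<times> nat \<Rightarrow> nat)" by (rule inj_to_nat)
    then have eq': "{(n, k, m). cnorm A (f n \<ominus> d k) < inverse (real (Suc m))} =
      {(n, k, m). cnorm A (g n \<ominus> d k) < inverse (real (Suc m))}"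
      using eq unfolding code_def by (simp only: inj_image_eq_iff)
    then have eq: "cnorm A (f n \<ominus> d k) < inverse (real (Suc m)) \<longleftrightarrow> cnorm A (g n \<ominus> d k) < inverse (real (Suc m))" for n k m
      by (auto simp: set_eq_iff)
    show "f = g"
    proof
      fix n
      have fg: "f n \<in> carrier A" "g n \<in> carrier A" using ell_inf_nth f g by blast+
      have le: "cnorm A (f n \<ominus> g n) \<le> 2 * inverse (real (Suc m))" for m
      proof -
        obtain k where k: "cnorm A (f n \<ominus> d k) < inverse (real (Suc m))"
          using dense[OF fg(1), of "inverse (real (Suc m))"] d by auto
        have dk: "d k \<in> carrier A" using d Q(2) by blast
        show ?thesis
          using k eq[of n k m] cnorm_triangle[OF fg(1) dk fg(2)] cnorm_minus_commute[OF dk fg(2)] by linarith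
      qed
      have "(\<lambda>m. 2 * inverse (real (Suc m))) \<longlonglongrightarrow> 0"
        using tendsto_mult_right_zero[OF LIMSEQ_inverse_real_of_nat] .
      then have "cnorm A (f n \<ominus> g n) \<le> 0" using LIMSEQ_le_const le by blast
      then have "cnorm A (f n \<ominus> g n) = 0" using cnorm_nonneg[OF minus_closed[OF fg]] by linarith
      then show "f n = g n" using fg by (simp add: cnorm_eq_0 minus_eq_zero_iff)
    qed
  qed
  obtain r :: "nat set \<Rightarrow> real" where r: "inj r"
    using nat_sets_eqpoll_reals unfolding eqpoll_def bij_betw_def by blast
  \<comment> \<open>The real line spanned by \<open>b\<close> provides continuum many elements of
    \<open>'u\<close>.\<close>
  have line: "inj (\<lambda>t. complex_of_real t \<odot>\<^bsub>B\<^esub> b)"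
  proof (rule injI)
    fix s t assume eq: "complex_of_real s \<odot>\<^bsub>B\<^esub> b = complex_of_real t \<odot>\<^bsub>B\<^esub> b"
    have "complex_of_real (s - t) \<odot>\<^bsub>B\<^esub> b = complex_of_real s \<odot>\<^bsub>B\<^esub> b \<oplus>\<^bsub>B\<^esub> (- complex_of_real t) \<odot>\<^bsub>B\<^esub> b"
      using B(2) B.smult_add_left[of b "complex_of_real s" "- complex_of_real t"] by simp
    also have "\<dots> = \<zero>\<^bsub>B\<^esub>" unfolding eq using B(2) by (simp add: B.neg_smult B.r_neg)
    finally have "cmod (complex_of_real (s - t)) * cnorm B b = 0"
      using B.cnorm_smult[OF B(2), of "complex_of_real (s - t)"] by simp
    moreover have "cnorm B b \<noteq> 0" using B(2,3) by (simp add: B.cnorm_eq_0)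
    ultimately show "s = t" unfolding norm_of_real by simp
  qed
  have "inj_on (\<lambda>f. complex_of_real (r (code f)) \<odot>\<^bsub>B\<^esub> b) (carrier (ell_inf A))"
  proof (rule inj_onI)
    fix f g assume f: "f \<in> carrier (ell_inf A)" and g: "g \<in> carrier (ell_inf A)"
      and "complex_of_real (r (code f)) \<odot>\<^bsub>B\<^esub> b = complex_of_real (r (code g)) \<odot>\<^bsub>B\<^esub> b"
    then have "r (code f) = r (code g)" using injD[OF line] by blast
    then have "code f = code g" using injD[OF r] by blast
    then show "f = g" using inj_onD[OF code _ f g] by blast
  qed
  then show thesis using that by blast
qed

text \<open>A nonzero projection over \<open>B\<close> has a nonzero entry, and this element of
  \<open>B\<close> shows that the element type of the class is large enough to hold the bounded
  sequences. The corner at the zero projection is the zero algebra and is treated apart.\<close>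

lemma corners_lift_flexible:
  assumes sep: "separable_space (ctopology A)" and flex: "flexible \<C>" and B: "B \<in> \<C>"
  shows "corners_lift B"
  unfolding corners_lift_def
proof (intro allI impI)
  have Bsep: "separable_unital_cstar B" using flex B unfolding flexible_def by blast
  interpret B: unital_cstar_algebra B using Bsep by (simp add: separable_unital_cstar_def)
  fix n :: nat and p assume n: "n \<ge> 1" and p: "projection (matrix_alg n B) p"
  interpret M: star_ring "matrix_alg n B" by (rule B.star_ring_matrix)
  interpret N: star_ring "corner (matrix_alg n B) p" by (rule M.star_ring_corner[OF p])
  show "has_lifts (corner (matrix_alg n B) p)"
  proof (cases "p = \<zero>\<^bsub>matrix_alg n B\<^esub>")
    case True
    have "x = \<zero>\<^bsub>matrix_alg n B\<^esub>" if "x \<in> carrier (corner (matrix_alg n B) p)" for x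
    proof -
      have x: "x \<in> carrier (matrix_alg n B)" "p \<otimes>\<^bsub>matrix_alg n B\<^esub> x = x"
        using that unfolding M.carrier_corner[OF p] by blast+
      show ?thesis using M.l_null[OF x(1)] x(2) unfolding True by metis
    qed
    then have "carrier (corner (matrix_alg n B) p) = {\<zero>\<^bsub>corner (matrix_alg n B) p\<^esub>}"
      using N.zero_closed unfolding M.corner_simps(4) by blast
    then show ?thesis using N.smult_zero_right by (intro has_lifts_zero)
  next
    case False
    have pc: "p \<in> {..<n} \<times> {..<n} \<rightarrow>\<^sub>E carrier B" using p by (simp add: projection_def)
    have "\<exists>i<n. \<exists>j<n. p (i, j) \<noteq> \<zero>\<^bsub>B\<^esub>"
    proof (rule ccontr)
      assume "\<not> ?thesis"
      then have "p = \<zero>\<^bsub>matrix_alg n B\<^esub>"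
        using M.zero_closed unfolding B.matrix_simps(1) by (intro B.matrix_ext[OF pc]) auto
      then show False using False by blast
    qed
    then obtain i j where ij: "i < n" "j < n" "p (i, j) \<noteq> \<zero>\<^bsub>B\<^esub>" by blast
    obtain \<iota> :: "(nat \<Rightarrow> 'a) \<Rightarrow> 'b" where "inj_on \<iota> (carrier (ell_inf A))"
      using ell_inf_embeds[OF sep B.unital_cstar_algebra_axioms B.matrix_entry[OF pc ij(1,2)] ij(3)] .
    moreover have "semiprojective TYPE('b) (corner (matrix_alg n B) p)"
      using flex B n p False unfolding flexible_def by blast
    ultimately show ?thesis by (rule semiprojective_liftable) (rule N.star_ring_axioms)
  qed
qed

lemma has_lifts_finite_saturation:
  assumes "separable_space (ctopology A)" "flexible \<C>" "B \<in> finite_saturation \<C>"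
  shows "separable_unital_cstar B" "has_lifts B"
proof -
  have "\<C> \<subseteq> {B. separable_unital_cstar B \<and> corners_lift B}"
    using assms(2) corners_lift_flexible[OF assms(1,2)] unfolding flexible_def by blast
  then have *: "separable_unital_cstar B \<and> corners_lift B"
    using assms(3) finitely_saturated_corners_lift unfolding finite_saturation_def by blast
  then show "separable_unital_cstar B" by blast
  interpret B: unital_cstar_algebra B using * by (simp add: separable_unital_cstar_def)
  show "has_lifts B" using has_lifts_of_corners_lift[OF B.star_ring_axioms] * by blast
qed

end

subsection \<open>Local approximation of the subalgebra\<close>

context finite_index_expectation begin

text \<open>A representative of the Rohlin projection is selfadjoint only modulo null sequences; its
  real part represents the same class and is selfadjoint at every index.\<close>

lemma rohlin_sequence_exists:
  assumes "expectation_rohlin A E" shows "\<exists>e M. rohlin_sequence A P E e M"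
proof -
  interpret L: unital_cstar_algebra "ell_inf A" by (rule unital_cstar_ell_inf)
  interpret K: star_ideal "ell_inf A" "c_zero A" by (rule star_ideal_c_zero)
  let ?L = "ell_inf A" and ?K = "c_zero A" and ?h = "inv (Index A E)"
  obtain X where X: "X \<in> central_seqs A" "projection (seq_alg A) X"
    "seq_expectation A E X = const_class A ?h"
    using assms unfolding expectation_rohlin_def by blast
  have "X \<in> carrier (quot ?L ?K)" using X(2) by (simp add: projection_def seq_alg_def)
  then obtain f where f: "f \<in> carrier ?L" "X = ?K +>\<^bsub>?L\<^esub> f" by (rule K.quot_carrierE)
  have fn: "f n \<in> carrier A" for n using ell_inf_nth[OF f(1)] .
  have eqD: "asym_eq g k" if g: "g \<in> carrier ?L" and k: "k \<in> carrier ?L" and eq: "?K +>\<^bsub>?L\<^esub> g = ?K +>\<^bsub>?L\<^esub> k" for g k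
  proof -
    have "g \<ominus>\<^bsub>?L\<^esub> k \<in> ?K" using eq K.coset_eq_iff[OF g k] by blast
    then show ?thesis
      unfolding c_zero_iff ell_inf_minus[OF g k] asym_eq_def using ell_inf_nth g k by blast
  qed
  have h: "?h \<in> carrier A" using Index_Units by simp
  have idem: "asym_eq (\<lambda>n. f n \<otimes> f n) f"
    using X(2) K.quot_simps(1)[OF f(1) f(1)]
    by (intro eqD ell_inf_closed f(1)) (simp add: projection_def seq_alg_def f(2))
  have adj: "asym_eq (\<lambda>n. cadj A (f n)) f"
    using X(2) K.quot_simps(4)[OF f(1)]
    by (intro eqD ell_inf_closed[OF f(1) f(1)] f(1)) (simp add: projection_def seq_alg_def f(2))
  have central: "asym_eq (\<lambda>n. f n \<otimes> a) (\<lambda>n. a \<otimes> f n)" if a: "a \<in> carrier A" for a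
  proof (rule eqD)
    note ca = ell_inf_const[OF a]
    show "(\<lambda>n. f n \<otimes> a) \<in> carrier ?L" "(\<lambda>n. a \<otimes> f n) \<in> carrier ?L"
      using ell_inf_closed(2)[OF f(1) ca] ell_inf_closed(2)[OF ca f(1)] .
    have "X \<otimes>\<^bsub>seq_alg A\<^esub> const_class A a = const_class A a \<otimes>\<^bsub>seq_alg A\<^esub> X"
      using X(1) a unfolding central_seqs_def by blast
    then show "?K +>\<^bsub>?L\<^esub> (\<lambda>n. f n \<otimes> a) = ?K +>\<^bsub>?L\<^esub> (\<lambda>n. a \<otimes> f n)"
      unfolding seq_alg_def const_class_def seq_class_def f(2) K.quot_simps(1)[OF f(1) ca] K.quot_simps(1)[OF ca f(1)]
      by simp
  qed
  have Ef: "(\<lambda>n. E (f n)) \<in> carrier ?L"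
  proof (rule ell_infI)
    show "cnorm A (E (f n)) \<le> cnorm ?L f" for n
      using E_cnorm_le[OF fn, of n] ell_inf_norm_ge[OF f(1), of n] by linarith
  qed (simp add: fn)
  have exp: "asym_eq (\<lambda>n. E (f n)) (\<lambda>n. ?h)"
  proof -
    \<comment> \<open>\<open>seq_expectation\<close> is a union over representatives of
      \<open>X\<close>, of which \<open>f\<close> is one.\<close>
    have "(\<lambda>n. E (f n)) \<in> seq_expectation A E X"
      unfolding seq_expectation_def seq_class_def f(2)
      using K.a_rcos_self[OF f(1)] K.a_rcos_self[OF Ef] by blast
    then have "(\<lambda>n. E (f n)) \<in> ?K +>\<^bsub>?L\<^esub> (\<lambda>n. ?h)"
      unfolding X(3) const_class_def seq_class_def .
    then have "(\<lambda>n. E (f n)) \<ominus>\<^bsub>?L\<^esub> (\<lambda>n. ?h) \<in> ?K"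
      using K.coset_memD(2)[OF ell_inf_const[OF h]] by blast
    then show ?thesis
      unfolding c_zero_iff ell_inf_minus[OF Ef ell_inf_const[OF h]] asym_eq_def using fn h by simp
  qed
  \<comment> \<open>The real part of \<open>f\<close>, equal to \<open>f\<close> modulo null
    sequences because the class of \<open>f\<close> is selfadjoint.\<close>
  define e where "e n = (1/2) \<odot> (f n \<oplus> cadj A (f n))" for n
  have eL: "e \<in> carrier ?L"
    using ell_inf_closed(3)[OF ell_inf_closed(1)[OF f(1) ell_inf_closed(4)[OF f(1) f(1)]] f(1), of "1/2"]
    by (simp add: e_def[abs_def])
  have en: "e n \<in> carrier A" for n using fn by (simp add: e_def)
  have ef: "asym_eq e f"
  proof -
    have "asym_eq (\<lambda>n. (1/2) \<odot> (f n \<oplus> cadj A (f n))) (\<lambda>n. (1/2) \<odot> (f n \<oplus> f n))"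
      using adj fn by (intro asym_eq_smult asym_eq_add asym_eq_refl) auto
    moreover have "(1/2) \<odot> (x \<oplus> x) = x" if "x \<in> carrier A" for x
      using that by (reify star_eqs, intro seqn_holdsI; simp)
    ultimately show ?thesis using fn by (simp add: e_def[abs_def])
  qed
  note fe = asym_eq_sym[OF ef]
  have "rohlin_sequence A P E e (cnorm ?L e)"
  proof unfold_locales
    show "e n \<in> carrier A" for n by (rule en)
    show "cnorm A (e n) \<le> cnorm ?L e" for n by (rule ell_inf_norm_ge[OF eL])
    show "cadj A (e n) = e n" for n
      unfolding e_def using fn[of n] by (reify star_eqs, intro seqn_holdsI; simp)
    have "asym_eq (\<lambda>n. e n \<otimes> e n) (\<lambda>n. f n \<otimes> f n)" by (rule asym_eq_mult[OF ef ef f(1) eL])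
    also note idem
    also note fe
    finally show "null_seq (\<lambda>n. e n \<otimes> e n \<ominus> e n)" by (simp add: asym_eq_def)
    show "null_seq (\<lambda>n. e n \<otimes> a \<ominus> a \<otimes> e n)" if a: "a \<in> carrier A" for a
    proof -
      note ca = ell_inf_const[OF a] and ra = asym_eq_refl[of "\<lambda>n. a", OF a]
      have "asym_eq (\<lambda>n. e n \<otimes> a) (\<lambda>n. f n \<otimes> a)" by (rule asym_eq_mult[OF ef ra f(1) ca])
      also note central[OF a]
      also have "asym_eq (\<lambda>n. a \<otimes> f n) (\<lambda>n. a \<otimes> e n)" by (rule asym_eq_mult[OF ra fe ca f(1)])
      finally show ?thesis by (simp add: asym_eq_def)
    qed
    have "null_seq (\<lambda>n. E (e n \<ominus> f n))" using ef by (intro null_seq_E) (simp add: asym_eq_def)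
    then have "asym_eq (\<lambda>n. E (e n)) (\<lambda>n. E (f n))" using en fn by (simp add: asym_eq_def E_minus)
    also note exp
    finally show "null_seq (\<lambda>n. E (e n) \<ominus> ?h)" by (simp add: asym_eq_def)
  qed
  then show ?thesis by blast
qed

text \<open>\<open>E\<close> is a contraction that fixes \<open>P\<close>, so it maps a countable
  dense subset of \<open>A\<close> to a dense subset of \<open>P\<close>.\<close>

lemma separable_subalg:
  assumes "separable_space (ctopology A)" shows "separable_space (ctopology (subalg A P))"
proof -
  interpret B: unital_cstar_algebra "subalg A P" by (rule subalg_unital_cstar(1)[OF P])
  note minus = subalg_unital_cstar(2)[OF P]
  have top: "topspace (ctopology A) = carrier A" and topB: "topspace (ctopology (subalg A P)) = P"
    using cmetric.topspace_mtopology B.cmetric.topspace_mtopology by (simp_all add: ctopology_def)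
  obtain Q where Q: "countable Q" "Q \<subseteq> carrier A" "ctopology A closure_of Q = carrier A"
    using assms unfolding separable_space_def top by blast
  have EQ: "E ` Q \<subseteq> carrier (subalg A P)" using Q(2) by auto
  have "ctopology (subalg A P) closure_of (E ` Q) = P"
  proof (intro equalityI subsetI)
    fix p assume "p \<in> ctopology (subalg A P) closure_of (E ` Q)"
    then show "p \<in> P" unfolding B.closure_of_iff[OF EQ] by simp
  next
    fix p assume p: "p \<in> P"
    have "\<exists>y\<in>E ` Q. cnorm (subalg A P) (p \<ominus>\<^bsub>subalg A P\<^esub> y) < r" if "r > 0" for r
    proof -
      obtain q where q: "q \<in> Q" "cnorm A (p \<ominus> q) < r"
        using Q(3) P_carrier[OF p] \<open>r > 0\<close> closure_of_iff[OF Q(2), of p] by blast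
      have qA: "q \<in> carrier A" using q Q(2) by blast
      have "cnorm A (p \<ominus> E q) \<le> cnorm A (p \<ominus> q)"
        using E_cnorm_le[of "p \<ominus> q"] p qA by (simp add: E_minus E_fix)
      then show ?thesis using q qA p by (intro bexI[of _ "E q"]) (auto simp: minus)
    qed
    then show "p \<in> ctopology (subalg A P) closure_of (E ` Q)"
      unfolding B.closure_of_iff[OF EQ] using p by simp
  qed
  then show ?thesis
    unfolding separable_space_def topB using Q(1) EQ by (intro exI[of _ "E ` Q"]) auto
qed

end

context rohlin_sequence begin

text \<open>The algebra \<open>B0\<close> found for \<open>A\<close> serves for \<open>P\<close> as
  well; only the map out of it changes. Lifting is invoked with \<open>P\<close> as target, which is
  where separability of \<open>P\<close> enters.\<close>

lemma unital_local_subalg: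
  assumes flex: "flexible \<C>" and loc: "unital_local_algebra \<C> A"
  shows "unital_local_algebra \<C> (subalg A P)"
proof -
  let ?B = "subalg A P"
  interpret B: unital_cstar_algebra ?B by (rule subalg_unital_cstar(1)[OF P])
  note minus = subalg_unital_cstar(2)[OF P]
  have sepA: "separable_space (ctopology A)"
    using loc by (simp add: unital_local_algebra_def separable_unital_cstar_def)
  note sep = separable_subalg[OF sepA]
  \<comment> \<open>The lifting notions belong to the target \<open>P\<close>, the estimates to
    \<open>A\<close>; this fact and the next translate between the two.\<close>
  have asymI: "B.asym_eq f g" if "\<And>n. f n \<in> P" "\<And>n. g n \<in> P" "null_seq (\<lambda>n. f n \<ominus> g n)" for f g
  proof -
    have "f n \<ominus> g n \<in> P" for n using B.minus_closed[of "f n" "g n"] that(1,2)[of n] by (simp add: minus)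
    then show ?thesis using that by (simp add: B.asym_eq_def B.null_seq_def null_seq_def minus)
  qed
  have asymD: "(\<lambda>n. cnorm A (f n \<ominus> g n)) \<longlonglongrightarrow> 0" if "B.asym_eq f g" for f g
    using B.asym_eq_carrier[OF that] that by (simp add: B.asym_eq_def B.null_seq_def minus)
  define K where "K = cnorm A c * M"
  have K: "K \<ge> 0" using M_nonneg by (simp add: K_def)
  have main: "\<exists>B0\<in>finite_saturation \<C>. \<exists>\<psi>. unital_hom B0 ?B \<psi> \<and>
      (\<forall>a\<in>S. (INF b\<in>carrier B0. cnorm ?B (a \<ominus>\<^bsub>?B\<^esub> \<psi> b)) < \<epsilon>)"
    if S: "finite S" "S \<subseteq> P" and \<epsilon>: "\<epsilon> > 0" for S \<epsilon>
  proof -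
    \<comment> \<open>The final error has three parts: from \<open>a\<close> to
      \<open>approx a\<close>, from there to \<open>approx (\<phi> (b a))\<close>, and from there to
      the lift. The middle one is at most \<open>K * \<delta>\<close>, which is below a third of
      \<open>\<epsilon>\<close>; adding 1 to \<open>K\<close> keeps the denominator
      positive.\<close>
    define \<delta> where "\<delta> = \<epsilon> / (3 * (K + 1))"
    have \<delta>: "\<delta> > 0" using \<epsilon> K by (simp add: \<delta>_def)
    have SA: "S \<subseteq> carrier A" using S(2) by auto
    obtain B0 \<phi> where B0: "B0 \<in> finite_saturation \<C>" and \<phi>: "unital_hom B0 A \<phi>"
      and close: "\<And>a. a \<in> S \<Longrightarrow> (INF b\<in>carrier B0. cnorm A (a \<ominus> \<phi> b)) < \<delta>"
      using loc S(1) SA \<delta> unfolding unital_local_algebra_def by meson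
    note B0_facts = B.has_lifts_finite_saturation[OF sep flex B0]
    interpret B0: unital_cstar_algebra B0 using B0_facts(1) by (simp add: separable_unital_cstar_def)
    have hom: "star_hom B0 A \<phi>" and one: "\<phi> \<one>\<^bsub>B0\<^esub> = \<one>" using \<phi> by (simp_all add: unital_hom_def)
    note \<phi>c = star_homD(1)[OF hom]
    have "\<exists>b. b \<in> carrier B0 \<and> cnorm A (a \<ominus> \<phi> b) < \<delta>" if "a \<in> S" for a
    proof -
      have "(\<lambda>b. cnorm A (a \<ominus> \<phi> b)) ` carrier B0 \<noteq> {}" using B0.zero_closed by blast
      from cInf_lessD[OF this close[OF that]] show ?thesis by blast
    qed
    then obtain b where b: "\<And>a. a \<in> S \<Longrightarrow> b a \<in> carrier B0" "\<And>a. a \<in> S \<Longrightarrow> cnorm A (a \<ominus> \<phi> (b a)) < \<delta>"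
      by metis
    have "B.asym_hom B0 (\<lambda>d. approx (\<phi> d))"
      unfolding B.asym_hom_def
    proof (intro conjI ballI allI)
      fix x assume x: "x \<in> carrier B0"
      show "approx (\<phi> x) \<in> carrier (ell_inf ?B)"
        using cnorm_approx_le[OF \<phi>c[OF x]] \<phi>c[OF x] by (intro B.ell_infI) auto
      show "B.asym_eq (approx (\<phi> (k \<odot>\<^bsub>B0\<^esub> x))) (\<lambda>n. k \<odot>\<^bsub>?B\<^esub> approx (\<phi> x) n)" for k
        using \<phi>c[OF x] approx_smult[OF \<phi>c[OF x], of k]
        by (intro asymI) (auto simp: star_homD(4)[OF hom x] null_seq_def a_minus_def r_neg)
      show "B.asym_eq (approx (\<phi> (cadj B0 x))) (\<lambda>n. cadj ?B (approx (\<phi> x) n))"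
        using \<phi>c[OF x] approx_cadj[OF \<phi>c[OF x]] by (intro asymI) (auto simp: star_homD(5)[OF hom x])
      fix y assume y: "y \<in> carrier B0"
      show "B.asym_eq (approx (\<phi> (x \<oplus>\<^bsub>B0\<^esub> y))) (\<lambda>n. approx (\<phi> x) n \<oplus>\<^bsub>?B\<^esub> approx (\<phi> y) n)"
        using \<phi>c[OF x] \<phi>c[OF y] approx_add[OF \<phi>c[OF x] \<phi>c[OF y]]
        by (intro asymI) (auto simp: star_homD(2)[OF hom x y] null_seq_def a_minus_def r_neg)
      show "B.asym_eq (approx (\<phi> (x \<otimes>\<^bsub>B0\<^esub> y))) (\<lambda>n. approx (\<phi> x) n \<otimes>\<^bsub>?B\<^esub> approx (\<phi> y) n)"
        using \<phi>c[OF x] \<phi>c[OF y] approx_mult[OF \<phi>c[OF x] \<phi>c[OF y]]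
        by (intro asymI) (auto simp: star_homD(3)[OF hom x y])
    qed
    then obtain \<psi> where \<psi>: "star_hom B0 (ell_inf ?B) \<psi>"
      and \<psi>_approx: "\<And>d. d \<in> carrier B0 \<Longrightarrow> B.asym_eq (\<psi> d) (approx (\<phi> d))"
      using B0_facts(2) unfolding B.has_lifts_def B.liftable_def by blast
    have \<psi>P: "\<psi> d n \<in> P" if "d \<in> carrier B0" for d n
      using B.asym_eq_carrier(1)[OF \<psi>_approx[OF that]] by simp
    have fixS: "(\<lambda>n. cnorm A (approx p n \<ominus> p)) \<longlonglongrightarrow> 0" if "p \<in> P" for p
      using null_seqD(2)[OF approx_fix[OF that]] .
    have "\<forall>\<^sub>F n in sequentially. \<forall>a\<in>S. cnorm A (a \<ominus> \<psi> (b a) n) < \<epsilon>"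
    proof (rule eventually_ball_finite[OF S(1)], rule ballI)
      fix a assume a: "a \<in> S"
      have aA: "a \<in> carrier A" "a \<in> P" using a SA S(2) by auto
      note ba = b(1)[OF a] and \<phi>ba = \<phi>c[OF b(1)[OF a]]
      have e3: "\<epsilon> / 3 > 0" using \<epsilon> by simp
      have "\<forall>\<^sub>F n in sequentially. cnorm A (\<psi> (b a) n \<ominus> approx (\<phi> (b a)) n) < \<epsilon> / 3"
        using order_tendstoD(2)[OF asymD[OF \<psi>_approx[OF ba]] e3] .
      moreover have "\<forall>\<^sub>F n in sequentially. cnorm A (approx a n \<ominus> a) < \<epsilon> / 3"
        using order_tendstoD(2)[OF fixS[OF aA(2)] e3] .
      ultimately show "\<forall>\<^sub>F n in sequentially. cnorm A (a \<ominus> \<psi> (b a) n) < \<epsilon>"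
      proof eventually_elim
        case (elim n)
        let ?x = "approx a n" and ?y = "approx (\<phi> (b a)) n" and ?z = "\<psi> (b a) n"
        have cA: "?x \<in> carrier A" "?y \<in> carrier A" "?z \<in> carrier A"
          using aA \<phi>ba P_carrier[OF \<psi>P[OF ba]] by simp_all
        have "?x = approx (a \<ominus> \<phi> (b a)) n \<oplus> ?y"
        proof -
          have "a = (a \<ominus> \<phi> (b a)) \<oplus> \<phi> (b a)"
            using aA(1) \<phi>ba by (reify star_eqs, intro seqn_holdsI; simp)
          then have "?x = approx ((a \<ominus> \<phi> (b a)) \<oplus> \<phi> (b a)) n" by simp
          also have "\<dots> = approx (a \<ominus> \<phi> (b a)) n \<oplus> ?y"
            using aA(1) \<phi>ba by (intro approx_add) auto
          finally show ?thesis .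
        qed
        then have "?x \<ominus> ?y = approx (a \<ominus> \<phi> (b a)) n"
          using cA(2) aA(1) \<phi>ba approx_closed[of "a \<ominus> \<phi> (b a)" n]
          by (simp add: a_minus_def a_assoc r_neg)
        then have "cnorm A (?x \<ominus> ?y) \<le> K * cnorm A (a \<ominus> \<phi> (b a))"
          using cnorm_approx_le[of "a \<ominus> \<phi> (b a)" n] aA(1) \<phi>ba by (simp add: K_def)
        also have "\<dots> \<le> K * \<delta>" using b(2)[OF a] K by (intro mult_left_mono) auto
        also have "\<dots> < \<epsilon> / 3"
        proof -
          have "K * \<delta> < (K + 1) * \<delta>" using \<delta> by simp
          also have "\<dots> = \<epsilon> / 3" using K by (simp add: \<delta>_def field_simps)
          finally show ?thesis .
        qed
        finally have xy: "cnorm A (?x \<ominus> ?y) < \<epsilon> / 3" .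
        have "cnorm A (a \<ominus> ?z) \<le> cnorm A (a \<ominus> ?x) + (cnorm A (?x \<ominus> ?y) + cnorm A (?y \<ominus> ?z))"
          using cnorm_triangle[OF aA(1) cA(1) cA(3)] cnorm_triangle[OF cA(1) cA(2) cA(3)] by linarith
        then show ?case
          using elim xy cnorm_minus_commute[OF aA(1) cA(1)] cnorm_minus_commute[OF cA(2) cA(3)] by linarith
      qed
    qed
    \<comment> \<open>The images of the unit are projections, and for a projection distance less
      than 1 from the unit already means equality.\<close>
    moreover have "\<forall>\<^sub>F n in sequentially. cnorm A (\<psi> \<one>\<^bsub>B0\<^esub> n \<ominus> \<one>) < 1"
    proof -
      have "B.asym_eq (\<psi> \<one>\<^bsub>B0\<^esub>) (approx \<one>)" using \<psi>_approx[OF B0.one_closed] one by simp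
      also have "B.asym_eq (approx \<one>) (\<lambda>n. \<one>)"
        using P(2) approx_fix[OF P(2)] by (intro asymI) auto
      finally show ?thesis using order_tendstoD(2)[OF asymD, of "\<psi> \<one>\<^bsub>B0\<^esub>" "\<lambda>n. \<one>" 1] by simp
    qed
    ultimately have "\<forall>\<^sub>F n in sequentially. (\<forall>a\<in>S. cnorm A (a \<ominus> \<psi> (b a) n) < \<epsilon>) \<and> cnorm A (\<psi> \<one>\<^bsub>B0\<^esub> n \<ominus> \<one>) < 1"
      by eventually_elim blast
    then obtain n where n: "\<And>a. a \<in> S \<Longrightarrow> cnorm A (a \<ominus> \<psi> (b a) n) < \<epsilon>" "cnorm A (\<psi> \<one>\<^bsub>B0\<^esub> n \<ominus> \<one>) < 1"
      unfolding eventually_sequentially by blast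
    have \<psi>B: "\<psi> d n \<in> carrier ?B" if "d \<in> carrier B0" for d n using \<psi>P[OF that] by simp
    have \<psi>n: "star_hom B0 ?B (\<lambda>x. \<psi> x n)"
      by (rule star_homI) (simp_all add: \<psi>B star_homD[OF \<psi>] B.ell_inf_simps del: subalg_simps)
    have "projection B0 \<one>\<^bsub>B0\<^esub>" by (simp add: projection_def)
    from star_hom_projection[OF \<psi>n this] have "projection ?B (\<psi> \<one>\<^bsub>B0\<^esub> n)" .
    moreover have "cnorm ?B (\<psi> \<one>\<^bsub>B0\<^esub> n \<ominus>\<^bsub>?B\<^esub> \<one>\<^bsub>?B\<^esub>) < 1"
      using n(2) \<psi>P[OF B0.one_closed] P(2) by (simp add: minus)
    ultimately have "\<psi> \<one>\<^bsub>B0\<^esub> n = \<one>\<^bsub>?B\<^esub>" by (rule B.projection_near_one)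
    then have "unital_hom B0 ?B (\<lambda>x. \<psi> x n)" using \<psi>n by (simp add: unital_hom_def)
    moreover have "(INF d\<in>carrier B0. cnorm ?B (a \<ominus>\<^bsub>?B\<^esub> \<psi> d n)) < \<epsilon>" if a: "a \<in> S" for a
    proof -
      have aP: "a \<in> P" using a S(2) by blast
      have "bdd_below ((\<lambda>d. cnorm ?B (a \<ominus>\<^bsub>?B\<^esub> \<psi> d n)) ` carrier B0)"
        using aP \<psi>P by (intro bdd_belowI2[where m=0]) (simp add: minus)
      from cINF_lower[OF this b(1)[OF a]] have "(INF d\<in>carrier B0. cnorm ?B (a \<ominus>\<^bsub>?B\<^esub> \<psi> d n)) \<le> cnorm ?B (a \<ominus>\<^bsub>?B\<^esub> \<psi> (b a) n)" .
      also have "\<dots> < \<epsilon>" using n(1)[OF a] aP \<psi>P[OF b(1)[OF a]] by (simp add: minus)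
      finally show ?thesis .
    qed
    ultimately show ?thesis using B0 by blast
  qed
  have "separable_unital_cstar ?B"
    unfolding separable_unital_cstar_def using B.unital_cstar_algebra_axioms sep by blast
  then show ?thesis unfolding unital_local_algebra_def using main by simp
qed

end

theorem theorem5p7:
  fixes \<C> :: "'u cstar_alg set" and A :: "'a cstar_alg" and P :: "'a set"
  assumes "flexible \<C>"
    and "finite_index_inclusion A P"
    and "inclusion_rohlin A P"
    and "unital_local_algebra \<C> A"
  shows "unital_local_algebra \<C> (subalg A P)"
proof -
  obtain E where E: "conditional_expectation A P E" "finite_index A E" "expectation_rohlin A E"
    using assms(3) unfolding inclusion_rohlin_def by blast
  have incl: "unital_cstar_algebra A" "cstar_subalgebra A P" "\<one>\<^bsub>A\<^esub> \<in> P"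
    using assms(2) by (simp_all add: finite_index_inclusion_def unital_inclusion_def)
  interpret F: finite_index_expectation A P E
    using incl E by (intro finite_index_expectation.intro finite_index_expectation_axioms.intro)
  obtain e M where "rohlin_sequence A P E e M" using F.rohlin_sequence_exists[OF E(3)] by blast
  then interpret R: rohlin_sequence A P E e M .
  show ?thesis by (rule R.unital_local_subalg[OF assms(1,4)])
qed

end
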